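(* For all $1\le k\le n$ and $1<\delta\le 2$, a $\delta$-balanced $(n,k)$-family of perfect hash functions of size $\frac{2^{O(k\log\log k)}}{(\delta-1)^{O(\log k)}}\log n$ can be constructed deterministically in time $\frac{2^{O(k\log\log k)}}{(\delta-1)^{O(\log k)}}\,n\log n+(\delta-1)^{-O(k/\log k)}$, where the implied constants are absolute. In particular, for any fixed $1<\delta\le 2$, the size is $2^{O(k\log\log k)}\log n$ and the construction time is $2^{O(k\log\log k)}\,n\log n$.
   Context: $[n]=\{1,\dots,n\}$ and $\binom{[n]}{k}$ is the family of $k$-element subsets of $[n]$. For $1\le k\le n$ and $\delta\ge 1$, a family (multiset) of functions from $[n]$ to $[k]$ is a $\delta$-balanced $(n,k)$-family of perfect hash functions if there is a real $T>0$ such that for every $S\in\binom{[n]}{k}$ the number of functions in the family that are one-to-one on $S$ lies between $T/\delta$ and $\delta T$. The size of a family is its number of functions; constructing it means outputting the list of all its functions. *)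

theory Defs
  imports Complex_Main "HOL-Library.Multiset" "HOL-Library.FuncSet"
begin

section \<open>Balanced families of perfect hash functions\<close>

text \<open>A function from \<open>[n]\<close> to \<open>[k]\<close> is an extensional function, so that distinct HOL functions in
  a family are distinct functions on \<open>[n]\<close>.\<close>

definition balanced_phf_family :: "real \<Rightarrow> nat \<Rightarrow> nat \<Rightarrow> (nat \<Rightarrow> nat) multiset \<Rightarrow> bool" where
  "balanced_phf_family \<delta> n k F \<longleftrightarrow>
     set_mset F \<subseteq> {1..n} \<rightarrow>\<^sub>E {1..k} \<and>
     (\<exists>T::real. T > 0 \<and>
        (\<forall>S. S \<subseteq> {1..n} \<and> card S = k \<longrightarrow>
           T / \<delta> \<le> real (size {#f \<in># F. inj_on f S#}) \<and>
           real (size {#f \<in># F. inj_on f S#}) \<le> \<delta> * T))"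


section \<open>A word RAM\<close>

text \<open>Time is measured on a unit-cost word RAM, programmed in a structured language. The memory is
  an infinite array of cells indexed by words. A real parameter \<open>\<delta>\<close> cannot be stored in a word;
  a program can access it only by comparing it with quotients of words. Arithmetic follows HOL:
  subtraction is truncated, \<open>x div 0 = 0\<close> and \<open>x mod 0 = x\<close>.\<close>

datatype binop = Add | Sub | Mul | Div | Mod | Less | Equal

datatype expr =
    Const nat
  | Load expr
  | Bin binop expr expr
  | LeParam expr expr

datatype com =
    Skip
  | Store expr expr
  | Emit expr
  | Seq com com
  | Cond expr com com
  | While expr com

type_synonym mem = "nat \<Rightarrow> nat"

fun binop_val :: "binop \<Rightarrow> nat \<Rightarrow> nat \<Rightarrow> nat" where
  "binop_val Add x y = x + y"
| "binop_val Sub x y = x - y"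
| "binop_val Mul x y = x * y"
| "binop_val Div x y = x div y"
| "binop_val Mod x y = x mod y"
| "binop_val Less x y = of_bool (x < y)"
| "binop_val Equal x y = of_bool (x = y)"

text \<open>\<open>LeParam a b\<close> tests \<open>a \<le> \<delta> * b\<close>.\<close>

fun eval :: "real \<Rightarrow> mem \<Rightarrow> expr \<Rightarrow> nat" where
  "eval \<delta> m (Const c) = c"
| "eval \<delta> m (Load a) = m (eval \<delta> m a)"
| "eval \<delta> m (Bin f a b) = binop_val f (eval \<delta> m a) (eval \<delta> m b)"
| "eval \<delta> m (LeParam a b) = of_bool (real (eval \<delta> m a) \<le> \<delta> * real (eval \<delta> m b))"

text \<open>Every value arising in an evaluation, including every address, fits into \<open>w\<close> bits.\<close>

fun fits :: "nat \<Rightarrow> real \<Rightarrow> mem \<Rightarrow> expr \<Rightarrow> bool" where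
  "fits w \<delta> m (Const c) \<longleftrightarrow> c < 2 ^ w"
| "fits w \<delta> m (Load a) \<longleftrightarrow> fits w \<delta> m a \<and> eval \<delta> m (Load a) < 2 ^ w"
| "fits w \<delta> m (Bin f a b) \<longleftrightarrow> fits w \<delta> m a \<and> fits w \<delta> m b \<and> eval \<delta> m (Bin f a b) < 2 ^ w"
| "fits w \<delta> m (LeParam a b) \<longleftrightarrow> fits w \<delta> m a \<and> fits w \<delta> m b \<and> eval \<delta> m (LeParam a b) < 2 ^ w"

fun cost :: "expr \<Rightarrow> nat" where
  "cost (Const c) = 1"
| "cost (Load a) = 1 + cost a"
| "cost (Bin f a b) = 1 + cost a + cost b"
| "cost (LeParam a b) = 1 + cost a + cost b"

text \<open>\<open>exec w \<delta> c (m, out) t (m', out')\<close>: started with memory \<open>m\<close> and output \<open>out\<close>, the program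
  \<open>c\<close> halts after \<open>t\<close> unit-cost operations on words of \<open>w\<close> bits, with memory \<open>m'\<close> and output
  \<open>out'\<close>. The output is append-only. A run in which a value overflows \<open>w\<close> bits has no derivation,
  so unit-cost arithmetic cannot be abused on huge numbers.\<close>

inductive exec :: "nat \<Rightarrow> real \<Rightarrow> com \<Rightarrow> mem \<times> nat list \<Rightarrow> nat \<Rightarrow> mem \<times> nat list \<Rightarrow> bool"
  for w :: nat and \<delta> :: real where
  Skip: "exec w \<delta> Skip s 1 s"
| Store: "fits w \<delta> m a \<Longrightarrow> fits w \<delta> m e \<Longrightarrow>
    exec w \<delta> (Store a e) (m, out) (1 + cost a + cost e) (m(eval \<delta> m a := eval \<delta> m e), out)"
| Emit: "fits w \<delta> m e \<Longrightarrow> exec w \<delta> (Emit e) (m, out) (1 + cost e) (m, out @ [eval \<delta> m e])"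
| Seq: "exec w \<delta> c1 s t1 s' \<Longrightarrow> exec w \<delta> c2 s' t2 s'' \<Longrightarrow> exec w \<delta> (Seq c1 c2) s (t1 + t2) s''"
| CondTrue: "fits w \<delta> m e \<Longrightarrow> eval \<delta> m e \<noteq> 0 \<Longrightarrow> exec w \<delta> c1 (m, out) t s' \<Longrightarrow>
    exec w \<delta> (Cond e c1 c2) (m, out) (1 + cost e + t) s'"
| CondFalse: "fits w \<delta> m e \<Longrightarrow> eval \<delta> m e = 0 \<Longrightarrow> exec w \<delta> c2 (m, out) t s' \<Longrightarrow>
    exec w \<delta> (Cond e c1 c2) (m, out) (1 + cost e + t) s'"
| WhileFalse: "fits w \<delta> m e \<Longrightarrow> eval \<delta> m e = 0 \<Longrightarrow>
    exec w \<delta> (While e c) (m, out) (1 + cost e) (m, out)"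
| WhileTrue: "fits w \<delta> m e \<Longrightarrow> eval \<delta> m e \<noteq> 0 \<Longrightarrow> exec w \<delta> c (m, out) t1 s' \<Longrightarrow>
    exec w \<delta> (While e c) s' t2 s'' \<Longrightarrow>
    exec w \<delta> (While e c) (m, out) (1 + cost e + t1 + t2) s''"

inductive_cases exec_SkipE: "exec w \<delta> Skip s t s'"
inductive_cases exec_StoreE: "exec w \<delta> (Store a e) s t s'"
inductive_cases exec_EmitE: "exec w \<delta> (Emit e) s t s'"
inductive_cases exec_SeqE: "exec w \<delta> (Seq c1 c2) s t s'"
inductive_cases exec_CondE: "exec w \<delta> (Cond e c1 c2) s t s'"
inductive_cases exec_WhileE: "exec w \<delta> (While e c) s t s'"

lemma exec_deterministic:
  "exec w \<delta> c s t s' \<Longrightarrow> exec w \<delta> c s u s'' \<Longrightarrow> t = u \<and> s' = s''"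
proof (induction arbitrary: u s'' rule: exec.induct)
  case (Skip s)
  then show ?case by (elim exec_SkipE) simp
next
  case (Store m a e out)
  from Store.prems show ?case by (elim exec_StoreE) simp
next
  case (Emit m e out)
  from Emit.prems show ?case by (elim exec_EmitE) simp
next
  case (Seq c1 s t1 s1 c2 t2 s2)
  from Seq.prems obtain v1 v2 r where "exec w \<delta> c1 s v1 r" "exec w \<delta> c2 r v2 s''" "u = v1 + v2"
    by (elim exec_SeqE) blast
  with Seq.IH show ?case by metis
next
  case (CondTrue m e c1 out t s1 c2)
  from CondTrue.prems CondTrue.hyps(2)
  obtain v where "exec w \<delta> c1 (m, out) v s''" "u = 1 + cost e + v"
    by (elim exec_CondE) auto
  with CondTrue.IH show ?case by metis
next
  case (CondFalse m e c2 out t s1 c1)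
  from CondFalse.prems CondFalse.hyps(2)
  obtain v where "exec w \<delta> c2 (m, out) v s''" "u = 1 + cost e + v"
    by (elim exec_CondE) auto
  with CondFalse.IH show ?case by metis
next
  case (WhileFalse m e c out)
  from WhileFalse.prems show ?case
    by (rule exec_WhileE) (use WhileFalse.hyps(2) in auto)
next
  case (WhileTrue m e c out t1 s1 t2 s2)
  from WhileTrue.prems obtain v1 v2 r where
    "exec w \<delta> c (m, out) v1 r" "exec w \<delta> (While e c) r v2 s''" "u = 1 + cost e + v1 + v2"
    by (rule exec_WhileE) (use WhileTrue.hyps(2) in auto)
  with WhileTrue.IH show ?case by metis
qed


section \<open>Constructing a family\<close>

definition input :: "nat \<Rightarrow> nat \<Rightarrow> mem" where
  "input n k = (\<lambda>_. 0)(0 := n, 1 := k)"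

text \<open>The tables of values \<open>f 1, \<dots>, f n\<close> of the functions, one after the other.\<close>

definition tables :: "nat \<Rightarrow> (nat \<Rightarrow> nat) list \<Rightarrow> nat list" where
  "tables n fs = concat (map (\<lambda>f. map f [1..<Suc n]) fs)"

text \<open>On input \<open>n\<close>, \<open>k\<close>, \<open>\<delta>\<close> the program \<open>P\<close> outputs a \<open>\<delta>\<close>-balanced \<open>(n,k)\<close>-family of size at most
  \<open>B\<close> within time \<open>\<tau>\<close>, on words of \<open>c log \<tau>\<close> bits, i.e. long enough to address the memory that
  can be used in time \<open>\<tau>\<close>.\<close>

definition constructs_family ::
    "com \<Rightarrow> real \<Rightarrow> nat \<Rightarrow> nat \<Rightarrow> real \<Rightarrow> real \<Rightarrow> real \<Rightarrow> bool" where
  "constructs_family P c n k \<delta> B \<tau> \<longleftrightarrow>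
     (\<exists>fs t m. exec (nat \<lfloor>c * log 2 \<tau>\<rfloor>) \<delta> P (input n k, []) t (m, tables n fs) \<and>
        balanced_phf_family \<delta> n k (mset fs) \<and>
        real (length fs) \<le> B \<and> real t \<le> \<tau>)"

text \<open>The logarithm occurring in asymptotic bounds, with the usual convention that makes the bounds
  meaningful for small arguments, where \<open>log n\<close>, \<open>log k\<close> or \<open>log log k\<close> would be zero, negative or
  undefined.\<close>

definition lg :: "real \<Rightarrow> real" where
  "lg x = max 1 (log 2 x)"

end

theory Submission
  imports Defs "HOL-Analysis.Convex" "HOL-Computational_Algebra.Computational_Algebra"
    "HOL-Combinatorics.Multiset_Permutations"
begin

text \<open>The family is a composition of hash functions. A residue modulo one of the first primes
  \<open>\<ge> 2 ^ g\<close>, followed by a linear polynomial over a prime field taken from a list that is found by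
  the method of conditional expectations, maps \<open>[n]\<close> to \<open>t = O (log (k / (\<delta> - 1)))\<close> bits with few
  collisions. A chain of polynomial hashes, whose degree of independence grows as the number of bits
  shrinks, then halves the number of bits until only \<open>O (log k + t / k)\<close> of them are left. Finally,
  Nisan's generator with the pairwise independent maps \<open>x \<mapsto> a * x + b\<close> first splits the \<open>k\<close> points
  evenly into about \<open>log k\<close> groups and then supplies independent polynomial hashes inside the groups.
  In each stage, the fraction of good seeds is the same for all \<open>k\<close>-sets up to a factor close to 1,
  and \<open>2 ^ O (k log log k) * (1 / (\<delta> - 1)) ^ O (log k)\<close> seeds suffice after the first stage.\<close>

section \<open>Primes\<close>

text \<open>The size may contain only one factor \<open>log n\<close>. The first stage uses about
  \<open>\<nu> / g\<close> moduli, each at least 2^g, and a code whose length is proportional to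
  \<open>g\<close>, where \<nu> is the bit length of \<open>n\<close>; so \<open>g\<close> cancels.
  A polynomial that is \<open>k\<close>-wise independent on \<open>O (log k)\<close> bits would cost
  \<open>k log k\<close> bits. In one of about \<open>log k\<close> groups
  \<open>O (k / log k)\<close> coefficients suffice, i.e. \<open>O (k)\<close> bits, and the
  generator stretches a seed of that size to all groups with about \<open>log log k\<close> maps:
  this is the origin of \<open>k log log k\<close>. A halving costs
  \<open>O (log k + log (1 / (\<delta> - 1)))\<close> bits at any length, since the degree shrinks
  in proportion to the length; at most about \<open>log k\<close> halvings give
  \<open>(1 / (\<delta> - 1)) ^ O (log k)\<close>. The share of good seeds may be exponentially
  small in \<open>k\<close>; it only has to be nearly the same for all \<open>k\<close>-sets. Errors
  must therefore be small relative to that share, which dictates the sizes of the primes of the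
  generators. Losses are measured as exponents of \<open>exp\<close>, so that they add up under
  composition.\<close>

lemma mult_binomial_dvd_common_multiple:
  fixes D N :: nat
  assumes D: "\<And>j. 1 \<le> j \<Longrightarrow> j \<le> N \<Longrightarrow> j dvd D"
  shows "1 \<le> m \<Longrightarrow> m \<le> n \<Longrightarrow> n \<le> N \<Longrightarrow> m * (n choose m) dvd D"
proof (induction m arbitrary: n rule: nat_induct_at_least)
  case base
  then show ?case using D[of n] by simp
next
  case (Suc m)
  obtain n' where n: "n = Suc n'" using Suc.prems by (cases n) auto
  have 1: "m * (n choose m) dvd D" using Suc by simp
  have 2: "m * (n' choose m) dvd D" using Suc n by simp
  define a where "a = m * (n choose m)"
  define b where "b = m * (n' choose m)"
  define c where "c = Suc m * (n choose Suc m)"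
  have pos: "a > 0" "b > 0" "c > 0"
    using Suc.prems Suc.hyps n unfolding a_def b_def c_def by (simp_all add: zero_less_binomial_iff)
  have ch: "n choose Suc m = (n' choose m) + (n' choose Suc m)" by (simp add: n)
  have c1: "c = n * (n' choose m)" unfolding c_def n by (rule Suc_times_binomial)
  have a1: "(n - m) * (n choose m) = n * (n' choose m)"
    using binomial_absorb_comp[of n m] by (simp add: n)
  \<comment> \<open>This is 1/c = 1/b - 1/a, the rule of Leibniz's harmonic triangle. Hence D/c =
    D/b - D/a is a difference of two integers.\<close>
  have key: "(real a - real b) * real c = real a * real b"
  proof -
    have e1: "real c = real n * real (n' choose m)" using c1 by simp
    have "real ((n - m) * (n choose m)) = real (n * (n' choose m))" using a1 by simp
    then have e2: "(real n - real m) * real (n choose m) = real n * real (n' choose m)"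
      using Suc.prems by (simp add: of_nat_diff)
    have "(real a - real b) * real c = real m * real (n' choose m) *
        (real n * real (n choose m) - real n * real (n' choose m))"
      unfolding e1 a_def b_def by (simp add: algebra_simps)
    also have "real n * real (n choose m) - real n * real (n' choose m) = real m * real (n choose m)"
      unfolding e2[symmetric] by (simp add: algebra_simps)
    finally show ?thesis unfolding a_def b_def by simp
  qed
  from 1 obtain u where u: "D = a * u" unfolding a_def by (auto elim: dvdE)
  from 2 obtain v where v: "D = b * v" unfolding b_def by (auto elim: dvdE)
  have "real c * (real v - real u) = real D"
  proof -
    have "real a * real b * (real c * (real v - real u))
        = real c * real a * (real b * real v) - real c * real b * (real a * real u)"
      by (simp add: algebra_simps)
    also have "real b * real v = real D" using v by simp
    also have "real a * real u = real D" using u by simp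
    also have "real c * real a * real D - real c * real b * real D = (real a - real b) * real c * real D"
      by (simp add: algebra_simps)
    also have "\<dots> = real a * real b * real D" using key by simp
    finally show ?thesis using pos by simp
  qed
  moreover have "v \<ge> u"
  proof (rule ccontr)
    assume "\<not> v \<ge> u"
    then have "real c * (real v - real u) < 0" using pos by (simp add: mult_pos_neg)
    then show False using \<open>real c * (real v - real u) = real D\<close> by simp
  qed
  ultimately have "real (c * (v - u)) = real D" by (simp add: of_nat_diff)
  then have "D = c * (v - u)" by (metis of_nat_eq_iff)
  then show ?case unfolding c_def by simp
qed

text \<open>The witness is the least common multiple, written as a product with one factor for each
  prime up to \<open>N\<close>: its largest power that is at most \<open>N\<close>.\<close>

lemma common_multiple_le_power_primes:
  fixes N :: nat
  assumes "N \<ge> 1"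
  shows "\<exists>D. D > 0 \<and> D \<le> N ^ card {p. prime p \<and> p \<le> N} \<and> (\<forall>j. 1 \<le> j \<and> j \<le> N \<longrightarrow> j dvd D)"
proof -
  define A where "A = {p::nat. prime p \<and> p \<le> N}"
  have fA: "finite A" unfolding A_def by simp
  define e where "e p = (GREATEST i. p ^ i \<le> N)" for p
  have e: "p ^ e p \<le> N" "\<And>i. p ^ i \<le> N \<Longrightarrow> i \<le> e p" if "p \<in> A" for p
  proof -
    have p2: "p \<ge> 2" using that prime_ge_2_nat unfolding A_def by auto
    have b: "\<And>i. p ^ i \<le> N \<Longrightarrow> i \<le> N"
    proof -
      fix i assume "p ^ i \<le> N"
      moreover have "i < 2 ^ i" by (rule less_exp)
      moreover have "(2::nat) ^ i \<le> p ^ i" using p2 by (rule power_mono) simp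
      ultimately show "i \<le> N" by linarith
    qed
    have "p ^ 0 \<le> N" using assms by simp
    then show "p ^ e p \<le> N" unfolding e_def by (rule GreatestI_nat[of "\<lambda>i. p ^ i \<le> N" 0 N]) (assumption | erule b)+
    show "\<And>i. p ^ i \<le> N \<Longrightarrow> i \<le> e p" unfolding e_def by (rule Greatest_le_nat[of "\<lambda>i. p ^ i \<le> N" _ N]) (assumption | erule b)+
  qed
  define D where "D = (\<Prod>p\<in>A. p ^ e p)"
  have Dpos: "D > 0" unfolding D_def using prime_gt_0_nat by (intro prod_pos) (auto simp: A_def)
  have "D \<le> (\<Prod>p\<in>A. N)" unfolding D_def by (rule prod_mono) (use e in auto)
  then have "D \<le> N ^ card A" by simp
  moreover have "j dvd D" if j: "1 \<le> j" "j \<le> N" for j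
  proof (rule multiplicity_le_imp_dvd)
    show "j \<noteq> 0" using j by simp
  next
    fix p :: nat assume p: "prime p"
    show "multiplicity p j \<le> multiplicity p D"
    proof (cases "p \<in> A")
      case True
      have "p ^ multiplicity p j dvd j" by (rule multiplicity_dvd)
      then have "p ^ multiplicity p j \<le> N" using j by (meson dvd_imp_le le_trans less_le_trans zero_less_one)
      then have "multiplicity p j \<le> e p" using e True by blast
      also have "p ^ e p dvd D" unfolding D_def using fA True by (rule dvd_prodI)
      then have "e p \<le> multiplicity p D"
        using Dpos p by (intro multiplicity_geI) auto
      finally show ?thesis .
    next
      case False
      then have "p > j" using p j unfolding A_def by auto
      then have "\<not> p dvd j" using j by (auto dest: dvd_imp_le)
      then show ?thesis by (simp add: not_dvd_imp_multiplicity_0)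
    qed
  qed
  ultimately show ?thesis using Dpos unfolding A_def by blast
qed

text \<open>Chebyshev's argument: \<open>m * (2 * m choose m)\<close> divides the least common multiple of
  \<open>1, \<dots>, 2 * m\<close>, which is at most \<open>(2 * m) ^ \<pi>(2 * m)\<close>.\<close>

lemma card_primes_power2:
  assumes "G \<ge> 1"
  shows "2 ^ G \<le> 1 + G * card {p::nat. prime p \<and> p \<le> 2 ^ G}"
proof -
  define m :: nat where "m = 2 ^ (G - 1)"
  have m: "m \<ge> 1" "2 * m = 2 ^ G" using assms unfolding m_def
    by (cases G; simp)+
  obtain D :: nat where D: "D > 0" "D \<le> (2^G) ^ card {p. prime p \<and> p \<le> (2^G::nat)}"
    "\<And>j. 1 \<le> j \<Longrightarrow> j \<le> 2^G \<Longrightarrow> j dvd D"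
    using common_multiple_le_power_primes[of "2^G"] by auto
  have "m * (2 * m choose m) dvd D"
    by (rule mult_binomial_dvd_common_multiple[of "2 ^ G"]) (use D m in auto)
  then have le: "m * (2 * m choose m) \<le> D" using D by (simp add: dvd_imp_le)
  have "4 ^ m / (2 * real m) \<le> real (2 * m choose m)"
    using m by (intro central_binomial_lower_bound) simp
  then have "4 ^ m / 2 \<le> real (m * (2 * m choose m))"
    using m by (simp add: field_simps)
  also have "\<dots> \<le> real ((2^G) ^ card {p. prime p \<and> p \<le> (2^G::nat)})"
    using le D(2) by (meson le_trans of_nat_le_iff)
  finally have "(2::real) ^ (2 * m) \<le> 2 ^ (1 + G * card {p. prime p \<and> p \<le> (2^G::nat)})"
    by (simp add: power_mult)
  then have "2 * m \<le> 1 + G * card {p. prime p \<and> p \<le> (2^G::nat)}"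
    by (subst (asm) power_increasing_iff) auto
  then show ?thesis using m by simp
qed

text \<open>The window is wide enough for the crude bound above: with fewer primes in it there would
  be fewer than 3 * 2^e primes up to 2^(2e + 8). The moduli of the first stage are taken from such a
  window.\<close>

lemma card_primes_between:
  "2 ^ (e + 1) \<le> card {p::nat. prime p \<and> 2 ^ e \<le> p \<and> p < 2 ^ (2 * e + 8)}"
proof -
  define G where "G = 2 * e + 8"
  define A where "A = {p::nat. prime p \<and> p \<le> 2 ^ G}"
  define B where "B = {p::nat. prime p \<and> 2 ^ e \<le> p \<and> p < 2 ^ G}"
  have "A \<subseteq> B \<union> {..<2 ^ e}"
  proof
    fix p assume p: "p \<in> A"
    have "p \<noteq> 2 ^ G"
      using p unfolding A_def G_def by (auto simp: prime_power_iff)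
    then show "p \<in> B \<union> {..<2 ^ e}" using p unfolding A_def B_def by auto
  qed
  then have "card A \<le> card (B \<union> {..<2 ^ e})" by (intro card_mono) (auto simp: B_def)
  also have "\<dots> \<le> card B + 2 ^ e" using card_Un_le[of B "{..<2^e}"] by simp
  finally have AB: "card A \<le> card B + 2 ^ e" .
  have "2 ^ G \<le> 1 + G * card A" unfolding A_def by (rule card_primes_power2) (simp add: G_def)
  also have "\<dots> \<le> 1 + G * (card B + 2 ^ e)" using AB by simp
  finally have 1: "2 ^ G \<le> 1 + G * (card B + 2 ^ e)" .
  \<comment> \<open>Gives \<open>G \<le> 8 * 2 ^ e\<close>, so that the assumption leads to 256 *
    4^e \<le> 1 + 24 * 4^e.\<close>
  have e2: "e + 4 \<le> 4 * 2 ^ e" by (induction e) auto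
  have "card B \<ge> 2 ^ (e + 1)"
  proof (rule ccontr)
    assume "\<not> card B \<ge> 2 ^ (e + 1)"
    then have "card B + 2 ^ e \<le> 3 * 2 ^ e" by simp
    then have "G * (card B + 2 ^ e) \<le> (8 * 2 ^ e) * (3 * 2 ^ e)"
      using e2 by (intro mult_mono) (auto simp: G_def)
    also have "\<dots> = 24 * (2 ^ e * 2 ^ e)" by simp
    finally have "2 ^ G \<le> 1 + 24 * (2 ^ e * 2 ^ e :: nat)" using 1 by linarith
    moreover have "(2::nat) ^ G = 256 * (2 ^ e * 2 ^ e)"
      unfolding G_def by (simp add: power_add power_mult power2_eq_square flip: power_mult_distrib)
    moreover have "(2::nat) ^ e * 2 ^ e \<ge> 1" by simp
    ultimately show False by linarith
  qed
  then show ?thesis unfolding B_def G_def by simp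
qed

definition next_prime :: "nat \<Rightarrow> nat" where
  "next_prime m = (LEAST p. prime p \<and> m \<le> p)"

lemma next_prime: "prime (next_prime m)" "m \<le> next_prime m"
  and next_prime_le: "prime p \<Longrightarrow> m \<le> p \<Longrightarrow> next_prime m \<le> p"
proof -
  obtain p where "prime p \<and> m \<le> p" using bigger_prime[of m] by (meson less_imp_le)
  then have "prime (next_prime m) \<and> m \<le> next_prime m" unfolding next_prime_def by (rule LeastI)
  then show "prime (next_prime m)" "m \<le> next_prime m" by auto
  show "prime p \<Longrightarrow> m \<le> p \<Longrightarrow> next_prime m \<le> p" for p
    unfolding next_prime_def by (rule Least_le) simp
qed

text \<open>Weaker than Bertrand's postulate, but it suffices that the bit length of the prime is
  linear in \<open>e\<close>; the factor 2 and the summand 8 end up in the constant of the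
  exponent.\<close>

lemma next_prime_power2_less: "next_prime (2 ^ e) < 2 ^ (2 * e + 8)"
proof -
  have "card {p::nat. prime p \<and> 2 ^ e \<le> p \<and> p < 2 ^ (2 * e + 8)} \<noteq> 0"
    using card_primes_between[of e] by (metis not_one_le_zero one_le_numeral one_le_power order.trans)
  then have "{p::nat. prime p \<and> 2 ^ e \<le> p \<and> p < 2 ^ (2 * e + 8)} \<noteq> {}" by auto
  then obtain p :: nat where "prime p" "2 ^ e \<le> p" "p < 2 ^ (2 * e + 8)" by blast
  then show ?thesis using next_prime_le[of p] by (meson le_less_trans)
qed

section \<open>Hashing by polynomials over a prime field\<close>

text \<open>The seed is a single number whose base \<open>p\<close> digits are the coefficients, so
  a uniform seed below \<open>p ^ d\<close> is a uniform polynomial of degree less than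
  \<open>d\<close>. Higher digits are ignored, which allows a later stage to read its own seed from
  the same number after a division by \<open>p ^ d\<close>.\<close>

definition poly_hash :: "nat \<Rightarrow> nat \<Rightarrow> nat \<Rightarrow> nat \<Rightarrow> nat" where
  "poly_hash p d s x = (\<Sum>i<d. (s div p ^ i mod p) * x ^ i) mod p"

text \<open>A nonzero polynomial over the field with \<open>p\<close> elements has no more roots
  than its degree. Here it is phrased by divisibility over the integers, so that the field need not
  be a type depending on \<open>p\<close>; synthetic division by one root carries the
  induction.\<close>

lemma prime_dvd_coeffs:
  fixes f :: "int poly" and p :: int
  assumes p: "prime p"
  shows "finite T \<Longrightarrow> (\<And>x y. x \<in> T \<Longrightarrow> y \<in> T \<Longrightarrow> p dvd x - y \<Longrightarrow> x = y) \<Longrightarrow>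
    (\<And>x. x \<in> T \<Longrightarrow> p dvd poly f x) \<Longrightarrow> degree f < card T \<Longrightarrow> [:p:] dvd f"
proof (induction "card T" arbitrary: T f)
  case 0
  then show ?case by simp
next
  case (Suc d)
  then obtain a T' where T: "T = insert a T'" "a \<notin> T'" "card T' = d"
    by (metis card_Suc_eq)
  define g where "g = synthetic_div f a"
  define r where "r = poly f a"
  have fg: "f = [:- a, 1:] * g + [:r:]"
    using synthetic_div_correct'[of a f] unfolding g_def r_def by metis
  have pa: "[:p:] dvd [:r:]" unfolding r_def using Suc.prems(3)[of a] T by (simp add: const_poly_dvd_const_poly_iff)
  have "[:p:] dvd g"
  proof (cases "degree f = 0")
    case True
    then have "g = 0" unfolding g_def by (simp add: synthetic_div_eq_0_iff)
    then show ?thesis by simp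
  next
    case False
    show ?thesis
    proof (rule Suc.hyps(1))
      show "d = card T'" using T by simp
      show "finite T'" using Suc.prems(1) T by simp
      show "\<And>x y. x \<in> T' \<Longrightarrow> y \<in> T' \<Longrightarrow> p dvd x - y \<Longrightarrow> x = y" using Suc.prems(2) T by blast
      show "degree g < card T'"
        using Suc.prems(4) Suc.hyps(2) False T by (simp add: g_def degree_synthetic_div)
      fix x assume x: "x \<in> T'"
      have "poly f x = poly ([:- a, 1:] * g + [:r:]) x" by (rule arg_cong[OF fg])
      then have "poly f x - poly f a = (x - a) * poly g x"
        unfolding r_def[symmetric] by (simp add: algebra_simps)
      moreover have "p dvd poly f x - poly f a"
        using Suc.prems(3)[of x] Suc.prems(3)[of a] x T by (intro dvd_diff) auto
      ultimately have "p dvd (x - a) * poly g x" by simp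
      moreover have "\<not> p dvd x - a" using Suc.prems(2)[of x a] x T by auto
      ultimately show "p dvd poly g x" using p by (simp add: prime_dvd_mult_iff)
    qed
  qed
  then have "[:p:] dvd [:- a, 1:] * g + [:r:]" by (intro dvd_add dvd_mult pa)
  then show ?case unfolding fg[symmetric] .
qed

lemma nat_digits_eqI:
  fixes s t p :: nat
  assumes "s < p ^ d" "t < p ^ d" "\<And>i. i < d \<Longrightarrow> s div p ^ i mod p = t div p ^ i mod p"
  shows "s = t"
  using assms
proof (induction d arbitrary: s t)
  case (Suc d)
  have 0: "s mod p = t mod p" using Suc.prems(3)[of 0] by simp
  have "s div p = t div p"
  proof (rule Suc.IH)
    show "s div p < p ^ d" "t div p < p ^ d" using Suc.prems(1,2) by (simp_all add: less_mult_imp_div_less mult.commute)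
    fix i assume "i < d"
    then show "s div p div p ^ i mod p = t div p div p ^ i mod p"
      using Suc.prems(3)[of "Suc i"] by (simp add: div_mult2_eq)
  qed
  with 0 show ?case by (metis div_mult_mod_eq)
qed simp

text \<open>Uniqueness of interpolation: the difference of the two polynomials vanishes modulo
  \<open>p\<close> at \<open>d\<close> points, so \<open>p\<close> divides its coefficients, and the
  digits are smaller than \<open>p\<close>.\<close>

lemma poly_hash_inj:
  assumes p: "prime p" and T: "T \<subseteq> {..<p}" "card T = d"
    and s: "s < p ^ d" "t < p ^ d" and eq: "\<And>x. x \<in> T \<Longrightarrow> poly_hash p d s x = poly_hash p d t x"
  shows "s = t"
proof (cases "d = 0")
  case False
  have fT: "finite T" using T(1) finite_subset by blast
  define c :: "nat \<Rightarrow> int" where "c i = int (s div p ^ i mod p) - int (t div p ^ i mod p)" for i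
  define f where "f = (\<Sum>i<d. monom (c i) i)"
  have pf: "poly f (int x) = int (\<Sum>i<d. (s div p ^ i mod p) * x ^ i) - int (\<Sum>i<d. (t div p ^ i mod p) * x ^ i)" for x
    by (simp add: f_def poly_sum poly_monom c_def sum_subtractf[symmetric] algebra_simps)
  have "[:int p:] dvd f"
  proof (rule prime_dvd_coeffs[where T = "int ` T"])
    show "prime (int p)" using p by simp
    show "finite (int ` T)" using fT by simp
    show "degree f < card (int ` T)"
    proof -
      have "degree f \<le> d - 1" unfolding f_def
        by (rule degree_sum_le) (auto intro!: order.trans[OF degree_monom_le])
      then show ?thesis using T False by (simp add: card_image)
    qed
    show "x = y" if "x \<in> int ` T" "y \<in> int ` T" "int p dvd x - y" for x y
    proof -
      from that obtain a b where ab: "x = int a" "y = int b" "a < p" "b < p" using T by auto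
      have "x mod int p = y mod int p" using that(3) by (simp add: mod_eq_dvd_iff)
      then show ?thesis using ab by simp
    qed
    show "int p dvd poly f x" if "x \<in> int ` T" for x
    proof -
      from that obtain a where a: "a \<in> T" "x = int a" by auto
      have "(\<Sum>i<d. (s div p ^ i mod p) * a ^ i) mod p = (\<Sum>i<d. (t div p ^ i mod p) * a ^ i) mod p"
        using eq[OF a(1)] unfolding poly_hash_def .
      then have "int (\<Sum>i<d. (s div p ^ i mod p) * a ^ i) mod int p = int (\<Sum>i<d. (t div p ^ i mod p) * a ^ i) mod int p"
        by (simp only: of_nat_mod[symmetric])
      then show ?thesis unfolding a pf by (simp add: mod_eq_dvd_iff)
    qed
  qed
  then have "\<And>i. int p dvd coeff f i" by (simp add: const_poly_dvd_iff)
  moreover have "coeff f i = c i" if "i < d" for i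
    using that by (simp add: f_def coeff_sum)
  ultimately have dv: "int p dvd c i" if "i < d" for i using that by metis
  show ?thesis
  proof (rule nat_digits_eqI[OF s])
    fix i assume "i < d"
    have "int (s div p ^ i mod p) mod int p = int (t div p ^ i mod p) mod int p"
      using dv[OF \<open>i < d\<close>] unfolding c_def by (simp add: mod_eq_dvd_iff)
    then show "s div p ^ i mod p = t div p ^ i mod p" by (simp flip: of_nat_mod)
  qed
qed (use s in simp)

lemma poly_hash_less: "p > 0 \<Longrightarrow> poly_hash p d s x < p"
  by (simp add: poly_hash_def)

lemma poly_hash_mod_power: "p > 0 \<Longrightarrow> poly_hash p d (s mod p ^ d) x = poly_hash p d s x"
proof -
  assume p: "p > 0"
  have "s mod p ^ d div p ^ i mod p = s div p ^ i mod p" if "i < d" for i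
  proof -
    have e: "p ^ d = p ^ i * (p * p ^ (d - Suc i))"
      using that by (metis Suc_diff_Suc diff_Suc_Suc le_add_diff_inverse less_imp_le power_Suc power_add)
    have "s mod p ^ d div p ^ i = s div p ^ i mod (p * p ^ (d - Suc i))"
      unfolding e using p by (simp add: mod_mult2_eq)
    then show ?thesis by (simp add: mod_mult2_eq)
  qed
  then show ?thesis unfolding poly_hash_def by (intro arg_cong[where f = "\<lambda>x. x mod p"] sum.cong) auto
qed

text \<open>For fixed high digits, prescribing values at \<open>e\<close> points becomes an
  interpolation problem for the low \<open>e\<close> digits alone, with known shifts.\<close>

lemma poly_hash_split:
  assumes "e \<le> d" "p > 0"
  shows "poly_hash p d s x = (poly_hash p e (s mod p ^ e) x + x ^ e * poly_hash p (d - e) (s div p ^ e) x) mod p"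
proof -
  have "(\<Sum>i<d. (s div p ^ i mod p) * x ^ i)
      = (\<Sum>i<e. (s div p ^ i mod p) * x ^ i) + (\<Sum>i\<in>{e..<d}. (s div p ^ i mod p) * x ^ i)"
    using assms(1) by (subst sum.union_disjoint[symmetric]) (auto intro: sum.cong)
  also have "(\<Sum>i\<in>{e..<d}. (s div p ^ i mod p) * x ^ i)
      = (\<Sum>i<d - e. (s div p ^ (i + e) mod p) * x ^ (i + e))"
    using sum.shift_bounds_nat_ivl[of "\<lambda>i. (s div p ^ i mod p) * x ^ i" 0 e "d - e"] assms(1)
    by (simp add: atLeast0LessThan)
  also have "\<dots> = x ^ e * (\<Sum>i<d - e. (s div p ^ e div p ^ i mod p) * x ^ i)"
  proof -
    have "s div p ^ (i + e) = s div p ^ e div p ^ i" for i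
      by (metis add.commute power_add div_mult2_eq)
    then show ?thesis by (simp add: sum_distrib_left power_add mult.assoc mult.left_commute mult.commute[of _ "x ^ e"])
  qed
  finally have 1: "(\<Sum>i<d. (s div p ^ i mod p) * x ^ i) = (\<Sum>i<e. (s div p ^ i mod p) * x ^ i)
      + x ^ e * (\<Sum>i<d - e. (s div p ^ e div p ^ i mod p) * x ^ i)" .
  have 2: "(A + X * B) mod p = (A mod p + X * (B mod p)) mod p" for A B X :: nat
  proof -
    have "(A mod p + X * (B mod p)) mod p = (A + (X * (B mod p)) mod p) mod p"
      by (simp only: mod_add_left_eq mod_add_right_eq)
    also have "\<dots> = (A + X * B mod p) mod p" by (simp only: mod_mult_right_eq)
    finally show ?thesis by (simp only: mod_add_right_eq)
  qed
  have "poly_hash p d s x = (poly_hash p e s x + x ^ e * poly_hash p (d - e) (s div p ^ e) x) mod p"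
    unfolding poly_hash_def 1 by (rule 2)
  then show ?thesis using assms(2) by (simp add: poly_hash_mod_power)
qed

lemma card_eq_if_sum_eq_bound:
  fixes f :: "'a \<Rightarrow> nat"
  assumes "finite A" "\<And>x. x \<in> A \<Longrightarrow> f x \<le> c" "sum f A = card A * c" "x \<in> A"
  shows "f x = c"
proof (rule ccontr)
  assume "f x \<noteq> c"
  then have "sum f A < (\<Sum>x\<in>A. c)"
    using assms by (intro sum_strict_mono_ex1) (auto simp: order.strict_iff_order intro!: bexI[of _ x])
  then show False using assms(3) by simp
qed

lemma nat_add_right_cancel_mod: "a mod p = b mod p" if "(a + c) mod p = (b + c) mod p" for a b c p :: nat
proof -
  have "(int a + int c) mod int p = (int b + int c) mod int p"
    using that by (metis of_nat_add of_nat_mod)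
  then have "int p dvd (int a + int c) - (int b + int c)" by (simp only: mod_eq_dvd_iff)
  then have "int a mod int p = int b mod int p" by (simp add: mod_eq_dvd_iff)
  then show ?thesis by (metis of_nat_eq_iff of_nat_mod)
qed

text \<open>Counting replaces solving the interpolation problem. Each value pattern has at most
  \<open>p ^ (d - card T)\<close> seeds, because the high digits determine the seed; the
  \<open>p ^ card T\<close> patterns share all \<open>p ^ d\<close> seeds, so every bound is
  attained.\<close>

lemma card_poly_hash_eq:
  assumes p: "prime p" and T: "T \<subseteq> {..<p}" "card T \<le> d" and v: "v \<in> T \<rightarrow>\<^sub>E {..<p}"
  shows "card {s \<in> {..<p ^ d}. restrict (poly_hash p d s) T = v} = p ^ (d - card T)"
proof -
  define e where "e = card T"
  have fT: "finite T" using T(1) finite_subset by blast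
  have p0: "p > 0" using p prime_gt_0_nat by blast
  define F where "F v = {s \<in> {..<p ^ d}. restrict (poly_hash p d s) T = v}" for v
  have le: "card (F v) \<le> p ^ (d - e)" for v
  proof -
    have "inj_on (\<lambda>s. s div p ^ e) (F v)"
    proof (rule inj_onI)
      fix s t assume st: "s \<in> F v" "t \<in> F v" "s div p ^ e = t div p ^ e"
      have "s mod p ^ e = t mod p ^ e"
      proof (rule poly_hash_inj[OF p T(1)])
        show "card T = e" by (simp add: e_def)
        show "s mod p ^ e < p ^ e" "t mod p ^ e < p ^ e" using p0 by simp_all
        fix x assume x: "x \<in> T"
        have "restrict (poly_hash p d s) T x = restrict (poly_hash p d t) T x"
          using st unfolding F_def by simp
        then have "poly_hash p d s x = poly_hash p d t x" using x by simp
        then have "(poly_hash p e (s mod p ^ e) x + x ^ e * poly_hash p (d - e) (s div p ^ e) x) mod p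
            = (poly_hash p e (t mod p ^ e) x + x ^ e * poly_hash p (d - e) (s div p ^ e) x) mod p"
          (is "(?a + ?c) mod p = (?b + ?c) mod p")
          using poly_hash_split[of e d p] T(2) p0 st(3) e_def by metis
        then have "poly_hash p e (s mod p ^ e) x mod p = poly_hash p e (t mod p ^ e) x mod p"
          by (rule nat_add_right_cancel_mod)
        then show "poly_hash p e (s mod p ^ e) x = poly_hash p e (t mod p ^ e) x"
          using poly_hash_less[OF p0] by simp
      qed
      then show "s = t" using st(3) by (metis div_mult_mod_eq)
    qed
    moreover have "(\<lambda>s. s div p ^ e) ` F v \<subseteq> {..<p ^ (d - e)}"
    proof -
      have "p ^ d = p ^ e * p ^ (d - e)" using T(2) by (simp add: e_def flip: power_add)
      then show ?thesis unfolding F_def by (auto simp: less_mult_imp_div_less mult.commute)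
    qed
    ultimately show ?thesis by (metis card_inj_on_le card_lessThan finite_lessThan)
  qed
  have "(\<Sum>v\<in>T \<rightarrow>\<^sub>E {..<p}. card (F v)) = card (\<Union>v\<in>T \<rightarrow>\<^sub>E {..<p}. F v)"
    using fT by (intro card_UN_disjoint[symmetric]) (auto simp: F_def intro!: finite_PiE)
  also have "(\<Union>v\<in>T \<rightarrow>\<^sub>E {..<p}. F v) = {..<p ^ d}"
    using poly_hash_less[OF p0] by (auto simp: F_def)
  also have "card {..<p ^ d} = card (T \<rightarrow>\<^sub>E {..<p}) * p ^ (d - e)"
    using fT T(2) by (simp add: card_PiE e_def flip: power_add)
  finally have "card (F v) = p ^ (d - e)"
    using le v fT by (intro card_eq_if_sum_eq_bound[of "T \<rightarrow>\<^sub>E {..<p}" "\<lambda>v. card (F v)"]) (auto intro!: finite_PiE)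
  then show ?thesis unfolding F_def e_def .
qed

text \<open>This is \<open>d\<close>-wise independence for arbitrary test functions of at most
  \<open>d\<close> values.\<close>

lemma sum_poly_hash:
  fixes Q :: "(nat \<Rightarrow> nat) \<Rightarrow> 'b::comm_semiring_1"
  assumes p: "prime p" and T: "T \<subseteq> {..<p}" "card T \<le> d"
  shows "(\<Sum>s<p ^ d. Q (restrict (poly_hash p d s) T))
    = of_nat (p ^ (d - card T)) * (\<Sum>v\<in>T \<rightarrow>\<^sub>E {..<p}. Q v)"
proof -
  have fT: "finite T" using T(1) finite_subset by blast
  have p0: "p > 0" using p prime_gt_0_nat by blast
  have "(\<Sum>s<p ^ d. Q (restrict (poly_hash p d s) T))
      = (\<Sum>v\<in>T \<rightarrow>\<^sub>E {..<p}. \<Sum>s\<in>{s \<in> {..<p ^ d}. restrict (poly_hash p d s) T = v}. Q (restrict (poly_hash p d s) T))"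
    by (rule sum.group[of "{..<p ^ d}" "T \<rightarrow>\<^sub>E {..<p}" "\<lambda>s. restrict (poly_hash p d s) T"
          "\<lambda>s. Q (restrict (poly_hash p d s) T)", symmetric]) (use poly_hash_less[OF p0] fT in \<open>auto intro!: finite_PiE\<close>)
  also have "\<dots> = (\<Sum>v\<in>T \<rightarrow>\<^sub>E {..<p}. of_nat (p ^ (d - card T)) * Q v)"
  proof (intro sum.cong refl)
    fix v assume v: "v \<in> T \<rightarrow>\<^sub>E {..<p}"
    define F where "F = {s \<in> {..<p ^ d}. restrict (poly_hash p d s) T = v}"
    have "(\<Sum>s\<in>F. Q (restrict (poly_hash p d s) T)) = (\<Sum>s\<in>F. Q v)"
      by (rule sum.cong) (auto simp: F_def)
    also have "\<dots> = of_nat (card F) * Q v" by simp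
    also have "card F = p ^ (d - card T)" unfolding F_def by (rule card_poly_hash_eq[OF p T v])
    finally show "(\<Sum>s\<in>{s \<in> {..<p ^ d}. restrict (poly_hash p d s) T = v}. Q (restrict (poly_hash p d s) T))
      = of_nat (p ^ (d - card T)) * Q v" unfolding F_def .
  qed
  finally show ?thesis by (simp add: sum_distrib_left)
qed

lemma card_poly_hash:
  assumes p: "prime p" and T: "T \<subseteq> {..<p}" "card T \<le> d"
  shows "card {s \<in> {..<p ^ d}. Q (restrict (poly_hash p d s) T)}
    = p ^ (d - card T) * card {v \<in> T \<rightarrow>\<^sub>E {..<p}. Q v}"
proof -
  have fT: "finite T" using T(1) finite_subset by blast
  have c: "card {x \<in> A. R x} = (\<Sum>x\<in>A. of_bool (R x))" if "finite A" for A :: "'c set" and R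
    using that by (simp add: sum_of_bool_eq Collect_conj_eq)
  have "card {s \<in> {..<p ^ d}. Q (restrict (poly_hash p d s) T)}
      = (\<Sum>s<p ^ d. of_bool (Q (restrict (poly_hash p d s) T)))" by (rule c) simp
  also have "\<dots> = p ^ (d - card T) * (\<Sum>v\<in>T \<rightarrow>\<^sub>E {..<p}. of_bool (Q v))"
    using sum_poly_hash[OF p T, of "\<lambda>v. of_bool (Q v) :: nat"] by simp
  also have "(\<Sum>v\<in>T \<rightarrow>\<^sub>E {..<p}. of_bool (Q v)) = card {v \<in> T \<rightarrow>\<^sub>E {..<p}. Q v}"
    by (rule c[symmetric]) (simp add: finite_PiE fT)
  finally show ?thesis .
qed

section \<open>Balanced injectivity and collision patterns\<close>

text \<open>The two factors are exponentials because the losses of composed stages then add. Members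
  are counted through an index set, so repeated functions count with multiplicity.\<close>

definition inj_balanced :: "real \<Rightarrow> nat \<Rightarrow> nat \<Rightarrow> 'i set \<Rightarrow> ('i \<Rightarrow> nat \<Rightarrow> nat) \<Rightarrow> bool" where
  "inj_balanced \<eta> k u I f \<longleftrightarrow> finite I \<and> (\<exists>T::real. T > 0 \<and> (\<forall>S. S \<subseteq> {..<u} \<and> card S = k \<longrightarrow>
     T * exp (- \<eta>) \<le> real (card {i \<in> I. inj_on (f i) S}) \<and> real (card {i \<in> I. inj_on (f i) S}) \<le> T * exp \<eta>))"

text \<open>For \<open>x \<le> 1 / 2\<close> the product of 1 - x and 1 + 2x is at least 1, hence 1
  - x \<ge> exp (-2x); this is where a loss doubles in passing from relative errors to
  exponents.\<close>

lemma exp_sandwich: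
  fixes a c x :: real
  assumes "\<bar>a - c\<bar> \<le> x * c" "0 \<le> x" "x \<le> 1 / 2" "0 \<le> c"
  shows "c * exp (- (2 * x)) \<le> a" "a \<le> c * exp (2 * x)"
proof -
  have "1 + 2 * x \<le> exp (2 * x)" by (rule exp_ge_add_one_self)
  have "x * x \<le> x * (1 / 2)" using assms by (intro mult_left_mono) auto
  then have "1 \<le> (1 - x) * (1 + 2 * x)" by (simp add: algebra_simps)
  also have "\<dots> \<le> (1 - x) * exp (2 * x)"
    using assms \<open>1 + 2 * x \<le> exp (2 * x)\<close> by (intro mult_left_mono) auto
  finally have "exp (- (2 * x)) \<le> 1 - x" by (simp add: exp_minus field_simps)
  then have "c * exp (- (2 * x)) \<le> c * (1 - x)" using assms by (intro mult_left_mono) auto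
  then show "c * exp (- (2 * x)) \<le> a" using assms(1) by (simp add: abs_le_iff algebra_simps)
  have "c * (1 + x) \<le> c * exp (2 * x)"
    using assms \<open>1 + 2 * x \<le> exp (2 * x)\<close> by (intro mult_left_mono) linarith+
  then show "a \<le> c * exp (2 * x)" using assms(1) by (simp add: abs_le_iff algebra_simps)
qed

lemma inj_balancedI:
  assumes "finite I" "I \<noteq> {}" "c > 0" "0 \<le> \<eta>" "\<eta> \<le> 1"
    and "\<And>S. S \<subseteq> {..<u} \<Longrightarrow> card S = k \<Longrightarrow>
      \<bar>real (card {i \<in> I. inj_on (f i) S}) / real (card I) - c\<bar> \<le> \<eta> / 2 * c"
  shows "inj_balanced \<eta> k u I f"
proof -
  have N: "real (card I) > 0" using assms(1,2) by (simp add: card_gt_0_iff)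
  have "real (card I) * c * exp (- \<eta>) \<le> real (card {i \<in> I. inj_on (f i) S})
     \<and> real (card {i \<in> I. inj_on (f i) S}) \<le> real (card I) * c * exp \<eta>"
    if S: "S \<subseteq> {..<u}" "card S = k" for S
  proof -
    define a where "a = real (card {i \<in> I. inj_on (f i) S}) / real (card I)"
    have a: "real (card {i \<in> I. inj_on (f i) S}) = real (card I) * a" using N unfolding a_def by simp
    have "\<bar>a - c\<bar> \<le> \<eta> / 2 * c" using assms(6)[OF S] unfolding a_def .
    then have "c * exp (- (2 * (\<eta> / 2))) \<le> a" "a \<le> c * exp (2 * (\<eta> / 2))"
      using assms(3-5) exp_sandwich[of a c "\<eta> / 2"] by simp_all
    then have "c * exp (- \<eta>) \<le> a" "a \<le> c * exp \<eta>" by simp_all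
    then show ?thesis unfolding a mult.assoc using N by (intro conjI mult_left_mono) simp_all
  qed
  then show ?thesis unfolding inj_balanced_def using assms(1,3) N
    by (intro conjI exI[of _ "real (card I) * c"]) auto
qed

text \<open>Classifies \<open>u\<close> by the first index \<open>i\<close> whose value repeats an
  earlier one. The partner \<open>j\<close> is unique, since the values before \<open>i\<close> are
  distinct.\<close>

lemma inj_expansion:
  fixes u :: "nat \<Rightarrow> 'a"
  shows "(1::real) = of_bool (inj_on u {..<n}) + (\<Sum>i<n. \<Sum>j<i. of_bool (u i = u j \<and> inj_on u {..<i}))"
proof (induction n)
  case (Suc n)
  have "of_bool (inj_on u {..<n}) =
      of_bool (inj_on u {..<Suc n}) + (\<Sum>j<n. of_bool (u n = u j \<and> inj_on u {..<n}) :: real)"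
  proof (cases "inj_on u {..<n}")
    case inj: True
    show ?thesis
    proof (cases "\<exists>j<n. u n = u j")
      case True
      then obtain j where j: "j < n" "u n = u j" by auto
      have "(u n = u i \<and> inj_on u {..<n}) = (i = j)" if "i < n" for i
        using inj j that by (auto simp: inj_on_def)
      then have "(\<Sum>i<n. of_bool (u n = u i \<and> inj_on u {..<n}) :: real) = (\<Sum>i<n. of_bool (i = j))"
        by (intro sum.cong) auto
      also have "\<dots> = 1" using j by (simp add: of_bool_def)
      moreover have "\<not> inj_on u {..<Suc n}"
        using j by (metis inj_onD lessThan_iff less_Suc_eq less_irrefl_nat)
      ultimately show ?thesis using inj by simp
    next
      case False
      then have "inj_on u {..<Suc n}" using inj by (auto simp: lessThan_Suc)
      moreover have "(\<Sum>i<n. of_bool (u n = u i \<and> inj_on u {..<n}) :: real) = 0"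
        using False by (intro sum.neutral) auto
      ultimately show ?thesis using inj by simp
    qed
  next
    case False
    then have "\<not> inj_on u {..<Suc n}" by (auto simp: lessThan_Suc)
    then show ?thesis using False by simp
  qed
  then show ?case using Suc by simp
qed simp

text \<open>Every index is the larger end of at most one pair, so the pairs are the edges of a
  forest. The larger end of the head exceeds all other indices that occur and is therefore a
  leaf.\<close>

fun decreasing_pairs :: "(nat \<times> nat) list \<Rightarrow> bool" where
  "decreasing_pairs [] \<longleftrightarrow> True"
| "decreasing_pairs (ij # ps) \<longleftrightarrow> snd ij < fst ij \<and> (\<forall>ab\<in>set ps. fst ab < fst ij) \<and> decreasing_pairs ps"

definition collides :: "(nat \<times> nat) list \<Rightarrow> (nat \<Rightarrow> 'a) \<Rightarrow> bool" where
  "collides ps u \<longleftrightarrow> (\<forall>ij\<in>set ps. u (fst ij) = u (snd ij))"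

lemma decreasing_pairs_snoc:
  "decreasing_pairs (ps @ [(i, j)]) \<longleftrightarrow> decreasing_pairs ps \<and> j < i \<and> (\<forall>ab\<in>set ps. i < fst ab)"
  by (induction ps) auto

lemma decreasing_pairs_less: "decreasing_pairs ps \<Longrightarrow> ij \<in> set ps \<Longrightarrow> snd ij < fst ij"
  by (induction ps) auto

lemma collides_snoc: "collides (ps @ [(i, j)]) u \<longleftrightarrow> collides ps u \<and> u i = u j"
  by (auto simp: collides_def)

definition prob :: "'i set \<Rightarrow> ('i \<Rightarrow> bool) \<Rightarrow> real" where
  "prob I W = (\<Sum>a\<in>I. of_bool (W a)) / real (card I)"

lemma prob_card: "finite I \<Longrightarrow> prob I W = real (card {a \<in> I. W a}) / real (card I)"
  by (simp add: prob_def sum_of_bool_eq Collect_conj_eq)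

lemma prob_mono: "(\<And>a. a \<in> I \<Longrightarrow> V a \<Longrightarrow> W a) \<Longrightarrow> prob I V \<le> prob I W"
  unfolding prob_def by (intro divide_right_mono sum_mono) auto

lemma prob_nonneg: "0 \<le> prob I V"
  unfolding prob_def by (intro divide_nonneg_nonneg sum_nonneg) auto

text \<open>\<open>inj_expansion\<close> multiplied by the indicator of the pattern: a first
  repetition at \<open>i\<close> extends the pattern by one pair and leaves injectivity below
  \<open>i\<close> as the remaining condition.\<close>

lemma prob_collides_inj:
  "prob I (\<lambda>a. collides ps (u a)) = prob I (\<lambda>a. collides ps (u a) \<and> inj_on (u a) {..<n})
     + (\<Sum>i<n. \<Sum>j<i. prob I (\<lambda>a. collides (ps @ [(i, j)]) (u a) \<and> inj_on (u a) {..<i}))"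
proof -
  have "of_bool (collides ps (u a)) = (of_bool (collides ps (u a) \<and> inj_on (u a) {..<n}) :: real)
     + (\<Sum>i<n. \<Sum>j<i. of_bool (collides (ps @ [(i, j)]) (u a) \<and> inj_on (u a) {..<i}))" for a
    using inj_expansion[of "u a" n] by (cases "collides ps (u a)") (simp_all add: collides_snoc)
  then have "(\<Sum>a\<in>I. of_bool (collides ps (u a)) :: real)
      = (\<Sum>a\<in>I. of_bool (collides ps (u a) \<and> inj_on (u a) {..<n}))
        + (\<Sum>a\<in>I. \<Sum>i<n. \<Sum>j<i. of_bool (collides (ps @ [(i, j)]) (u a) \<and> inj_on (u a) {..<i}))"
    by (simp add: sum.distrib)
  also have "(\<Sum>a\<in>I. \<Sum>i<n. \<Sum>j<i. of_bool (collides (ps @ [(i, j)]) (u a) \<and> inj_on (u a) {..<i}) :: real)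
      = (\<Sum>i<n. \<Sum>j<i. \<Sum>a\<in>I. of_bool (collides (ps @ [(i, j)]) (u a) \<and> inj_on (u a) {..<i}))"
    by (subst sum.swap, intro sum.cong refl, rule sum.swap)
  finally show ?thesis unfolding prob_def by (simp add: add_divide_distrib sum_divide_distrib)
qed

text \<open>Expanding \<open>r\<close> times writes the indicator of injectivity through collision patterns that are
  forests with at most \<open>r\<close> edges, so only the joint laws of \<open>2 * r\<close> values matter.\<close>

lemma prob_inj_diff:
  fixes u1 :: "'i \<Rightarrow> nat \<Rightarrow> 'a" and u2 :: "'j \<Rightarrow> nat \<Rightarrow> 'b"
  assumes H: "\<And>ps. decreasing_pairs ps \<Longrightarrow> (\<forall>ij\<in>set ps. fst ij < k) \<Longrightarrow> length ps \<le> r \<Longrightarrow>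
      prob I (\<lambda>a. collides ps (u1 a)) = prob J (\<lambda>a. collides ps (u2 a)) \<and>
      prob I (\<lambda>a. collides ps (u1 a)) \<le> \<mu> ^ length ps"
    and mu: "0 \<le> \<mu>"
  shows "decreasing_pairs ps \<Longrightarrow> (\<forall>ij\<in>set ps. n \<le> fst ij \<and> fst ij < k) \<Longrightarrow> length ps + m = r \<Longrightarrow> n \<le> k \<Longrightarrow>
    \<bar>prob I (\<lambda>a. collides ps (u1 a) \<and> inj_on (u1 a) {..<n})
       - prob J (\<lambda>a. collides ps (u2 a) \<and> inj_on (u2 a) {..<n})\<bar> \<le> real (k\<^sup>2) ^ m * \<mu> ^ r"
proof (induction m arbitrary: ps n)
  case 0
  have "prob I (\<lambda>a. collides ps (u1 a) \<and> inj_on (u1 a) {..<n}) \<le> prob I (\<lambda>a. collides ps (u1 a))"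
    "prob J (\<lambda>a. collides ps (u2 a) \<and> inj_on (u2 a) {..<n}) \<le> prob J (\<lambda>a. collides ps (u2 a))"
    by (auto intro: prob_mono)
  then show ?case using H[of ps] 0 prob_nonneg[of I "\<lambda>a. collides ps (u1 a) \<and> inj_on (u1 a) {..<n}"]
      prob_nonneg[of J "\<lambda>a. collides ps (u2 a) \<and> inj_on (u2 a) {..<n}"] by auto
next
  case (Suc m)
  define A where "A i j = prob I (\<lambda>a. collides (ps @ [(i, j)]) (u1 a) \<and> inj_on (u1 a) {..<i})" for i j
  define B where "B i j = prob J (\<lambda>a. collides (ps @ [(i, j)]) (u2 a) \<and> inj_on (u2 a) {..<i})" for i j
  \<comment> \<open>Both probabilities obey the recursion \<open>prob_collides_inj\<close>, whose
    left-hand sides agree by \<open>H\<close>. The at most k^2 terms have one more pair each; it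
    goes to the end of the list because its larger index lies below all former ones.\<close>
  have le: "\<bar>A i j - B i j\<bar> \<le> real (k\<^sup>2) ^ m * \<mu> ^ r" if "i < n" "j < i" for i j
    unfolding A_def B_def
  proof (rule Suc.IH)
    show "decreasing_pairs (ps @ [(i, j)])" using Suc.prems that by (force simp: decreasing_pairs_snoc)
    show "\<forall>ij\<in>set (ps @ [(i, j)]). i \<le> fst ij \<and> fst ij < k" using Suc.prems that by force
    show "length (ps @ [(i, j)]) + m = r" "i \<le> k" using Suc.prems that by auto
  qed
  have c0: "0 \<le> real (k\<^sup>2) ^ m * \<mu> ^ r" using mu by simp
  have "(\<Sum>i<n. \<Sum>j<i. \<bar>A i j - B i j\<bar>) \<le> (\<Sum>i<n. \<Sum>j<i. real (k\<^sup>2) ^ m * \<mu> ^ r)"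
    by (intro sum_mono le) auto
  also have "\<dots> \<le> (\<Sum>i<n. real k * (real (k\<^sup>2) ^ m * \<mu> ^ r))"
    using c0 Suc.prems(4) by (intro sum_mono) (simp add: mult_right_mono)
  also have "\<dots> \<le> real k * (real k * (real (k\<^sup>2) ^ m * \<mu> ^ r))"
    using c0 Suc.prems(4) by (simp add: mult_right_mono)
  finally have "(\<Sum>i<n. \<Sum>j<i. \<bar>A i j - B i j\<bar>) \<le> real (k\<^sup>2) ^ Suc m * \<mu> ^ r"
    by (simp add: power2_eq_square mult.assoc)
  moreover have "\<bar>(\<Sum>i<n. \<Sum>j<i. A i j) - (\<Sum>i<n. \<Sum>j<i. B i j)\<bar> \<le> (\<Sum>i<n. \<Sum>j<i. \<bar>A i j - B i j\<bar>)"
    by (simp add: sum_subtractf[symmetric]) (intro order.trans[OF sum_abs] sum_mono sum_abs)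
  moreover have "prob I (\<lambda>a. collides ps (u1 a)) = prob J (\<lambda>a. collides ps (u2 a))"
    using H[of ps] Suc.prems by auto
  ultimately show ?case
    using prob_collides_inj[of I ps u1 n] prob_collides_inj[of J ps u2 n] unfolding A_def B_def by linarith
qed

lemma card_residue_class_le:
  fixes p z t :: nat
  assumes "z > 0"
  shows "card {c \<in> {..<p}. c mod z = t} \<le> p div z + 1"
proof -
  have "inj_on (\<lambda>c. c div z) {c \<in> {..<p}. c mod z = t}"
    by (rule inj_onI) (metis (mono_tags, lifting) div_mult_mod_eq mem_Collect_eq)
  moreover have "(\<lambda>c. c div z) ` {c \<in> {..<p}. c mod z = t} \<subseteq> {..p div z}"
    by (auto intro: div_le_mono)
  ultimately have "card {c \<in> {..<p}. c mod z = t} \<le> card {..p div z}"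
    by (rule card_inj_on_le) simp
  then show ?thesis by simp
qed

text \<open>Moves value patterns from points to positions in an enumeration, which makes their
  number the same for all \<open>k\<close>-sets.\<close>

lemma card_PiE_reindex:
  assumes "inj_on e Q"
  shows "card {v \<in> (e ` Q) \<rightarrow>\<^sub>E X. R (\<lambda>i\<in>Q. v (e i))} = card {w \<in> Q \<rightarrow>\<^sub>E X. R w}"
proof (rule bij_betw_same_card)
  show "bij_betw (\<lambda>v. \<lambda>i\<in>Q. v (e i)) {v \<in> (e ` Q) \<rightarrow>\<^sub>E X. R (\<lambda>i\<in>Q. v (e i))} {w \<in> Q \<rightarrow>\<^sub>E X. R w}"
  proof (rule bij_betwI[where g = "\<lambda>w. \<lambda>x\<in>e ` Q. w (the_inv_into Q e x)"])
    show "(\<lambda>v. \<lambda>i\<in>Q. v (e i)) \<in> {v \<in> (e ` Q) \<rightarrow>\<^sub>E X. R (\<lambda>i\<in>Q. v (e i))} \<rightarrow> {w \<in> Q \<rightarrow>\<^sub>E X. R w}"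
      by auto
    have eq: "(\<lambda>i\<in>Q. (\<lambda>x\<in>e ` Q. w (the_inv_into Q e x)) (e i)) = w" if "w \<in> Q \<rightarrow>\<^sub>E X" for w
    proof
      fix i
      show "(\<lambda>i\<in>Q. (\<lambda>x\<in>e ` Q. w (the_inv_into Q e x)) (e i)) i = w i"
        using PiE_arb[OF that, of i] by (cases "i \<in> Q") (simp_all add: the_inv_into_f_f[OF assms])
    qed
    show "(\<lambda>w. \<lambda>x\<in>e ` Q. w (the_inv_into Q e x)) \<in> {w \<in> Q \<rightarrow>\<^sub>E X. R w} \<rightarrow> {v \<in> (e ` Q) \<rightarrow>\<^sub>E X. R (\<lambda>i\<in>Q. v (e i))}"
    proof
      fix w assume w: "w \<in> {w \<in> Q \<rightarrow>\<^sub>E X. R w}"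
      then have "R (\<lambda>i\<in>Q. (\<lambda>x\<in>e ` Q. w (the_inv_into Q e x)) (e i))" using eq[of w] by simp
      moreover have "(\<lambda>x\<in>e ` Q. w (the_inv_into Q e x)) \<in> (e ` Q) \<rightarrow>\<^sub>E X"
        using w by (intro restrict_PiE_iff[THEN iffD2]) (auto simp: the_inv_into_f_f[OF assms])
      ultimately show "(\<lambda>x\<in>e ` Q. w (the_inv_into Q e x)) \<in> {v \<in> (e ` Q) \<rightarrow>\<^sub>E X. R (\<lambda>i\<in>Q. v (e i))}" by simp
    qed
    show "(\<lambda>x\<in>e ` Q. (\<lambda>i\<in>Q. v (e i)) (the_inv_into Q e x)) = v" if "v \<in> {v \<in> (e ` Q) \<rightarrow>\<^sub>E X. R (\<lambda>i\<in>Q. v (e i))}" for v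
    proof
      fix x
      have v: "v \<in> (e ` Q) \<rightarrow>\<^sub>E X" using that by simp
      show "(\<lambda>x\<in>e ` Q. (\<lambda>i\<in>Q. v (e i)) (the_inv_into Q e x)) x = v x"
      proof (cases "x \<in> e ` Q")
        case True
        then obtain i where "i \<in> Q" "x = e i" by blast
        then show ?thesis using True by (simp add: the_inv_into_f_f[OF assms])
      next
        case False
        then show ?thesis using PiE_arb[OF v False] by simp
      qed
    qed
    show "(\<lambda>i\<in>Q. (\<lambda>x\<in>e ` Q. w (the_inv_into Q e x)) (e i)) = w" if "w \<in> {w \<in> Q \<rightarrow>\<^sub>E X. R w}" for w
      using eq that by simp
  qed
qed

definition pair_support :: "(nat \<times> nat) list \<Rightarrow> nat set" where
  "pair_support ps = fst ` set ps \<union> snd ` set ps"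

lemma card_pair_support: "card (pair_support ps) \<le> 2 * length ps"
proof -
  have "card (pair_support ps) \<le> card (fst ` set ps) + card (snd ` set ps)"
    unfolding pair_support_def by (rule card_Un_le)
  moreover have "card (fst ` set ps) \<le> length ps" "card (snd ` set ps) \<le> length ps"
    by (meson List.finite_set card_image_le card_length order_trans)+
  ultimately show ?thesis by simp
qed

text \<open>Induction from the leaf: once all other values are fixed, the value at the larger index
  of the head is confined to one residue class modulo \<open>z\<close>, with at most
  \<open>p div z + 1\<close> elements below \<open>p\<close>.\<close>

lemma card_collides_le:
  fixes p z :: nat
  assumes z: "z > 0"
  shows "decreasing_pairs ps \<Longrightarrow> finite Q \<Longrightarrow> pair_support ps \<subseteq> Q \<Longrightarrow>
    card {w \<in> Q \<rightarrow>\<^sub>E {..<p}. collides ps (\<lambda>i. w i mod z)} * p ^ length ps \<le> (p div z + 1) ^ length ps * p ^ card Q"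
proof (induction ps arbitrary: Q)
  case Nil
  then show ?case by (simp add: collides_def card_PiE)
next
  case (Cons ij ps)
  obtain i j where ij: "ij = (i, j)" by fastforce
  define Q0 where "Q0 = Q - {i}"
  have Q: "Q = insert i Q0" "i \<notin> Q0" "finite Q0" using Cons.prems ij by (auto simp: Q0_def pair_support_def)
  have sub: "pair_support ps \<subseteq> Q0"
  proof
    fix x assume "x \<in> pair_support ps"
    then obtain ab where ab: "ab \<in> set ps" "x = fst ab \<or> x = snd ab" by (auto simp: pair_support_def)
    have "snd ab < fst ab" "fst ab < i" using Cons.prems(1) ij decreasing_pairs_less[OF _ ab(1)] ab(1) by auto
    then have "x \<noteq> i" using ab(2) by auto
    moreover have "x \<in> Q"
    proof -
      have "x \<in> pair_support (ij # ps)" using ab by (auto simp: pair_support_def)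
      then show ?thesis by (rule subsetD[OF Cons.prems(3)])
    qed
    ultimately show "x \<in> Q0" unfolding Q0_def by simp
  qed
  have j: "j < i" using Cons.prems(1) ij by simp
  define W where "W = {w \<in> Q0 \<rightarrow>\<^sub>E {..<p}. collides ps (\<lambda>i. w i mod z)}"
  have fW: "finite W" unfolding W_def using Q(3) by (simp add: finite_PiE)
  have "{w \<in> Q \<rightarrow>\<^sub>E {..<p}. collides (ij # ps) (\<lambda>i. w i mod z)}
      \<subseteq> (\<Union>w\<in>W. (\<lambda>c. w(i := c)) ` {c \<in> {..<p}. c mod z = w j mod z})"
  proof
    fix v assume v: "v \<in> {w \<in> Q \<rightarrow>\<^sub>E {..<p}. collides (ij # ps) (\<lambda>i. w i mod z)}"
    then obtain c w where cw: "c < p" "w \<in> Q0 \<rightarrow>\<^sub>E {..<p}" "v = w(i := c)"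
      unfolding Q(1) PiE_insert_eq by auto
    have "collides ps (\<lambda>i. w i mod z)"
      unfolding collides_def
    proof
      fix ab assume ab: "ab \<in> set ps"
      then have "fst ab \<noteq> i" "snd ab \<noteq> i" using sub Q(2) unfolding pair_support_def by auto
      moreover have "v (fst ab) mod z = v (snd ab) mod z" using v ab by (auto simp: collides_def)
      ultimately show "w (fst ab) mod z = w (snd ab) mod z" using cw by simp
    qed
    moreover have "c mod z = w j mod z" using v cw ij j by (auto simp: collides_def)
    ultimately show "v \<in> (\<Union>w\<in>W. (\<lambda>c. w(i := c)) ` {c \<in> {..<p}. c mod z = w j mod z})"
      using cw unfolding W_def by auto
  qed
  then have "card {w \<in> Q \<rightarrow>\<^sub>E {..<p}. collides (ij # ps) (\<lambda>i. w i mod z)}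
      \<le> card (\<Union>w\<in>W. (\<lambda>c. w(i := c)) ` {c \<in> {..<p}. c mod z = w j mod z})"
    using fW by (intro card_mono) auto
  also have "\<dots> \<le> (\<Sum>w\<in>W. card ((\<lambda>c. w(i := c)) ` {c \<in> {..<p}. c mod z = w j mod z}))"
    using fW by (rule card_UN_le)
  also have "\<dots> \<le> (\<Sum>w\<in>W. p div z + 1)"
    by (intro sum_mono order.trans[OF card_image_le card_residue_class_le[OF z]]) simp
  finally have le: "card {w \<in> Q \<rightarrow>\<^sub>E {..<p}. collides (ij # ps) (\<lambda>i. w i mod z)} \<le> card W * (p div z + 1)" by simp
  have IH: "card W * p ^ length ps \<le> (p div z + 1) ^ length ps * p ^ card Q0"
    unfolding W_def using Cons.prems Q sub by (intro Cons.IH) auto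
  have "card {w \<in> Q \<rightarrow>\<^sub>E {..<p}. collides (ij # ps) (\<lambda>i. w i mod z)} * p ^ length (ij # ps)
      \<le> card W * (p div z + 1) * (p * p ^ length ps)"
    using le by (simp add: mult_right_mono)
  also have "\<dots> = (card W * p ^ length ps) * ((p div z + 1) * p)" by (simp only: mult_ac)
  also have "\<dots> \<le> ((p div z + 1) ^ length ps * p ^ card Q0) * ((p div z + 1) * p)"
    by (rule mult_right_mono[OF IH]) simp
  also have "\<dots> = (p div z + 1) ^ length (ij # ps) * p ^ card Q"
  proof -
    have "card Q = Suc (card Q0)" using Q by simp
    then show ?thesis by (simp only: list.size power_Suc mult_ac add_0_right add_Suc_right)
  qed
  finally show ?case .
qed

text \<open>A pattern touches at most \<open>2 * length ps\<close> points, where the values are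
  independent; hence the probability does not depend on the enumeration \<open>e\<close>. The factor
  2/z for each pair absorbs the rounding in \<open>p div z + 1\<close>, thanks to
  \<open>z \<le> p\<close>.\<close>

lemma prob_collides_poly_hash:
  assumes p: "prime p" and z: "z > 0" "z \<le> p" and e: "inj_on e {..<k}" "e ` {..<k} \<subseteq> {..<p}"
    and ps: "decreasing_pairs ps" "\<forall>ij\<in>set ps. fst ij < k" "2 * length ps \<le> d"
  shows "prob {..<p ^ d} (\<lambda>s. collides ps (\<lambda>i. poly_hash p d s (e i) mod z))
      = real (card {w \<in> pair_support ps \<rightarrow>\<^sub>E {..<p}. collides ps (\<lambda>i. w i mod z)}) / real p ^ card (pair_support ps)"
    and "prob {..<p ^ d} (\<lambda>s. collides ps (\<lambda>i. poly_hash p d s (e i) mod z)) \<le> (2 / real z) ^ length ps"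
proof -
  define Q where "Q = pair_support ps"
  have p0: "p > 0" using p prime_gt_0_nat by blast
  have Qk: "Q \<subseteq> {..<k}"
  proof
    fix x assume "x \<in> Q"
    then obtain ab where ab: "ab \<in> set ps" "x = fst ab \<or> x = snd ab" by (auto simp: Q_def pair_support_def)
    have "snd ab < fst ab" "fst ab < k" using decreasing_pairs_less[OF ps(1) ab(1)] ab(1) ps(2) by auto
    then show "x \<in> {..<k}" using ab(2) by auto
  qed
  have fQ: "finite Q" using Qk finite_subset by blast
  have inj: "inj_on e Q" using e(1) Qk inj_on_subset by blast
  have cQ: "card (e ` Q) = card Q" using inj by (rule card_image)
  have Qd: "card Q \<le> d" using card_pair_support[of ps] ps(3) unfolding Q_def by linarith
  define R where "R w \<longleftrightarrow> collides ps (\<lambda>i. w i mod z)" for w :: "nat \<Rightarrow> nat"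
  have Rrestr: "R (\<lambda>i\<in>Q. v (e i)) \<longleftrightarrow> R (\<lambda>i. v (e i))" for v
    unfolding R_def collides_def Q_def pair_support_def by (intro ball_cong) auto
  have "card {s \<in> {..<p ^ d}. R (\<lambda>i. poly_hash p d s (e i))}
      = card {s \<in> {..<p ^ d}. R (\<lambda>i\<in>Q. restrict (poly_hash p d s) (e ` Q) (e i))}"
    by (rule arg_cong[where f = card], rule Collect_cong, rule conj_cong[OF refl],
        subst Rrestr, unfold R_def collides_def Q_def pair_support_def, rule ball_cong) auto
  also have "\<dots> = p ^ (d - card Q) * card {v \<in> (e ` Q) \<rightarrow>\<^sub>E {..<p}. R (\<lambda>i\<in>Q. v (e i))}"
    using card_poly_hash[OF p, of "e ` Q" d "\<lambda>v. R (\<lambda>i\<in>Q. v (e i))"] e(2) Qk Qd cQ by auto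
  also have "card {v \<in> (e ` Q) \<rightarrow>\<^sub>E {..<p}. R (\<lambda>i\<in>Q. v (e i))} = card {w \<in> Q \<rightarrow>\<^sub>E {..<p}. R w}"
    by (rule card_PiE_reindex[OF inj])
  finally have c: "card {s \<in> {..<p ^ d}. R (\<lambda>i. poly_hash p d s (e i))} = p ^ (d - card Q) * card {w \<in> Q \<rightarrow>\<^sub>E {..<p}. R w}" .
  have pd: "real p ^ d = real p ^ (d - card Q) * real p ^ card Q" using Qd by (simp flip: power_add)
  have eq: "prob {..<p ^ d} (\<lambda>s. R (\<lambda>i. poly_hash p d s (e i)))
      = real (card {w \<in> Q \<rightarrow>\<^sub>E {..<p}. R w}) / real p ^ card Q"
    using c p0 by (simp add: prob_card pd del: lessThan_iff)
  then show "prob {..<p ^ d} (\<lambda>s. collides ps (\<lambda>i. poly_hash p d s (e i) mod z))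
      = real (card {w \<in> pair_support ps \<rightarrow>\<^sub>E {..<p}. collides ps (\<lambda>i. w i mod z)}) / real p ^ card (pair_support ps)"
    unfolding R_def Q_def .
  have "card {w \<in> Q \<rightarrow>\<^sub>E {..<p}. R w} * p ^ length ps \<le> (p div z + 1) ^ length ps * p ^ card Q"
    unfolding R_def by (rule card_collides_le[OF z(1) ps(1) fQ]) (simp add: Q_def)
  then have "real (card {w \<in> Q \<rightarrow>\<^sub>E {..<p}. R w} * p ^ length ps) \<le> real ((p div z + 1) ^ length ps * p ^ card Q)"
    by (rule of_nat_mono)
  then have "real (card {w \<in> Q \<rightarrow>\<^sub>E {..<p}. R w}) / real p ^ card Q \<le> real (p div z + 1) ^ length ps / real p ^ length ps"
    using p0 by (simp add: field_simps)
  also have "\<dots> = (real (p div z + 1) / real p) ^ length ps" by (simp add: power_divide)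
  also have "\<dots> \<le> (2 / real z) ^ length ps"
  proof (rule power_mono)
    have "z * (p div z) \<le> p" by (rule times_div_less_eq_dividend)
    then have "z * (p div z + 1) \<le> 2 * p" unfolding distrib_left using z by linarith
    then have "real (z * (p div z + 1)) \<le> real (2 * p)" by (rule of_nat_mono)
    then show "real (p div z + 1) / real p \<le> 2 / real z" using p0 z by (simp add: field_simps)
  qed simp
  finally show "prob {..<p ^ d} (\<lambda>s. collides ps (\<lambda>i. poly_hash p d s (e i) mod z)) \<le> (2 / real z) ^ length ps"
    using eq unfolding R_def by simp
qed

text \<open>Every \<open>k\<close>-set is compared with the reference set {..<k}. Patterns with at
  most \<open>r\<close> pairs are equally likely for both, so the injectivity probabilities differ
  by at most (2 k^2 / z)^r. By a union bound the reference probability is at least 1/2, which makes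
  this absolute error a relative one.\<close>

lemma inj_balanced_poly_hash:
  assumes p: "prime p" and z: "z > 0" "z \<le> p" and k: "k \<le> p"
    and half: "real (k\<^sup>2) * (2 / real z) \<le> 1 / 2" and \<eta>: "0 \<le> \<eta>" "\<eta> \<le> 1"
    and small: "(real (k\<^sup>2) * (2 / real z)) ^ r \<le> \<eta> / 4"
  shows "inj_balanced \<eta> k p {..<p ^ (2 * r)} (\<lambda>s x. poly_hash p (2 * r) s x mod z)"
proof -
  define I where "I = {..<p ^ (2 * r)}"
  define f where "f s x = poly_hash p (2 * r) s x mod z" for s x
  have p0: "p > 0" using p prime_gt_0_nat by blast
  have I: "finite I" "I \<noteq> {}" unfolding I_def using p0 by (auto simp: lessThan_empty_iff)
  define q where "q e = prob I (\<lambda>s. inj_on (\<lambda>i. f s (e i)) {..<k})" for e :: "nat \<Rightarrow> nat"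
  have qdiff: "\<bar>q e - q id\<bar> \<le> \<eta> / 4" if e: "inj_on e {..<k}" "e ` {..<k} \<subseteq> {..<p}" for e
  proof -
    have "\<bar>prob I (\<lambda>s. collides [] (\<lambda>i. f s (e i)) \<and> inj_on (\<lambda>i. f s (e i)) {..<k})
       - prob I (\<lambda>s. collides [] (\<lambda>i. f s (id i)) \<and> inj_on (\<lambda>i. f s (id i)) {..<k})\<bar> \<le> real (k\<^sup>2) ^ r * (2 / real z) ^ r"
    proof (rule prob_inj_diff)
      fix ps assume ps: "decreasing_pairs ps" "\<forall>ij\<in>set ps. fst ij < k" "length ps \<le> r"
      then show "prob I (\<lambda>s. collides ps (\<lambda>i. f s (e i))) = prob I (\<lambda>s. collides ps (\<lambda>i. f s (id i))) \<and>
         prob I (\<lambda>s. collides ps (\<lambda>i. f s (e i))) \<le> (2 / real z) ^ length ps"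
        unfolding I_def f_def
        using prob_collides_poly_hash[OF p z e ps(1,2), of "2 * r"] prob_collides_poly_hash[OF p z, of id k ps "2 * r"] k
        by auto
    qed auto
    then show ?thesis using small unfolding q_def power_mult_distrib by (simp add: collides_def)
  qed
  have qid: "q id \<ge> 1 / 2"
  proof -
    define A where "A i j = prob I (\<lambda>s. collides ([] @ [(i, j)]) (\<lambda>i. f s (id i)) \<and> inj_on (\<lambda>i. f s (id i)) {..<i})" for i j
    have 1: "1 = q id + (\<Sum>i<k. \<Sum>j<i. A i j)"
      using prob_collides_inj[of I "[]" "\<lambda>s i. f s (id i)" k] I unfolding q_def A_def
      by (simp add: collides_def prob_def)
    \<comment> \<open>For \<open>r = 0\<close> the hypothesis \<open>small\<close> reads 1 \<le>
      \<eta>/4, contradicting \<open>\<eta> \<le> 1\<close>. Otherwise at least two coefficients are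
      available, enough for a union bound over single pairs.\<close>
    show ?thesis
    proof (cases "r = 0")
      case True
      then show ?thesis using small \<eta> by simp
    next
      case False
      have "A i j \<le> 2 / real z" if "i < k" "j < i" for i j
      proof -
        have "A i j \<le> prob I (\<lambda>s. collides [(i, j)] (\<lambda>i. f s (id i)))"
          unfolding A_def by (rule prob_mono) simp
        also have "\<dots> \<le> (2 / real z) ^ length [(i, j)]"
          unfolding I_def f_def by (rule prob_collides_poly_hash(2)[OF p z]) (use k that False in auto)
        finally show ?thesis by simp
      qed
      then have "(\<Sum>i<k. \<Sum>j<i. A i j) \<le> (\<Sum>i<k. \<Sum>j<i. 2 / real z)" by (intro sum_mono) auto
      also have "\<dots> \<le> (\<Sum>i<k. real k * (2 / real z))"
        by (intro sum_mono) (simp add: divide_right_mono)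
      also have "\<dots> = real (k\<^sup>2) * (2 / real z)" by (simp add: power2_eq_square)
      finally show ?thesis using 1 half by linarith
    qed
  qed
  have "inj_balanced \<eta> k p I f"
  proof (rule inj_balancedI[OF I _ \<eta>, where c = "q id"])
    show "q id > 0" using qid by simp
    fix S assume S: "S \<subseteq> {..<p}" "card S = k"
    have fS: "finite S" using S finite_subset by blast
    then obtain e where e: "bij_betw e {..<k} S" using ex_bij_betw_nat_finite[OF fS] S by (auto simp: atLeast0LessThan)
    have e': "inj_on e {..<k}" "e ` {..<k} = S" using e by (auto simp: bij_betw_def)
    have "inj_on (\<lambda>i. f s (e i)) {..<k} \<longleftrightarrow> inj_on (f s) S" for s
      using comp_inj_on_iff[OF e'(1), of "f s"] e'(2) by (simp add: o_def)
    then have "q e = real (card {i \<in> I. inj_on (f i) S}) / real (card I)"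
      unfolding q_def by (simp add: prob_card I)
    moreover have "\<bar>q e - q id\<bar> \<le> \<eta> / 4" using e' S by (intro qdiff) auto
    moreover have "\<eta> / 4 \<le> \<eta> / 2 * q id" using qid \<eta> mult_left_mono[of "1/2" "q id" "\<eta> / 2"] by simp
    ultimately show "\<bar>real (card {i \<in> I. inj_on (f i) S}) / real (card I) - q id\<bar> \<le> \<eta> / 2 * q id" by linarith
  qed
  then show ?thesis unfolding I_def f_def .
qed

section \<open>Nisan's generator and pairwise independence\<close>

lemma sum_nat_product:
  fixes F :: "nat \<Rightarrow> nat \<Rightarrow> 'b::comm_monoid_add"
  assumes "A > 0"
  shows "(\<Sum>s<A * B. F (s mod A) (s div A)) = (\<Sum>i<A. \<Sum>j<B. F i j)"
proof -
  have "(\<Sum>s<A * B. F (s mod A) (s div A)) = (\<Sum>(i, j)\<in>{..<A} \<times> {..<B}. F i j)"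
  proof (rule sum.reindex_bij_witness[where i = "\<lambda>(i, j). i + A * j" and j = "\<lambda>s. (s mod A, s div A)"])
    fix ij assume "ij \<in> {..<A} \<times> {..<B}"
    then obtain i j where ij: "ij = (i, j)" "i < A" "j < B" by auto
    have "i + A * j < A + A * j" using ij by simp
    also have "\<dots> = A * Suc j" by simp
    also have "\<dots> \<le> A * B" using ij by (intro mult_le_mono2) simp
    finally show "(case ij of (i, j) \<Rightarrow> i + A * j) \<in> {..<A * B}" using ij by simp
  qed (use assms in \<open>auto simp: less_mult_imp_div_less mult.commute\<close>)
  then show ?thesis by (simp add: sum.cartesian_product)
qed

text \<open>The base \<open>p ^ 2\<close> digits of \<open>t\<close> are the maps. The bits of the
  address \<open>j\<close>, lowest first, decide whether the current word is replaced by its image.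
  A seed of 2b + 1 field elements thus describes 2^b words, each of which is computable in
  \<open>b\<close> steps.\<close>

fun nisan_steps :: "nat \<Rightarrow> nat \<Rightarrow> nat \<Rightarrow> nat \<Rightarrow> nat \<Rightarrow> nat" where
  "nisan_steps p 0 s j t = s"
| "nisan_steps p (Suc b) s j t =
     nisan_steps p b (if odd j then poly_hash p 2 t s else s) (j div 2) (t div p ^ 2)"

definition nisan :: "nat \<Rightarrow> nat \<Rightarrow> nat \<Rightarrow> nat \<Rightarrow> nat" where
  "nisan p b t j = nisan_steps p b (t mod p) j (t div p)"

lemma nisan_steps_less: "s < p \<Longrightarrow> nisan_steps p b s j t < p"
  by (induction b arbitrary: s j t) (auto simp: poly_hash_less)

lemma sum_poly_hash_one:
  fixes g :: "nat \<Rightarrow> 'b::comm_semiring_1"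
  assumes p: "prime p" and s: "s < p"
  shows "(\<Sum>t<p ^ 2. g (poly_hash p 2 t s)) = of_nat p * (\<Sum>v<p. g v)"
proof -
  have "(\<Sum>t<p ^ 2. g (poly_hash p 2 t s)) = of_nat (p ^ (2 - card {s})) * (\<Sum>v\<in>{s} \<rightarrow>\<^sub>E {..<p}. g (v s))"
    using sum_poly_hash[OF p, of "{s}" 2 "\<lambda>v. g (v s)"] s by simp
  also have "(\<Sum>v\<in>{s} \<rightarrow>\<^sub>E {..<p}. g (v s)) = (\<Sum>v<p. g v)"
    by (rule sum.reindex_bij_witness[where i = "\<lambda>v. \<lambda>x\<in>{s}. v" and j = "\<lambda>v. v s"])
       (auto simp: PiE_iff extensional_def)
  finally show ?thesis by simp
qed

lemma sum_poly_hash_two: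
  fixes g :: "nat \<Rightarrow> nat \<Rightarrow> 'b::comm_semiring_1"
  assumes p: "prime p" and s: "s < p" "s' < p" "s \<noteq> s'"
  shows "(\<Sum>t<p ^ 2. g (poly_hash p 2 t s) (poly_hash p 2 t s')) = (\<Sum>v<p. \<Sum>v'<p. g v v')"
proof -
  have "(\<Sum>t<p ^ 2. g (poly_hash p 2 t s) (poly_hash p 2 t s'))
      = of_nat (p ^ (2 - card {s, s'})) * (\<Sum>v\<in>{s, s'} \<rightarrow>\<^sub>E {..<p}. g (v s) (v s'))"
    using sum_poly_hash[OF p, of "{s, s'}" 2 "\<lambda>v. g (v s) (v s')"] s by simp
  also have "(\<Sum>v\<in>{s, s'} \<rightarrow>\<^sub>E {..<p}. g (v s) (v s')) = (\<Sum>(v, v')\<in>{..<p} \<times> {..<p}. g v v')"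
    by (rule sum.reindex_bij_witness[where i = "\<lambda>(v, v'). \<lambda>x\<in>{s, s'}. if x = s then v else v'" and j = "\<lambda>v. (v s, v s')"])
       (use s in \<open>auto simp: PiE_iff extensional_def fun_eq_iff\<close>)
  finally show ?thesis using s by (simp add: sum.cartesian_product)
qed

text \<open>Second moment method: by pairwise independence, only the diagonal terms survive in the
  expected square of the deviation.\<close>

lemma pairwise_mixing:
  fixes A B :: "nat \<Rightarrow> complex"
  assumes p: "prime p" and A: "\<And>s. s < p \<Longrightarrow> norm (A s) \<le> 1" and B: "\<And>s. s < p \<Longrightarrow> norm (B s) \<le> 1"
  shows "(\<Sum>t<p ^ 2. norm ((\<Sum>s<p. A s * B (poly_hash p 2 t s)) / of_nat p
      - (\<Sum>s<p. A s) / of_nat p * ((\<Sum>s<p. B s) / of_nat p))) \<le> real (p ^ 2) / sqrt (real p)"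
proof -
  have p0: "p > 0" using p prime_gt_0_nat by blast
  define m where "m = (\<Sum>s<p. B s) / of_nat p"
  define D where "D v = B v - m" for v
  have D0: "(\<Sum>v<p. D v) = 0" using p0 by (simp add: D_def sum_subtractf m_def)
  define Y where "Y t = (\<Sum>s<p. A s * D (poly_hash p 2 t s))" for t
  have Yeq: "(\<Sum>s<p. A s * B (poly_hash p 2 t s)) / of_nat p - (\<Sum>s<p. A s) / of_nat p * m = Y t / of_nat p" for t
    using p0 by (simp add: Y_def D_def field_simps sum_subtractf sum_distrib_left sum_distrib_right)
  have D2: "(\<Sum>v<p. (norm (D v))\<^sup>2) \<le> real p"
  proof -
    have "of_real (\<Sum>v<p. (norm (D v))\<^sup>2) = (\<Sum>v<p. D v * cnj (D v))"
      by (simp only: of_real_sum complex_norm_square)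
    also have "\<dots> = (\<Sum>v<p. D v * cnj (B v)) - (\<Sum>v<p. D v) * cnj m"
      by (simp add: D_def algebra_simps sum_subtractf sum_distrib_left sum_distrib_right sum.distrib)
    also have "\<dots> = (\<Sum>v<p. B v * cnj (B v)) - m * (\<Sum>v<p. cnj (B v))"
      unfolding D0 by (simp add: D_def algebra_simps sum_subtractf sum_distrib_left)
    also have "(\<Sum>v<p. cnj (B v)) = of_nat p * cnj m" using p0 by (simp add: m_def)
    also have "(\<Sum>v<p. B v * cnj (B v)) - m * (of_nat p * cnj m)
        = of_real ((\<Sum>v<p. (norm (B v))\<^sup>2) - real p * (norm m)\<^sup>2)"
      by (simp only: of_real_diff of_real_sum of_real_mult complex_norm_square of_real_of_nat_eq) (simp add: mult_ac)
    finally have "(\<Sum>v<p. (norm (D v))\<^sup>2) = (\<Sum>v<p. (norm (B v))\<^sup>2) - real p * (norm m)\<^sup>2"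
      by (simp only: of_real_eq_iff)
    also have "\<dots> \<le> (\<Sum>v<p. (norm (B v))\<^sup>2)" by simp
    also have "\<dots> \<le> (\<Sum>v<p. 1)" using B by (intro sum_mono) (auto simp: power_le_one)
    finally show ?thesis by simp
  qed
  have "of_real (\<Sum>t<p ^ 2. (norm (Y t))\<^sup>2) = (\<Sum>t<p ^ 2. Y t * cnj (Y t))"
    by (simp only: of_real_sum complex_norm_square)
  also have "\<dots> = (\<Sum>t<p ^ 2. \<Sum>s<p. \<Sum>s'<p. (A s * cnj (A s')) * (D (poly_hash p 2 t s) * cnj (D (poly_hash p 2 t s'))))"
    unfolding Y_def cnj_sum sum_product by (simp add: mult_ac)
  also have "\<dots> = (\<Sum>s<p. \<Sum>s'<p. \<Sum>t<p ^ 2. (A s * cnj (A s')) * (D (poly_hash p 2 t s) * cnj (D (poly_hash p 2 t s'))))"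
    by (rule trans[OF sum.swap sum.cong[OF refl sum.swap]])
  also have "\<dots> = (\<Sum>s<p. \<Sum>s'<p. (A s * cnj (A s')) * (if s = s' then of_nat p * (\<Sum>v<p. D v * cnj (D v)) else 0))"
  proof (intro sum.cong refl)
    fix s s' assume s: "s \<in> {..<p}" "s' \<in> {..<p}"
    have "(\<Sum>t<p ^ 2. D (poly_hash p 2 t s) * cnj (D (poly_hash p 2 t s')))
        = (if s = s' then of_nat p * (\<Sum>v<p. D v * cnj (D v)) else 0)"
    proof (cases "s = s'")
      case True
      then show ?thesis using sum_poly_hash_one[OF p, of s "\<lambda>v. D v * cnj (D v)"] s by simp
    next
      case False
      have "(\<Sum>t<p ^ 2. D (poly_hash p 2 t s) * cnj (D (poly_hash p 2 t s'))) = (\<Sum>v<p. \<Sum>v'<p. D v * cnj (D v'))"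
        using sum_poly_hash_two[OF p, of s s' "\<lambda>v v'. D v * cnj (D v')"] s False by simp
      also have "\<dots> = (\<Sum>v<p. D v) * (\<Sum>v'<p. cnj (D v'))" by (simp only: sum_product)
      finally show ?thesis using D0 False by simp
    qed
    then show "(\<Sum>t<p ^ 2. (A s * cnj (A s')) * (D (poly_hash p 2 t s) * cnj (D (poly_hash p 2 t s'))))
        = (A s * cnj (A s')) * (if s = s' then of_nat p * (\<Sum>v<p. D v * cnj (D v)) else 0)"
      by (simp only: sum_distrib_left[symmetric])
  qed
  also have "\<dots> = (\<Sum>s<p. (A s * cnj (A s)) * (of_nat p * (\<Sum>v<p. D v * cnj (D v))))"
    by (intro sum.cong refl) (simp add: if_distrib[where f = "\<lambda>x. _ * x"] cong: if_cong)
  also have "\<dots> = of_real ((\<Sum>s<p. (norm (A s))\<^sup>2) * (real p * (\<Sum>v<p. (norm (D v))\<^sup>2)))"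
    by (simp only: of_real_mult of_real_sum complex_norm_square of_real_of_nat_eq sum_distrib_right)
  finally have "(\<Sum>t<p ^ 2. (norm (Y t))\<^sup>2) = (\<Sum>s<p. (norm (A s))\<^sup>2) * (real p * (\<Sum>v<p. (norm (D v))\<^sup>2))"
    by (simp only: of_real_eq_iff)
  also have "\<dots> \<le> real p * (real p * real p)"
  proof (intro mult_mono)
    have "(\<Sum>s<p. (norm (A s))\<^sup>2) \<le> (\<Sum>s<p. 1)" using A by (intro sum_mono) (auto simp: power_le_one)
    then show "(\<Sum>s<p. (norm (A s))\<^sup>2) \<le> real p" by simp
  qed (use D2 in \<open>auto intro!: mult_nonneg_nonneg sum_nonneg\<close>)
  finally have Y2: "(\<Sum>t<p ^ 2. (norm (Y t))\<^sup>2) \<le> real p ^ 3" by (simp add: power3_eq_cube)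
  \<comment> \<open>The Cauchy-Schwarz inequality passes from the second moment to the first one,
    which is the form that the induction over the depth of the generator uses.\<close>
  have "(\<Sum>t<p ^ 2. norm (Y t)) ^ 2 \<le> real (p ^ 2) * (\<Sum>t<p ^ 2. (norm (Y t))\<^sup>2)"
    using sum_squared_le_sum_of_squares[of "\<lambda>t. norm (Y t)" "{..<p^2}"] by (simp add: mult.commute)
  also have "\<dots> \<le> real (p ^ 2) * real p ^ 3" by (intro mult_left_mono Y2) simp
  also have "\<dots> = (real p ^ 3 / sqrt (real p))\<^sup>2"
    using p0 by (simp add: power_divide eval_nat_numeral)
  finally have "(\<Sum>t<p ^ 2. norm (Y t)) \<le> real p ^ 3 / sqrt (real p)"
    by (rule power2_le_imp_le) simp
  then have "(\<Sum>t<p ^ 2. norm (Y t)) / real p \<le> real (p ^ 2) / sqrt (real p)"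
    using p0 by (simp add: field_simps eval_nat_numeral)
  then show ?thesis unfolding m_def[symmetric] Yeq
    by (simp add: norm_divide sum_divide_distrib)
qed

lemma prod_even_odd:
  fixes g :: "nat \<Rightarrow> 'b::comm_monoid_mult"
  shows "(\<Prod>j<2 * N. g j) = (\<Prod>j<N. g (2 * j)) * (\<Prod>j<N. g (2 * j + 1))"
  by (induction N) (simp_all add: mult_ac)

lemma norm_prod_le_one:
  fixes f :: "'a \<Rightarrow> complex"
  shows "(\<And>x. x \<in> A \<Longrightarrow> norm (f x) \<le> 1) \<Longrightarrow> norm (prod f A) \<le> 1"
  unfolding prod_norm[symmetric] by (rule prod_le_1) auto

text \<open>One map joins two generators of half the size that share the remaining maps:
  \<open>pairwise_mixing\<close> separates their averages at the price of 1 / sqrt p, and the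
  induction hypothesis treats each half, whence the recursion 2 * (2^b - 1) + 1 = 2^(b+1) - 1. The
  norm stands inside the sum over \<open>t\<close> because both halves depend on the same
  \<open>t\<close>.\<close>

lemma nisan_steps_product:
  fixes f :: "nat \<Rightarrow> nat \<Rightarrow> complex"
  assumes p: "prime p" and f: "\<And>j s. s < p \<Longrightarrow> norm (f j s) \<le> 1"
  shows "(\<Sum>t<p ^ (2 * b). norm ((\<Sum>s<p. \<Prod>j<2 ^ b. f j (nisan_steps p b s j t)) / of_nat p
      - (\<Prod>j<2 ^ b. (\<Sum>s<p. f j s) / of_nat p))) \<le> real (p ^ (2 * b)) * ((2 ^ b - 1) / sqrt (real p))"
  using f
proof (induction b arbitrary: f)
  case 0
  then show ?case by simp
next
  case (Suc b)
  have p0: "p > 0" using p prime_gt_0_nat by blast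
  define e where "e = 1 / sqrt (real p)"
  define avg where "avg g = (\<Sum>s<p. g s) / of_nat p" for g :: "nat \<Rightarrow> complex"
  define A where "A t s = (\<Prod>j<2 ^ b. f (2 * j) (nisan_steps p b s j t))" for t s
  define B where "B t s = (\<Prod>j<2 ^ b. f (2 * j + 1) (nisan_steps p b s j t))" for t s
  define \<alpha> where "\<alpha> = (\<Prod>j<2 ^ b. avg (f (2 * j)))"
  define \<beta> where "\<beta> = (\<Prod>j<2 ^ b. avg (f (2 * j + 1)))"
  have nA: "norm (A t s) \<le> 1" and nB: "norm (B t s) \<le> 1" if "s < p" for t s
    unfolding A_def B_def using that by (auto intro!: norm_prod_le_one Suc.prems nisan_steps_less)
  have navg: "norm (avg g) \<le> 1" if "\<And>s. s < p \<Longrightarrow> norm (g s) \<le> 1" for g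
  proof -
    have "norm (\<Sum>s<p. g s) \<le> (\<Sum>s<p. 1)" using that by (intro sum_norm_le) auto
    then show ?thesis using p0 by (simp add: avg_def norm_divide)
  qed
  have n\<alpha>: "norm \<alpha> \<le> 1" unfolding \<alpha>_def by (intro norm_prod_le_one navg Suc.prems) auto
  have IHA: "(\<Sum>t<p ^ (2 * b). norm (avg (A t) - \<alpha>)) \<le> real (p ^ (2 * b)) * ((2 ^ b - 1) * e)"
    using Suc.IH[of "\<lambda>j. f (2 * j)"] Suc.prems unfolding avg_def A_def \<alpha>_def e_def by simp
  have IHB: "(\<Sum>t<p ^ (2 * b). norm (avg (B t) - \<beta>)) \<le> real (p ^ (2 * b)) * ((2 ^ b - 1) * e)"
    using Suc.IH[of "\<lambda>j. f (2 * j + 1)"] Suc.prems unfolding avg_def B_def \<beta>_def e_def by simp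
  have steps: "(\<Prod>j<2 ^ Suc b. f j (nisan_steps p (Suc b) s j t))
      = A (t div p ^ 2) s * B (t div p ^ 2) (poly_hash p 2 (t mod p ^ 2) s)" for s t
    unfolding A_def B_def power_Suc prod_even_odd
    by (simp add: poly_hash_mod_power[OF p0])
  have rhs: "(\<Prod>j<2 ^ Suc b. (\<Sum>s<p. f j s) / of_nat p) = \<alpha> * \<beta>"
    unfolding \<alpha>_def \<beta>_def power_Suc prod_even_odd avg_def by simp
  define E where "E t2 t = norm ((\<Sum>s<p. A t s * B t (poly_hash p 2 t2 s)) / of_nat p - \<alpha> * \<beta>)" for t2 t
  have E: "E t2 t \<le> norm ((\<Sum>s<p. A t s * B t (poly_hash p 2 t2 s)) / of_nat p - avg (A t) * avg (B t))
      + norm (avg (A t) - \<alpha>) + norm (avg (B t) - \<beta>)" for t2 t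
  proof -
    have "(\<Sum>s<p. A t s * B t (poly_hash p 2 t2 s)) / of_nat p - \<alpha> * \<beta>
        = ((\<Sum>s<p. A t s * B t (poly_hash p 2 t2 s)) / of_nat p - avg (A t) * avg (B t))
          + ((avg (A t) - \<alpha>) * avg (B t) + \<alpha> * (avg (B t) - \<beta>))" by (simp add: algebra_simps)
    then have "E t2 t \<le> norm ((\<Sum>s<p. A t s * B t (poly_hash p 2 t2 s)) / of_nat p - avg (A t) * avg (B t))
        + (norm ((avg (A t) - \<alpha>) * avg (B t)) + norm (\<alpha> * (avg (B t) - \<beta>)))"
      unfolding E_def by (metis (no_types, lifting) norm_triangle_ineq norm_triangle_mono order_refl)
    moreover have "norm ((avg (A t) - \<alpha>) * avg (B t)) \<le> norm (avg (A t) - \<alpha>)"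
      unfolding norm_mult using navg[of "B t"] nB by (intro mult_right_le_one_le) auto
    moreover have "norm (\<alpha> * (avg (B t) - \<beta>)) \<le> norm (avg (B t) - \<beta>)"
      unfolding norm_mult using n\<alpha> by (intro mult_left_le_one_le) auto
    ultimately show ?thesis by linarith
  qed
  have mix: "(\<Sum>t2<p ^ 2. norm ((\<Sum>s<p. A t s * B t (poly_hash p 2 t2 s)) / of_nat p - avg (A t) * avg (B t)))
      \<le> real (p ^ 2) * e" for t
    using pairwise_mixing[OF p, of "A t" "B t"] nA nB unfolding avg_def e_def by simp
  have "(\<Sum>t<p ^ (2 * Suc b). norm ((\<Sum>s<p. \<Prod>j<2 ^ Suc b. f j (nisan_steps p (Suc b) s j t)) / of_nat p
      - (\<Prod>j<2 ^ Suc b. (\<Sum>s<p. f j s) / of_nat p)))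
      = (\<Sum>t<p ^ 2 * p ^ (2 * b). E (t mod p ^ 2) (t div p ^ 2))"
    unfolding steps rhs E_def by (rule sum.cong) (simp_all add: power_add power2_eq_square)
  also have "\<dots> = (\<Sum>t2<p ^ 2. \<Sum>t<p ^ (2 * b). E t2 t)" using p0 by (intro sum_nat_product) simp
  also have "\<dots> = (\<Sum>t<p ^ (2 * b). \<Sum>t2<p ^ 2. E t2 t)" by (rule sum.swap)
  also have "\<dots> \<le> (\<Sum>t<p ^ (2 * b). real (p ^ 2) * e + real (p ^ 2) * norm (avg (A t) - \<alpha>) + real (p ^ 2) * norm (avg (B t) - \<beta>))"
  proof (rule sum_mono)
    fix t
    have "(\<Sum>t2<p ^ 2. E t2 t) \<le> (\<Sum>t2<p ^ 2. norm ((\<Sum>s<p. A t s * B t (poly_hash p 2 t2 s)) / of_nat p - avg (A t) * avg (B t))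
      + norm (avg (A t) - \<alpha>) + norm (avg (B t) - \<beta>))" by (intro sum_mono E)
    also have "\<dots> \<le> real (p ^ 2) * e + real (p ^ 2) * norm (avg (A t) - \<alpha>) + real (p ^ 2) * norm (avg (B t) - \<beta>)"
      using mix[of t] by (simp add: sum.distrib)
    finally show "(\<Sum>t2<p ^ 2. E t2 t) \<le> real (p ^ 2) * e + real (p ^ 2) * norm (avg (A t) - \<alpha>) + real (p ^ 2) * norm (avg (B t) - \<beta>)" .
  qed
  also have "\<dots> = real (p ^ 2) * (real (p ^ (2 * b)) * e + (\<Sum>t<p ^ (2 * b). norm (avg (A t) - \<alpha>))
      + (\<Sum>t<p ^ (2 * b). norm (avg (B t) - \<beta>)))"
    by (simp add: sum.distrib sum_distrib_left algebra_simps)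
  also have "\<dots> \<le> real (p ^ 2) * (real (p ^ (2 * b)) * e + real (p ^ (2 * b)) * ((2 ^ b - 1) * e) + real (p ^ (2 * b)) * ((2 ^ b - 1) * e))"
    by (intro mult_left_mono add_mono IHA IHB) simp_all
  also have "\<dots> = real (p ^ (2 * Suc b)) * ((2 ^ Suc b - 1) * e)"
    by (simp add: algebra_simps power_add power2_eq_square)
  finally show ?case unfolding e_def by simp
qed

lemma nisan_product:
  fixes f :: "nat \<Rightarrow> nat \<Rightarrow> complex"
  assumes p: "prime p" and f: "\<And>j s. s < p \<Longrightarrow> norm (f j s) \<le> 1"
  shows "norm ((\<Sum>t<p ^ (2 * b + 1). \<Prod>j<2 ^ b. f j (nisan p b t j)) / of_nat (p ^ (2 * b + 1))
      - (\<Prod>j<2 ^ b. (\<Sum>s<p. f j s) / of_nat p)) \<le> 2 ^ b / sqrt (real p)"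
proof -
  have p0: "p > 0" using p prime_gt_0_nat by blast
  define c where "c = (\<Prod>j<2 ^ b. (\<Sum>s<p. f j s) / of_nat p)"
  define N where "N = p ^ (2 * b)"
  have N: "N > 0" unfolding N_def using p0 by simp
  define g where "g t = (\<Sum>s<p. \<Prod>j<2 ^ b. f j (nisan_steps p b s j t)) / of_nat p" for t
  have "(\<Sum>t<p * N. \<Prod>j<2 ^ b. f j (nisan p b t j)) = (\<Sum>s<p. \<Sum>t<N. \<Prod>j<2 ^ b. f j (nisan_steps p b s j t))"
    unfolding nisan_def using sum_nat_product[OF p0, of "\<lambda>s t. \<Prod>j<2 ^ b. f j (nisan_steps p b s j t)" N] .
  also have "\<dots> = (\<Sum>t<N. of_nat p * g t)" unfolding g_def using p0 by (subst sum.swap) simp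
  finally have "(\<Sum>t<p ^ (2 * b + 1). \<Prod>j<2 ^ b. f j (nisan p b t j)) / of_nat (p ^ (2 * b + 1)) = (\<Sum>t<N. g t) / of_nat N"
    using p0 by (simp add: N_def sum_distrib_left[symmetric])
  also have "\<dots> - c = (\<Sum>t<N. g t - c) / of_nat N" using N by (simp add: sum_subtractf field_simps)
  finally have "norm ((\<Sum>t<p ^ (2 * b + 1). \<Prod>j<2 ^ b. f j (nisan p b t j)) / of_nat (p ^ (2 * b + 1)) - c)
      = norm (\<Sum>t<N. g t - c) / real N" by (simp add: norm_divide)
  also have "\<dots> \<le> (\<Sum>t<N. norm (g t - c)) / real N" by (intro divide_right_mono norm_sum) simp
  also have "\<dots> \<le> real N * ((2 ^ b - 1) / sqrt (real p)) / real N"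
    using nisan_steps_product[where b = b and f = f, OF p f] unfolding g_def c_def N_def by (intro divide_right_mono) auto
  also have "\<dots> \<le> 2 ^ b / sqrt (real p)" using N by (simp add: divide_right_mono)
  finally show ?thesis unfolding c_def .
qed

section \<open>Splitting the points evenly into groups\<close>

lemma digits_sum_less:
  fixes c :: "nat \<Rightarrow> nat"
  shows "(\<And>j. j < l \<Longrightarrow> c j < B) \<Longrightarrow> (\<Sum>j<l. c j * B ^ j) < B ^ l"
proof (induction l)
  case (Suc l)
  have "(\<Sum>j<Suc l. c j * B ^ j) < B ^ l + c l * B ^ l" using Suc by simp
  also have "\<dots> = Suc (c l) * B ^ l" by simp
  also have "\<dots> \<le> B * B ^ l" using Suc.prems[of l] by (intro mult_le_mono1) simp
  finally show ?case by simp
qed simp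

lemma digits_sum_inj:
  fixes c c' :: "nat \<Rightarrow> nat"
  assumes "\<And>j. j < l \<Longrightarrow> c j < B" "\<And>j. j < l \<Longrightarrow> c' j < B"
    and "(\<Sum>j<l. c j * B ^ j) = (\<Sum>j<l. c' j * B ^ j)" "i < l"
  shows "c i = c' i"
  using assms
proof (induction l arbitrary: c c' i)
  case (Suc l)
  have sh: "(\<Sum>j<Suc l. d j * B ^ j) = d 0 + B * (\<Sum>j<l. d (Suc j) * B ^ j)" for d :: "nat \<Rightarrow> nat"
    by (simp add: sum.lessThan_Suc_shift sum_distrib_left mult_ac del: sum.lessThan_Suc)
  have eq: "c 0 + B * (\<Sum>j<l. c (Suc j) * B ^ j) = c' 0 + B * (\<Sum>j<l. c' (Suc j) * B ^ j)"
    using Suc.prems(3) unfolding sh .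
  have "c 0 = (c 0 + B * (\<Sum>j<l. c (Suc j) * B ^ j)) mod B" using Suc.prems(1)[of 0] by simp
  also have "\<dots> = c' 0" unfolding eq using Suc.prems(2)[of 0] by simp
  finally have 0: "c 0 = c' 0" .
  have "B > 0" using Suc.prems(1)[of 0] by simp
  then have "(\<Sum>j<l. c (Suc j) * B ^ j) = (\<Sum>j<l. c' (Suc j) * B ^ j)" using eq 0 by simp
  then show ?case using 0 Suc.IH[of "\<lambda>j. c (Suc j)" "\<lambda>j. c' (Suc j)" "i - 1"] Suc.prems
    by (cases i) auto
qed simp

text \<open>The multiplicities become base \<open>B\<close> digits, so a multiset of size below
  \<open>B\<close> is encoded by one number. The weight is additive over the elements, which turns
  its characters into products.\<close>

definition mset_weight :: "nat \<Rightarrow> nat multiset \<Rightarrow> nat" where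
  "mset_weight B M = (\<Sum>x\<in>#M. B ^ x)"

lemma mset_weight_eq:
  assumes "set_mset M \<subseteq> {..<l}"
  shows "mset_weight B M = (\<Sum>j<l. count M j * B ^ j)"
  using assms
proof (induction M)
  case (add x M)
  have "(\<Sum>j<l. count (add_mset x M) j * B ^ j) = (\<Sum>j<l. count M j * B ^ j + (if x = j then B ^ j else 0))"
    by (intro sum.cong) auto
  also have "\<dots> = mset_weight B M + B ^ x" using add by (simp add: sum.distrib)
  finally show ?case by (simp add: mset_weight_def)
qed (simp add: mset_weight_def)

lemma mset_weight_inj:
  assumes "set_mset M \<subseteq> {..<l}" "set_mset A \<subseteq> {..<l}" "size M < B" "size A < B"
    and "mset_weight B M = mset_weight B A"
  shows "M = A"
proof (rule multiset_eqI)
  fix x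
  show "count M x = count A x"
  proof (cases "x < l")
    case True
    have eq: "(\<Sum>j<l. count M j * B ^ j) = (\<Sum>j<l. count A j * B ^ j)"
      using mset_weight_eq[OF assms(1), of B] mset_weight_eq[OF assms(2), of B] assms(5) by simp
    show ?thesis
    proof (rule digits_sum_inj[of l "count M" B "count A" x, OF _ _ eq True])
      show "\<And>j. j < l \<Longrightarrow> count M j < B" "\<And>j. j < l \<Longrightarrow> count A j < B"
        using le_less_trans[OF count_le_size assms(3)] le_less_trans[OF count_le_size assms(4)] by auto
    qed
  next
    case False
    then have "x \<notin># M" "x \<notin># A" using assms(1,2) by auto
    then show ?thesis by (simp add: not_in_iff)
  qed
qed

lemma mset_weight_less:
  assumes "set_mset M \<subseteq> {..<l}" "size M < B"
  shows "mset_weight B M < B ^ l"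
  unfolding mset_weight_eq[OF assms(1)]
  by (rule digits_sum_less) (rule le_less_trans[OF count_le_size assms(2)])

text \<open>Orthogonality of the characters of the cyclic group of order \<open>Q\<close>.\<close>

lemma sum_roots_indicator:
  assumes "a < Q" "b < Q"
  shows "(\<Sum>\<theta><Q. (cis (2 * pi * real a / real Q)) ^ \<theta> * cnj (cis (2 * pi * real b / real Q)) ^ \<theta>)
    = of_nat Q * of_bool (a = b)"
proof -
  define w where "w = cis (2 * pi * real a / real Q) * cnj (cis (2 * pi * real b / real Q))"
  have w: "w = cis (2 * pi * real a / real Q - 2 * pi * real b / real Q)"
    unfolding w_def by (simp add: cis_mult cis_cnj)
  have Q: "Q > 0" using assms by simp
  have 1: "(\<Sum>\<theta><Q. (cis (2 * pi * real a / real Q)) ^ \<theta> * cnj (cis (2 * pi * real b / real Q)) ^ \<theta>) = (\<Sum>\<theta><Q. w ^ \<theta>)"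
    unfolding w_def power_mult_distrib by simp
  have unit: "cis (2 * pi * real c / real Q) ^ Q = 1" for c :: nat
    using Q cis_multiple_2pi[of "real c"] by (simp add: DeMoivre mult_ac)
  show ?thesis
  proof (cases "a = b")
    case True
    then have "w = 1" unfolding w by simp
    then show ?thesis unfolding 1 using True by simp
  next
    case False
    have "w \<noteq> 1"
    proof
      assume "w = 1"
      have "cis (2 * pi * real a / real Q) = w * cis (2 * pi * real b / real Q)"
        unfolding w by (simp add: cis_mult)
      then have "cis (2 * pi * real a / real Q) = cis (2 * pi * real b / real Q)"
        using \<open>w = 1\<close> by simp
      moreover have "inj_on (\<lambda>c. cis (2 * pi * real c / real Q)) {..<Q}"
        using bij_betw_roots_unity[OF Q] by (simp add: bij_betw_def)
      ultimately show False using assms False by (auto dest: inj_onD)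
    qed
    moreover have "w ^ Q = 1" unfolding w_def power_mult_distrib
      using unit[of a] unit[of b] by (simp flip: complex_cnj_power)
    ultimately show ?thesis unfolding 1 using False by (simp add: geometric_sum)
  qed
qed

text \<open>A multiset of colours is recognised by the character sums of its weight, which are averages
  of product functions.\<close>

lemma image_mset_indicator:
  assumes A: "set_mset A \<subseteq> {..<l}" "size A = k"
  shows "\<exists>(Q :: nat) (c :: nat \<Rightarrow> complex) (h :: nat \<Rightarrow> nat \<Rightarrow> complex).
    Q > 0 \<and> (\<forall>\<theta>. norm (c \<theta>) \<le> 1) \<and> (\<forall>\<theta> i. norm (h \<theta> i) \<le> 1) \<and>
    (\<forall>(S :: nat set) \<phi>. finite S \<and> card S = k \<and> \<phi> ` S \<subseteq> {..<l} \<longrightarrow>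
      of_nat Q * of_bool (image_mset \<phi> (mset_set S) = A) = (\<Sum>\<theta><Q. c \<theta> * (\<Prod>x\<in>S. h \<theta> (\<phi> x))))"
proof -
  define B where "B = k + 1"
  define Q where "Q = B ^ l"
  define c where "c \<theta> = cnj (cis (2 * pi * real (mset_weight B A) / real Q)) ^ \<theta>" for \<theta> :: nat
  define h where "h \<theta> i = cis (2 * pi * real (B ^ i) / real Q) ^ \<theta>" for \<theta> i :: nat
  have Q: "Q > 0" unfolding Q_def B_def by simp
  have cis_sum: "cis (\<Sum>x\<in>S. g x) = (\<Prod>x\<in>S. cis (g x))" for S :: "nat set" and g :: "nat \<Rightarrow> real"
    by (induction S rule: infinite_finite_induct) (auto simp: cis_mult[symmetric])
  show ?thesis
  proof (intro exI[of _ Q] exI[of _ c] exI[of _ h] conjI allI impI)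
    show "Q > 0" by (rule Q)
    show "norm (c \<theta>) \<le> 1" "norm (h \<theta> i) \<le> 1" for \<theta> i
      unfolding c_def h_def by (simp_all add: norm_power)
    fix S :: "nat set" and \<phi> assume "finite S \<and> card S = k \<and> \<phi> ` S \<subseteq> {..<l}"
    then have S: "finite S" "card S = k" "\<phi> ` S \<subseteq> {..<l}" by auto
    define M where "M = image_mset \<phi> (mset_set S)"
    have M: "set_mset M \<subseteq> {..<l}" "size M = k" unfolding M_def using S by auto
    have "of_bool (M = A) = (of_bool (mset_weight B M = mset_weight B A) :: complex)"
      using mset_weight_inj[OF M(1) A(1), of B] M(2) A(2) by (auto simp: B_def)
    then have "of_nat Q * of_bool (M = A) =
        (\<Sum>\<theta><Q. (cis (2 * pi * real (mset_weight B M) / real Q)) ^ \<theta> * c \<theta>)"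
      using sum_roots_indicator[of "mset_weight B M" Q "mset_weight B A"]
        mset_weight_less[OF M(1), of B] mset_weight_less[OF A(1), of B] M(2) A(2)
      unfolding Q_def c_def by (simp add: B_def)
    also have "(\<lambda>\<theta>. (cis (2 * pi * real (mset_weight B M) / real Q)) ^ \<theta> * c \<theta>)
        = (\<lambda>\<theta>. c \<theta> * (\<Prod>x\<in>S. h \<theta> (\<phi> x)))"
    proof
      fix \<theta>
      have "mset_weight B M = (\<Sum>x\<in>S. B ^ \<phi> x)"
        unfolding M_def mset_weight_def by (simp add: image_mset.compositionality o_def sum_unfold_sum_mset)
      then have "2 * pi * real (mset_weight B M) / real Q = (\<Sum>x\<in>S. 2 * pi * real (B ^ \<phi> x) / real Q)"
        by (simp add: sum_divide_distrib sum_distrib_left)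
      then show "(cis (2 * pi * real (mset_weight B M) / real Q)) ^ \<theta> * c \<theta> = c \<theta> * (\<Prod>x\<in>S. h \<theta> (\<phi> x))"
        unfolding h_def by (simp only: cis_sum prod_power_distrib mult.commute)
    qed
    finally show "of_nat Q * of_bool (image_mset \<phi> (mset_set S) = A) = (\<Sum>\<theta><Q. c \<theta> * (\<Prod>x\<in>S. h \<theta> (\<phi> x)))"
      unfolding M_def .
  qed
qed

text \<open>The reference value for independent words. The residues of a uniform word modulo
  \<open>l\<close> are slightly biased if \<open>l\<close> does not divide \<open>p\<close>; the
  bias is part of the reference value and is not an error of the generator.\<close>

definition iid_ratio :: "nat \<Rightarrow> nat \<Rightarrow> nat \<Rightarrow> nat multiset \<Rightarrow> real" where
  "iid_ratio p l k A = real (card {v \<in> {..<k} \<rightarrow>\<^sub>E {..<p}. image_mset (\<lambda>i. v i mod l) (mset_set {..<k}) = A}) / real p ^ k"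

text \<open>Each character contributes an average of products over \<open>S\<close>, which the
  generator reproduces up to 2^b / sqrt p. The sum over \<open>Q\<close> characters is matched by
  the factor \<open>Q\<close> in front of the indicator, so the error does not grow with the number
  of multisets.\<close>

lemma nisan_split:
  assumes p: "prime p" and l: "l > 0" and A: "set_mset A \<subseteq> {..<l}" "size A = k"
    and S: "S \<subseteq> {..<2 ^ b}" "card S = k"
  shows "\<bar>real (card {t \<in> {..<p ^ (2 * b + 1)}. image_mset (\<lambda>x. nisan p b t x mod l) (mset_set S) = A}) / real (p ^ (2 * b + 1))
      - iid_ratio p l k A\<bar> \<le> 2 ^ b / sqrt (real p)"
proof -
  have p0: "p > 0" using p prime_gt_0_nat by blast
  have fS: "finite S" using S(1) finite_subset by blast
  obtain Q :: nat and c :: "nat \<Rightarrow> complex" and h :: "nat \<Rightarrow> nat \<Rightarrow> complex"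
    where Q: "Q > 0" and c: "\<forall>\<theta>. norm (c \<theta>) \<le> 1" and h: "\<forall>\<theta> i. norm (h \<theta> i) \<le> 1"
    and ind0: "\<forall>(S :: nat set) \<phi>. finite S \<and> card S = k \<and> \<phi> ` S \<subseteq> {..<l} \<longrightarrow>
      of_nat Q * of_bool (image_mset \<phi> (mset_set S) = A) = (\<Sum>\<theta><Q. c \<theta> * (\<Prod>x\<in>S. h \<theta> (\<phi> x)))"
    using image_mset_indicator[OF A] by blast
  have ind: "of_nat Q * of_bool (image_mset \<phi> (mset_set S) = A) = (\<Sum>\<theta><Q. c \<theta> * (\<Prod>x\<in>S. h \<theta> (\<phi> x)))"
    if "finite S" "card S = k" "\<phi> ` S \<subseteq> {..<l}" for S :: "nat set" and \<phi>
    using ind0 that by blast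
  define N where "N = p ^ (2 * b + 1)"
  have N0: "N > 0" unfolding N_def using p0 by simp
  define g where "g \<theta> = (\<Sum>s<p. h \<theta> (s mod l)) / of_nat p" for \<theta>
  have cardsum: "of_nat (card {t \<in> I. R t}) = (\<Sum>t\<in>I. of_bool (R t))" if "finite I" for I :: "'c set" and R
    using that by (simp add: sum_of_bool_eq Collect_conj_eq)
  define \<Phi> where "\<Phi> \<theta> = (\<Sum>t<N. \<Prod>x\<in>S. h \<theta> (nisan p b t x mod l)) / of_nat N" for \<theta>
  have lhs: "of_nat Q * (of_nat (card {t \<in> {..<N}. image_mset (\<lambda>x. nisan p b t x mod l) (mset_set S) = A}) / of_nat N)
      = (\<Sum>\<theta><Q. c \<theta> * \<Phi> \<theta>)"
  proof -
    have "of_nat Q * (of_nat (card {t \<in> {..<N}. image_mset (\<lambda>x. nisan p b t x mod l) (mset_set S) = A}))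
       = (\<Sum>t<N. of_nat Q * of_bool (image_mset (\<lambda>x. nisan p b t x mod l) (mset_set S) = A))"
      by (subst cardsum) (simp_all only: finite_lessThan sum_distrib_left)
    also have "\<dots> = (\<Sum>t<N. \<Sum>\<theta><Q. c \<theta> * (\<Prod>x\<in>S. h \<theta> (nisan p b t x mod l)))"
      using l by (intro sum.cong refl ind fS S(2)) auto
    also have "\<dots> = (\<Sum>\<theta><Q. c \<theta> * (\<Sum>t<N. \<Prod>x\<in>S. h \<theta> (nisan p b t x mod l)))"
      by (subst sum.swap) (simp only: sum_distrib_left)
    finally show ?thesis unfolding \<Phi>_def
      by (simp only: times_divide_eq_right sum_divide_distrib[symmetric])
  qed
  have rhs: "of_nat Q * of_real (iid_ratio p l k A) = (\<Sum>\<theta><Q. c \<theta> * g \<theta> ^ k)"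
  proof -
    define V where "V = {..<k} \<rightarrow>\<^sub>E {..<p}"
    have fV: "finite V" unfolding V_def by (simp add: finite_PiE)
    have "of_nat Q * (of_nat (card {v \<in> V. image_mset (\<lambda>i. v i mod l) (mset_set {..<k}) = A}))
       = (\<Sum>v\<in>V. of_nat Q * of_bool (image_mset (\<lambda>i. v i mod l) (mset_set {..<k}) = A))"
      by (subst cardsum) (simp_all only: fV sum_distrib_left)
    also have "\<dots> = (\<Sum>v\<in>V. \<Sum>\<theta><Q. c \<theta> * (\<Prod>i<k. h \<theta> (v i mod l)))"
      using l by (intro sum.cong refl ind) auto
    also have "\<dots> = (\<Sum>\<theta><Q. c \<theta> * (\<Sum>v\<in>V. \<Prod>i<k. h \<theta> (v i mod l)))"
      by (subst sum.swap) (simp only: sum_distrib_left)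
    also have "(\<lambda>\<theta>. \<Sum>v\<in>V. \<Prod>i<k. h \<theta> (v i mod l)) = (\<lambda>\<theta>. (of_nat p * g \<theta>) ^ k)"
    proof
      fix \<theta>
      have "(\<Sum>v\<in>V. \<Prod>i<k. h \<theta> (v i mod l)) = (\<Prod>i<k. \<Sum>s<p. h \<theta> (s mod l))"
        unfolding V_def by (rule prod_sum_PiE[symmetric]) auto
      then show "(\<Sum>v\<in>V. \<Prod>i<k. h \<theta> (v i mod l)) = (of_nat p * g \<theta>) ^ k"
        using p0 by (simp add: g_def)
    qed
    finally have eq: "of_nat Q * (of_nat (card {v \<in> V. image_mset (\<lambda>i. v i mod l) (mset_set {..<k}) = A}))
      = (\<Sum>\<theta><Q. c \<theta> * (of_nat p * g \<theta>) ^ k)" .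
    have "of_nat Q * of_real (iid_ratio p l k A)
        = (of_nat Q * (of_nat (card {v \<in> V. image_mset (\<lambda>i. v i mod l) (mset_set {..<k}) = A}))) / (of_nat p ^ k :: complex)"
      unfolding iid_ratio_def V_def by simp
    also have "\<dots> = (\<Sum>\<theta><Q. c \<theta> * g \<theta> ^ k)"
      unfolding eq sum_divide_distrib using p0 by (intro sum.cong) (simp_all add: power_mult_distrib)
    finally show ?thesis .
  qed
  have diff: "norm (\<Phi> \<theta> - g \<theta> ^ k) \<le> 2 ^ b / sqrt (real p)" for \<theta>
  proof -
    \<comment> \<open>Words at addresses outside \<open>S\<close> are tested by the constant 1, so
      that a product over all 2^b words is one over \<open>S\<close>.\<close>
    define f where "f j s = (if j \<in> S then h \<theta> (s mod l) else 1)" for j s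
    have "norm ((\<Sum>t<p ^ (2 * b + 1). \<Prod>j<2 ^ b. f j (nisan p b t j)) / of_nat (p ^ (2 * b + 1))
      - (\<Prod>j<2 ^ b. (\<Sum>s<p. f j s) / of_nat p)) \<le> 2 ^ b / sqrt (real p)"
      by (rule nisan_product[OF p]) (auto simp: f_def h)
    also have "(\<lambda>t. \<Prod>j<2 ^ b. f j (nisan p b t j)) = (\<lambda>t. \<Prod>x\<in>S. h \<theta> (nisan p b t x mod l))"
    proof
      fix t
      have "(\<Prod>j<2 ^ b. f j (nisan p b t j)) = (\<Prod>j\<in>S. f j (nisan p b t j))"
        using S(1) by (intro prod.mono_neutral_right) (auto simp: f_def)
      then show "(\<Prod>j<2 ^ b. f j (nisan p b t j)) = (\<Prod>x\<in>S. h \<theta> (nisan p b t x mod l))"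
        by (simp add: f_def)
    qed
    also have "(\<Prod>j<2 ^ b. (\<Sum>s<p. f j s) / of_nat p) = (\<Prod>j\<in>S. (\<Sum>s<p. f j s) / of_nat p)"
      using S(1) p0 by (intro prod.mono_neutral_right) (auto simp: f_def)
    also have "\<dots> = g \<theta> ^ k" using S(2) by (simp add: f_def g_def)
    finally show ?thesis unfolding \<Phi>_def N_def .
  qed
  define x where "x = real (card {t \<in> {..<N}. image_mset (\<lambda>x. nisan p b t x mod l) (mset_set S) = A}) / real N"
  have "real Q * \<bar>x - iid_ratio p l k A\<bar> = norm (of_nat Q * of_real x - of_nat Q * of_real (iid_ratio p l k A) :: complex)"
    by (simp only: norm_mult norm_of_nat norm_of_real of_real_diff[symmetric] right_diff_distrib[symmetric])
  also have "of_nat Q * of_real x = (\<Sum>\<theta><Q. c \<theta> * \<Phi> \<theta>)" using lhs unfolding x_def by simp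
  also have "norm ((\<Sum>\<theta><Q. c \<theta> * \<Phi> \<theta>) - of_nat Q * of_real (iid_ratio p l k A)) = norm (\<Sum>\<theta><Q. c \<theta> * (\<Phi> \<theta> - g \<theta> ^ k))"
    unfolding rhs by (simp add: sum_subtractf right_diff_distrib)
  also have "\<dots> \<le> (\<Sum>\<theta><Q. 2 ^ b / sqrt (real p))"
  proof (rule sum_norm_le)
    fix \<theta>
    have "norm (c \<theta> * (\<Phi> \<theta> - g \<theta> ^ k)) \<le> norm (\<Phi> \<theta> - g \<theta> ^ k)"
      unfolding norm_mult by (rule mult_left_le_one_le) (auto simp: c)
    then show "norm (c \<theta> * (\<Phi> \<theta> - g \<theta> ^ k)) \<le> 2 ^ b / sqrt (real p)" using diff[of \<theta>] by linarith
  qed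
  also have "\<dots> = real Q * (2 ^ b / sqrt (real p))" by simp
  finally have "\<bar>x - iid_ratio p l k A\<bar> \<le> 2 ^ b / sqrt (real p)"
    using Q by (simp only: mult_le_cancel_left_pos of_nat_0_less_iff)
  then show ?thesis unfolding x_def N_def .
qed

text \<open>Only words below \<open>l * (p div l)\<close> are counted. Such a word is a quotient and
  a residue; the residues follow an arrangement of \<open>A\<close> and the quotients are
  free.\<close>

lemma iid_ratio_ge:
  assumes l: "l > 0" and A: "set_mset A \<subseteq> {..<l}" "size A = k"
  shows "real (card (permutations_of_multiset A)) * (real (p div l) / real p) ^ k \<le> iid_ratio p l k A"
proof -
  define F where "F = (\<lambda>(xs, w). \<lambda>i\<in>{..<k}. l * w i + xs ! i)"
  define X where "X = permutations_of_multiset A \<times> ({..<k} \<rightarrow>\<^sub>E {..<p div l})"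
  define Y where "Y = {v \<in> {..<k} \<rightarrow>\<^sub>E {..<p}. image_mset (\<lambda>i. v i mod l) (mset_set {..<k}) = A}"
  have xs: "length xs = k" "mset xs = A" "\<And>i. i < k \<Longrightarrow> xs ! i < l" if "xs \<in> permutations_of_multiset A" for xs
  proof -
    show m: "mset xs = A" using that by (simp add: permutations_of_multiset_def)
    then show "length xs = k" using A(2) by (metis size_mset)
    then show "\<And>i. i < k \<Longrightarrow> xs ! i < l" using m A(1) by (metis lessThan_iff nth_mem set_mset_mset subsetD)
  qed
  have sub: "F ` X \<subseteq> Y"
  proof
    fix v assume "v \<in> F ` X"
    then obtain ys w where yw: "ys \<in> permutations_of_multiset A" "w \<in> {..<k} \<rightarrow>\<^sub>E {..<p div l}" "v = F (ys, w)"
      unfolding X_def by auto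
    have vi: "v i = l * w i + ys ! i" if "i < k" for i using yw(3) that by (simp add: F_def)
    have "v i < p" if "i < k" for i
    proof -
      have "w i < p div l" using yw(2) that by auto
      have "v i < l * Suc (w i)" unfolding vi[OF that] using xs(3)[OF yw(1) that] by simp
      also have "\<dots> \<le> l * (p div l)" using \<open>w i < p div l\<close> by (intro mult_le_mono2) simp
      also have "\<dots> \<le> p" by simp
      finally show ?thesis .
    qed
    then have "v \<in> {..<k} \<rightarrow>\<^sub>E {..<p}" using yw(3) by (auto simp: F_def PiE_iff extensional_def)
    moreover have "image_mset (\<lambda>i. v i mod l) (mset_set {..<k}) = A"
    proof -
      have "image_mset (\<lambda>i. v i mod l) (mset_set {..<k}) = image_mset (\<lambda>i. ys ! i) (mset_set {..<k})"
        using vi xs(3)[OF yw(1)] by (intro image_mset_cong) auto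
      also have "\<dots> = mset (map ((!) ys) [0..<k])" by (simp add: atLeast0LessThan)
      also have "\<dots> = mset ys" using xs(1)[OF yw(1)] map_nth[of ys] by simp
      finally show ?thesis using xs(2)[OF yw(1)] by simp
    qed
    ultimately show "v \<in> Y" unfolding Y_def by simp
  qed
  have inj: "inj_on F X"
  proof (rule inj_onI)
    fix a b assume ab: "a \<in> X" "b \<in> X" "F a = F b"
    obtain ys w zs w' where eqs: "a = (ys, w)" "b = (zs, w')" by fastforce
    have y: "ys \<in> permutations_of_multiset A" "zs \<in> permutations_of_multiset A"
      "w \<in> {..<k} \<rightarrow>\<^sub>E {..<p div l}" "w' \<in> {..<k} \<rightarrow>\<^sub>E {..<p div l}" using ab eqs unfolding X_def by auto
    have eq: "l * w i + ys ! i = l * w' i + zs ! i" if "i < k" for i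
      using fun_cong[OF ab(3), of i] that unfolding eqs F_def by simp
    have e1: "ys ! i = zs ! i" if "i < k" for i
      using arg_cong[OF eq[OF that], of "\<lambda>x. x mod l"] xs(3)[OF y(1) that] xs(3)[OF y(2) that] by simp
    have e2: "w i = w' i" if "i < k" for i using eq[OF that] e1[OF that] l by simp
    have "ys = zs" using e1 xs(1)[OF y(1)] xs(1)[OF y(2)] by (intro nth_equalityI) auto
    moreover have "w = w'" using e2 y(3,4) by (intro PiE_ext) auto
    ultimately show "a = b" using eqs by simp
  qed
  have "card X = card (F ` X)" using inj by (simp add: card_image)
  also have "\<dots> \<le> card Y" using sub by (intro card_mono) (auto simp: Y_def finite_PiE)
  finally have "real (card (permutations_of_multiset A)) * real (p div l) ^ k \<le> real (card Y)"
    unfolding X_def by (simp add: card_cartesian_product card_PiE flip: of_nat_power of_nat_mult)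
  then have "real (card (permutations_of_multiset A)) * real (p div l) ^ k / real p ^ k \<le> real (card Y) / real p ^ k"
    by (rule divide_right_mono) simp
  then show ?thesis unfolding iid_ratio_def Y_def by (simp add: power_divide)
qed

text \<open>The group sizes aimed at. They are as even as possible, and they allow the final
  colours, group plus \<open>l\<close> times position, to fill {..<k} exactly.\<close>

definition residues_mset :: "nat \<Rightarrow> nat \<Rightarrow> nat multiset" where
  "residues_mset l k = image_mset (\<lambda>c. c mod l) (mset_set {..<k})"

lemma residues_mset: "l > 0 \<Longrightarrow> set_mset (residues_mset l k) \<subseteq> {..<l}" "size (residues_mset l k) = k"
  by (auto simp: residues_mset_def)

lemma count_residues_mset: "count (residues_mset l k) j = card {c \<in> {..<k}. c mod l = j}"
  unfolding residues_mset_def by (subst count_image_mset) (auto simp: vimage_def Int_def intro: arg_cong[where f = card])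

lemma residue_class_image: "j < l \<Longrightarrow> {c \<in> {..<k}. c mod l = j} = (\<lambda>i. j + l * i) ` {i. j + l * i < k}" for j l k :: nat
proof (intro set_eqI iffI)
  fix c assume c: "c \<in> {c \<in> {..<k}. c mod l = j}"
  then have "c = j + l * (c div l)" by (auto simp: algebra_simps)
  then show "c \<in> (\<lambda>i. j + l * i) ` {i. j + l * i < k}" using c by (metis (mono_tags, lifting) imageI lessThan_iff mem_Collect_eq)
qed auto

text \<open>The number of elements of {..<k} congruent to \<open>j\<close> modulo \<open>l\<close>,
  for \<open>j < l\<close> and \<open>j < k\<close>, in a closed form that the program can
  evaluate.\<close>

definition class_size :: "nat \<Rightarrow> nat \<Rightarrow> nat \<Rightarrow> nat" where
  "class_size k l j = (k - 1 - j) div l + 1"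

lemma card_residue_class: "j < l \<Longrightarrow> j < k \<Longrightarrow> card {c \<in> {..<k}. c mod l = j} = class_size k l j"
proof -
  assume j: "j < l" "j < k"
  have "{i. j + l * i < k} = {..<class_size k l j}"
  proof (rule set_eqI)
    fix i
    have "j + l * i < k \<longleftrightarrow> i * l \<le> k - 1 - j" using j by (auto simp: mult.commute)
    also have "\<dots> \<longleftrightarrow> i \<le> (k - 1 - j) div l" using j less_eq_div_iff_mult_less_eq[of l i "k - 1 - j"] by auto
    finally show "i \<in> {i. j + l * i < k} \<longleftrightarrow> i \<in> {..<class_size k l j}" by (auto simp: class_size_def)
  qed
  moreover have "inj_on (\<lambda>i. j + l * i) {i. j + l * i < k}" using j by (auto intro!: inj_onI)
  ultimately show ?thesis unfolding residue_class_image[OF j(1)] by (simp add: card_image)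
qed

text \<open>The multinomial coefficient of an even partition loses only a factor polynomial in
  \<open>k\<close> for each colour. Adding the element \<open>k\<close> multiplies it by (k + 1) /
  (k div l + 1), which is at least l (k + 1) / (k + l); Bernoulli's inequality accounts for the
  rest.\<close>

lemma card_permutations_residues: "l > 0 \<Longrightarrow> real l ^ k \<le> real (card (permutations_of_multiset (residues_mset l k))) * real (k + 1) ^ l"
proof (induction k)
  case 0
  then show ?case by (simp add: residues_mset_def)
next
  case (Suc k)
  define C where "C k = real (card (permutations_of_multiset (residues_mset l k)))" for k
  have step: "residues_mset l (Suc k) = residues_mset l k + {#k mod l#}"
    unfolding residues_mset_def by (simp add: lessThan_Suc)
  have cnt: "count (residues_mset l k) (k mod l) = k div l"
  proof -
    have "{i. k mod l + l * i < k} = {..<k div l}"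
    proof (rule set_eqI)
      fix i
      have "k mod l + l * i < k \<longleftrightarrow> l * i < l * (k div l)"
        using mult_div_mod_eq[of l k] by linarith
      then show "i \<in> {i. k mod l + l * i < k} \<longleftrightarrow> i \<in> {..<k div l}" using Suc.prems by simp
    qed
    moreover have "inj_on (\<lambda>i. k mod l + l * i) {i. k mod l + l * i < k}" using Suc.prems by (auto intro!: inj_onI)
    ultimately show ?thesis using Suc.prems
      by (simp add: count_residues_mset residue_class_image[of "k mod l" l k] card_image del: lessThan_iff)
  qed
  have "C (Suc k) * (real (k div l) + 1) = real (k + 1) * C k"
    using card_permutations_of_multiset_insert_aux[of "residues_mset l k" "k mod l"] residues_mset(2)[of l k]
    unfolding C_def step cnt by (metis of_nat_1 of_nat_add of_nat_mult)
  then have CS: "C (Suc k) = real (k + 1) * C k / (real (k div l) + 1)" by (simp add: field_simps add_nonneg_eq_0_iff)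
  have q: "real l * (real (k div l) + 1) \<le> real (k + l)"
  proof -
    have "l * (k div l) + l \<le> k + l" by simp
    then have "real (l * (k div l) + l) \<le> real (k + l)" by (rule of_nat_mono)
    then show ?thesis by (simp add: algebra_simps)
  qed
  \<comment> \<open>After division this is 1 + (l - 1)/(k + 1) \<le> (1 + 1/(k + 1))^l. Bernoulli's
    inequality even gives it with \<open>l\<close> in place of l - 1.\<close>
  have bern: "real (k + l) * real (k + 1) ^ l \<le> real (k + 1) * real (k + 2) ^ l"
  proof -
    have "1 + real l * (1 / real (k + 1)) \<le> (1 + 1 / real (k + 1)) ^ l"
      by (rule Bernoulli_inequality) (rule order.trans[of _ 0]; simp)
    then have "(1 + real l * (1 / real (k + 1))) * (real (k + 1) * real (k + 1) ^ l)
        \<le> (1 + 1 / real (k + 1)) ^ l * (real (k + 1) * real (k + 1) ^ l)" by (rule mult_right_mono) simp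
    also have "(1 + 1 / real (k + 1)) ^ l * (real (k + 1) * real (k + 1) ^ l) = real (k + 1) * ((1 + 1 / real (k + 1)) * real (k + 1)) ^ l"
      by (simp only: power_mult_distrib mult_ac)
    also have "(1 + 1 / real (k + 1)) * real (k + 1) = real (k + 2)" by (simp add: field_simps)
    also have "(1 + real l * (1 / real (k + 1))) * (real (k + 1) * real (k + 1) ^ l) = real (k + 1 + l) * real (k + 1) ^ l"
      by (simp add: field_simps)
    finally have "real (k + 1 + l) * real (k + 1) ^ l \<le> real (k + 1) * real (k + 2) ^ l" .
    moreover have "real (k + l) * real (k + 1) ^ l \<le> real (k + 1 + l) * real (k + 1) ^ l" by (intro mult_right_mono) auto
    ultimately show ?thesis by linarith
  qed
  have C0: "0 \<le> C k" unfolding C_def by simp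
  have "real l ^ Suc k * real (k + l) \<le> real l * (C k * real (k + 1) ^ l) * real (k + l)"
    using Suc.IH[OF Suc.prems] unfolding C_def by (simp add: mult_left_mono mult_right_mono)
  also have "\<dots> = real l * C k * (real (k + l) * real (k + 1) ^ l)" by simp
  also have "\<dots> \<le> real l * C k * (real (k + 1) * real (k + 2) ^ l)" by (intro mult_left_mono bern) (simp add: C0)
  also have "\<dots> = (real l * (real (k div l) + 1)) * (C (Suc k) * real (k + 2) ^ l)"
    unfolding CS by (simp add: field_simps add_nonneg_eq_0_iff)
  also have "\<dots> \<le> real (k + l) * (C (Suc k) * real (k + 2) ^ l)"
    by (intro mult_right_mono q) (simp add: C_def)
  finally have "real l ^ Suc k * real (k + l) \<le> (C (Suc k) * real (k + 2) ^ l) * real (k + l)" by (simp only: mult.commute)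
  then show ?case using Suc.prems unfolding C_def by simp
qed

text \<open>The arrangements cost the factor \<open>(k + 1) ^ l\<close>. Rounding \<open>p\<close>
  down to a multiple of \<open>l\<close> costs at most (1 - l/p)^k, which is at least 1/2 because
  \<open>p\<close> is at least 2kl.\<close>

lemma iid_ratio_residues_ge:
  assumes l: "l > 0" and p: "2 * (k * l) \<le> p" "p > 0"
  shows "1 / (2 * real (k + 1) ^ l) \<le> iid_ratio p l k (residues_mset l k)"
proof -
  have "real p < real l * (real (p div l) + 1)"
  proof -
    have "p < l * (p div l + 1)" using l dividend_less_times_div[of l p] by simp
    then have "real p < real (l * (p div l + 1))" by (rule of_nat_less_iff[THEN iffD2])
    then show ?thesis by (simp add: algebra_simps)
  qed
  then have "1 \<le> real l * (real (p div l) + 1) / real p" using p by (simp add: le_divide_eq)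
  then have q: "1 - real l / real p \<le> real l * (real (p div l) / real p)"
    by (simp add: distrib_left add_divide_distrib)
  have "2 * (real k * real l) \<le> real p" using of_nat_mono[OF p(1), where 'a = real] by simp
  then have "real k * (real l / real p) \<le> 1 / 2" using p(2) by (simp add: field_simps)
  then have "1 / 2 \<le> 1 + real k * (- (real l / real p))" by simp
  also have "\<dots> \<le> (1 + (- (real l / real p))) ^ k"
  proof (cases "k = 0")
    case False
    have "l \<le> p" using p(1) False by (cases k) auto
    then show ?thesis using p by (intro Bernoulli_inequality) (simp add: field_simps)
  qed simp
  also have "\<dots> \<le> (real l * (real (p div l) / real p)) ^ k"
  proof (cases "k = 0")
    case False
    have "l \<le> p" using p(1) False by (cases k) auto
    then show ?thesis using p q by (intro power_mono) (auto simp: field_simps)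
  qed simp
  finally have half: "1 / 2 \<le> real l ^ k * (real (p div l) / real p) ^ k" by (simp only: power_mult_distrib)
  have "real l ^ k / real (k + 1) ^ l \<le> real (card (permutations_of_multiset (residues_mset l k)))"
    using card_permutations_residues[OF l, of k] by (simp add: field_simps)
  then have "real l ^ k / real (k + 1) ^ l * (real (p div l) / real p) ^ k
      \<le> real (card (permutations_of_multiset (residues_mset l k))) * (real (p div l) / real p) ^ k"
    by (intro mult_right_mono) auto
  also have "\<dots> \<le> iid_ratio p l k (residues_mset l k)"
    by (rule iid_ratio_ge[OF l residues_mset(1)[OF l] residues_mset(2)])
  finally have "(real l ^ k * (real (p div l) / real p) ^ k) / real (k + 1) ^ l \<le> iid_ratio p l k (residues_mset l k)" by simp
  moreover have "(1 / 2) / real (k + 1) ^ l \<le> (real l ^ k * (real (p div l) / real p) ^ k) / real (k + 1) ^ l"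
    using half by (intro divide_right_mono) auto
  ultimately show ?thesis by simp
qed

section \<open>Perfect hashing inside the groups\<close>

definition perfect_ratio :: "nat \<Rightarrow> nat \<Rightarrow> real" where
  "perfect_ratio p m = real (card {v \<in> {..<m} \<rightarrow>\<^sub>E {..<p}. inj_on (\<lambda>i. v i mod m) {..<m}}) / real p ^ m"

text \<open>In the step from m to m + 1 the quotient grows by (1 + 1/m)^m, which is at most e; 4 is
  a convenient upper bound for e.\<close>

lemma power_self_le_fact: "real m ^ m \<le> 4 ^ m * fact m"
proof (induction m)
  case (Suc m)
  have "(real (Suc m)) ^ m \<le> 4 * real m ^ m"
  proof (cases "m = 0")
    case False
    have "1 + 1 / real m \<le> exp (1 / real m)" by (rule exp_ge_add_one_self)
    then have "(1 + 1 / real m) ^ m \<le> exp (1 / real m) ^ m" by (rule power_mono) simp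
    also have "\<dots> = exp 1" using False by (simp flip: exp_of_nat_mult)
    also have "\<dots> \<le> 4" using exp_le by linarith
    finally have "(1 + 1 / real m) ^ m * real m ^ m \<le> 4 * real m ^ m" by (rule mult_right_mono) simp
    moreover have "(1 + 1 / real m) * real m = real (Suc m)" using False by (simp add: field_simps)
    ultimately show ?thesis by (simp only: power_mult_distrib[symmetric])
  qed simp
  then have "real (Suc m) ^ Suc m \<le> real (Suc m) * (4 * real m ^ m)"
    unfolding power_Suc by (rule mult_left_mono) simp
  also have "\<dots> \<le> real (Suc m) * (4 * (4 ^ m * fact m))" by (intro mult_left_mono Suc.IH) auto
  finally show ?case by (simp add: algebra_simps)
qed simp

text \<open>The perfect patterns include the arrangements of the multiset containing every residue
  once, so \<open>iid_ratio_ge\<close> applies: m! / m^m contributes 4^(-m), and the rounding of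
  \<open>p div m\<close> another 2^(-m).\<close>

lemma perfect_ratio_ge:
  assumes "m \<le> p" "p > 0"
  shows "1 / 8 ^ m \<le> perfect_ratio p m"
proof (cases "m = 0")
  case True
  then show ?thesis by (simp add: perfect_ratio_def)
next
  case False
  define A where "A = mset_set {..<m}"
  have A: "set_mset A \<subseteq> {..<m}" "size A = m" unfolding A_def by auto
  have perm: "card (permutations_of_multiset A) = fact m"
    using card_permutations_of_multiset_aux[of A] A unfolding A_def by simp
  have "p < m * (p div m + 1)" using False dividend_less_times_div[of m p] by simp
  moreover have "p div m \<ge> 1" using assms False by (simp add: Suc_le_eq div_greater_zero_iff)
  then have "m * (p div m + 1) \<le> m * (2 * (p div m))" by (intro mult_le_mono2) simp
  ultimately have "p \<le> m * (2 * (p div m))" by linarith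
  then have "real p \<le> real (m * (2 * (p div m)))" by (rule of_nat_mono)
  then have "1 / (2 * real m) \<le> real (p div m) / real p" using assms False by (simp add: field_simps)
  then have "(1 / (2 * real m)) ^ m \<le> (real (p div m) / real p) ^ m" by (rule power_mono) simp
  then have "fact m * (1 / (2 * real m)) ^ m \<le> fact m * (real (p div m) / real p) ^ m" by (rule mult_left_mono) simp
  also have "\<dots> \<le> iid_ratio p m m A" using iid_ratio_ge[of m A m p] A False perm by simp
  also have "\<dots> \<le> perfect_ratio p m"
    unfolding iid_ratio_def perfect_ratio_def
  proof (intro divide_right_mono of_nat_mono card_mono)
    show "{v \<in> {..<m} \<rightarrow>\<^sub>E {..<p}. image_mset (\<lambda>i. v i mod m) (mset_set {..<m}) = A}
        \<subseteq> {v \<in> {..<m} \<rightarrow>\<^sub>E {..<p}. inj_on (\<lambda>i. v i mod m) {..<m}}"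
    proof (intro subsetI CollectI conjI)
      fix v assume v: "v \<in> {v \<in> {..<m} \<rightarrow>\<^sub>E {..<p}. image_mset (\<lambda>i. v i mod m) (mset_set {..<m}) = A}"
      then show "v \<in> {..<m} \<rightarrow>\<^sub>E {..<p}" by simp
      have "(\<lambda>i. v i mod m) ` {..<m} = set_mset (image_mset (\<lambda>i. v i mod m) (mset_set {..<m}))" by simp
      also have "\<dots> = {..<m}" using v unfolding A_def by simp
      finally show "inj_on (\<lambda>i. v i mod m) {..<m}" by (intro eq_card_imp_inj_on) simp_all
    qed
  qed (auto simp: finite_PiE)
  finally have 1: "fact m * (1 / (2 * real m)) ^ m \<le> perfect_ratio p m" .
  have "real m ^ m * 2 ^ m \<le> (4 ^ m * fact m) * 2 ^ m" by (intro mult_right_mono power_self_le_fact) simp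
  also have "(4 ^ m * fact m) * 2 ^ m = fact m * (8::real) ^ m"
    by (simp add: power_mult_distrib[symmetric] mult_ac)
  finally have "1 / 8 ^ m \<le> fact m * (1 / (2 * real m)) ^ m"
    using False by (simp add: power_mult_distrib power_divide field_simps)
  then show ?thesis using 1 by simp
qed

lemma perfect_ratio_le: "p > 0 \<Longrightarrow> perfect_ratio p m \<le> 1"
proof -
  assume p: "p > 0"
  have "card {v \<in> {..<m} \<rightarrow>\<^sub>E {..<p}. inj_on (\<lambda>i. v i mod m) {..<m}} \<le> card ({..<m} \<rightarrow>\<^sub>E {..<p})"
    by (intro card_mono) (auto simp: finite_PiE)
  then have "real (card {v \<in> {..<m} \<rightarrow>\<^sub>E {..<p}. inj_on (\<lambda>i. v i mod m) {..<m}}) \<le> real (p ^ m)"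
    by (simp add: card_PiE)
  then show ?thesis using p by (simp add: perfect_ratio_def)
qed

text \<open>Only the incomplete last period is unbalanced. This is needed because a word of the
  generator is a residue modulo one prime and is then read in base another prime.\<close>

lemma periodic_ratio:
  assumes D: "D > 0" and N: "N > 0" and per: "\<And>s. R (s mod D) \<longleftrightarrow> R s"
  shows "\<bar>real (card {s \<in> {..<N}. R s}) / real N - real (card {s \<in> {..<D}. R s}) / real D\<bar> \<le> real D / real N"
proof -
  define q r where "q = N div D" and "r = N mod D"
  define I where "I = card {s \<in> {..<D}. R s}"
  define J where "J = card {s \<in> {D * q..<N}. R s}"
  have Nq: "N = D * q + r" unfolding q_def r_def by simp
  have r: "r < D" unfolding r_def using D by simp
  have cardsum: "card {t \<in> A. R t} = (\<Sum>t\<in>A. of_bool (R t))" if "finite A" for A :: "nat set"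
    using that by (simp add: sum_of_bool_eq Collect_conj_eq)
  have "card {s \<in> {..<D * q}. R s} = (\<Sum>s<D * q. of_bool (R (s mod D)))"
    unfolding per by (rule cardsum) simp
  also have "\<dots> = (\<Sum>i<D. \<Sum>j<q. of_bool (R i))"
    using sum_nat_product[OF D, of "\<lambda>i j. of_bool (R i) :: nat" q] .
  also have "\<dots> = q * I" unfolding I_def by (subst cardsum) (simp_all add: sum_distrib_left)
  finally have 1: "card {s \<in> {..<D * q}. R s} = q * I" .
  have "{s \<in> {..<N}. R s} = {s \<in> {..<D * q}. R s} \<union> {s \<in> {D * q..<N}. R s}" using Nq by auto
  moreover have "{s \<in> {..<D * q}. R s} \<inter> {s \<in> {D * q..<N}. R s} = {}" by auto
  ultimately have C: "card {s \<in> {..<N}. R s} = q * I + J"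
    unfolding J_def 1[symmetric] by (subst card_Un_disjoint[symmetric]) (simp_all only: finite_lessThan finite_atLeastLessThan finite_Collect_conjI Collect_mem_eq simp_thms)
  have "J \<le> card {D * q..<N}" unfolding J_def by (intro card_mono) auto
  then have J: "J \<le> r" using Nq by simp
  have "I \<le> card {..<D}" unfolding I_def by (intro card_mono) auto
  then have I: "I \<le> D" by simp
  have "real (card {s \<in> {..<N}. R s}) / real N - real I / real D = (real J * real D - real I * real r) / (real N * real D)"
  proof -
    have "real (card {s \<in> {..<N}. R s}) / real N - real I / real D
        = (real (q * I + J) * real D - real I * real N) / (real N * real D)"
      unfolding C using D N by (simp add: diff_frac_eq)
    also have "real (q * I + J) * real D - real I * real N = real J * real D - real I * real r"
      by (simp add: Nq algebra_simps)
    finally show ?thesis .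
  qed
  also have "\<bar>\<dots>\<bar> \<le> (real D * real D) / (real N * real D)"
  proof -
    have "real J * real D \<le> real D * real D" using J r by (intro mult_right_mono) auto
    moreover have "real I * real r \<le> real D * real D" using I r by (intro mult_mono) auto
    moreover have "0 \<le> real J * real D" "0 \<le> real I * real r" by simp_all
    ultimately have "\<bar>real J * real D - real I * real r\<bar> \<le> real D * real D" by linarith
    then show ?thesis unfolding abs_divide abs_mult abs_of_nat by (rule divide_right_mono) simp
  qed
  finally show ?thesis unfolding I_def using D by simp
qed

lemma perfect_ratio_poly_hash:
  assumes p: "prime p" and T: "T \<subseteq> {..<p}" "card T = m" "m \<le> d" and N: "N > 0"
  shows "\<bar>real (card {s \<in> {..<N}. inj_on (\<lambda>x. poly_hash p d s x mod m) T}) / real N - perfect_ratio p m\<bar> \<le> real (p ^ d) / real N"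
proof -
  have p0: "p > 0" using p prime_gt_0_nat by blast
  have fT: "finite T" using T(1) finite_subset by blast
  obtain e where e: "bij_betw e {..<m} T"
    using ex_bij_betw_nat_finite[OF fT] T(2) by (auto simp: atLeast0LessThan)
  have e': "inj_on e {..<m}" "e ` {..<m} = T" using e by (auto simp: bij_betw_def)
  define R where "R v \<longleftrightarrow> inj_on (\<lambda>x. v x mod m) T" for v :: "nat \<Rightarrow> nat"
  define R' where "R' w \<longleftrightarrow> inj_on (\<lambda>i. w i mod m) {..<m}" for w :: "nat \<Rightarrow> nat"
  have RR': "R v \<longleftrightarrow> R' (\<lambda>i\<in>{..<m}. v (e i))" for v
  proof -
    have "R v \<longleftrightarrow> inj_on ((\<lambda>x. v x mod m) \<circ> e) {..<m}"
      unfolding R_def using comp_inj_on_iff[OF e'(1)] e'(2) by metis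
    also have "\<dots> \<longleftrightarrow> R' (\<lambda>i\<in>{..<m}. v (e i))" unfolding R'_def by (rule inj_on_cong) simp
    finally show ?thesis .
  qed
  have "card {s \<in> {..<p ^ d}. R (restrict (poly_hash p d s) T)} = p ^ (d - m) * card {v \<in> T \<rightarrow>\<^sub>E {..<p}. R v}"
    using card_poly_hash[OF p T(1), of d R] T by simp
  also have "{v \<in> T \<rightarrow>\<^sub>E {..<p}. R v} = {v \<in> (e ` {..<m}) \<rightarrow>\<^sub>E {..<p}. R' (\<lambda>i\<in>{..<m}. v (e i))}"
    unfolding e'(2) RR' ..
  also have "card \<dots> = card {w \<in> {..<m} \<rightarrow>\<^sub>E {..<p}. R' w}" by (rule card_PiE_reindex[OF e'(1)])
  finally have c: "card {s \<in> {..<p ^ d}. R (restrict (poly_hash p d s) T)} = p ^ (d - m) * card {w \<in> {..<m} \<rightarrow>\<^sub>E {..<p}. R' w}" .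
  have Rr: "R (restrict (poly_hash p d s) T) \<longleftrightarrow> inj_on (\<lambda>x. poly_hash p d s x mod m) T" for s
    unfolding R_def by (rule inj_on_cong) simp
  have pd: "real p ^ d = real p ^ (d - m) * real p ^ m" using T(3) by (simp flip: power_add)
  have "real (card {s \<in> {..<p ^ d}. inj_on (\<lambda>x. poly_hash p d s x mod m) T}) / real (p ^ d) = perfect_ratio p m"
    using c p0 unfolding Rr perfect_ratio_def R'_def by (simp add: pd del: lessThan_iff)
  then show ?thesis
    using periodic_ratio[of "p ^ d" N "\<lambda>s. inj_on (\<lambda>x. poly_hash p d s x mod m) T"] p0 N
    by (simp add: poly_hash_mod_power del: lessThan_iff)
qed

lemma nisan_steps_mod: "p > 0 \<Longrightarrow> nisan_steps p b s j (t mod p ^ (2 * b)) = nisan_steps p b s j t"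
proof (induction b arbitrary: s j t)
  case (Suc b)
  have e: "p ^ (2 * Suc b) = p ^ 2 * p ^ (2 * b)" by (simp flip: power_add)
  have "t mod (p ^ 2 * p ^ (2 * b)) mod p ^ 2 = t mod p ^ 2" by (simp add: mod_mod_cancel)
  then have 1: "poly_hash p 2 (t mod (p ^ 2 * p ^ (2 * b))) s = poly_hash p 2 t s"
    using poly_hash_mod_power[OF Suc.prems, of 2 "t mod (p ^ 2 * p ^ (2 * b))" s] poly_hash_mod_power[OF Suc.prems, of 2 t s]
    by simp
  have 2: "t mod (p ^ 2 * p ^ (2 * b)) div p ^ 2 = t div p ^ 2 mod p ^ (2 * b)"
    using Suc.prems by (simp add: mod_mult2_eq)
  show ?case unfolding e nisan_steps.simps 1 2 using Suc by simp
qed simp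

lemma nisan_mod: "p > 0 \<Longrightarrow> nisan p b (t mod p ^ (2 * b + 1)) j = nisan p b t j"
proof -
  assume p: "p > 0"
  have e: "p ^ (2 * b + 1) = p * p ^ (2 * b)" by simp
  have 1: "t mod (p * p ^ (2 * b)) mod p = t mod p" by (simp add: mod_mod_cancel)
  have 2: "t mod (p * p ^ (2 * b)) div p = t div p mod p ^ (2 * b)" using p by (simp add: mod_mult2_eq)
  show ?thesis unfolding nisan_def e 1 2 by (rule nisan_steps_mod[OF p])
qed

lemma norm_prod_diff_real:
  fixes a c :: "'i \<Rightarrow> real"
  assumes "\<And>i. i \<in> I \<Longrightarrow> 0 \<le> a i \<and> a i \<le> 1" "\<And>i. i \<in> I \<Longrightarrow> 0 \<le> c i \<and> c i \<le> 1"
    and "\<And>i. i \<in> I \<Longrightarrow> \<bar>a i - c i\<bar> \<le> x"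
  shows "\<bar>prod a I - prod c I\<bar> \<le> real (card I) * x"
proof -
  have "norm (prod a I - prod c I) \<le> (\<Sum>i\<in>I. norm (a i - c i))"
    by (rule norm_prod_diff) (use assms in auto)
  also have "\<dots> \<le> (\<Sum>i\<in>I. x)" by (intro sum_mono) (use assms in auto)
  finally show ?thesis by simp
qed

text \<open>Two errors separate the groups from independence: the generator replaces independent
  words, at the price of 2^b / sqrt P, and a word below \<open>P\<close> is not exactly a uniform
  polynomial seed, at the price of p^d / P for each of the 2^b groups.\<close>

lemma nisan_perfect:
  assumes P: "prime P" and p: "prime p" and T: "\<And>j. j < 2 ^ b \<Longrightarrow> T j \<subseteq> {..<p} \<and> card (T j) = m j \<and> m j \<le> d"
  shows "\<bar>real (card {t \<in> {..<P ^ (2 * b + 1)}. \<forall>j<2 ^ b. inj_on (\<lambda>x. poly_hash p d (nisan P b t j) x mod m j) (T j)}) / real (P ^ (2 * b + 1))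
      - (\<Prod>j<2 ^ b. perfect_ratio p (m j))\<bar> \<le> 2 ^ b / sqrt (real P) + 2 ^ b * (real (p ^ d) / real P)"
proof -
  have P0: "P > 0" using P prime_gt_0_nat by blast
  have p0: "p > 0" using p prime_gt_0_nat by blast
  define R where "R j s \<longleftrightarrow> inj_on (\<lambda>x. poly_hash p d s x mod m j) (T j)" for j s
  define f where "f j s = (of_bool (R j s) :: real)" for j s
  define N where "N = P ^ (2 * b + 1)"
  define avg where "avg j = (\<Sum>s<P. f j s) / real P" for j
  have cardsum: "real (card {t \<in> I. Q t}) = (\<Sum>t\<in>I. of_bool (Q t))" if "finite I" for I :: "nat set" and Q
    using that by (simp add: sum_of_bool_eq Collect_conj_eq)
  have prodb: "(\<Prod>j<n. of_bool (Q j) :: real) = of_bool (\<forall>j<n. Q j)" for n :: nat and Q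
    by (induction n) (auto simp: less_Suc_eq)
  have lhs: "(\<Sum>t<N. \<Prod>j<2 ^ b. f j (nisan P b t j)) = real (card {t \<in> {..<N}. \<forall>j<2 ^ b. R j (nisan P b t j)})"
    unfolding f_def prodb by (rule cardsum[symmetric]) simp
  have "norm ((\<Sum>t<P ^ (2 * b + 1). \<Prod>j<2 ^ b. complex_of_real (f j (nisan P b t j))) / of_nat (P ^ (2 * b + 1))
      - (\<Prod>j<2 ^ b. (\<Sum>s<P. complex_of_real (f j s)) / of_nat P)) \<le> 2 ^ b / sqrt (real P)"
    by (rule nisan_product[OF P]) (simp add: f_def)
  also have "(\<Sum>t<P ^ (2 * b + 1). \<Prod>j<2 ^ b. complex_of_real (f j (nisan P b t j))) / of_nat (P ^ (2 * b + 1))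
      - (\<Prod>j<2 ^ b. (\<Sum>s<P. complex_of_real (f j s)) / of_nat P)
      = complex_of_real ((\<Sum>t<N. \<Prod>j<2 ^ b. f j (nisan P b t j)) / real N - (\<Prod>j<2 ^ b. avg j))"
    unfolding N_def avg_def
    by (simp only: of_real_diff of_real_divide of_real_sum of_real_prod of_real_of_nat_eq)
  finally have 1: "\<bar>real (card {t \<in> {..<N}. \<forall>j<2 ^ b. R j (nisan P b t j)}) / real N - (\<Prod>j<2 ^ b. avg j)\<bar> \<le> 2 ^ b / sqrt (real P)"
    unfolding lhs norm_of_real .
  have avg: "avg j = real (card {s \<in> {..<P}. R j s}) / real P" for j
    unfolding avg_def f_def by (subst cardsum) simp_all
  have "card {s \<in> {..<P}. R j s} \<le> card {..<P}" for j by (rule card_mono) auto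
  then have "real (card {s \<in> {..<P}. R j s}) \<le> real P" for j by (metis card_lessThan of_nat_mono)
  then have avg01: "0 \<le> avg j \<and> avg j \<le> 1" for j unfolding avg using P0 by simp
  have "\<bar>(\<Prod>j<2 ^ b. avg j) - (\<Prod>j<2 ^ b. perfect_ratio p (m j))\<bar> \<le> real (card {..<2 ^ b :: nat}) * (real (p ^ d) / real P)"
  proof (rule norm_prod_diff_real)
    show "0 \<le> avg i \<and> avg i \<le> 1" for i by (rule avg01)
    show "0 \<le> perfect_ratio p (m i) \<and> perfect_ratio p (m i) \<le> 1" for i
      using perfect_ratio_le[OF p0] by (simp add: perfect_ratio_def)
    show "\<bar>avg i - perfect_ratio p (m i)\<bar> \<le> real (p ^ d) / real P" if "i \<in> {..<2 ^ b}" for i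
      unfolding avg R_def using T[of i] that P0 by (intro perfect_ratio_poly_hash[OF p]) auto
  qed
  then have 2: "\<bar>(\<Prod>j<2 ^ b. avg j) - (\<Prod>j<2 ^ b. perfect_ratio p (m j))\<bar> \<le> 2 ^ b * (real (p ^ d) / real P)" by simp
  show ?thesis using 1 2 unfolding N_def R_def by linarith
qed

text \<open>Group \<open>j\<close> gets the colours below \<open>k\<close> that are congruent to
  \<open>j\<close>, one for each position in the group; thus exactly \<open>k\<close> colours are
  used although the group sizes differ. The seed of the second generator is what remains of
  \<open>t\<close> after division by the number of seeds of the first.\<close>

definition split_hash :: "nat \<Rightarrow> nat \<Rightarrow> nat \<Rightarrow> nat \<Rightarrow> nat \<Rightarrow> nat \<Rightarrow> nat \<Rightarrow> nat \<Rightarrow> nat \<Rightarrow> nat" where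
  "split_hash k lam P1 \<beta> P2 p d t x =
    (let j = nisan P1 \<beta> t x mod 2 ^ lam
     in j + 2 ^ lam * (poly_hash p d (nisan P2 lam (t div P1 ^ (2 * \<beta> + 1)) j) x mod class_size k (2 ^ lam) j))"

lemma class_bound: "j < k \<Longrightarrow> v < class_size k l j \<Longrightarrow> j + l * v < k"
proof -
  assume j: "j < k" and v: "v < class_size k l j"
  have "l * v \<le> l * ((k - 1 - j) div l)" using v by (intro mult_le_mono2) (simp add: class_size_def)
  also have "\<dots> \<le> k - 1 - j" by (rule times_div_less_eq_dividend)
  finally show ?thesis using j by linarith
qed

lemma split_hash_less: "2 ^ lam \<le> k \<Longrightarrow> split_hash k lam P1 \<beta> P2 p d t x < k"
  unfolding split_hash_def Let_def
  by (rule class_bound) (auto simp: class_size_def intro: less_le_trans[OF mod_less_divisor])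

text \<open>An injection of \<open>k\<close> points into {..<k} is a bijection, so the residues of
  the colours modulo \<open>l\<close> form the multiset \<open>residues_mset l k\<close>.
  Conversely, the residue of a colour reveals the group, so injectivity inside the groups
  suffices.\<close>

lemma inj_split_iff:
  assumes l: "0 < l" "l \<le> k" and S: "finite S" "card S = k"
    and \<phi>: "\<And>x. \<phi> x < l" and g: "\<And>j x. g j x < class_size k l j"
  shows "inj_on (\<lambda>x. \<phi> x + l * g (\<phi> x) x) S \<longleftrightarrow>
    image_mset \<phi> (mset_set S) = residues_mset l k \<and> (\<forall>j<l. inj_on (g j) {x \<in> S. \<phi> x = j})"
proof -
  define f where "f x = \<phi> x + l * g (\<phi> x) x" for x
  have fm: "f x mod l = \<phi> x" for x unfolding f_def using \<phi>[of x] by simp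
  have fk: "f x < k" for x
    unfolding f_def using \<phi>[of x] l g by (intro class_bound) auto
  have "image_mset \<phi> (mset_set S) = residues_mset l k" if inj: "inj_on f S"
  proof -
    have "f ` S = {..<k}" using fk inj S by (intro card_subset_eq) (auto simp: card_image)
    then have "image_mset f (mset_set S) = mset_set {..<k}"
      using image_mset_mset_set[OF inj] by simp
    then have "image_mset (\<lambda>c. c mod l) (image_mset f (mset_set S)) = residues_mset l k"
      unfolding residues_mset_def by simp
    then show ?thesis by (simp add: image_mset.compositionality o_def fm)
  qed
  moreover have "inj_on (g j) {x \<in> S. \<phi> x = j}" if inj: "inj_on f S" for j
  proof (rule inj_onI)
    fix x y assume "x \<in> {x \<in> S. \<phi> x = j}" "y \<in> {x \<in> S. \<phi> x = j}" "g j x = g j y"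
    then have "x \<in> S" "y \<in> S" "f x = f y" by (auto simp: f_def)
    then show "x = y" using inj by (auto dest: inj_onD)
  qed
  moreover have "inj_on f S" if inj: "\<forall>j<l. inj_on (g j) {x \<in> S. \<phi> x = j}"
  proof (rule inj_onI)
    fix x y assume xy: "x \<in> S" "y \<in> S" "f x = f y"
    have e: "\<phi> x = \<phi> y" using fm[of x] fm[of y] xy(3) by simp
    then have "g (\<phi> x) x = g (\<phi> x) y" using xy(3) l by (simp add: f_def)
    moreover have "inj_on (g (\<phi> x)) {z \<in> S. \<phi> z = \<phi> x}" using inj \<phi>[of x] by blast
    ultimately show "x = y" using xy e by (auto dest: inj_onD)
  qed
  ultimately show ?thesis unfolding f_def by blast
qed

text \<open>Whichever even split occurs, the group sizes are the same, so the second seed succeeds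
  with the same probability \<open>C2\<close> up to the relative error \<open>x\<close>. Together
  with the error \<open>x\<close> of the split itself this gives 3x, half of what
  \<open>6 * x \<le> \<eta>\<close> allows.\<close>

lemma inj_balanced_split_hash:
  assumes P1: "prime P1" and P2: "prime P2" and p: "prime p" "u \<le> p"
    and k: "2 ^ lam \<le> k" and d: "\<And>j. j < 2 ^ lam \<Longrightarrow> class_size k (2 ^ lam) j \<le> d"
    and c1: "c1 > 0" and split: "\<And>S. S \<subseteq> {..<u} \<Longrightarrow> card S = k \<Longrightarrow>
      \<bar>real (card {t \<in> {..<P1 ^ (2 * \<beta> + 1)}. image_mset (\<lambda>x. nisan P1 \<beta> t x mod 2 ^ lam) (mset_set S) = residues_mset (2 ^ lam) k})
         / real (P1 ^ (2 * \<beta> + 1)) - c1\<bar> \<le> x * c1"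
    and group: "2 ^ lam / sqrt (real P2) + 2 ^ lam * (real (p ^ d) / real P2)
      \<le> x * (\<Prod>j<2 ^ lam. perfect_ratio p (class_size k (2 ^ lam) j))"
    and c2: "0 < (\<Prod>j<2 ^ lam. perfect_ratio p (class_size k (2 ^ lam) j))"
    and x: "0 \<le> x" "6 * x \<le> \<eta>" "\<eta> \<le> 1"
  shows "inj_balanced \<eta> k u {..<P1 ^ (2 * \<beta> + 1) * P2 ^ (2 * lam + 1)} (split_hash k lam P1 \<beta> P2 p d)"
proof -
  define l :: nat where "l = 2 ^ lam"
  define N1 where "N1 = P1 ^ (2 * \<beta> + 1)"
  define N2 where "N2 = P2 ^ (2 * lam + 1)"
  define C2 where "C2 = (\<Prod>j<2 ^ lam. perfect_ratio p (class_size k (2 ^ lam) j))"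
  have l: "0 < l" "l \<le> k" using k unfolding l_def by auto
  have P10: "P1 > 0" and P20: "P2 > 0" using P1 P2 prime_gt_0_nat by blast+
  have N: "N1 > 0" "N2 > 0" unfolding N1_def N2_def using P10 P20 by simp_all
  show ?thesis
  proof (rule inj_balancedI[where c = "c1 * C2"])
    show "finite {..<P1 ^ (2 * \<beta> + 1) * P2 ^ (2 * lam + 1)}" by simp
    show "{..<P1 ^ (2 * \<beta> + 1) * P2 ^ (2 * lam + 1)} \<noteq> {}"
      using N unfolding N1_def[symmetric] N2_def[symmetric] by (auto simp: lessThan_empty_iff)
    show "c1 * C2 > 0" using c1 c2 unfolding C2_def by simp
    show "0 \<le> \<eta>" "\<eta> \<le> 1" using x by auto
    fix S assume S: "S \<subseteq> {..<u}" "card S = k"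
    have fS: "finite S" using S(1) finite_subset by blast
    define \<phi> where "\<phi> t y = nisan P1 \<beta> t y mod l" for t y
    define sp where "sp t \<longleftrightarrow> image_mset (\<phi> t) (mset_set S) = residues_mset l k" for t
    define pf where "pf t t2 \<longleftrightarrow> (\<forall>j<l. inj_on (\<lambda>y. poly_hash p d (nisan P2 lam t2 j) y mod class_size k l j) {y \<in> S. \<phi> t y = j})" for t t2
    have \<phi>mod: "\<phi> (t mod N1) = \<phi> t" for t unfolding \<phi>_def N1_def by (simp only: nisan_mod[OF P10])
    have inj_iff: "inj_on (split_hash k lam P1 \<beta> P2 p d t) S \<longleftrightarrow> sp (t mod N1) \<and> pf (t mod N1) (t div N1)" for t
    proof -
      have "split_hash k lam P1 \<beta> P2 p d t = (\<lambda>y. \<phi> t y + l * (poly_hash p d (nisan P2 lam (t div N1) (\<phi> t y)) y mod class_size k l (\<phi> t y)))"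
        unfolding split_hash_def Let_def \<phi>_def N1_def l_def ..
      then show ?thesis unfolding sp_def pf_def \<phi>mod
        using inj_split_iff[OF l fS S(2), of "\<phi> t" "\<lambda>j y. poly_hash p d (nisan P2 lam (t div N1) j) y mod class_size k l j"] l
        by (simp add: \<phi>_def class_size_def)
    qed
    have cardsum: "real (card {t \<in> {..<n}. Q t}) = (\<Sum>t<n. of_bool (Q t))" for n :: nat and Q
      by (simp add: sum_of_bool_eq Collect_conj_eq del: lessThan_iff)
    define E where "E t = real (card {t2 \<in> {..<N2}. pf t t2}) / real N2" for t
    define q where "q = real (card {t \<in> {..<N1}. sp t}) / real N1"
    define r where "r = real (card {t \<in> {..<N1 * N2}. inj_on (split_hash k lam P1 \<beta> P2 p d t) S}) / real (N1 * N2)"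
    have q: "\<bar>q - c1\<bar> \<le> x * c1"
      using split[OF S] unfolding q_def sp_def \<phi>_def N1_def l_def .
    have E: "\<bar>E t - C2\<bar> \<le> x * C2" if t: "sp t" for t
    proof -
      define T where "T j = {y \<in> S. \<phi> t y = j}" for j
      have "T j \<subseteq> {..<p} \<and> card (T j) = class_size k (2 ^ lam) j \<and> class_size k (2 ^ lam) j \<le> d" if "j < 2 ^ lam" for j
      proof (intro conjI d that)
        show "T j \<subseteq> {..<p}" using S(1) p(2) unfolding T_def by auto
        have "card (T j) = count (image_mset (\<phi> t) (mset_set S)) j"
          unfolding T_def using fS by (subst count_image_mset) (auto simp: vimage_def Int_def intro: arg_cong[where f = card])
        also have "\<dots> = card {c \<in> {..<k}. c mod l = j}" using t unfolding sp_def by (simp add: count_residues_mset)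
        also have "\<dots> = class_size k l j" using that l unfolding l_def by (intro card_residue_class) auto
        finally show "card (T j) = class_size k (2 ^ lam) j" unfolding l_def .
      qed
      then have "\<bar>real (card {t \<in> {..<P2 ^ (2 * lam + 1)}. \<forall>j<2 ^ lam. inj_on (\<lambda>x. poly_hash p d (nisan P2 lam t j) x mod class_size k (2 ^ lam) j) (T j)}) / real (P2 ^ (2 * lam + 1))
          - (\<Prod>j<2 ^ lam. perfect_ratio p (class_size k (2 ^ lam) j))\<bar> \<le> 2 ^ lam / sqrt (real P2) + 2 ^ lam * (real (p ^ d) / real P2)"
        by (rule nisan_perfect[OF P2 p(1)])
      then show ?thesis using group unfolding E_def pf_def N2_def l_def T_def C2_def by linarith
    qed
    have "real (card {t \<in> {..<N1 * N2}. inj_on (split_hash k lam P1 \<beta> P2 p d t) S})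
        = (\<Sum>t<N1 * N2. of_bool (sp (t mod N1) \<and> pf (t mod N1) (t div N1)))"
      unfolding cardsum inj_iff ..
    also have "\<dots> = (\<Sum>t<N1. \<Sum>t2<N2. of_bool (sp t \<and> pf t t2))"
      using sum_nat_product[OF N(1), of "\<lambda>t t2. of_bool (sp t \<and> pf t t2) :: real" N2] .
    also have "\<dots> = (\<Sum>t<N1. of_bool (sp t) * (real N2 * E t))"
    proof (rule sum.cong[OF refl])
      fix t
      show "(\<Sum>t2<N2. of_bool (sp t \<and> pf t t2)) = of_bool (sp t) * (real N2 * E t)"
        unfolding E_def cardsum using N by (cases "sp t") simp_all
    qed
    finally have r: "r = (\<Sum>t<N1. of_bool (sp t) * E t) / real N1"
      unfolding r_def using N by (simp add: sum_distrib_left[symmetric] mult.left_commute)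
    have "r - q * C2 = (\<Sum>t<N1. of_bool (sp t) * (E t - C2)) / real N1"
      unfolding r q_def cardsum by (simp add: right_diff_distrib sum_subtractf sum_distrib_right diff_divide_distrib)
    also have "\<bar>\<dots>\<bar> \<le> (\<Sum>t<N1. of_bool (sp t) * (x * C2)) / real N1"
    proof -
      have "\<bar>\<Sum>t<N1. of_bool (sp t) * (E t - C2)\<bar> \<le> (\<Sum>t<N1. \<bar>of_bool (sp t) * (E t - C2)\<bar>)" by (rule sum_abs)
      also have "\<dots> \<le> (\<Sum>t<N1. of_bool (sp t) * (x * C2))"
        by (rule sum_mono) (use E in \<open>auto simp: abs_mult\<close>)
      finally show ?thesis using N by (simp add: abs_divide divide_right_mono)
    qed
    also have "\<dots> = q * (x * C2)" unfolding q_def cardsum by (simp add: sum_distrib_right)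
    finally have rq: "\<bar>r - q * C2\<bar> \<le> q * (x * C2)" .
    have C2: "C2 > 0" using c2 unfolding C2_def .
    have "q \<le> 2 * c1"
    proof -
      have "x * c1 \<le> 1 * c1" using x c1 by (intro mult_right_mono) auto
      then show ?thesis using q by linarith
    qed
    then have "q * (x * C2) \<le> 2 * c1 * (x * C2)" using x C2 by (intro mult_right_mono) auto
    moreover have "\<bar>q * C2 - c1 * C2\<bar> \<le> x * c1 * C2"
    proof -
      have "\<bar>q * C2 - c1 * C2\<bar> = \<bar>q - c1\<bar> * C2" using C2 by (simp add: left_diff_distrib[symmetric] abs_mult)
      also have "\<dots> \<le> x * c1 * C2" using q C2 by (intro mult_right_mono) auto
      finally show ?thesis .
    qed
    ultimately have "\<bar>r - c1 * C2\<bar> \<le> 3 * x * (c1 * C2)" using rq by (simp add: mult_ac)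
    also have "\<dots> \<le> \<eta> / 2 * (c1 * C2)" using x c1 C2 by (intro mult_right_mono) auto
    finally show "\<bar>real (card {i \<in> {..<P1 ^ (2 * \<beta> + 1) * P2 ^ (2 * lam + 1)}. inj_on (split_hash k lam P1 \<beta> P2 p d i) S})
        / real (card {..<P1 ^ (2 * \<beta> + 1) * P2 ^ (2 * lam + 1)}) - c1 * C2\<bar> \<le> \<eta> / 2 * (c1 * C2)"
      unfolding r_def N1_def N2_def card_lessThan .
  qed
qed

section \<open>Reducing the universe to a few bits\<close>

lemma prod_primes_dvd:
  fixes A :: "nat set"
  assumes "finite A" "\<And>p. p \<in> A \<Longrightarrow> prime p" "\<And>p. p \<in> A \<Longrightarrow> p dvd D"
  shows "\<Prod>A dvd D"
  using assms
proof (induction A rule: finite_induct)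
  case (insert p A)
  have "coprime p (\<Prod>A)"
  proof (rule prod_coprime_right)
    fix r assume "r \<in> A"
    then show "coprime p r" using insert by (intro primes_coprime) auto
  qed
  then show ?case using insert by (simp add: divides_mult)
qed simp

text \<open>Applied to a difference of two points: only few moduli fail to separate them, since the
  product of these moduli divides the difference.\<close>

lemma card_prime_divisors_le:
  fixes A :: "nat set"
  assumes A: "finite A" "\<And>p. p \<in> A \<Longrightarrow> prime p \<and> p dvd D \<and> 2 ^ g \<le> p" and D: "D > 0" "D < 2 ^ \<nu>"
  shows "g * card A \<le> \<nu>"
proof -
  have "(2 ^ g) ^ card A = (\<Prod>p\<in>A. 2 ^ g :: nat)" by simp
  also have "\<dots> \<le> \<Prod>A" by (rule prod_mono) (use A in auto)
  also have "\<dots> \<le> D" using D A by (intro dvd_imp_le prod_primes_dvd) auto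
  also have "\<dots> < 2 ^ \<nu>" by (rule D)
  finally have "(2::nat) ^ (g * card A) < 2 ^ \<nu>" by (simp add: power_mult)
  then show ?thesis by simp
qed

definition collisions :: "nat \<Rightarrow> nat \<Rightarrow> (nat \<Rightarrow> nat) \<Rightarrow> nat set \<Rightarrow> nat \<Rightarrow> nat \<Rightarrow> nat set" where
  "collisions p q a I v v' = {i \<in> I. poly_hash p 2 (a i) v mod q = poly_hash p 2 (a i) v' mod q}"

text \<open>The pessimistic estimator for the method of conditional expectations. It is an
  exponential moment, so a bound on the sum bounds the number of collisions of every single
  pair.\<close>

definition potential :: "nat \<Rightarrow> nat \<Rightarrow> (nat \<Rightarrow> nat) \<Rightarrow> nat set \<Rightarrow> nat \<Rightarrow> nat" where
  "potential p q a I M = (\<Sum>v<M. \<Sum>v'<v. 2 ^ card (collisions p q a I v v'))"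

lemma card_collision_pair:
  assumes p: "prime p" and q: "q > 0" "q \<le> p" and v: "v < p" "v' < p" "v \<noteq> v'"
  shows "q * card {s \<in> {..<p ^ 2}. poly_hash p 2 s v mod q = poly_hash p 2 s v' mod q} \<le> 2 * p ^ 2"
proof -
  have p0: "p > 0" using p prime_gt_0_nat by blast
  define e where "e i = (if i = 1 then v else v')" for i :: nat
  have e: "inj_on e {..<2}" "e ` {..<2} \<subseteq> {..<p}" using v by (auto simp: e_def inj_on_def less_2_cases_iff)
  have "prob {..<p ^ 2} (\<lambda>s. collides [(1, 0)] (\<lambda>i. poly_hash p 2 s (e i) mod q)) \<le> (2 / real q) ^ length [(1::nat, 0::nat)]"
    by (rule prob_collides_poly_hash(2)[OF p q e]) auto
  then have "real (card {s \<in> {..<p ^ 2}. poly_hash p 2 s v mod q = poly_hash p 2 s v' mod q}) / real (p ^ 2) \<le> 2 / real q"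
    by (simp add: prob_card collides_def e_def del: lessThan_iff)
  then have "real (q * card {s \<in> {..<p ^ 2}. poly_hash p 2 s v mod q = poly_hash p 2 s v' mod q}) \<le> real (2 * p ^ 2)"
    using p0 q by (simp add: divide_le_eq le_divide_eq mult.commute del: lessThan_iff)
  then show ?thesis by (simp only: of_nat_le_iff)
qed

lemma collisions_insert:
  assumes "finite I" "i \<notin> I"
  shows "2 ^ card (collisions p q (a(i := s)) (insert i I) v v') =
    2 ^ card (collisions p q a I v v') * (1 + of_bool (poly_hash p 2 s v mod q = poly_hash p 2 s v' mod q) :: nat)"
proof -
  define C where "C = collisions p q a I v v'"
  have "finite C" "i \<notin> C" using assms unfolding C_def collisions_def by auto
  moreover have "collisions p q (a(i := s)) (insert i I) v v' = (if poly_hash p 2 s v mod q = poly_hash p 2 s v' mod q then insert i C else C)"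
    using assms(2) unfolding C_def collisions_def by auto
  ultimately show ?thesis unfolding C_def[symmetric] by simp
qed

text \<open>A random polynomial makes a given pair collide with probability at most 2/q. Averaged
  over \<open>s\<close>, each summand grows by a factor of at most 1 + 2/q, and some
  \<open>s\<close> is no worse than the average.\<close>

lemma greedy_step:
  assumes p: "prime p" and q: "q > 0" "q \<le> p" and M: "M \<le> p" and I: "finite I" "i \<notin> I"
  shows "\<exists>s<p ^ 2. q * potential p q (a(i := s)) (insert i I) M \<le> (q + 2) * potential p q a I M"
proof (rule ccontr)
  assume "\<not> ?thesis"
  then have gt: "(q + 2) * potential p q a I M < q * potential p q (a(i := s)) (insert i I) M" if "s < p ^ 2" for s
    using that by (meson not_le)
  have p0: "p > 0" using p prime_gt_0_nat by blast
  define w where "w v v' = (2 ^ card (collisions p q a I v v') :: nat)" for v v'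
  define b where "b v v' s = (of_bool (poly_hash p 2 s v mod q = poly_hash p 2 s v' mod q) :: nat)" for v v' s
  have cnt: "q * (\<Sum>s<p ^ 2. b v v' s) \<le> 2 * p ^ 2" if "v' < v" "v < M" for v v'
    using card_collision_pair[OF p q, of v v'] that M unfolding b_def
    by (simp add: sum_of_bool_eq Collect_conj_eq del: lessThan_iff)
  have "(\<Sum>s<p ^ 2. q * potential p q (a(i := s)) (insert i I) M)
      = (\<Sum>s<p ^ 2. \<Sum>v<M. \<Sum>v'<v. q * (w v v' * (1 + b v v' s)))"
    unfolding potential_def collisions_insert[OF I] w_def b_def by (simp only: sum_distrib_left)
  also have "\<dots> = (\<Sum>v<M. \<Sum>v'<v. \<Sum>s<p ^ 2. q * (w v v' * (1 + b v v' s)))"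
    by (rule trans[OF sum.swap sum.cong[OF refl sum.swap]])
  also have "\<dots> \<le> (\<Sum>v<M. \<Sum>v'<v. w v v' * ((q + 2) * p ^ 2))"
  proof (intro sum_mono)
    fix v v' assume v: "v \<in> {..<M}" "v' \<in> {..<v}"
    have "(\<Sum>s<p ^ 2. q * (w v v' * (1 + b v v' s))) = w v v' * (q * p ^ 2 + q * (\<Sum>s<p ^ 2. b v v' s))"
      by (simp add: sum_distrib_left sum.distrib algebra_simps)
    also have "\<dots> \<le> w v v' * (q * p ^ 2 + 2 * p ^ 2)"
      using cnt[of v' v] v by (intro mult_le_mono2 add_left_mono) auto
    finally show "(\<Sum>s<p ^ 2. q * (w v v' * (1 + b v v' s))) \<le> w v v' * ((q + 2) * p ^ 2)" by (simp only: distrib_right)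
  qed
  also have "\<dots> = p ^ 2 * ((q + 2) * potential p q a I M)"
    unfolding potential_def w_def by (simp only: sum_distrib_left sum_distrib_right mult_ac)
  finally have "(\<Sum>s<p ^ 2. q * potential p q (a(i := s)) (insert i I) M) \<le> (\<Sum>s<p ^ 2. (q + 2) * potential p q a I M)" by simp
  moreover have "(\<Sum>s<p ^ 2. (q + 2) * potential p q a I M) < (\<Sum>s<p ^ 2. q * potential p q (a(i := s)) (insert i I) M)"
    using p0 gt by (intro sum_strict_mono) (auto simp: lessThan_empty_iff)
  ultimately show False by simp
qed

text \<open>After \<open>q * G\<close> greedy steps the potential is at most M^2 exp (2G), hence at
  most 2^(2G) * 4^(2G); this is the exponent 6G. A single pair with c collisions already contributes
  2^c.\<close>

lemma collisions_le_of_potential: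
  assumes q: "q > 0" and L: "L = q * G" and M: "M = 2 ^ G"
    and pot: "real (potential p q a I M) \<le> real (M ^ 2) * (1 + 2 / real q) ^ L"
    and v: "v' < v" "v < M"
  shows "card (collisions p q a I v v') \<le> 6 * G"
proof -
  have "2 ^ card (collisions p q a I v v') \<le> (\<Sum>v'<v. 2 ^ card (collisions p q a I v v') :: nat)"
    by (rule member_le_sum) (use v in auto)
  also have "\<dots> \<le> potential p q a I M"
    unfolding potential_def by (rule member_le_sum[of v]) (use v in auto)
  finally have "real (2 ^ card (collisions p q a I v v')) \<le> real (potential p q a I M)" by (rule of_nat_mono)
  also have "\<dots> \<le> real (M ^ 2) * (1 + 2 / real q) ^ L" by (rule pot)
  also have "\<dots> \<le> real (M ^ 2) * exp (2 / real q) ^ L"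
    by (intro mult_left_mono power_mono) (auto simp: add.commute intro: exp_ge_add_one_self)
  also have "\<dots> \<le> real (M ^ 2) * 4 ^ (2 * G)"
  proof (rule mult_left_mono)
    have "exp (2 / real q) ^ L = exp 1 ^ (2 * G)"
      using q unfolding L by (simp flip: exp_of_nat_mult)
    also have "\<dots> \<le> 4 ^ (2 * G)" using exp_le by (intro power_mono) (linarith, simp)
    finally show "exp (2 / real q) ^ L \<le> 4 ^ (2 * G)" .
  qed simp
  also have "real (M ^ 2) * 4 ^ (2 * G) = 2 ^ (6 * G)"
    unfolding M by (simp add: power_mult power2_eq_square power_mult_distrib[symmetric])
  finally have "(2::real) ^ card (collisions p q a I v v') \<le> 2 ^ (6 * G)" by simp
  then show ?thesis by (subst (asm) power_increasing_iff) auto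
qed

text \<open>A pair collides either because the modulus divides the difference, which happens for at
  most \<open>\<nu> div g\<close> of the moduli, or because the polynomial identifies the two
  residues, which happens for at most \<open>6 * G\<close> of the \<open>2 ^ t * G\<close> entries.
  Both lengths are chosen so that these fractions are at most 1/2^t and 6/2^t. A union bound over at
  most k^2 pairs finishes the proof.\<close>

lemma inj_balanced_residue_code:
  assumes P: "finite Ps" "card Ps = 2 ^ t * (\<nu> div g + 1)" "\<And>c. c \<in> Ps \<Longrightarrow> prime c \<and> 2 ^ g \<le> c \<and> c \<le> 2 ^ G"
    and g: "g > 0" and n: "n \<le> 2 ^ \<nu>" and G: "G > 0"
    and good: "\<And>v v'. v' < v \<Longrightarrow> v < 2 ^ G \<Longrightarrow> card (collisions p (2 ^ t) a {1..2 ^ t * G} v v') \<le> 6 * G"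
    and k: "k < 2 ^ \<kappa>" and t: "2 * \<kappa> + h + 4 \<le> t"
  shows "inj_balanced (1 / 2 ^ h) k n (Ps \<times> {1..2 ^ t * G}) (\<lambda>(c, i) x. poly_hash p 2 (a i) (x mod c) mod 2 ^ t)"
proof -
  define L where "L = 2 ^ t * G"
  define R where "R = card Ps"
  define f where "f = (\<lambda>(c, i) x. poly_hash p 2 (a i) (x mod c) mod 2 ^ t)"
  define I where "I = Ps \<times> {1..L}"
  have fI: "finite I" unfolding I_def using P by simp
  have cI: "card I = R * L" unfolding I_def R_def by (simp add: card_cartesian_product)
  have R: "R > 0" unfolding R_def using P(2) by simp
  have L: "L > 0" unfolding L_def using G by simp
  have pair: "2 ^ t * card {ci \<in> I. f ci x = f ci y} \<le> 7 * (R * L)" if xy: "y < x" "x < n" for x y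
  proof -
    define B where "B = {c \<in> Ps. x mod c = y mod c}"
    have "g * card B \<le> \<nu>"
    proof (rule card_prime_divisors_le)
      show "finite B" unfolding B_def using P(1) by simp
      show "x - y > 0" "x - y < 2 ^ \<nu>" using xy n by auto
      show "prime c \<and> c dvd x - y \<and> 2 ^ g \<le> c" if "c \<in> B" for c
        using that P(3)[of c] xy unfolding B_def by (auto simp: mod_eq_dvd_iff_nat)
    qed
    then have "card B \<le> \<nu> div g" using g by (simp add: less_eq_div_iff_mult_less_eq mult.commute)
    then have B: "2 ^ t * card B \<le> R" unfolding R_def P(2) by (intro mult_le_mono2) simp
    have "{ci \<in> I. f ci x = f ci y} \<subseteq> B \<times> {1..L} \<union> (\<Union>c\<in>Ps - B. {c} \<times> {i \<in> {1..L}. f (c, i) x = f (c, i) y})"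
      unfolding I_def B_def by auto
    then have "card {ci \<in> I. f ci x = f ci y} \<le> card (B \<times> {1..L} \<union> (\<Union>c\<in>Ps - B. {c} \<times> {i \<in> {1..L}. f (c, i) x = f (c, i) y}))"
      using P(1) by (intro card_mono) (auto simp: B_def)
    also have "\<dots> \<le> card (B \<times> {1..L}) + card (\<Union>c\<in>Ps - B. {c} \<times> {i \<in> {1..L}. f (c, i) x = f (c, i) y})"
      by (rule card_Un_le)
    also have "card (\<Union>c\<in>Ps - B. {c} \<times> {i \<in> {1..L}. f (c, i) x = f (c, i) y})
        \<le> (\<Sum>c\<in>Ps - B. card ({c} \<times> {i \<in> {1..L}. f (c, i) x = f (c, i) y}))"
      using P(1) by (intro card_UN_le) simp
    also have "\<dots> \<le> (\<Sum>c\<in>Ps - B. 6 * G)"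
    proof (rule sum_mono)
      fix c assume c: "c \<in> Ps - B"
      define v v' where "v = x mod c" and "v' = y mod c"
      have c0: "c > 0" using P(3)[of c] c prime_gt_0_nat by blast
      have "v < c" "v' < c" unfolding v_def v'_def using c0 by auto
      then have vG: "v < 2 ^ G" "v' < 2 ^ G" using P(3)[of c] c by auto
      have ne: "v \<noteq> v'" using c unfolding B_def v_def v'_def by auto
      have e: "{i \<in> {1..L}. f (c, i) x = f (c, i) y} = collisions p (2 ^ t) a {1..L} v v'"
        "{i \<in> {1..L}. f (c, i) x = f (c, i) y} = collisions p (2 ^ t) a {1..L} v' v"
        unfolding f_def collisions_def v_def v'_def by auto
      have "card {i \<in> {1..L}. f (c, i) x = f (c, i) y} \<le> 6 * G"
      proof (cases "v' < v")
        case True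
        then show ?thesis unfolding e(1) unfolding L_def using vG by (intro good)
      next
        case False
        then show ?thesis unfolding e(2) unfolding L_def using vG ne by (intro good) auto
      qed
      then show "card ({c} \<times> {i \<in> {1..L}. f (c, i) x = f (c, i) y}) \<le> 6 * G" by (simp add: card_cartesian_product)
    qed
    also have "\<dots> = card (Ps - B) * (6 * G)" by simp
    also have "\<dots> \<le> R * (6 * G)" unfolding R_def using P(1) by (intro mult_le_mono1 card_mono) auto
    finally have "card {ci \<in> I. f ci x = f ci y} \<le> card B * L + R * (6 * G)" by (simp add: card_cartesian_product)
    then have "2 ^ t * card {ci \<in> I. f ci x = f ci y} \<le> 2 ^ t * (card B * L + R * (6 * G))" by (rule mult_le_mono2)
    also have "\<dots> = (2 ^ t * card B) * L + 6 * (R * L)" unfolding L_def by (simp add: algebra_simps)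
    also have "\<dots> \<le> R * L + 6 * (R * L)" using B by (intro add_right_mono mult_le_mono1)
    finally show ?thesis by (simp add: mult_ac)
  qed
  have "inj_balanced (1 / 2 ^ h) k n I f"
  proof (rule inj_balancedI[where c = 1])
    show "finite I" by (rule fI)
    show "I \<noteq> {}" using cI R L by (metis card.empty mult_is_0 neq0_conv)
    fix S assume S: "S \<subseteq> {..<n}" "card S = k"
    have fS: "finite S" using S(1) finite_subset by blast
    define Bad where "Bad = {ci \<in> I. \<not> inj_on (f ci) S}"
    define D where "D = {xy \<in> S \<times> S. snd xy < fst xy}"
    have D: "finite D" "card D \<le> k\<^sup>2"
    proof -
      show "finite D" unfolding D_def using fS by simp
      have "card D \<le> card (S \<times> S)" unfolding D_def using fS by (intro card_mono) auto
      then show "card D \<le> k\<^sup>2" using S(2) by (simp add: card_cartesian_product power2_eq_square)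
    qed
    have "Bad \<subseteq> (\<Union>xy\<in>D. {ci \<in> I. f ci (fst xy) = f ci (snd xy)})"
    proof
      fix ci assume ci: "ci \<in> Bad"
      then obtain x y where xy: "x \<in> S" "y \<in> S" "f ci x = f ci y" "x \<noteq> y" unfolding Bad_def inj_on_def by auto
      have "(max x y, min x y) \<in> D" using xy unfolding D_def by (auto simp: max_def min_def)
      moreover have "f ci (max x y) = f ci (min x y)" using xy by (auto simp: max_def min_def)
      ultimately show "ci \<in> (\<Union>xy\<in>D. {ci \<in> I. f ci (fst xy) = f ci (snd xy)})" using ci unfolding Bad_def by force
    qed
    then have "card Bad \<le> card (\<Union>xy\<in>D. {ci \<in> I. f ci (fst xy) = f ci (snd xy)})"
      using fI D by (intro card_mono) auto
    also have "\<dots> \<le> (\<Sum>xy\<in>D. card {ci \<in> I. f ci (fst xy) = f ci (snd xy)})" using D by (intro card_UN_le)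
    finally have "2 ^ t * card Bad \<le> 2 ^ t * (\<Sum>xy\<in>D. card {ci \<in> I. f ci (fst xy) = f ci (snd xy)})" by (rule mult_le_mono2)
    also have "\<dots> = (\<Sum>xy\<in>D. 2 ^ t * card {ci \<in> I. f ci (fst xy) = f ci (snd xy)})" by (simp add: sum_distrib_left)
    also have "\<dots> \<le> (\<Sum>xy\<in>D. 7 * (R * L))"
      by (intro sum_mono pair) (use S in \<open>auto simp: D_def\<close>)
    also have "\<dots> \<le> k\<^sup>2 * (7 * (R * L))" using D by (simp add: mult_le_mono1)
    finally have bad: "2 ^ t * card Bad \<le> k\<^sup>2 * (7 * (R * L))" .
    have "k\<^sup>2 \<le> (2 ^ \<kappa>)\<^sup>2" using k by (intro power_mono) auto
    then have "k\<^sup>2 * 7 \<le> (2 ^ \<kappa>)\<^sup>2 * 8" by (intro mult_le_mono) auto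
    also have "\<dots> = 2 ^ (2 * \<kappa> + 3)" by (simp add: power_add power_mult[symmetric] mult.commute)
    finally have "2 ^ (h + 1) * (k\<^sup>2 * 7) \<le> 2 ^ (h + 1) * 2 ^ (2 * \<kappa> + 3)" by (rule mult_le_mono2)
    \<comment> \<open>Origin of the 4: the factor 7 is rounded up to 2^3, and one more factor 2 is
      due to the half in \<open>inj_balancedI\<close>.\<close>
    also have "\<dots> = 2 ^ (2 * \<kappa> + h + 4)"
      unfolding power_add[symmetric] by (rule arg_cong[where f = "\<lambda>x. 2 ^ x"]) simp
    also have "\<dots> \<le> 2 ^ t" using t by (intro power_increasing) auto
    finally have kt: "2 ^ (h + 1) * (k\<^sup>2 * 7) \<le> (2::nat) ^ t" .
    have "2 ^ t * (2 ^ (h + 1) * card Bad) \<le> 2 ^ (h + 1) * (k\<^sup>2 * (7 * (R * L)))"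
      using mult_le_mono2[OF bad, of "2 ^ (h + 1)"] by (simp only: mult.left_commute)
    also have "\<dots> = (2 ^ (h + 1) * (k\<^sup>2 * 7)) * (R * L)" by (simp only: mult.assoc)
    also have "\<dots> \<le> 2 ^ t * (R * L)" by (rule mult_le_mono1[OF kt])
    finally have "2 ^ (h + 1) * card Bad \<le> R * L" by simp
    then have "real (2 ^ (h + 1) * card Bad) \<le> real (R * L)" by (rule of_nat_mono)
    then have rb: "real (card Bad) / real (R * L) \<le> 1 / 2 ^ h / 2"
      using R L by (simp add: field_simps)
    have "card I = card {ci \<in> I. inj_on (f ci) S} + card Bad"
      unfolding Bad_def using fI by (subst card_Un_disjoint[symmetric]) (auto intro: arg_cong[where f = card])
    then have "real (card {ci \<in> I. inj_on (f ci) S}) = real (R * L) - real (card Bad)" unfolding cI by simp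
    then have "real (card {ci \<in> I. inj_on (f ci) S}) / real (card I) - 1 = - (real (card Bad) / real (R * L))"
      unfolding cI using R L by (simp add: diff_divide_distrib)
    then show "\<bar>real (card {i \<in> I. inj_on (f i) S}) / real (card I) - 1\<bar> \<le> 1 / 2 ^ h / 2 * 1"
      using rb by simp
  qed auto
  then show ?thesis unfolding I_def f_def L_def .
qed

section \<open>The colouring of a short universe\<close>

lemma inj_balanced_mono_universe:
  "inj_balanced \<eta> k u I f \<Longrightarrow> u' \<le> u \<Longrightarrow> inj_balanced \<eta> k u' I f"
  unfolding inj_balanced_def by (meson lessThan_subset_iff order_trans)

text \<open>A good first index maps \<open>S\<close> to another \<open>k\<close>-set, for which the
  second stage has nearly the same number of good indices. The reference numbers multiply and the
  exponents add.\<close>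

lemma inj_balanced_compose:
  fixes f :: "'i \<Rightarrow> nat \<Rightarrow> nat" and g :: "'j \<Rightarrow> nat \<Rightarrow> nat"
  assumes f: "inj_balanced \<eta>1 k u I f" and g: "inj_balanced \<eta>2 k u' J g"
    and maps: "\<And>i x. i \<in> I \<Longrightarrow> x < u \<Longrightarrow> f i x < u'"
  shows "inj_balanced (\<eta>1 + \<eta>2) k u (I \<times> J) (\<lambda>(i, j) x. g j (f i x))"
proof -
  obtain T1 where T1: "finite I" "T1 > 0" and b1: "\<And>S. S \<subseteq> {..<u} \<and> card S = k \<Longrightarrow>
     T1 * exp (- \<eta>1) \<le> real (card {i \<in> I. inj_on (f i) S}) \<and> real (card {i \<in> I. inj_on (f i) S}) \<le> T1 * exp \<eta>1"
    using f unfolding inj_balanced_def by blast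
  obtain T2 where T2: "finite J" "T2 > 0" and b2: "\<And>S. S \<subseteq> {..<u'} \<and> card S = k \<Longrightarrow>
     T2 * exp (- \<eta>2) \<le> real (card {i \<in> J. inj_on (g i) S}) \<and> real (card {i \<in> J. inj_on (g i) S}) \<le> T2 * exp \<eta>2"
    using g unfolding inj_balanced_def by blast
  have main: "T1 * T2 * exp (- (\<eta>1 + \<eta>2)) \<le> real (card {ij \<in> I \<times> J. inj_on ((\<lambda>(i, j) x. g j (f i x)) ij) S}) \<and>
      real (card {ij \<in> I \<times> J. inj_on ((\<lambda>(i, j) x. g j (f i x)) ij) S}) \<le> T1 * T2 * exp (\<eta>1 + \<eta>2)"
    if S: "S \<subseteq> {..<u} \<and> card S = k" for S
  proof -
    define A where "A = {i \<in> I. inj_on (f i) S}"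
    define B where "B i = {j \<in> J. inj_on (g j) (f i ` S)}" for i
    have eq: "{ij \<in> I \<times> J. inj_on ((\<lambda>(i, j) x. g j (f i x)) ij) S} = Sigma A B"
    proof (rule set_eqI)
      fix ij :: "'i \<times> 'j"
      obtain i j where ij: "ij = (i, j)" by fastforce
      have "inj_on (\<lambda>x. g j (f i x)) S \<longleftrightarrow> inj_on (f i) S \<and> inj_on (g j) (f i ` S)"
        using comp_inj_on_iff[of "f i" S "g j"] inj_on_imageI2[of "g j" "f i" S] by (auto simp: o_def)
      then show "ij \<in> {ij \<in> I \<times> J. inj_on ((\<lambda>(i, j) x. g j (f i x)) ij) S} \<longleftrightarrow> ij \<in> Sigma A B"
        unfolding A_def B_def ij by auto
    qed
    have fA: "finite A" unfolding A_def using T1 by simp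
    have c: "real (card (Sigma A B)) = (\<Sum>i\<in>A. real (card (B i)))"
      using fA T2 by (subst card_SigmaI) (auto simp: B_def)
    have Bi: "T2 * exp (- \<eta>2) \<le> real (card (B i)) \<and> real (card (B i)) \<le> T2 * exp \<eta>2" if i: "i \<in> A" for i
      unfolding B_def
    proof (rule b2)
      have "card (f i ` S) = k" using i S unfolding A_def by (simp add: card_image)
      moreover have "f i ` S \<subseteq> {..<u'}" using i S maps unfolding A_def by auto
      ultimately show "f i ` S \<subseteq> {..<u'} \<and> card (f i ` S) = k" by simp
    qed
    have A: "T1 * exp (- \<eta>1) \<le> real (card A)" "real (card A) \<le> T1 * exp \<eta>1"
      using b1[OF S] unfolding A_def by auto
    have "T1 * T2 * exp (- (\<eta>1 + \<eta>2)) = (T1 * exp (- \<eta>1)) * (T2 * exp (- \<eta>2))"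
    proof -
      have "exp (- (\<eta>1 + \<eta>2)) = exp (- \<eta>1) * exp (- \<eta>2)" by (simp flip: exp_add)
      then show ?thesis by (simp only: mult_ac)
    qed
    also have "\<dots> \<le> real (card A) * (T2 * exp (- \<eta>2))" using A T2 by (intro mult_right_mono) auto
    also have "\<dots> \<le> (\<Sum>i\<in>A. real (card (B i)))"
      using sum_mono[of A "\<lambda>_. T2 * exp (- \<eta>2)" "\<lambda>i. real (card (B i))"] Bi by simp
    finally have lo: "T1 * T2 * exp (- (\<eta>1 + \<eta>2)) \<le> (\<Sum>i\<in>A. real (card (B i)))" .
    have "(\<Sum>i\<in>A. real (card (B i))) \<le> real (card A) * (T2 * exp \<eta>2)"
      using sum_mono[of A "\<lambda>i. real (card (B i))" "\<lambda>_. T2 * exp \<eta>2"] Bi by simp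
    also have "\<dots> \<le> (T1 * exp \<eta>1) * (T2 * exp \<eta>2)" using A T2 by (intro mult_right_mono) auto
    also have "\<dots> = T1 * T2 * exp (\<eta>1 + \<eta>2)" by (simp add: exp_add mult_ac)
    finally show ?thesis using lo unfolding eq c by simp
  qed
  show ?thesis unfolding inj_balanced_def
    using T1 T2 main by (intro conjI exI[of _ "T1 * T2"] allI impI) auto
qed

lemma inj_balanced_reindex:
  assumes "inj_balanced \<eta> k u I f" "bij_betw \<pi> J I"
  shows "inj_balanced \<eta> k u J (\<lambda>j. f (\<pi> j))"
proof -
  have "card {j \<in> J. inj_on (f (\<pi> j)) S} = card {i \<in> I. inj_on (f i) S}" for S
  proof (rule bij_betw_same_card)
    show "bij_betw \<pi> {j \<in> J. inj_on (f (\<pi> j)) S} {i \<in> I. inj_on (f i) S}"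
      using assms(2) unfolding bij_betw_def inj_on_def by auto
  qed
  moreover have "finite J" using assms bij_betw_finite unfolding inj_balanced_def by blast
  ultimately show ?thesis using assms(1) unfolding inj_balanced_def by simp
qed

lemma bij_betw_mod_div: "A > 0 \<Longrightarrow> bij_betw (\<lambda>s. (s mod A, s div A)) {..<A * B} ({..<A} \<times> {..<B})" for A B :: nat
proof (rule bij_betwI[where g = "\<lambda>(i, j). i + A * j"])
  assume A: "A > 0"
  show "(\<lambda>s. (s mod A, s div A)) \<in> {..<A * B} \<rightarrow> {..<A} \<times> {..<B}"
    using A by (auto simp: less_mult_imp_div_less mult.commute)
  show "(\<lambda>(i, j). i + A * j) \<in> {..<A} \<times> {..<B} \<rightarrow> {..<A * B}"
  proof
    fix ij assume "ij \<in> {..<A} \<times> {..<B}"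
    then obtain i j where ij: "ij = (i, j)" "i < A" "j < B" by auto
    have "i + A * j < A * Suc j" using ij by simp
    also have "\<dots> \<le> A * B" using ij by (intro mult_le_mono2) simp
    finally show "(case ij of (i, j) \<Rightarrow> i + A * j) \<in> {..<A * B}" using ij by simp
  qed
qed auto

section \<open>Parameters and the hash chain\<close>

definition bit_length :: "nat \<Rightarrow> nat" where
  "bit_length m = (LEAST e. m < 2 ^ e)"

lemma bit_length: "m < 2 ^ bit_length m" and bit_length_le: "m < 2 ^ e \<Longrightarrow> bit_length m \<le> e"
proof -
  have "m < 2 ^ m" by (rule less_exp)
  then show "m < 2 ^ bit_length m" unfolding bit_length_def by (rule LeastI)
  show "m < 2 ^ e \<Longrightarrow> bit_length m \<le> e" unfolding bit_length_def by (rule Least_le)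
qed

lemma power_bit_length_le: "m \<ge> 1 \<Longrightarrow> 2 ^ (bit_length m - 1) \<le> m"
  using bit_length_le[of m "bit_length m - 1"] bit_length[of m]
  by (cases "bit_length m") (auto simp: not_less[symmetric])

lemma bit_length_ge1: "m \<ge> 1 \<Longrightarrow> bit_length m \<ge> 1"
  using bit_length[of m] by (cases "bit_length m") auto

lemma bit_length_le_self: "bit_length m \<le> m"
  by (rule bit_length_le) (rule less_exp)

definition kap :: "nat \<Rightarrow> nat" where "kap k = bit_length k"
text \<open>One stage loses 1/2^prec. The argument \<open>y\<close> will be the least integer with
  1/2^y \<le> \<delta> - 1, and the additional bits leave room for the \<open>kap k + 2\<close>
  stages that can occur.\<close>

definition prec :: "nat \<Rightarrow> nat \<Rightarrow> nat" where "prec k y = y + kap k + 2"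
text \<open>Exactly the number of bits demanded by \<open>inj_balanced_residue_code\<close> for
  \<kappa> = \<open>kap k\<close> and h = \<open>prec k y\<close>.\<close>

definition start_bits :: "nat \<Rightarrow> nat \<Rightarrow> nat" where "start_bits k y = prec k y + 2 * kap k + 4"
text \<open>The 8 keeps a halved length b' at 4 * \<open>kap k\<close> or more, where 2 k^2 / 2^b'
  is still at most 2^(-b'/4). The quotient by \<open>k\<close> limits the number of halvings to
  \<open>kap k\<close>.\<close>

definition stop_bits :: "nat \<Rightarrow> nat \<Rightarrow> nat" where "stop_bits k y = 8 * kap k + start_bits k y div k"
text \<open>About log log k, so that there are about log k groups. If \<open>y \<ge> k\<close>, a
  single group is affordable: its \<open>O (b * k)\<close> bits stay within the budget
  \<open>kap k * y\<close>.\<close>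

definition lam :: "nat \<Rightarrow> nat \<Rightarrow> nat" where "lam k y = (if y < k then bit_length (kap k) - 1 else 0)"
definition halve :: "nat \<Rightarrow> nat" where "halve b = (b + 1) div 2"
text \<open>Twice the number \<open>r\<close> of \<open>inj_balanced_poly_hash\<close>, with
  \<open>r\<close> large enough for 4 * (prec + 2) \<le> r * \<open>halve b\<close>: shorter words
  need more independence for the same precision.\<close>

definition chain_deg :: "nat \<Rightarrow> nat \<Rightarrow> nat \<Rightarrow> nat" where
  "chain_deg k y b = 2 * (4 * (prec k y + 2) div halve b + 1)"
text \<open>With a single group the word is reduced modulo 1, so the generator of depth 0
  does.\<close>

definition split_depth :: "nat \<Rightarrow> nat \<Rightarrow> nat \<Rightarrow> nat" where "split_depth k y b = (if lam k y = 0 then 0 else b)"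
text \<open>Makes sqrt P1 so large that the error 2^b / sqrt P1 is small even relative to the
  probability of an even split, whose lower bound is 1 / (2 * (k + 1)^l) for l = 2^lam
  groups.\<close>

definition split_bits :: "nat \<Rightarrow> nat \<Rightarrow> nat \<Rightarrow> nat" where
  "split_bits k y b = 2 * (b + prec k y + 4 + kap k * 2 ^ lam k y)"
definition group_deg :: "nat \<Rightarrow> nat \<Rightarrow> nat" where "group_deg k y = k div 2 ^ lam k y + 1"
text \<open>The first summand makes the error of the generator small against a success probability
  of at least 2^(-3k); the second leaves room for all \<open>p ^ d\<close> seeds of a polynomial, as
  \<open>p\<close> is less than 2^(2b + 8).\<close>

definition group_bits :: "nat \<Rightarrow> nat \<Rightarrow> nat \<Rightarrow> nat" where
  "group_bits k y b = 2 * (prec k y + 4 + 3 * k + lam k y) + (2 * b + 8) * group_deg k y"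

text \<open>Each level divides the part of the seed that it has read out of \<open>s\<close>, so one
  number drives the whole chain. The conjunct \<open>1 < b\<close> ensures that
  \<open>halve b\<close> is smaller than \<open>b\<close> for all arguments, including
  \<open>k = 0\<close>.\<close>

function colour_hash :: "nat \<Rightarrow> nat \<Rightarrow> nat \<Rightarrow> nat \<Rightarrow> nat \<Rightarrow> nat" where
  "colour_hash k y b s v = (if stop_bits k y < b \<and> 1 < b
     then colour_hash k y (halve b) (s div next_prime (2 ^ b) ^ chain_deg k y b)
       (poly_hash (next_prime (2 ^ b)) (chain_deg k y b) s v mod 2 ^ halve b)
     else split_hash k (lam k y) (next_prime (2 ^ split_bits k y b)) (split_depth k y b)
       (next_prime (2 ^ group_bits k y b)) (next_prime (2 ^ b)) (group_deg k y) s v)"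
  by auto
termination by (relation "measure (\<lambda>(k, y, b, s, v). b)") (auto simp: halve_def)

function seed_count :: "nat \<Rightarrow> nat \<Rightarrow> nat \<Rightarrow> nat" where
  "seed_count k y b = (if stop_bits k y < b \<and> 1 < b
     then next_prime (2 ^ b) ^ chain_deg k y b * seed_count k y (halve b)
     else next_prime (2 ^ split_bits k y b) ^ (2 * split_depth k y b + 1) *
       next_prime (2 ^ group_bits k y b) ^ (2 * lam k y + 1))"
  by auto
termination by (relation "measure (\<lambda>(k, y, b). b)") (auto simp: halve_def)

function chain_length :: "nat \<Rightarrow> nat \<Rightarrow> nat \<Rightarrow> nat" where
  "chain_length k y b = (if stop_bits k y < b \<and> 1 < b then Suc (chain_length k y (halve b)) else 0)"
  by auto
termination by (relation "measure (\<lambda>(k, y, b). b)") (auto simp: halve_def)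

declare colour_hash.simps[simp del] seed_count.simps[simp del] chain_length.simps[simp del]

lemma kap: "k < 2 ^ kap k" "1 \<le> k \<Longrightarrow> 2 ^ (kap k - 1) \<le> k" "1 \<le> k \<Longrightarrow> 1 \<le> kap k" "kap k \<le> k"
  unfolding kap_def by (rule bit_length power_bit_length_le bit_length_ge1 bit_length_le_self; simp)+

lemma lam_le: "1 \<le> k \<Longrightarrow> 2 ^ lam k y \<le> kap k"
proof -
  assume k: "1 \<le> k"
  have "2 ^ (bit_length (kap k) - 1) \<le> kap k" using kap(3)[OF k] by (rule power_bit_length_le)
  then show ?thesis using kap(3)[OF k] by (simp add: lam_def)
qed

text \<open>Halving rounds up, and b - 1 is the quantity that it divides by at least 2.\<close>

lemma chain_length_le: "1 \<le> k \<Longrightarrow> b - 1 \<le> 2 ^ j * (stop_bits k y - 1) \<Longrightarrow> chain_length k y b \<le> j"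
proof (induction j arbitrary: b)
  case 0
  have "stop_bits k y \<ge> 1" using kap(3)[OF 0(1)] unfolding stop_bits_def by simp
  then show ?case using 0 by (simp add: chain_length.simps[of k y b])
next
  case (Suc j)
  have "halve b - 1 \<le> (b - 1) div 2" unfolding halve_def by simp
  also have "\<dots> \<le> (2 * (2 ^ j * (stop_bits k y - 1))) div 2" using Suc.prems by (intro div_le_mono) (simp add: mult.assoc)
  finally have "chain_length k y (halve b) \<le> j" using Suc by simp
  then show ?case by (simp add: chain_length.simps[of k y b])
qed

lemma chain_length_start: "1 \<le> k \<Longrightarrow> chain_length k y (start_bits k y) \<le> kap k"
proof (rule chain_length_le)
  assume k: "1 \<le> k"
  have "start_bits k y < k * (start_bits k y div k + 1)" using k dividend_less_times_div[of k "start_bits k y"] by simp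
  also have "\<dots> \<le> 2 ^ kap k * (stop_bits k y - 1)"
    using kap(1)[of k] kap(3)[OF k] unfolding stop_bits_def by (intro mult_le_mono) auto
  finally show "start_bits k y - 1 \<le> 2 ^ kap k * (stop_bits k y - 1)" by simp
qed

lemma next_prime_gt0: "next_prime m > 0"
  using next_prime(1)[of m] prime_gt_0_nat by blast

lemma chain_step_balanced:
  assumes k: "1 \<le> k" and b: "stop_bits k y < b"
  shows "inj_balanced (1 / 2 ^ prec k y) k (2 ^ b) {..<next_prime (2 ^ b) ^ chain_deg k y b}
    (\<lambda>s v. poly_hash (next_prime (2 ^ b)) (chain_deg k y b) s v mod 2 ^ halve b)"
proof -
  define h where "h = prec k y"
  define b' where "b' = halve b"
  define r where "r = 4 * (h + 2) div b' + 1"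
  have d: "chain_deg k y b = 2 * r" unfolding chain_deg_def r_def b'_def h_def ..
  have b': "4 * kap k \<le> b'" "b' \<le> b" using b kap(3)[OF k] unfolding b'_def halve_def stop_bits_def by auto
  have b'0: "b' \<ge> 1" using b' kap(3)[OF k] by simp
  have pb: "2 ^ b \<le> next_prime (2 ^ b)" by (rule next_prime)
  have zp: "2 ^ b' \<le> next_prime (2 ^ b)"
    by (rule order.trans[OF _ pb], rule power_increasing) (use b' in auto)
  have "k \<le> 2 ^ kap k" using kap(1) by (simp add: less_imp_le)
  also have "\<dots> \<le> 2 ^ b'" using b' by (intro power_increasing) auto
  finally have kp: "k \<le> next_prime (2 ^ b)" using zp by simp
  have k2: "real (k\<^sup>2) \<le> 2 ^ (2 * kap k)"
  proof -
    have "k\<^sup>2 \<le> (2 ^ kap k)\<^sup>2" using kap(1)[of k] by (intro power_mono) auto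
    then have "k\<^sup>2 \<le> 2 ^ (2 * kap k)" by (simp add: power_mult[symmetric] mult.commute)
    then have "real (k\<^sup>2) \<le> real (2 ^ (2 * kap k))" by (rule of_nat_mono)
    then show ?thesis by simp
  qed
  define e where "e = real (k\<^sup>2) * (2 / real (2 ^ b'))"
  have e0: "0 \<le> e" unfolding e_def by simp
  have e: "e * 2 ^ b' \<le> 2 ^ (2 * kap k + 1)"
    unfolding e_def using k2 by simp
  have half: "e \<le> 1 / 2"
  proof -
    have "e * 2 ^ b' \<le> 2 ^ (2 * kap k + 1)" by (rule e)
    also have "\<dots> \<le> 2 ^ (b' - 1)" using b' kap(3)[OF k] by (intro power_increasing) auto
    also have "\<dots> = 1 / 2 * 2 ^ b'" using b'0 by (cases b') auto
    finally show ?thesis by simp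
  qed
  \<comment> \<open>In essence \<open>e\<close> is at most 2^(-b'/4) and r * b' is at least 4 * (h +
    2). Fourth powers keep all exponents integral.\<close>
  have small: "e ^ r \<le> 1 / 2 ^ h / 4"
  proof -
    have "(e ^ 4 * 2 ^ b') * (2 ^ b') ^ 3 = (e * 2 ^ b') ^ 4" by (simp add: power_mult_distrib eval_nat_numeral)
    also have "\<dots> \<le> (2 ^ (2 * kap k + 1)) ^ 4" using e e0 by (intro power_mono) auto
    also have "\<dots> = 2 ^ (4 * (2 * kap k + 1))" by (simp only: power_mult[symmetric] mult.commute[of 4])
    also have "\<dots> \<le> 2 ^ (3 * b')" using b' kap(3)[OF k] by (intro power_increasing) auto
    also have "\<dots> = 1 * (2 ^ b') ^ 3" by (simp add: power_mult[symmetric] mult.commute)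
    finally have "(e ^ 4 * 2 ^ b') * (2 ^ b') ^ 3 \<le> 1 * ((2::real) ^ b') ^ 3" .
    then have e4: "e ^ 4 * 2 ^ b' \<le> 1" by (rule mult_right_le_imp_le) simp
    have "4 * (h + 2) \<le> b' * r" unfolding r_def using b'0 dividend_less_times_div[of b' "4 * (h + 2)"] by simp
    then have "((2::real) ^ (h + 2)) ^ 4 \<le> 2 ^ (b' * r)"
      unfolding power_mult[symmetric] by (intro power_increasing) (simp_all add: mult.commute)
    then have "(e ^ r) ^ 4 * (2 ^ (h + 2)) ^ 4 \<le> (e ^ r) ^ 4 * 2 ^ (b' * r)"
      using e0 by (intro mult_left_mono) simp_all
    also have "\<dots> = (e ^ 4 * 2 ^ b') ^ r"
      unfolding power_mult_distrib power_mult[symmetric] by (simp add: mult.commute)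
    also have "\<dots> \<le> 1" using e4 e0 by (intro power_le_one) auto
    finally have "(e ^ r * 2 ^ (h + 2)) ^ 4 \<le> 1" by (simp only: power_mult_distrib)
    then have "e ^ r * 2 ^ (h + 2) \<le> 1" using e0 power_le_one_iff[of "e ^ r * 2 ^ (h + 2)" 4] by simp
    then show ?thesis by (simp add: field_simps)
  qed
  have "inj_balanced (1 / 2 ^ h) k (next_prime (2 ^ b)) {..<next_prime (2 ^ b) ^ (2 * r)} (\<lambda>s v. poly_hash (next_prime (2 ^ b)) (2 * r) s v mod 2 ^ b')"
    using half small zp kp unfolding e_def
    by (intro inj_balanced_poly_hash[OF next_prime(1)]) auto
  then show ?thesis unfolding d b'_def[symmetric] h_def[symmetric] by (rule inj_balanced_mono_universe) (rule pb)
qed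

lemma final_step_balanced:
  assumes k: "1 \<le> k" and b: "kap k \<le> b"
  shows "inj_balanced (1 / 2 ^ prec k y) k (2 ^ b)
    {..<next_prime (2 ^ split_bits k y b) ^ (2 * split_depth k y b + 1) * next_prime (2 ^ group_bits k y b) ^ (2 * lam k y + 1)}
    (split_hash k (lam k y) (next_prime (2 ^ split_bits k y b)) (split_depth k y b)
       (next_prime (2 ^ group_bits k y b)) (next_prime (2 ^ b)) (group_deg k y))"
proof -
  define h where "h = prec k y"
  define m where "m = lam k y"
  define l :: nat where "l = 2 ^ m"
  define P1 where "P1 = next_prime (2 ^ split_bits k y b)"
  define P2 where "P2 = next_prime (2 ^ group_bits k y b)"
  define p where "p = next_prime (2 ^ b)"
  define d where "d = group_deg k y"
  have lk: "l \<le> kap k" "l \<le> k" "l > 0" using lam_le[OF k, of y] kap(4)[of k] unfolding l_def m_def by auto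
  have h2: "h \<ge> kap k + 2" unfolding h_def prec_def by simp
  \<comment> \<open>A power of two with \<open>6 * x \<le> 1 / 2 ^ h\<close>, the slack that
    \<open>inj_balanced_split_hash\<close> asks for.\<close>
  define x :: real where "x = 1 / 2 ^ (h + 3)"
  \<comment> \<open>With a single group every seed gives the even split, so the reference
    probability is 1.\<close>
  define c1 where "c1 = (if m = 0 then 1 else iid_ratio P1 l k (residues_mset l k))"
  have cls: "class_size k (2 ^ m) j \<le> d" for j
    unfolding class_size_def d_def group_deg_def m_def by (simp add: div_le_mono)
  have cls_k: "class_size k (2 ^ m) j \<le> k" for j
    using k div_le_dividend[of "k - 1 - j" "2 ^ m"] unfolding class_size_def by linarith
  have sqrtP1: "2 ^ (b + h + 4 + kap k * l) \<le> sqrt (real P1)"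
  proof -
    have "(2 ^ (b + h + 4 + kap k * l))\<^sup>2 = (2::nat) ^ split_bits k y b"
      unfolding split_bits_def h_def m_def l_def by (simp only: power_mult[symmetric] mult.commute[of 2])
    also have "\<dots> \<le> P1" unfolding P1_def by (rule next_prime)
    finally have "real ((2 ^ (b + h + 4 + kap k * l))\<^sup>2) \<le> real P1" by (rule of_nat_mono)
    then show ?thesis by (simp add: real_le_rsqrt)
  qed
  have P1big: "2 * (k * l) \<le> P1"
  proof -
    have "k * l \<le> 2 ^ kap k * 2 ^ kap k" using kap(1)[of k] lk less_exp[of "kap k"] by (intro mult_le_mono) auto
    then have "2 * (k * l) \<le> 2 ^ (1 + kap k + kap k)" by (simp add: power_add)
    also have "\<dots> \<le> 2 ^ split_bits k y b" unfolding split_bits_def prec_def by (intro power_increasing) auto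
    also have "\<dots> \<le> P1" unfolding P1_def by (rule next_prime)
    finally show ?thesis .
  qed
  have c1: "1 / (2 * 2 ^ (kap k * l)) \<le> c1"
  proof (cases "m = 0")
    case True
    have "(1::real) \<le> 2 ^ (kap k * l)" by simp
    then have "(1::real) \<le> 2 * 2 ^ (kap k * l)" by linarith
    then have "1 / (2 * 2 ^ (kap k * l)) \<le> (1::real)" by (simp add: divide_le_eq)
    then show ?thesis using True unfolding c1_def by simp
  next
    case False
    have "real (k + 1) \<le> 2 ^ kap k"
    proof -
      have "k + 1 \<le> 2 ^ kap k" using kap(1)[of k] by simp
      then have "real (k + 1) \<le> real (2 ^ kap k)" by (rule of_nat_mono)
      then show ?thesis by simp
    qed
    then have "real (k + 1) ^ l \<le> (2 ^ kap k) ^ l" by (rule power_mono) simp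
    then have "real (k + 1) ^ l \<le> 2 ^ (kap k * l)" by (simp add: power_mult)
    then have "1 / (2 * 2 ^ (kap k * l)) \<le> 1 / (2 * real (k + 1) ^ l)" by (intro divide_left_mono) auto
    also have "\<dots> \<le> iid_ratio P1 l k (residues_mset l k)"
      using lk P1big unfolding P1_def by (intro iid_ratio_residues_ge next_prime_gt0) auto
    finally show ?thesis using False unfolding c1_def by simp
  qed
  have c1pos: "c1 > 0" using c1 by (rule less_le_trans[rotated]) simp
  have split: "\<bar>real (card {t \<in> {..<P1 ^ (2 * split_depth k y b + 1)}. image_mset (\<lambda>x. nisan P1 (split_depth k y b) t x mod 2 ^ m) (mset_set S) = residues_mset (2 ^ m) k})
         / real (P1 ^ (2 * split_depth k y b + 1)) - c1\<bar> \<le> x * c1"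
    if S: "S \<subseteq> {..<2 ^ b}" "card S = k" for S
  proof (cases "m = 0")
    case True
    have "image_mset (\<lambda>x. nisan P1 (split_depth k y b) t x mod 2 ^ m) (mset_set S) = residues_mset (2 ^ m) k" for t
      using True S(2) unfolding residues_mset_def by (simp add: image_mset_const_eq)
    then have "{t \<in> {..<P1 ^ (2 * split_depth k y b + 1)}. image_mset (\<lambda>x. nisan P1 (split_depth k y b) t x mod 2 ^ m) (mset_set S) = residues_mset (2 ^ m) k}
        = {..<P1 ^ (2 * split_depth k y b + 1)}" by auto
    moreover have "real (P1 ^ (2 * split_depth k y b + 1)) \<noteq> 0" using next_prime_gt0[of "2 ^ split_bits k y b"] unfolding P1_def by simp
    ultimately show ?thesis using True unfolding c1_def x_def by (simp only: card_lessThan divide_self) simp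
  next
    case False
    have sd: "split_depth k y b = b" using False unfolding split_depth_def m_def by simp
    have "\<bar>real (card {t \<in> {..<P1 ^ (2 * b + 1)}. image_mset (\<lambda>x. nisan P1 b t x mod l) (mset_set S) = residues_mset l k}) / real (P1 ^ (2 * b + 1))
      - iid_ratio P1 l k (residues_mset l k)\<bar> \<le> 2 ^ b / sqrt (real P1)"
      unfolding P1_def by (rule nisan_split[OF next_prime(1) lk(3) residues_mset(1)[OF lk(3)] residues_mset(2) S])
    also have "2 ^ b / sqrt (real P1) \<le> 2 ^ b / 2 ^ (b + h + 4 + kap k * l)"
      using sqrtP1 next_prime_gt0[of "2 ^ split_bits k y b"] unfolding P1_def[symmetric] by (intro divide_left_mono) auto
    also have "\<dots> = x * (1 / (2 * 2 ^ (kap k * l)))" unfolding x_def by (simp add: power_add)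
    also have "\<dots> \<le> x * c1" unfolding x_def by (rule mult_left_mono[OF c1]) simp
    finally show ?thesis using False unfolding sd c1_def l_def by simp
  qed
  define C2 where "C2 = (\<Prod>j<2 ^ m. perfect_ratio p (class_size k (2 ^ m) j))"
  have sumcls: "(\<Sum>j<2 ^ m. class_size k (2 ^ m) j) = k"
  proof -
    have "(\<Sum>j<l. class_size k l j) = (\<Sum>j<l. card {c \<in> {..<k}. c mod l = j})"
      by (intro sum.cong refl card_residue_class[symmetric]) (use lk in auto)
    also have "\<dots> = card {..<k}"
    proof -
      have "(\<lambda>c. c mod l) ` {..<k} \<subseteq> {..<l}" using lk by auto
      then show ?thesis using sum.group[of "{..<k}" "{..<l}" "\<lambda>c. c mod l" "\<lambda>_. 1::nat"] by simp
    qed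
    finally show ?thesis unfolding l_def by simp
  qed
  have C2: "1 / 2 ^ (3 * k) \<le> C2"
  proof -
    have "(2::nat) ^ kap k \<le> 2 ^ b" using b by (intro power_increasing) auto
    then have "k \<le> 2 ^ b" using kap(1)[of k] by linarith
    also have "\<dots> \<le> p" unfolding p_def by (rule next_prime)
    finally have kp: "k \<le> p" .
    \<comment> \<open>The class sizes add up to \<open>k\<close>, so the bounds 8^(-m) of the
      individual groups multiply to 2^(-3k).\<close>
    have "1 / 2 ^ (3 * k) = (1 / 8 :: real) ^ (\<Sum>j<2 ^ m. class_size k (2 ^ m) j)"
      unfolding sumcls by (simp add: power_mult power_one_over)
    also have "\<dots> = (\<Prod>j<2 ^ m. (1 / 8) ^ class_size k (2 ^ m) j)" by (rule power_sum)
    also have "\<dots> \<le> C2" unfolding C2_def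
    proof (rule prod_mono)
      fix j :: nat
      have "1 / 8 ^ class_size k (2 ^ m) j \<le> perfect_ratio p (class_size k (2 ^ m) j)"
        using cls_k[of j] kp next_prime_gt0 unfolding p_def by (intro perfect_ratio_ge) (auto intro: order_trans)
      then show "0 \<le> (1 / 8 :: real) ^ class_size k (2 ^ m) j \<and> (1 / 8) ^ class_size k (2 ^ m) j \<le> perfect_ratio p (class_size k (2 ^ m) j)"
        by (simp add: power_one_over)
    qed
    finally show ?thesis .
  qed
  have C2pos: "C2 > 0" using C2 by (rule less_le_trans[rotated]) simp
  have group: "2 ^ m / sqrt (real P2) + 2 ^ m * (real (p ^ d) / real P2) \<le> x * C2"
  proof -
    define w where "w = h + 4 + 3 * k + m"
    have gb: "group_bits k y b = 2 * w + (2 * b + 8) * d" unfolding group_bits_def w_def h_def m_def d_def ..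
    have P2: "2 ^ (2 * w + (2 * b + 8) * d) \<le> P2" unfolding P2_def gb[symmetric] by (rule next_prime)
    have "(2 ^ w)\<^sup>2 \<le> (2::nat) ^ (2 * w + (2 * b + 8) * d)"
      unfolding power_mult[symmetric] by (intro power_increasing) auto
    then have "real ((2 ^ w)\<^sup>2) \<le> real P2" using P2 by (intro of_nat_mono) simp
    then have s: "2 ^ w \<le> sqrt (real P2)" by (simp add: real_le_rsqrt)
    have "2 ^ m / sqrt (real P2) \<le> 2 ^ m / 2 ^ w"
      using s next_prime_gt0[of "2 ^ group_bits k y b"] unfolding P2_def[symmetric] by (intro divide_left_mono) auto
    then have 1: "2 ^ m / sqrt (real P2) \<le> 1 / 2 ^ (h + 4 + 3 * k)" unfolding w_def by (simp add: power_add)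
    have "p ^ d \<le> (2 ^ (2 * b + 8)) ^ d" unfolding p_def using next_prime_power2_less[of b] by (intro power_mono) auto
    then have "p ^ d * 2 ^ (2 * w) \<le> 2 ^ ((2 * b + 8) * d) * 2 ^ (2 * w)"
      unfolding power_mult by (rule mult_le_mono1)
    also have "\<dots> = 2 ^ (2 * w + (2 * b + 8) * d)" unfolding power_add by (rule mult.commute)
    also note P2
    finally have "real (p ^ d * 2 ^ (2 * w)) \<le> real P2" by (rule of_nat_mono)
    then have "real (p ^ d) / real P2 \<le> 1 / 2 ^ (2 * w)"
      using next_prime_gt0[of "2 ^ group_bits k y b"] unfolding P2_def[symmetric] by (simp add: field_simps)
    then have "2 ^ m * (real (p ^ d) / real P2) \<le> 2 ^ m * (1 / 2 ^ (2 * w))" by (rule mult_left_mono) simp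
    also have "\<dots> \<le> 2 ^ m * (1 / 2 ^ (h + 4 + 3 * k + m))"
      unfolding w_def by (intro mult_left_mono divide_left_mono power_increasing) auto
    also have "\<dots> = 1 / 2 ^ (h + 4 + 3 * k)" by (simp add: power_add)
    finally have "2 ^ m / sqrt (real P2) + 2 ^ m * (real (p ^ d) / real P2) \<le> 2 * (1 / 2 ^ (h + 4 + 3 * k))" using 1 by simp
    also have "\<dots> = x * (1 / 2 ^ (3 * k))" unfolding x_def by (simp add: power_add)
    also have "\<dots> \<le> x * C2" unfolding x_def by (rule mult_left_mono[OF C2]) simp
    finally show ?thesis .
  qed
  have "inj_balanced (1 / 2 ^ h) k (2 ^ b) {..<P1 ^ (2 * split_depth k y b + 1) * P2 ^ (2 * m + 1)}
      (split_hash k m P1 (split_depth k y b) P2 p d)"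
  proof (rule inj_balanced_split_hash[OF _ _ _ _ _ _ c1pos split])
    show "prime P1" "prime P2" "prime p" "2 ^ b \<le> p" unfolding P1_def P2_def p_def by (rule next_prime)+
    show "2 ^ m \<le> k" using lk unfolding l_def by simp
    show "\<And>j. class_size k (2 ^ m) j \<le> d" by (rule cls)
    show "2 ^ m / sqrt (real P2) + 2 ^ m * (real (p ^ d) / real P2) \<le> x * (\<Prod>j<2 ^ m. perfect_ratio p (class_size k (2 ^ m) j))"
      using group unfolding C2_def .
    show "0 < (\<Prod>j<2 ^ m. perfect_ratio p (class_size k (2 ^ m) j))" using C2pos unfolding C2_def .
    show "0 \<le> x" unfolding x_def by simp
    show "6 * x \<le> 1 / 2 ^ h" unfolding x_def by (simp add: power_add field_simps)
    show "1 / 2 ^ h \<le> (1::real)" by simp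
  qed
  then show ?thesis unfolding h_def m_def P1_def P2_def p_def d_def .
qed

lemma stop_bits_ge: "1 \<le> k \<Longrightarrow> 8 \<le> stop_bits k y"
  using kap(3)[of k] unfolding stop_bits_def by simp

lemma colour_hash_less: "1 \<le> k \<Longrightarrow> colour_hash k y b s v < k"
proof (induction b arbitrary: s v rule: less_induct)
  case (less b)
  show ?case
  proof (cases "stop_bits k y < b")
    case True
    then have b: "1 < b" using stop_bits_ge[OF less.prems, of y] by simp
    then have "halve b < b" unfolding halve_def by simp
    then show ?thesis using less True b by (simp add: colour_hash.simps[of k y b])
  next
    case False
    have "2 ^ lam k y \<le> k" using lam_le[OF less.prems, of y] kap(4)[of k] by simp
    then show ?thesis using False by (simp add: colour_hash.simps[of k y b] split_hash_less)
  qed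
qed

text \<open>Every halving and the final stage lose 1/2^prec each, hence the numerator
  \<open>chain_length k y b + 1\<close>.\<close>

lemma colour_hash_balanced:
  assumes k: "1 \<le> k"
  shows "kap k \<le> b \<Longrightarrow> inj_balanced (real (chain_length k y b + 1) / 2 ^ prec k y) k (2 ^ b)
    {..<seed_count k y b} (colour_hash k y b)"
proof (induction b rule: less_induct)
  case (less b)
  show ?case
  proof (cases "stop_bits k y < b")
    case True
    then have b: "1 < b" using stop_bits_ge[OF k, of y] by simp
    have hb: "halve b < b" "kap k \<le> halve b" using True b unfolding halve_def stop_bits_def by auto
    define p where "p = next_prime (2 ^ b)"
    define d where "d = chain_deg k y b"
    define f where "f s v = poly_hash p d s v mod 2 ^ halve b" for s v
    have p0: "p > 0" unfolding p_def by (rule next_prime_gt0)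
    have fmod: "f (s mod p ^ d) = f s" for s unfolding f_def by (simp add: poly_hash_mod_power[OF p0])
    have "inj_balanced (1 / 2 ^ prec k y + real (chain_length k y (halve b) + 1) / 2 ^ prec k y) k (2 ^ b)
        ({..<p ^ d} \<times> {..<seed_count k y (halve b)}) (\<lambda>(i, j) x. colour_hash k y (halve b) j (f i x))"
    proof (rule inj_balanced_compose)
      show "inj_balanced (1 / 2 ^ prec k y) k (2 ^ b) {..<p ^ d} f"
        unfolding p_def d_def f_def by (rule chain_step_balanced[OF k True])
      show "inj_balanced (real (chain_length k y (halve b) + 1) / 2 ^ prec k y) k (2 ^ halve b) {..<seed_count k y (halve b)} (colour_hash k y (halve b))"
        by (rule less.IH[OF hb])
    qed (simp add: f_def)
    then have "inj_balanced (1 / 2 ^ prec k y + real (chain_length k y (halve b) + 1) / 2 ^ prec k y) k (2 ^ b)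
        {..<p ^ d * seed_count k y (halve b)}
        (\<lambda>s. (\<lambda>(i, j) x. colour_hash k y (halve b) j (f i x)) (s mod p ^ d, s div p ^ d))"
      by (rule inj_balanced_reindex) (rule bij_betw_mod_div, use p0 in simp)
    moreover have "(\<lambda>s. (\<lambda>(i, j) x. colour_hash k y (halve b) j (f i x)) (s mod p ^ d, s div p ^ d)) = colour_hash k y b"
      using True b by (intro ext) (simp add: colour_hash.simps[of k y b] f_def p_def d_def poly_hash_mod_power next_prime_gt0)
    moreover have "p ^ d * seed_count k y (halve b) = seed_count k y b"
      using True b by (simp add: seed_count.simps[of k y b] p_def d_def)
    moreover have "1 / 2 ^ prec k y + real (chain_length k y (halve b) + 1) / 2 ^ prec k y = real (chain_length k y b + 1) / 2 ^ prec k y"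
      using True b by (simp add: chain_length.simps[of k y b] add_divide_distrib[symmetric])
    ultimately show ?thesis by simp
  next
    case False
    then have "colour_hash k y b = split_hash k (lam k y) (next_prime (2 ^ split_bits k y b)) (split_depth k y b)
       (next_prime (2 ^ group_bits k y b)) (next_prime (2 ^ b)) (group_deg k y)"
      by (intro ext) (simp add: colour_hash.simps[of k y b])
    then show ?thesis
      using final_step_balanced[OF k less.prems, of y] False
      by (simp add: seed_count.simps[of k y b] chain_length.simps[of k y b])
  qed
qed

section \<open>Counting the seeds of the colouring\<close>

text \<open>The exponent k log log k + log k * log (1 / (\<delta> - 1)) of the theorem in integer
  form; the number of seeds and the running time are bounded through multiples of it.\<close>

definition expo :: "nat \<Rightarrow> nat \<Rightarrow> nat" where
  "expo k y = k * bit_length (kap k) + kap k * y"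

text \<open>Applied to \<open>kap k\<close> it yields a cube of order \<open>k\<close>. The first
  generator has about \<open>kap k\<close> maps over a field of order \<open>kap k\<close> squared
  many bits, which is cubic in \<open>kap k\<close>.\<close>

lemma cube_le: "n ^ 3 \<le> 4 * 2 ^ n" for n :: nat
proof (induction n rule: less_induct)
  case (less n)
  show ?case
  proof (cases "n \<le> 4")
    case True
    then have "n \<in> {0, 1, 2, 3, 4}" by auto
    then show ?thesis by (elim insertE) (simp_all add: eval_nat_numeral)
  next
    case False
    then obtain m where m: "n = Suc m" "4 \<le> m" by (cases n) auto
    have "m * m * 4 \<le> m * m * m" using m by (intro mult_le_mono2)
    moreover have "m * 4 \<le> m * m" using m by (intro mult_le_mono2)
    ultimately have "3 * (m * m) + 3 * m + 1 \<le> m * m * m" using m by linarith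
    then have "Suc m ^ 3 \<le> 2 * m ^ 3" by (simp add: power3_eq_cube algebra_simps)
    also have "\<dots> \<le> 2 * (4 * 2 ^ m)" using less.IH[of m] m by (intro mult_le_mono2) simp
    finally show ?thesis using m by simp
  qed
qed

lemma expo_bounds:
  assumes k: "1 \<le> k"
  shows "k \<le> expo k y" "y \<le> expo k y" "kap k * y \<le> expo k y" "kap k ^ 3 \<le> 8 * expo k y" "kap k ^ 3 \<le> 8 * k + y"
    "kap k * kap k \<le> 8 * expo k y" "kap k \<le> expo k y" "k * bit_length (kap k) \<le> expo k y"
    "prec k y \<le> 4 * expo k y" "start_bits k y \<le> 10 * expo k y"
    "kap k * prec k y \<le> 11 * expo k y" "kap k * start_bits k y \<le> 31 * expo k y" "1 \<le> expo k y"
proof -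
  define K Z where "K = kap k" and "Z = expo k y"
  have K1: "1 \<le> K" "K \<le> k" unfolding K_def using kap(3)[OF k] kap(4) by auto
  have bl: "1 \<le> bit_length K" using K1(1) by (rule bit_length_ge1)
  have "k * 1 \<le> k * bit_length K" using bl by (rule mult_le_mono2)
  then show a1: "k \<le> expo k y" unfolding expo_def K_def[symmetric] by linarith
  have "1 * y \<le> K * y" using K1(1) by (rule mult_le_mono1)
  then show a2: "y \<le> expo k y" unfolding expo_def K_def[symmetric] by linarith
  show a3: "kap k * y \<le> expo k y" unfolding expo_def by simp
  show a8: "k * bit_length (kap k) \<le> expo k y" unfolding expo_def by simp
  have "K ^ 3 \<le> 4 * 2 ^ K" by (rule cube_le)
  also have "(2::nat) ^ K = 2 * 2 ^ (K - 1)" using K1(1) by (cases K) auto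
  also have "4 * (2 * 2 ^ (K - 1)) \<le> 4 * (2 * k)" using kap(2)[OF k] unfolding K_def by simp
  finally have c: "K ^ 3 \<le> 8 * k" by simp
  then show "kap k ^ 3 \<le> 8 * k + y" unfolding K_def by simp
  show a4: "kap k ^ 3 \<le> 8 * expo k y" using c a1 unfolding K_def by linarith
  have "K * K * 1 \<le> K * K * K" using K1(1) by (rule mult_le_mono2)
  then have "K * K \<le> K ^ 3" by (simp add: power3_eq_cube)
  then show a5: "kap k * kap k \<le> 8 * expo k y" using a4 unfolding K_def by linarith
  show a6: "kap k \<le> expo k y" using K1(2) a1 unfolding K_def by linarith
  show "1 \<le> expo k y" using k a1 by linarith
  then show "prec k y \<le> 4 * expo k y" "start_bits k y \<le> 10 * expo k y"
    unfolding prec_def start_bits_def using a2 a6 by linarith+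
  have "K * prec k y = K * y + K * K + 2 * K" unfolding prec_def K_def by (simp add: algebra_simps)
  then show a9: "kap k * prec k y \<le> 11 * expo k y" using a3 a5 a6 unfolding K_def by linarith
  have "K * start_bits k y = K * prec k y + 2 * (K * K) + 4 * K" unfolding start_bits_def K_def by (simp add: algebra_simps)
  then show "kap k * start_bits k y \<le> 31 * expo k y" using a9 a5 a6 unfolding K_def by linarith
qed

text \<open>The number of coefficients is inversely proportional to the length \<open>b\<close> and
  each coefficient has O(b) bits, so the bits of one stage are bounded independently of
  \<open>b\<close>.\<close>

lemma chain_factor_le:
  assumes k: "1 \<le> k" and b: "1 < b" "b \<le> start_bits k y"
  shows "next_prime (2 ^ b) ^ chain_deg k y b \<le> 2 ^ (96 * (prec k y + 2) + 24 * start_bits k y)"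
proof -
  define b' where "b' = halve b"
  define h where "h = prec k y"
  have b': "1 \<le> b'" "b \<le> 2 * b'" "b' \<le> b" using b unfolding b'_def halve_def by auto
  have "next_prime (2 ^ b) ^ chain_deg k y b \<le> (2 ^ (2 * b + 8)) ^ chain_deg k y b"
    using next_prime_power2_less[of b] by (intro power_mono) auto
  also have "\<dots> = 2 ^ ((2 * b + 8) * chain_deg k y b)" by (simp only: power_mult)
  also have "\<dots> \<le> 2 ^ (96 * (h + 2) + 24 * start_bits k y)"
  proof (rule power_increasing)
    have "(2 * b + 8) * chain_deg k y b \<le> (12 * b') * (2 * (4 * (h + 2) div b' + 1))"
      unfolding chain_deg_def b'_def[symmetric] h_def[symmetric] using b' by (intro mult_le_mono1) simp
    also have "\<dots> = 24 * (b' * (4 * (h + 2) div b')) + 24 * b'" by (simp add: algebra_simps)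
    also have "\<dots> \<le> 24 * (4 * (h + 2)) + 24 * start_bits k y"
      using b' b by (intro add_mono mult_le_mono2 times_div_less_eq_dividend) simp
    finally show "(2 * b + 8) * chain_deg k y b \<le> 96 * (h + 2) + 24 * start_bits k y" by simp
  qed simp
  finally show ?thesis unfolding h_def .
qed

text \<open>For \<open>y \<ge> k\<close> the single group costs about b * k bits, and the quotient
  in \<open>stop_bits\<close> contributes only \<open>start_bits\<close> to this product. For
  \<open>y < k\<close> the length \<open>b\<close> is O(kap k): the split costs O(kap k ^ 3 + kap k
  * prec) bits, and the second generator has O(k) bits for each of its \<open>lam\<close> maps, the
  source of k log log k.\<close>

lemma final_factor_le:
  assumes k: "1 \<le> k" and b: "b \<le> start_bits k y" "b \<le> stop_bits k y"
  shows "next_prime (2 ^ split_bits k y b) ^ (2 * split_depth k y b + 1) *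
       next_prime (2 ^ group_bits k y b) ^ (2 * lam k y + 1) \<le> 2 ^ (24000 * expo k y)"
proof -
  define K Z h t m where "K = kap k" and "Z = expo k y" and "h = prec k y" and "t = start_bits k y" and "m = lam k y"
  note eb = expo_bounds[OF k, of y, folded K_def Z_def h_def t_def]
  have K1: "1 \<le> K" "K \<le> k" unfolding K_def using kap(3)[OF k] kap(4) by auto
  have lK: "2 ^ m \<le> K" unfolding m_def K_def by (rule lam_le[OF k])
  have t: "t = y + 3 * K + 6" unfolding t_def start_bits_def prec_def K_def by simp
  define w1 w2 where "w1 = split_bits k y b" and "w2 = group_bits k y b"
  define \<beta> where "\<beta> = split_depth k y b"
  have "(2 * w1 + 8) * (2 * \<beta> + 1) + (2 * w2 + 8) * (2 * m + 1) \<le> 24000 * Z"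
  proof (cases "m = 0")
    case True
    have \<beta>: "\<beta> = 0" using True unfolding \<beta>_def split_depth_def m_def by simp
    have w1: "w1 = 2 * (b + h + 4 + K)" using True unfolding w1_def split_bits_def h_def K_def m_def by simp
    define g where "g = (2 * b + 8) * (k + 1)"
    have w2: "w2 = 2 * (h + 4 + 3 * k) + g"
      using True unfolding g_def w2_def group_bits_def group_deg_def h_def m_def by simp
    have "(2 * b + 8) * (k + 1) \<le> 88 * Z"
    proof (cases "y < k")
      case yk: True
      \<comment> \<open>If \<open>y < k\<close>, the exponent \<open>lam\<close> vanishes only for
        \<open>kap k = 1\<close>, that is for \<open>k = 1\<close>.\<close>
      have "bit_length K - 1 = 0" using True yk unfolding m_def lam_def K_def by simp
      then have "bit_length K \<le> 1" by simp
      then have "K < 2" using bit_length[of K] power_increasing[of "bit_length K" 1 "2::nat"] by simp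
      then have "K = 1" using K1 by simp
      then have "k = 1" using kap(1)[of k] k unfolding K_def by simp
      then show ?thesis using b eb(10) eb(13) unfolding t_def[symmetric] by simp
    next
      case False
      have "(2 * b + 8) * (k + 1) \<le> (16 * K + 8 + 2 * (t div k)) * (2 * k)"
        using b(2) k unfolding stop_bits_def K_def[symmetric] t_def[symmetric] by (intro mult_le_mono) simp_all
      also have "\<dots> = 32 * (K * k) + 16 * k + 4 * (k * (t div k))" by (simp add: algebra_simps)
      also have "\<dots> \<le> 32 * (K * y) + 16 * k + 4 * t"
        using False by (intro add_mono mult_le_mono2 times_div_less_eq_dividend) auto
      also have "\<dots> \<le> 88 * Z" using eb(1) eb(3) eb(10) by linarith
      finally show ?thesis .
    qed
    then have "g \<le> 88 * Z" unfolding g_def .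
    then have "w2 \<le> 110 * Z" unfolding w2 using eb(1) eb(9) eb(13) by simp
    moreover have "w1 \<le> 38 * Z" unfolding w1 using b(1)[folded t_def] eb(7) eb(9) eb(10) eb(13) by simp
    ultimately show ?thesis using True \<beta> eb(13) by simp
  next
    case False
    have yk: "y < k" using False unfolding m_def lam_def by (auto split: if_splits)
    have "t div k \<le> 9"
    proof -
      have "t \<le> 9 * k + k - 1" using t yk K1 k by linarith
      then have "t < 10 * k" using k by linarith
      then show ?thesis using k by (simp add: less_mult_imp_div_less less_Suc_eq_le[symmetric])
    qed
    then have b17: "b \<le> 17 * K" using b(2) K1 unfolding stop_bits_def K_def[symmetric] t_def[symmetric] by linarith
    have \<beta>: "\<beta> = b" using False unfolding \<beta>_def split_depth_def m_def by simp
    have Kl: "K * 2 ^ m \<le> K * K" using lK by (rule mult_le_mono2)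
    have w1: "w1 \<le> 2 * (17 * K + h + 4 + K * K)"
      unfolding w1_def split_bits_def h_def[symmetric] K_def[symmetric] m_def[symmetric]
      by (intro mult_le_mono2 add_mono) (use b17 lK in simp_all)
    have "(2 * w1 + 8) * (2 * \<beta> + 1) \<le> (4 * (17 * K + h + 4 + K * K) + 8) * (35 * K)"
      unfolding \<beta> using w1 b17 K1 by (intro mult_le_mono) linarith+
    also have "\<dots> = 35 * (68 * (K * K) + 4 * (K * h) + 24 * K + 4 * K ^ 3)" by (simp add: power3_eq_cube algebra_simps)
    also have "\<dots> \<le> 35 * (68 * (8 * Z) + 4 * (11 * Z) + 24 * Z + 4 * (8 * Z))"
      using eb(4,6,7,11) by (intro mult_le_mono2 add_mono) auto
    finally have A: "(2 * w1 + 8) * (2 * \<beta> + 1) \<le> 22540 * Z" by simp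
    have bl: "m + 1 = bit_length K" using False yk unfolding m_def lam_def K_def by simp
    \<comment> \<open>There are more than K/2 groups, so a group has O(k/K) points, and a polynomial
      with that many coefficients of O(K) bits has O(k) bits in total.\<close>
    have K2: "K < 2 * 2 ^ m" using bit_length[of K] unfolding bl[symmetric] by simp
    have "K * (k div 2 ^ m + 1) \<le> 2 * 2 ^ m * (k div 2 ^ m) + K"
      using K2 mult_le_mono1[of K "2 * 2 ^ m" "k div 2 ^ m"] by (simp add: algebra_simps)
    also have "\<dots> \<le> 2 * k + k"
      unfolding mult.assoc using K1 by (intro add_mono mult_le_mono2 times_div_less_eq_dividend)
    finally have KM: "K * (k div 2 ^ m + 1) \<le> 3 * k" by simp
    have "(2 * b + 8) * group_deg k y \<le> (42 * K) * (k div 2 ^ m + 1)"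
      unfolding group_deg_def m_def[symmetric] using b17 K1 by (intro mult_le_mono1) linarith
    also have "\<dots> = 42 * (K * (k div 2 ^ m + 1))" by simp
    also have "\<dots> \<le> 42 * (3 * k)" by (rule mult_le_mono2[OF KM])
    finally have g: "(2 * b + 8) * group_deg k y \<le> 126 * k" by simp
    have "m < 2 ^ m" by (rule less_exp)
    then have mk: "m \<le> k" using lK K1 by linarith
    have hk: "h \<le> 4 * k" using yk K1 k unfolding h_def prec_def K_def[symmetric] by linarith
    have "w2 \<le> 2 * (4 * k + 4 * k + 3 * k + k) + 126 * k"
      unfolding w2_def group_bits_def h_def[symmetric] m_def[symmetric]
      by (intro add_mono mult_le_mono2 g hk mk) (use k in auto)
    then have "(2 * w2 + 8) * (2 * m + 1) \<le> (308 * k) * (2 * bit_length K)"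
      by (intro mult_le_mono) (use k bl in simp_all)
    also have "\<dots> = 616 * (k * bit_length K)" by simp
    also have "\<dots> \<le> 616 * Z" using eb(8) by (intro mult_le_mono2)
    finally show ?thesis using A by linarith
  qed
  then have e: "(2 * w1 + 8) * (2 * \<beta> + 1) + (2 * w2 + 8) * (2 * m + 1) \<le> 24000 * Z" .
  have np: "next_prime (2 ^ w) ^ e \<le> 2 ^ ((2 * w + 8) * e)" for w e
    unfolding power_mult[of 2 "2 * w + 8"] using next_prime_power2_less[of w] by (intro power_mono) auto
  have "next_prime (2 ^ w1) ^ (2 * \<beta> + 1) * next_prime (2 ^ w2) ^ (2 * m + 1)
      \<le> 2 ^ ((2 * w1 + 8) * (2 * \<beta> + 1)) * 2 ^ ((2 * w2 + 8) * (2 * m + 1))"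
    by (intro mult_le_mono np)
  also have "\<dots> = 2 ^ ((2 * w1 + 8) * (2 * \<beta> + 1) + (2 * w2 + 8) * (2 * m + 1))" by (simp only: power_add)
  also have "\<dots> \<le> 2 ^ (24000 * Z)" using e by (intro power_increasing) auto
  finally show ?thesis unfolding w1_def w2_def \<beta>_def m_def Z_def .
qed

lemma seed_count_le:
  assumes k: "1 \<le> k"
  shows "seed_count k y (start_bits k y) \<le> 2 ^ (26000 * expo k y)"
proof -
  define X where "X = 96 * (prec k y + 2) + 24 * start_bits k y"
  have main: "b \<le> start_bits k y \<Longrightarrow> seed_count k y b \<le> 2 ^ (chain_length k y b * X + 24000 * expo k y)" for b
  proof (induction b rule: less_induct)
    case (less b)
    show ?case
    proof (cases "stop_bits k y < b")
      case True
      then have b: "1 < b" using stop_bits_ge[OF k, of y] by simp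
      have hb: "halve b < b" using b unfolding halve_def by simp
      have "next_prime (2 ^ b) ^ chain_deg k y b * seed_count k y (halve b) \<le> 2 ^ X * 2 ^ (chain_length k y (halve b) * X + 24000 * expo k y)"
        using chain_factor_le[OF k b less.prems] less.IH[OF hb] hb less.prems unfolding X_def by (intro mult_le_mono) auto
      then show ?thesis using True b
        by (simp add: seed_count.simps[of k y b] chain_length.simps[of k y b] power_add mult_ac)
    next
      case False
      then show ?thesis using final_factor_le[OF k less.prems]
        by (simp add: seed_count.simps[of k y b] chain_length.simps[of k y b])
    qed
  qed
  note eb = expo_bounds[OF k, of y]
  have "chain_length k y (start_bits k y) * X \<le> kap k * X" by (rule mult_le_mono1[OF chain_length_start[OF k]])
  also have "\<dots> = 96 * (kap k * prec k y) + 192 * kap k + 24 * (kap k * start_bits k y)" unfolding X_def by (simp add: algebra_simps)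
  also have "\<dots> \<le> 2000 * expo k y" using eb(7,11,12) by linarith
  finally have "chain_length k y (start_bits k y) * X + 24000 * expo k y \<le> 26000 * expo k y" by linarith
  then have "(2::nat) ^ (chain_length k y (start_bits k y) * X + 24000 * expo k y) \<le> 2 ^ (26000 * expo k y)"
    by (intro power_increasing) auto
  then show ?thesis using main[of "start_bits k y"] by linarith
qed

section \<open>Running programs on the word RAM\<close>

text \<open>The bound 200 exceeds all constants of the program, the largest of which is the base
  address 99 of the array, and it does not exceed the memory bound \<Omega> below.\<close>

fun small_consts :: "expr \<Rightarrow> bool" where
  "small_consts (Const c) \<longleftrightarrow> c \<le> 200"
| "small_consts (Load a) \<longleftrightarrow> small_consts a"
| "small_consts (Bin f a b) \<longleftrightarrow> small_consts a \<and> small_consts b"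
| "small_consts (LeParam a b) \<longleftrightarrow> small_consts a \<and> small_consts b"

definition small_expr :: "expr \<Rightarrow> bool" where
  "small_expr e \<longleftrightarrow> small_consts e \<and> cost e \<le> 60"

fun small_com :: "com \<Rightarrow> bool" where
  "small_com Skip \<longleftrightarrow> True"
| "small_com (Store a e) \<longleftrightarrow> small_expr a \<and> small_expr e"
| "small_com (Emit e) \<longleftrightarrow> small_expr e"
| "small_com (Seq c1 c2) \<longleftrightarrow> small_com c1 \<and> small_com c2"
| "small_com (Cond e c1 c2) \<longleftrightarrow> small_expr e \<and> small_com c1 \<and> small_com c2"
| "small_com (While e c) \<longleftrightarrow> small_expr e \<and> small_com c"

abbreviation V :: "nat \<Rightarrow> expr" where "V i \<equiv> Load (Const i)"
abbreviation asg :: "nat \<Rightarrow> expr \<Rightarrow> com" where "asg i e \<equiv> Store (Const i) e"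

text \<open>Counting down evaluates the limit once and makes the test a plain register. The body
  sees the values N, ..., 1.\<close>

definition for_loop :: "nat \<Rightarrow> expr \<Rightarrow> com \<Rightarrow> com" where
  "for_loop c e body = Seq (asg c e) (While (V c) (Seq body (asg c (Bin Sub (V c) (Const 1)))))"

text \<open>Since expressions have bounded size, a single bound on the contents of the memory implies that
  no intermediate value overflows.\<close>

locale ram =
  fixes w :: nat and \<delta> :: real and \<Omega> :: nat
  assumes \<Omega>_ge: "200 \<le> \<Omega>" and \<Omega>_fits: "\<Omega> ^ 60 < 2 ^ w"
begin

definition bounded_mem :: "mem \<Rightarrow> bool" where "bounded_mem m \<longleftrightarrow> (\<forall>a. m a \<le> \<Omega>)"

lemma bounded_memD: "bounded_mem m \<Longrightarrow> m a \<le> \<Omega>"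
  by (simp add: bounded_mem_def)

text \<open>Among the operations only sums and products can exceed their arguments, and these
  multiply the bounds of the arguments by at most \<Omega>. Subexpressions are cheaper, so the same
  estimate excludes an overflow of intermediate values.\<close>

lemma eval_le_power: "bounded_mem m \<Longrightarrow> small_consts e \<Longrightarrow> eval \<delta> m e \<le> \<Omega> ^ cost e"
proof (induction e)
  case (Const c)
  then show ?case using \<Omega>_ge by simp
next
  case (Load a)
  have "m (eval \<delta> m a) \<le> \<Omega> ^ 1" using Load bounded_memD by simp
  also have "\<dots> \<le> \<Omega> ^ cost (Load a)" using \<Omega>_ge by (intro power_increasing) auto
  finally show ?case by simp
next
  case (Bin f a b)
  define x y where "x = eval \<delta> m a" and "y = eval \<delta> m b"
  have xy: "x \<le> \<Omega> ^ cost a" "y \<le> \<Omega> ^ cost b" unfolding x_def y_def using Bin by auto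
  have ge: "\<Omega> ^ i \<ge> 1" for i using \<Omega>_ge by (simp add: Suc_le_eq)
  have mono: "\<Omega> ^ i \<le> \<Omega> ^ j" if "i \<le> j" for i j using that \<Omega>_ge by (intro power_increasing) auto
  have "x + y \<le> \<Omega> ^ (cost a + cost b) + \<Omega> ^ (cost a + cost b)"
    using xy mono[of "cost a" "cost a + cost b"] mono[of "cost b" "cost a + cost b"] by linarith
  also have "\<dots> \<le> \<Omega> * \<Omega> ^ (cost a + cost b)" using \<Omega>_ge by (simp flip: mult_2)
  finally have s: "x + y \<le> \<Omega> ^ (1 + cost a + cost b)" by simp
  have "x * y \<le> \<Omega> ^ (cost a + cost b)" unfolding power_add using xy by (rule mult_le_mono)
  also have "\<dots> \<le> \<Omega> ^ (1 + cost a + cost b)" by (rule mono) simp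
  finally have p: "x * y \<le> \<Omega> ^ (1 + cost a + cost b)" .
  have "binop_val f x y \<le> \<Omega> ^ (1 + cost a + cost b)"
  proof (cases f)
    case Div
    have "x div y \<le> \<Omega> ^ (1 + cost a + cost b)" using s div_le_dividend[of x y] by linarith
    then show ?thesis using Div by (simp only: binop_val.simps)
  next
    case Mod
    have "x mod y \<le> \<Omega> ^ (1 + cost a + cost b)" using s mod_less_eq_dividend[of x y] by linarith
    then show ?thesis using Mod by (simp only: binop_val.simps)
  qed (use s p ge[of "1 + cost a + cost b"] in \<open>auto simp: of_bool_def\<close>)
  then show ?case unfolding x_def y_def by simp
next
  case (LeParam a b)
  have "\<Omega> ^ cost (LeParam a b) \<ge> 1" using \<Omega>_ge by (simp add: Suc_le_eq)
  then show ?case by (simp add: of_bool_def)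
qed

lemma power_cost_fits: "cost e \<le> 60 \<Longrightarrow> x \<le> \<Omega> ^ cost e \<Longrightarrow> x < 2 ^ w"
  using \<Omega>_fits power_increasing[of "cost e" 60 \<Omega>] \<Omega>_ge by linarith

lemma fits_small: "bounded_mem m \<Longrightarrow> small_consts e \<Longrightarrow> cost e \<le> 60 \<Longrightarrow> fits w \<delta> m e"
proof (induction e)
  case (Const c)
  then show ?case using power_cost_fits[OF Const(3) eval_le_power[OF Const(1,2)]] by simp
next
  case (Load a)
  then show ?case using power_cost_fits[OF Load(4) eval_le_power[OF Load(2,3)]] by simp
next
  case (Bin f a b)
  then show ?case using power_cost_fits[OF Bin(5) eval_le_power[OF Bin(3,4)]] by simp
next
  case (LeParam a b)
  then show ?case using power_cost_fits[OF LeParam(5) eval_le_power[OF LeParam(3,4)]] by simp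
qed

text \<open>Total correctness with a time bound and with the output that is appended. The bounds on
  the expressions and on the memory are premises inside the definition, so the rules need not carry
  them; they are discharged once, for the whole program.\<close>

definition run :: "com \<Rightarrow> mem \<Rightarrow> nat \<Rightarrow> (mem \<Rightarrow> nat list \<Rightarrow> bool) \<Rightarrow> bool" where
  "run c m T Q \<longleftrightarrow> (small_com c \<longrightarrow> bounded_mem m \<longrightarrow>
     (\<forall>out. \<exists>t m' os. exec w \<delta> c (m, out) t (m', out @ os) \<and> t \<le> T \<and> bounded_mem m' \<and> Q m' os))"

lemma runI:
  "(\<And>out. small_com c \<Longrightarrow> bounded_mem m \<Longrightarrow>
     \<exists>t m' os. exec w \<delta> c (m, out) t (m', out @ os) \<and> t \<le> T \<and> bounded_mem m' \<and> Q m' os) \<Longrightarrow> run c m T Q"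
  unfolding run_def by blast

lemma runE:
  assumes "run c m T Q" "small_com c" "bounded_mem m"
  obtains t m' os where "exec w \<delta> c (m, out) t (m', out @ os)" "t \<le> T" "bounded_mem m'" "Q m' os"
  using assms unfolding run_def by blast

text \<open>Gives access to the hidden memory bound where a value copied or derived from a cell has
  to be shown to be at most \<Omega>.\<close>

lemma run_bounded: "(bounded_mem m \<Longrightarrow> run c m T Q) \<Longrightarrow> run c m T Q"
  unfolding run_def by blast

lemma run_mono:
  assumes "run c m T Q" "T \<le> T'" "\<And>m' os. Q m' os \<Longrightarrow> Q' m' os"
  shows "run c m T' Q'"
proof (rule runI)
  fix out assume "small_com c" "bounded_mem m"
  with assms(1) obtain t m' os where "exec w \<delta> c (m, out) t (m', out @ os)" "t \<le> T" "bounded_mem m'" "Q m' os"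
    by (rule runE)
  then show "\<exists>t m' os. exec w \<delta> c (m, out) t (m', out @ os) \<and> t \<le> T' \<and> bounded_mem m' \<and> Q' m' os"
    using assms(2,3) by (intro exI[of _ t] exI[of _ m'] exI[of _ os]) auto
qed

lemma run_skip: "Q m [] \<Longrightarrow> run Skip m 1 Q"
proof (rule runI)
  fix out assume "Q m []" "bounded_mem m"
  then show "\<exists>t m' os. exec w \<delta> Skip (m, out) t (m', out @ os) \<and> t \<le> 1 \<and> bounded_mem m' \<and> Q m' os"
    using exec.Skip[of w \<delta> "(m, out)"] by (intro exI[of _ 1] exI[of _ m] exI[of _ "[]"]) simp
qed

lemma run_store:
  assumes "eval \<delta> m e \<le> \<Omega>" "Q (m(eval \<delta> m a := eval \<delta> m e)) []"
  shows "run (Store a e) m 128 Q"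
proof (rule runI)
  fix out assume *: "small_com (Store a e)" "bounded_mem m"
  then have "exec w \<delta> (Store a e) (m, out) (1 + cost a + cost e) (m(eval \<delta> m a := eval \<delta> m e), out)"
    by (intro exec.Store fits_small) (auto simp: small_expr_def)
  then show "\<exists>t m' os. exec w \<delta> (Store a e) (m, out) t (m', out @ os) \<and> t \<le> 128 \<and> bounded_mem m' \<and> Q m' os"
    using assms * by (intro exI[of _ "1 + cost a + cost e"] exI[of _ "m(eval \<delta> m a := eval \<delta> m e)"] exI[of _ "[]"])
      (auto simp: small_expr_def bounded_mem_def)
qed

lemma run_emit:
  assumes "Q m [eval \<delta> m e]"
  shows "run (Emit e) m 64 Q"
proof (rule runI)
  fix out assume *: "small_com (Emit e)" "bounded_mem m"
  then have "exec w \<delta> (Emit e) (m, out) (1 + cost e) (m, out @ [eval \<delta> m e])"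
    by (intro exec.Emit fits_small) (auto simp: small_expr_def)
  then show "\<exists>t m' os. exec w \<delta> (Emit e) (m, out) t (m', out @ os) \<and> t \<le> 64 \<and> bounded_mem m' \<and> Q m' os"
    using assms * by (intro exI[of _ "1 + cost e"] exI[of _ m] exI[of _ "[eval \<delta> m e]"])
      (auto simp: small_expr_def)
qed

lemma run_seq:
  assumes "run c1 m T1 (\<lambda>m1 o1. run c2 m1 T2 (\<lambda>m2 o2. Q m2 (o1 @ o2)))"
  shows "run (Seq c1 c2) m (T1 + T2) Q"
proof (rule runI)
  fix out assume *: "small_com (Seq c1 c2)" "bounded_mem m"
  obtain t1 m1 o1 where 1: "exec w \<delta> c1 (m, out) t1 (m1, out @ o1)" "t1 \<le> T1" "bounded_mem m1"
    "run c2 m1 T2 (\<lambda>m2 o2. Q m2 (o1 @ o2))"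
    using assms by (rule runE) (use * in auto)
  obtain t2 m2 o2 where 2: "exec w \<delta> c2 (m1, out @ o1) t2 (m2, (out @ o1) @ o2)" "t2 \<le> T2" "bounded_mem m2" "Q m2 (o1 @ o2)"
    using 1(4) by (rule runE[where out = "out @ o1"]) (use * 1 in auto)
  show "\<exists>t m' os. exec w \<delta> (Seq c1 c2) (m, out) t (m', out @ os) \<and> t \<le> T1 + T2 \<and> bounded_mem m' \<and> Q m' os"
    using exec.Seq[OF 1(1) 2(1)] 1 2 by (intro exI[of _ "t1 + t2"] exI[of _ m2] exI[of _ "o1 @ o2"]) auto
qed

lemma run_cond:
  assumes "eval \<delta> m e \<noteq> 0 \<Longrightarrow> run c1 m T Q" "eval \<delta> m e = 0 \<Longrightarrow> run c2 m T Q"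
  shows "run (Cond e c1 c2) m (T + 64) Q"
proof (rule runI)
  fix out assume *: "small_com (Cond e c1 c2)" "bounded_mem m"
  then have f: "fits w \<delta> m e" "cost e \<le> 60" by (auto intro: fits_small simp: small_expr_def)
  show "\<exists>t m' os. exec w \<delta> (Cond e c1 c2) (m, out) t (m', out @ os) \<and> t \<le> T + 64 \<and> bounded_mem m' \<and> Q m' os"
  proof (cases "eval \<delta> m e = 0")
    case True
    obtain t m' os where 1: "exec w \<delta> c2 (m, out) t (m', out @ os)" "t \<le> T" "bounded_mem m'" "Q m' os"
      using assms(2)[OF True] by (rule runE) (use * in auto)
    show ?thesis using exec.CondFalse[OF f(1) True 1(1)] 1 f by (intro exI[of _ "1 + cost e + t"] exI[of _ m'] exI[of _ os]) auto
  next
    case False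
    obtain t m' os where 1: "exec w \<delta> c1 (m, out) t (m', out @ os)" "t \<le> T" "bounded_mem m'" "Q m' os"
      using assms(1)[OF False] by (rule runE) (use * in auto)
    show ?thesis using exec.CondTrue[OF f(1) False 1(1)] 1 f by (intro exI[of _ "1 + cost e + t"] exI[of _ m'] exI[of _ os]) auto
  qed
qed

text \<open>The first argument of the invariant is a strictly decreasing variant; its initial value
  bounds the number of iterations and hence the time. The constant 64 covers one test, as a
  condition costs at most 60.\<close>

lemma run_while:
  fixes I :: "nat \<Rightarrow> mem \<Rightarrow> nat list \<Rightarrow> bool"
  assumes step: "\<And>v m os. I v m os \<Longrightarrow> eval \<delta> m e \<noteq> 0 \<Longrightarrow> run c m T (\<lambda>m' o'. \<exists>v'<v. I v' m' (os @ o'))"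
    and stop: "\<And>v m os. I v m os \<Longrightarrow> eval \<delta> m e = 0 \<Longrightarrow> Q m os"
    and init: "I v m []"
  shows "run (While e c) m (v * (T + 64) + 64) Q"
proof -
  have "I v m os \<Longrightarrow> run (While e c) m (v * (T + 64) + 64) (\<lambda>m' o'. Q m' (os @ o'))" for v m os
  proof (induction v arbitrary: m os rule: less_induct)
    case (less v)
    show ?case
    proof (rule runI)
      fix out assume *: "small_com (While e c)" "bounded_mem m"
      then have f: "fits w \<delta> m e" "cost e \<le> 60" by (auto intro: fits_small simp: small_expr_def)
      show "\<exists>t m' o'. exec w \<delta> (While e c) (m, out) t (m', out @ o') \<and> t \<le> v * (T + 64) + 64 \<and> bounded_mem m' \<and> Q m' (os @ o')"
      proof (cases "eval \<delta> m e = 0")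
        case True
        then show ?thesis using exec.WhileFalse[OF f(1) True, of c out] f stop[OF less.prems True] *
          by (intro exI[of _ "1 + cost e"] exI[of _ m] exI[of _ "[]"]) auto
      next
        case False
        obtain t1 m1 o1 where 1: "exec w \<delta> c (m, out) t1 (m1, out @ o1)" "t1 \<le> T" "bounded_mem m1" "\<exists>v'<v. I v' m1 (os @ o1)"
          using step[OF less.prems False] by (rule runE) (use * in auto)
        then obtain v' where v': "v' < v" "I v' m1 (os @ o1)" by blast
        obtain t2 m2 o2 where 2: "exec w \<delta> (While e c) (m1, out @ o1) t2 (m2, (out @ o1) @ o2)" "t2 \<le> v' * (T + 64) + 64"
          "bounded_mem m2" "Q m2 ((os @ o1) @ o2)"
          using less.IH[OF v'] by (rule runE[where out = "out @ o1"]) (use * 1 in auto)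
        have "Suc v' * (T + 64) \<le> v * (T + 64)" using v'(1) by (intro mult_le_mono1) simp
        then show ?thesis using exec.WhileTrue[OF f(1) False 1(1) 2(1)] 1 2 f
          by (intro exI[of _ "1 + cost e + t1 + t2"] exI[of _ m2] exI[of _ "o1 @ o2"]) auto
      qed
    qed
  qed
  from this[OF init] show ?thesis by simp
qed

lemma run_asg:
  assumes "eval \<delta> m e \<le> \<Omega>" "Q (m(i := eval \<delta> m e)) []"
  shows "run (asg i e) m 128 Q"
  by (rule run_store) (use assms in auto)

text \<open>The invariant is demanded for the memory with the counter already decreased. The
  overhead 192 = 128 + 64 pays for the assignment and the test.\<close>

lemma run_for:
  fixes I :: "nat \<Rightarrow> mem \<Rightarrow> nat list \<Rightarrow> bool"
  assumes N: "eval \<delta> m e = N" "N \<le> \<Omega>"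
    and init: "I N (m(c := N)) []"
    and step: "\<And>j m os. I (Suc j) m os \<Longrightarrow> m c = Suc j \<Longrightarrow> j < N \<Longrightarrow>
      run body m T (\<lambda>m' o'. m' c = Suc j \<and> I j (m'(c := j)) (os @ o'))"
    and stop: "\<And>m os. I 0 m os \<Longrightarrow> m c = 0 \<Longrightarrow> Q m os"
  shows "run (for_loop c e body) m (N * (T + 192) + 192) Q"
proof -
  have "run (for_loop c e body) m (128 + (N * ((T + 128) + 64) + 64)) Q"
    unfolding for_loop_def
  proof (intro run_seq run_asg)
    show "eval \<delta> m e \<le> \<Omega>" using N by simp
    show "run (While (V c) (Seq body (asg c (Bin Sub (V c) (Const 1))))) (m(c := eval \<delta> m e)) (N * ((T + 128) + 64) + 64) (\<lambda>m2 o2. Q m2 ([] @ o2))"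
    proof (rule run_while[where I = "\<lambda>v m os. I v m os \<and> m c = v \<and> v \<le> N"])
      show "I N (m(c := eval \<delta> m e)) [] \<and> (m(c := eval \<delta> m e)) c = N \<and> N \<le> N" using N init by simp
      fix v m os assume I: "I v m os \<and> m c = v \<and> v \<le> N"
      {
        assume "eval \<delta> m (V c) = 0"
        then show "Q m ([] @ os)" using I stop by simp
      }
      assume "eval \<delta> m (V c) \<noteq> 0"
      then obtain j where j: "v = Suc j" using I by (cases v) auto
      show "run (Seq body (asg c (Bin Sub (V c) (Const 1)))) m (T + 128) (\<lambda>m' o'. \<exists>v'<v. I v' m' (os @ o') \<and> m' c = v' \<and> v' \<le> N)"
      proof (intro run_seq)
        show "run body m T (\<lambda>m1 o1. run (asg c (Bin Sub (V c) (Const 1))) m1 128 (\<lambda>m2 o2. \<exists>v'<v. I v' m2 (os @ o1 @ o2) \<and> m2 c = v' \<and> v' \<le> N))"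
        proof (rule run_mono[OF step[of j m os] order.refl])
          show "I (Suc j) m os" "m c = Suc j" "j < N" using I j by auto
          fix m' o' assume m': "m' c = Suc j \<and> I j (m'(c := j)) (os @ o')"
          show "run (asg c (Bin Sub (V c) (Const 1))) m' 128 (\<lambda>m2 o2. \<exists>v'<v. I v' m2 (os @ o' @ o2) \<and> m2 c = v' \<and> v' \<le> N)"
            by (rule run_asg) (use m' j I N in auto)
        qed
      qed
    qed
  qed
  then show ?thesis by (rule run_mono) (auto simp: algebra_simps)
qed

text \<open>Runs without output, the case of all subroutines below the loops that list the
  tables.\<close>

definition srun :: "com \<Rightarrow> mem \<Rightarrow> nat \<Rightarrow> (mem \<Rightarrow> bool) \<Rightarrow> bool" where
  "srun c m T Q \<longleftrightarrow> run c m T (\<lambda>m' os. os = [] \<and> Q m')"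

lemma srun_bounded: "(bounded_mem m \<Longrightarrow> srun c m T Q) \<Longrightarrow> srun c m T Q"
  unfolding srun_def by (rule run_bounded)

lemma srun_mono: "srun c m T Q \<Longrightarrow> T \<le> T' \<Longrightarrow> (\<And>m'. Q m' \<Longrightarrow> Q' m') \<Longrightarrow> srun c m T' Q'"
  unfolding srun_def by (erule run_mono) auto

lemma srun_time: "srun c m T Q \<Longrightarrow> T \<le> T' \<Longrightarrow> srun c m T' Q"
  by (rule srun_mono)

lemma srun_skip: "Q m \<Longrightarrow> srun Skip m 1 Q"
  unfolding srun_def by (rule run_skip) simp

lemma srun_store: "eval \<delta> m e \<le> \<Omega> \<Longrightarrow> Q (m(eval \<delta> m a := eval \<delta> m e)) \<Longrightarrow> srun (Store a e) m 128 Q"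
  unfolding srun_def by (rule run_store) auto

lemma srun_asg: "eval \<delta> m e \<le> \<Omega> \<Longrightarrow> Q (m(i := eval \<delta> m e)) \<Longrightarrow> srun (asg i e) m 128 Q"
  unfolding srun_def by (rule run_asg) auto

lemma run_seq_silent: "srun c1 m T1 (\<lambda>m1. run c2 m1 T2 Q) \<Longrightarrow> run (Seq c1 c2) m (T1 + T2) Q"
  unfolding srun_def by (rule run_seq, erule run_mono) auto

lemma srun_seq: "srun c1 m T1 (\<lambda>m1. srun c2 m1 T2 Q) \<Longrightarrow> srun (Seq c1 c2) m (T1 + T2) Q"
  unfolding srun_def[of "Seq c1 c2"] by (rule run_seq_silent) (simp add: srun_def)

lemma srun_cond:
  "(eval \<delta> m e \<noteq> 0 \<Longrightarrow> srun c1 m T Q) \<Longrightarrow> (eval \<delta> m e = 0 \<Longrightarrow> srun c2 m T Q) \<Longrightarrow> srun (Cond e c1 c2) m (T + 64) Q"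
  unfolding srun_def by (rule run_cond)

lemma srun_while:
  fixes I :: "nat \<Rightarrow> mem \<Rightarrow> bool"
  assumes "\<And>v m. I v m \<Longrightarrow> eval \<delta> m e \<noteq> 0 \<Longrightarrow> srun c m T (\<lambda>m'. \<exists>v'<v. I v' m')"
    and "\<And>v m. I v m \<Longrightarrow> eval \<delta> m e = 0 \<Longrightarrow> Q m" and "I v m"
  shows "srun (While e c) m (v * (T + 64) + 64) Q"
  unfolding srun_def
proof (rule run_while[where I = "\<lambda>v m os. os = [] \<and> I v m"])
  fix v m and os :: "nat list" assume I: "os = [] \<and> I v m" and "eval \<delta> m e \<noteq> 0"
  then have "srun c m T (\<lambda>m'. \<exists>v'<v. I v' m')" using assms(1) by blast
  then show "run c m T (\<lambda>m' o'. \<exists>v'<v. os @ o' = [] \<and> I v' m')"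
    unfolding srun_def by (rule run_mono) (use I in auto)
qed (use assms(2,3) in auto)

lemma srun_for:
  fixes I :: "nat \<Rightarrow> mem \<Rightarrow> bool"
  assumes "eval \<delta> m e = N" "N \<le> \<Omega>" "I N (m(c := N))"
    and "\<And>j m. I (Suc j) m \<Longrightarrow> m c = Suc j \<Longrightarrow> j < N \<Longrightarrow> srun body m T (\<lambda>m'. m' c = Suc j \<and> I j (m'(c := j)))"
    and "\<And>m. I 0 m \<Longrightarrow> m c = 0 \<Longrightarrow> Q m"
  shows "srun (for_loop c e body) m (N * (T + 192) + 192) Q"
  unfolding srun_def
proof (rule run_for[where I = "\<lambda>v m os. os = [] \<and> I v m"])
  fix j m and os :: "nat list" assume I: "os = [] \<and> I (Suc j) m" and "m c = Suc j" "j < N"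
  then have "srun body m T (\<lambda>m'. m' c = Suc j \<and> I j (m'(c := j)))" using assms(4) by blast
  then show "run body m T (\<lambda>m' o'. m' c = Suc j \<and> os @ o' = [] \<and> I j (m'(c := j)))"
    unfolding srun_def by (rule run_mono) (use I in auto)
qed (use assms(1,2,3,5) in auto)

end

section \<open>Arithmetic subroutines\<close>

abbreviation seq_com (infixr ";;" 60) where "c ;; d \<equiv> Seq c d"
abbreviation asg_com (infix "::=" 62) where "i ::= e \<equiv> asg i e"
abbreviation add_expr (infixl "[+]" 65) where "a [+] b \<equiv> Bin Add a b"
abbreviation sub_expr (infixl "[-]" 65) where "a [-] b \<equiv> Bin Sub a b"
abbreviation mul_expr (infixl "[*]" 70) where "a [*] b \<equiv> Bin Mul a b"
abbreviation div_expr (infixl "[div]" 70) where "a [div] b \<equiv> Bin Div a b"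
abbreviation mod_expr (infixl "[mod]" 70) where "a [mod] b \<equiv> Bin Mod a b"
abbreviation less_expr (infix "[<]" 64) where "a [<] b \<equiv> Bin Less a b"
abbreviation eq_expr (infix "[=]" 64) where "a [=] b \<equiv> Bin Equal a b"

abbreviation "rN \<equiv> 10 :: nat"
abbreviation "rQ \<equiv> 11 :: nat"
abbreviation "rE \<equiv> 12 :: nat"
abbreviation "rP \<equiv> 13 :: nat"
abbreviation "rD \<equiv> 14 :: nat"
abbreviation "rX \<equiv> 15 :: nat"
abbreviation "rS \<equiv> 16 :: nat"
abbreviation "rA \<equiv> 17 :: nat"
abbreviation "rW \<equiv> 18 :: nat"
abbreviation "rC \<equiv> 19 :: nat"
abbreviation "rB \<equiv> 20 :: nat"
abbreviation "rJ \<equiv> 21 :: nat"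
abbreviation "rR \<equiv> 22 :: nat"

definition frame :: "nat set \<Rightarrow> mem \<Rightarrow> mem \<Rightarrow> bool" where
  "frame X m m' \<longleftrightarrow> (\<forall>a. a \<notin> X \<longrightarrow> m' a = m a)"

lemma frameD: "frame X m m' \<Longrightarrow> a \<notin> X \<Longrightarrow> m' a = m a"
  by (simp add: frame_def)

lemma frame_trans: "frame X m m' \<Longrightarrow> frame Y m' m'' \<Longrightarrow> X \<subseteq> Z \<Longrightarrow> Y \<subseteq> Z \<Longrightarrow> frame Z m m''"
  unfolding frame_def by (metis subsetD)

lemma frame_refl: "frame X m m"
  unfolding frame_def by simp

text \<open>Starts from the lowest coefficient and strips the digits off \<open>rS\<close>, which
  finally holds the unread rest of the seed for the next stage.\<close>

definition poly_com :: com where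
  "poly_com = rA ::= Const 0 ;; rW ::= Const 1 ;;
     for_loop rC (V rD)
       (rA ::= (V rA [+] (V rS [mod] V rP) [*] V rW) [mod] V rP ;;
        rW ::= (V rW [*] V rX) [mod] V rP ;;
        rS ::= V rS [div] V rP)"

definition nisan_com :: com where
  "nisan_com = rA ::= V rS [mod] V rP ;; rS ::= V rS [div] V rP ;;
     for_loop rC (V rB)
       (Cond (V rJ [mod] Const 2)
          (rA ::= (V rS [mod] V rP [+] (V rS [div] V rP) [mod] V rP [*] V rA) [mod] V rP) Skip ;;
        rS ::= V rS [div] (V rP [*] V rP) ;;
        rJ ::= V rJ [div] Const 2)"

definition pow2_com :: com where
  "pow2_com = rN ::= Const 1 ;; for_loop rC (V rE) (rN ::= V rN [*] Const 2)"

definition next_prime_com :: com where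
  "next_prime_com = rQ ::= Const 2 ;;
     While (V rQ [<] V rN)
       (Cond (V rN [mod] V rQ [=] Const 0)
          (rN ::= V rN [+] Const 1 ;; rQ ::= Const 2)
          (rQ ::= V rQ [+] Const 1))"

text \<open>Executed after each stage of the hash with the number of its seeds. The total number of
  seeds is thus a by-product of every evaluation and needs no recursion of its own.\<close>

definition mul_pow_com :: com where
  "mul_pow_com = for_loop rC (V rD) (rR ::= V rR [*] V rP)"

definition bit_length_com :: com where
  "bit_length_com = rE ::= Const 0 ;; rQ ::= Const 1 ;;
     While ((V rN [<] V rQ) [=] Const 0) (rQ ::= V rQ [*] Const 2 ;; rE ::= V rE [+] Const 1)"

lemma poly_hash_Suc:
  "poly_hash p (Suc i) s x = (poly_hash p i s x + (s div p ^ i mod p) * (x ^ i mod p)) mod p"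
proof -
  have "(a mod p + b * (c mod p)) mod p = (a + b * c) mod p" for a b c :: nat
  proof -
    have "(a mod p + b * (c mod p)) mod p = (a + (b * (c mod p)) mod p) mod p"
      by (simp only: mod_add_left_eq mod_add_right_eq)
    then show ?thesis by (simp only: mod_mult_right_eq mod_add_right_eq)
  qed
  then show ?thesis unfolding poly_hash_def sum.lessThan_Suc by simp
qed

lemma poly_hash_two: "poly_hash p 2 s x = (s mod p + (s div p) mod p * x) mod p"
  unfolding poly_hash_def by (simp add: numeral_2_eq_2)

context ram
begin

lemma srun_poly:
  assumes m: "m rP = p" "2 \<le> p" "m rD = d" "m rS = s" "m rX = x"
    and Q: "\<And>m'. frame {rS, rA, rW, rC} m m' \<Longrightarrow> m' rA = poly_hash p d s x \<Longrightarrow> m' rS = s div p ^ d \<Longrightarrow> Q m'"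
  shows "srun poly_com m (d * 600 + 500) Q"
proof (rule srun_bounded)
  assume b: "bounded_mem m"
  have O: "p \<le> \<Omega>" "d \<le> \<Omega>" "s \<le> \<Omega>" "1 \<le> \<Omega>" using bounded_memD[OF b] m \<Omega>_ge by auto
  have modl: "a mod p \<le> \<Omega>" for a using O m mod_less_divisor[of p a] by linarith
  have sw: "s div a div p = s div p div a" for a by (simp only: div_mult2_eq[symmetric] mult.commute)
  define I where "I j m' \<longleftrightarrow> frame {rS, rA, rW, rC} m m' \<and> j \<le> d \<and> m' rA = poly_hash p (d - j) s x \<and>
    m' rW = x ^ (d - j) mod p \<and> m' rS = s div p ^ (d - j)" for j m'
  have "srun poly_com m (128 + (128 + (d * ((128 + (128 + 128)) + 192) + 192))) Q"
    unfolding poly_com_def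
  proof (intro srun_seq srun_asg)
    show "eval \<delta> m (Const 0) \<le> \<Omega>" by simp
    show "eval \<delta> (m(rA := eval \<delta> m (Const 0))) (Const 1) \<le> \<Omega>" using O by simp
    show "srun (for_loop rC (V rD) (rA ::= (V rA [+] (V rS [mod] V rP) [*] V rW) [mod] V rP ;;
        rW ::= (V rW [*] V rX) [mod] V rP ;; rS ::= V rS [div] V rP))
      (m(rA := eval \<delta> m (Const 0), rW := eval \<delta> (m(rA := eval \<delta> m (Const 0))) (Const 1)))
      (d * ((128 + (128 + 128)) + 192) + 192) Q"
    proof (rule srun_for[where I = I])
      show "I d ((m(rA := eval \<delta> m (Const 0), rW := eval \<delta> (m(rA := eval \<delta> m (Const 0))) (Const 1)))(rC := d))"
        unfolding I_def using m by (auto simp: frame_def poly_hash_def)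
      fix j m1 assume I: "I (Suc j) m1" and c: "m1 rC = Suc j" and j: "j < d"
      have i: "d - j = Suc (d - Suc j)" using j by simp
      have m1: "m1 rP = p" "m1 rX = x" using I m unfolding I_def frame_def by auto
      show "srun (rA ::= (V rA [+] (V rS [mod] V rP) [*] V rW) [mod] V rP ;; rW ::= (V rW [*] V rX) [mod] V rP ;; rS ::= V rS [div] V rP)
        m1 (128 + (128 + 128)) (\<lambda>m'. m' rC = Suc j \<and> I j (m'(rC := j)))"
      proof (intro srun_seq srun_asg)
        show "eval \<delta> m1 ((V rA [+] (V rS [mod] V rP) [*] V rW) [mod] V rP) \<le> \<Omega>" using m1 modl by simp
        show "eval \<delta> (m1(rA := eval \<delta> m1 ((V rA [+] (V rS [mod] V rP) [*] V rW) [mod] V rP))) ((V rW [*] V rX) [mod] V rP) \<le> \<Omega>"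
          using m1 modl by simp
      qed (use I c j m1 O div_le_dividend[of s] sw in \<open>auto simp: I_def frame_def i poly_hash_Suc mult.commute mod_mult_left_eq
          mod_mult_right_eq div_mult2_eq intro: order.trans[OF div_le_dividend]\<close>)
    qed (use m O in \<open>auto simp: I_def intro: Q\<close>)
  qed
  then show ?thesis by (rule srun_time) simp
qed

lemma srun_nisan:
  assumes m: "m rP = p" "2 \<le> p" "m rB = b" "m rS = s" "m rJ = j0"
    and Q: "\<And>m'. frame {rS, rA, rJ, rC} m m' \<Longrightarrow> m' rA = nisan p b s j0 \<Longrightarrow> m' rS = s div p ^ (2 * b + 1) \<Longrightarrow> Q m'"
  shows "srun nisan_com m (b * 700 + 500) Q"
proof (rule srun_bounded)
  assume bd: "bounded_mem m"
  have O: "p \<le> \<Omega>" "b \<le> \<Omega>" "s \<le> \<Omega>" "j0 \<le> \<Omega>" "1 \<le> \<Omega>" using bounded_memD[OF bd] m \<Omega>_ge by auto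
  have modl: "a mod p \<le> \<Omega>" for a using O m mod_less_divisor[of p a] by linarith
  have divl: "s div a \<le> \<Omega>" for a using O div_le_dividend[of s a] by linarith
  \<comment> \<open>The invariant says that continuing from the current registers gives the desired
    word; no closed form of the intermediate words is required.\<close>
  define I where "I i m' \<longleftrightarrow> frame {rS, rA, rJ, rC} m m' \<and> i \<le> b \<and> m' rJ \<le> \<Omega> \<and>
    nisan_steps p i (m' rA) (m' rJ) (m' rS) = nisan p b s j0 \<and> m' rS = s div p ^ (2 * (b - i) + 1)" for i m'
  have "srun nisan_com m (128 + (128 + (b * (((128 + 64) + (128 + 128)) + 192) + 192))) Q"
    unfolding nisan_com_def
  proof (intro srun_seq srun_asg)
    show "srun (for_loop rC (V rB) (Cond (V rJ [mod] Const 2)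
          (rA ::= (V rS [mod] V rP [+] (V rS [div] V rP) [mod] V rP [*] V rA) [mod] V rP) Skip ;;
        rS ::= V rS [div] (V rP [*] V rP) ;; rJ ::= V rJ [div] Const 2))
      (m(rA := eval \<delta> m (V rS [mod] V rP), rS := eval \<delta> (m(rA := eval \<delta> m (V rS [mod] V rP))) (V rS [div] V rP)))
      (b * (((128 + 64) + (128 + 128)) + 192) + 192) Q"
    proof (rule srun_for[where I = I])
      show "I b ((m(rA := eval \<delta> m (V rS [mod] V rP), rS := eval \<delta> (m(rA := eval \<delta> m (V rS [mod] V rP))) (V rS [div] V rP)))(rC := b))"
        unfolding I_def nisan_def using m O by (auto simp: frame_def)
      fix i m1 assume I: "I (Suc i) m1" and c: "m1 rC = Suc i" and i: "i < b"
      have e: "2 * (b - i) + 1 = (2 * (b - Suc i) + 1) + 2" using i by simp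
      have m1: "m1 rP = p" using I m unfolding I_def frame_def by auto
      have sS: "m1 rS div (p * p) = s div p ^ (2 * (b - i) + 1)"
        using I unfolding I_def e by (simp only: power_add power2_eq_square div_mult2_eq[symmetric])
      show "srun (Cond (V rJ [mod] Const 2)
          (rA ::= (V rS [mod] V rP [+] (V rS [div] V rP) [mod] V rP [*] V rA) [mod] V rP) Skip ;;
        rS ::= V rS [div] (V rP [*] V rP) ;; rJ ::= V rJ [div] Const 2)
        m1 ((128 + 64) + (128 + 128)) (\<lambda>m'. m' rC = Suc i \<and> I i (m'(rC := i)))"
      proof (intro srun_seq srun_cond)
        assume od: "eval \<delta> m1 (V rJ [mod] Const 2) \<noteq> 0"
        show "srun (rA ::= (V rS [mod] V rP [+] (V rS [div] V rP) [mod] V rP [*] V rA) [mod] V rP) m1 128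
          (\<lambda>m1. srun (rS ::= V rS [div] (V rP [*] V rP) ;; rJ ::= V rJ [div] Const 2) m1 (128 + 128) (\<lambda>m'. m' rC = Suc i \<and> I i (m'(rC := i))))"
          by (intro srun_asg srun_seq)
             (use I c i m1 O od modl divl sS in \<open>auto simp: I_def frame_def poly_hash_two power2_eq_square odd_iff_mod_2_eq_one\<close>)
      next
        assume ev: "eval \<delta> m1 (V rJ [mod] Const 2) = 0"
        show "srun Skip m1 128 (\<lambda>m1. srun (rS ::= V rS [div] (V rP [*] V rP) ;; rJ ::= V rJ [div] Const 2) m1 (128 + 128) (\<lambda>m'. m' rC = Suc i \<and> I i (m'(rC := i))))"
          by (rule srun_time[OF srun_skip], intro srun_asg srun_seq)
             (use I c i m1 O ev divl sS in \<open>auto simp: I_def frame_def power2_eq_square even_iff_mod_2_eq_zero\<close>)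
      qed
    qed (use m O in \<open>auto simp: I_def intro: Q\<close>)
  qed (use m O modl divl in auto)
  then show ?thesis by (rule srun_time) simp
qed

lemma srun_pow2:
  assumes m: "m rE = e" "2 ^ e \<le> \<Omega>"
    and Q: "\<And>m'. frame {rN, rC} m m' \<Longrightarrow> m' rN = 2 ^ e \<Longrightarrow> Q m'"
  shows "srun pow2_com m (e * 400 + 400) Q"
proof -
  have O: "e \<le> \<Omega>" "1 \<le> \<Omega>" using less_exp[of e] m(2) \<Omega>_ge by linarith+
  define I where "I j m' \<longleftrightarrow> frame {rN, rC} m m' \<and> j \<le> e \<and> m' rN = 2 ^ (e - j)" for j m'
  have "srun pow2_com m (128 + (e * (128 + 192) + 192)) Q"
    unfolding pow2_com_def
  proof (intro srun_seq srun_asg)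
    show "srun (for_loop rC (V rE) (rN ::= V rN [*] Const 2)) (m(rN := eval \<delta> m (Const 1))) (e * (128 + 192) + 192) Q"
    proof (rule srun_for[where I = I])
      fix j m1 assume I: "I (Suc j) m1" and c: "m1 rC = Suc j" and j: "j < e"
      have i: "e - j = Suc (e - Suc j)" using j by simp
      have "(2::nat) ^ (e - j) \<le> 2 ^ e" by (rule power_increasing) auto
      then have le: "2 * 2 ^ (e - Suc j) \<le> \<Omega>" using m unfolding i by simp
      show "srun (rN ::= V rN [*] Const 2) m1 128 (\<lambda>m'. m' rC = Suc j \<and> I j (m'(rC := j)))"
        by (rule srun_asg) (use I c j le in \<open>auto simp: I_def frame_def i\<close>)
    qed (use m O in \<open>auto simp: I_def frame_def intro: Q\<close>)
  qed (use O in auto)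
  then show ?thesis by (rule srun_time) simp
qed

lemma srun_mul_pow:
  assumes m: "m rP = p" "1 \<le> p" "m rD = d" "m rR = r" "r * p ^ d \<le> \<Omega>"
    and Q: "\<And>m'. frame {rR, rC} m m' \<Longrightarrow> m' rR = r * p ^ d \<Longrightarrow> Q m'"
  shows "srun mul_pow_com m (d * 400 + 400) Q"
proof (rule srun_bounded)
  assume b: "bounded_mem m"
  have O: "d \<le> \<Omega>" using bounded_memD[OF b] m by auto
  define I where "I j m' \<longleftrightarrow> frame {rR, rC} m m' \<and> j \<le> d \<and> m' rR = r * p ^ (d - j)" for j m'
  have "srun mul_pow_com m (d * (128 + 192) + 192) Q"
    unfolding mul_pow_com_def
  proof (rule srun_for[where I = I])
    fix j m1 assume I: "I (Suc j) m1" and c: "m1 rC = Suc j" and j: "j < d"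
    have i: "d - j = Suc (d - Suc j)" using j by simp
    have "p ^ (d - j) \<le> p ^ d" using m by (intro power_increasing) auto
    then have "r * p ^ (d - j) \<le> \<Omega>" using m(5) by (meson mult_le_mono2 order_trans)
    then have le: "r * p ^ (d - Suc j) * p \<le> \<Omega>" unfolding i by (simp add: mult_ac)
    show "srun (rR ::= V rR [*] V rP) m1 128 (\<lambda>m'. m' rC = Suc j \<and> I j (m'(rC := j)))"
      by (rule srun_asg) (use I c j le m in \<open>auto simp: I_def frame_def i mult_ac\<close>)
  qed (use m O in \<open>auto simp: I_def frame_def intro: Q\<close>)
  then show ?thesis by (rule srun_time) simp
qed

lemma srun_bit_length:
  assumes m: "m rN = a" "2 * a + 1 \<le> \<Omega>"
    and Q: "\<And>m'. frame {rQ, rE} m m' \<Longrightarrow> m' rE = bit_length a \<Longrightarrow> Q m'"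
  shows "srun bit_length_com m (bit_length a * 400 + 400) Q"
proof -
  define I where "I v m' \<longleftrightarrow> frame {rQ, rE} m m' \<and> m' rQ = 2 ^ m' rE \<and> m' rE + v = bit_length a" for v m'
  have not_less: "2 ^ e \<le> a" if "e < bit_length a" for e
    using bit_length_le[of a e] that by (meson not_le)
  have "srun bit_length_com m (128 + (128 + (bit_length a * ((128 + 128) + 64) + 64))) Q"
    unfolding bit_length_com_def
  proof (intro srun_seq srun_asg)
    show "srun (While ((V rN [<] V rQ) [=] Const 0) (rQ ::= V rQ [*] Const 2 ;; rE ::= V rE [+] Const 1))
      (m(rE := eval \<delta> m (Const 0), rQ := eval \<delta> (m(rE := eval \<delta> m (Const 0))) (Const 1))) (bit_length a * ((128 + 128) + 64) + 64) Q"
    proof (rule srun_while[where I = I])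
      fix v m1 assume I: "I v m1"
      have N: "m1 rN = a" using I m unfolding I_def frame_def by auto
      {
        assume "eval \<delta> m1 ((V rN [<] V rQ) [=] Const 0) \<noteq> 0"
        then have le: "2 ^ m1 rE \<le> a" using I N unfolding I_def by (auto simp: of_bool_def split: if_splits)
        then have "m1 rE \<noteq> bit_length a" using bit_length[of a] by auto
        then obtain v' where v': "v = Suc v'" using I unfolding I_def by (cases v) auto
        have "m1 rE < 2 ^ m1 rE" by (rule less_exp)
        then have "Suc (m1 rE) \<le> \<Omega>" using le m(2) by linarith
        then show "srun (rQ ::= V rQ [*] Const 2 ;; rE ::= V rE [+] Const 1) m1 (128 + 128) (\<lambda>m'. \<exists>v'<v. I v' m')"
          by (intro srun_seq srun_asg) (use I le m v' in \<open>auto simp: I_def frame_def\<close>)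
      }
      assume "eval \<delta> m1 ((V rN [<] V rQ) [=] Const 0) = 0"
      then have "a < 2 ^ m1 rE" using I N unfolding I_def by (auto simp: of_bool_def split: if_splits)
      then have "\<not> m1 rE < bit_length a" using not_less[of "m1 rE"] by linarith
      then show "Q m1" using I unfolding I_def by (intro Q) auto
    qed (use m in \<open>auto simp: I_def frame_def\<close>)
  qed (use \<Omega>_ge in auto)
  then show ?thesis by (rule srun_time) simp
qed

lemma srun_next_prime:
  assumes m: "m rN = a" "2 \<le> a" "next_prime a \<le> \<Omega>"
    and Q: "\<And>m'. frame {rN, rQ} m m' \<Longrightarrow> m' rN = next_prime a \<Longrightarrow> Q m'"
  shows "srun next_prime_com m (600 * (next_prime a + 1) ^ 2) Q"
proof -
  define p where "p = next_prime a"
  have p: "prime p" "a \<le> p" unfolding p_def by (rule next_prime)+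
  \<comment> \<open>A lexicographic measure: raising the candidate resets the divisor to 2, which is
    paid for by the weight \<open>p + 1\<close> of a candidate.\<close>
  define \<mu> where "\<mu> c q = (p - c) * (p + 1) + (p - q)" for c q
  define I where "I v m' \<longleftrightarrow> frame {rN, rQ} m m' \<and> a \<le> m' rN \<and> m' rN \<le> p \<and> 2 \<le> m' rQ \<and> m' rQ \<le> m' rN \<and>
    (\<forall>d. 2 \<le> d \<and> d < m' rQ \<longrightarrow> \<not> d dvd m' rN) \<and> v = \<mu> (m' rN) (m' rQ)" for v m'
  have "srun next_prime_com m (128 + (\<mu> a 2 * (((128 + 128) + 64) + 64) + 64)) Q"
    unfolding next_prime_com_def
  proof (intro srun_seq srun_asg)
    show "srun (While (V rQ [<] V rN) (Cond (V rN [mod] V rQ [=] Const 0)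
          (rN ::= V rN [+] Const 1 ;; rQ ::= Const 2) (rQ ::= V rQ [+] Const 1)))
      (m(rQ := eval \<delta> m (Const 2))) (\<mu> a 2 * (((128 + 128) + 64) + 64) + 64) Q"
    proof (rule srun_while[where I = I])
      show "I (\<mu> a 2) (m(rQ := eval \<delta> m (Const 2)))" using m p unfolding I_def frame_def by auto
      fix v m1 assume I: "I v m1"
      {
        assume "eval \<delta> m1 (V rQ [<] V rN) \<noteq> 0"
        then have lt: "m1 rQ < m1 rN" by (auto simp: of_bool_def split: if_splits)
        show "srun (Cond (V rN [mod] V rQ [=] Const 0) (rN ::= V rN [+] Const 1 ;; rQ ::= Const 2) (rQ ::= V rQ [+] Const 1))
          m1 ((128 + 128) + 64) (\<lambda>m'. \<exists>v'<v. I v' m')"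
        proof (rule srun_cond)
          assume "eval \<delta> m1 (V rN [mod] V rQ [=] Const 0) \<noteq> 0"
          then have "m1 rQ dvd m1 rN" by (auto simp: of_bool_def mod_eq_0_iff_dvd split: if_splits)
          then have "\<not> prime (m1 rN)" using prime_nat_not_dvd[of "m1 rN" "m1 rQ"] lt I unfolding I_def by auto
          then have np: "m1 rN < p" using p I unfolding I_def by (metis le_neq_implies_less)
          have "\<mu> (m1 rN + 1) 2 < v"
          proof -
            have "p - m1 rN = Suc (p - (m1 rN + 1))" using np by simp
            then have "v = (p - (m1 rN + 1)) * (p + 1) + (p + 1) + (p - m1 rQ)" using I unfolding I_def \<mu>_def by simp
            then show ?thesis unfolding \<mu>_def by simp
          qed
          then show "srun (rN ::= V rN [+] Const 1 ;; rQ ::= Const 2) m1 (128 + 128) (\<lambda>m'. \<exists>v'<v. I v' m')"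
            by (intro srun_seq srun_asg)
               (use I np m \<Omega>_ge lt in \<open>auto simp: I_def frame_def p_def intro!: exI[of _ "\<mu> (m1 rN + 1) 2"]\<close>)
        next
          assume "eval \<delta> m1 (V rN [mod] V rQ [=] Const 0) = 0"
          then have nd: "\<not> m1 rQ dvd m1 rN" by (auto simp: of_bool_def mod_eq_0_iff_dvd split: if_splits)
          have "\<mu> (m1 rN) (m1 rQ + 1) < v" using I lt unfolding I_def \<mu>_def by auto
          then have "srun (rQ ::= V rQ [+] Const 1) m1 128 (\<lambda>m'. \<exists>v'<v. I v' m')"
            by (intro srun_asg)
               (use I nd m lt in \<open>auto simp: I_def frame_def p_def less_Suc_eq intro!: exI[of _ "\<mu> (m1 rN) (m1 rQ + 1)"]\<close>)
          then show "srun (rQ ::= V rQ [+] Const 1) m1 (128 + 128) (\<lambda>m'. \<exists>v'<v. I v' m')" by (rule srun_time) simp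
        qed
      }
      assume "eval \<delta> m1 (V rQ [<] V rN) = 0"
      then have eq: "m1 rQ = m1 rN" using I unfolding I_def by (auto simp: of_bool_def split: if_splits)
      have "prime (m1 rN)"
      proof (rule ccontr)
        assume np: "\<not> prime (m1 rN)"
        have "m1 rN \<noteq> 1" using I unfolding I_def by auto
        then obtain d where d: "prime d" "d dvd m1 rN" using prime_factor_nat by blast
        have "d \<le> m1 rN" using d(2) I unfolding I_def by (intro dvd_imp_le) auto
        moreover have "d \<noteq> m1 rN" using d np by auto
        ultimately show False using I d prime_ge_2_nat[OF d(1)] eq unfolding I_def by auto
      qed
      then have "m1 rN = p" using I next_prime_le[of "m1 rN" a] unfolding I_def p_def by auto
      then show "Q m1" using I unfolding I_def p_def by (intro Q) auto
    qed
  qed (use \<Omega>_ge in auto)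
  moreover have "128 + (\<mu> a 2 * (((128 + 128) + 64) + 64) + 64) \<le> 600 * (p + 1) ^ 2"
  proof -
    have "(p - a) * (p + 1) + (p - 2) \<le> p * (p + 1) + p" by (intro add_mono mult_le_mono1) auto
    then have "\<mu> a 2 \<le> (p + 1) ^ 2" unfolding \<mu>_def by (simp add: power2_eq_square)
    moreover have "1 \<le> (p + 1) ^ 2" by simp
    moreover define z where "z = (p + 1) ^ 2"
    ultimately show ?thesis unfolding z_def[symmetric] by simp
  qed
  ultimately show ?thesis unfolding p_def by (rule srun_time)
qed

end

lemma seed_count_ge1: "1 \<le> seed_count k y b"
proof (induction k y b rule: seed_count.induct)
  case (1 k y b)
  show ?case
  proof (cases "stop_bits k y < b \<and> 1 < b")
    case True
    then show ?thesis using 1 next_prime_gt0[of "2 ^ b"] by (subst seed_count.simps) (simp add: Suc_le_eq)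
  next
    case False
    then show ?thesis using next_prime_gt0 by (subst seed_count.simps) (auto simp: Suc_le_eq)
  qed
qed

section \<open>The program for the colouring\<close>

abbreviation "gK \<equiv> 30 :: nat"
abbreviation "gH \<equiv> 33 :: nat"
abbreviation "gT \<equiv> 34 :: nat"
abbreviation "gStop \<equiv> 35 :: nat"
abbreviation "gLam \<equiv> 36 :: nat"
abbreviation "gPow \<equiv> 37 :: nat"
abbreviation "vb \<equiv> 50 :: nat"
abbreviation "vv \<equiv> 51 :: nat"
abbreviation "vp \<equiv> 53 :: nat"
abbreviation "vphi \<equiv> 54 :: nat"
abbreviation "vout \<equiv> 55 :: nat"

definition prime_com :: com where "prime_com = pow2_com ;; next_prime_com"

definition step_com :: com where
  "step_com = rE ::= V vb ;; prime_com ;; rP ::= V rN ;;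
     vb ::= (V vb [+] Const 1) [div] Const 2 ;;
     rD ::= Const 2 [*] ((Const 4 [*] (V gH [+] Const 2)) [div] V vb [+] Const 1) ;;
     rX ::= V vv ;; poly_com ;; mul_pow_com ;;
     rE ::= V vb ;; pow2_com ;; vv ::= V rA [mod] V rN"

text \<open>The product with the truth value of 0 < \<open>gLam\<close> computes
  \<open>split_depth\<close> without a branch.\<close>

definition split_com :: com where
  "split_com = rE ::= Const 2 [*] (V vb [+] V gH [+] Const 4 [+] V gK [*] V gPow) ;; prime_com ;; rP ::= V rN ;;
     rB ::= (Const 0 [<] V gLam) [*] V vb ;; rJ ::= V vv ;; nisan_com ;;
     rD ::= Const 2 [*] V rB [+] Const 1 ;; mul_pow_com ;; vphi ::= V rA [mod] V gPow"

definition group_com :: com where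
  "group_com = rE ::= V vb ;; prime_com ;; vp ::= V rN ;;
     rE ::= Const 2 [*] (V gH [+] Const 4 [+] Const 3 [*] V 1 [+] V gLam) [+]
       (Const 2 [*] V vb [+] Const 8) [*] (V 1 [div] V gPow [+] Const 1) ;; prime_com ;; rP ::= V rN ;;
     rB ::= V gLam ;; rJ ::= V vphi ;; nisan_com ;;
     rD ::= Const 2 [*] V rB [+] Const 1 ;; mul_pow_com ;;
     rP ::= V vp ;; rD ::= V 1 [div] V gPow [+] Const 1 ;; rX ::= V vv ;; rS ::= V rA ;; poly_com ;;
     vout ::= V vphi [+] V gPow [*] (V rA [mod] ((V 1 [-] Const 1 [-] V vphi) [div] V gPow [+] Const 1))"

definition colour_com :: com where
  "colour_com = rR ::= Const 1 ;; vb ::= V gT ;; While (V gStop [<] V vb) step_com ;; split_com ;; group_com"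

definition work_regs :: "nat set" where "work_regs = {rN, rQ, rE, rP, rD, rX, rS, rA, rW, rC, rB, rJ, rR, vb, vv, vp, vphi, vout}"

abbreviation "split_regs \<equiv> {rN, rQ, rC, rE, rP, rB, rJ, rA, rS, rD, rR, vphi} :: nat set"

abbreviation "group_regs \<equiv> {rN, rQ, rC, rE, rP, rB, rJ, rA, rS, rD, rR, rX, rW, vp, vout} :: nat set"

definition params :: "nat \<Rightarrow> nat \<Rightarrow> mem \<Rightarrow> bool" where
  "params k y m \<longleftrightarrow> m 1 = k \<and> m gK = kap k \<and> m gH = prec k y \<and> m gT = start_bits k y \<and>
     m gStop = stop_bits k y \<and> m gLam = lam k y \<and> m gPow = 2 ^ lam k y"

lemma params_frame: "params k y m \<Longrightarrow> frame X m m' \<Longrightarrow> X \<subseteq> work_regs \<Longrightarrow> params k y m'"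
proof -
  assume *: "params k y m" "frame X m m'" "X \<subseteq> work_regs"
  have "m' a = m a" if "a \<notin> work_regs" for a using * that unfolding frame_def by blast
  then show ?thesis using *(1) unfolding params_def work_regs_def by simp
qed

context ram
begin

lemma srun_prime:
  assumes m: "m rE = e" "1 \<le> e" "next_prime (2 ^ e) \<le> U" "U \<le> \<Omega>"
    and Q: "\<And>m'. frame {rN, rQ, rC} m m' \<Longrightarrow> m' rN = next_prime (2 ^ e) \<Longrightarrow> Q m'"
  shows "srun prime_com m (1400 * (U + 1) ^ 2) Q"
proof -
  define p where "p = next_prime (2 ^ e)"
  have p: "2 ^ e \<le> p" unfolding p_def by (rule next_prime)
  have e2: "2 \<le> (2::nat) ^ e" using m(2) power_increasing[of 1 e "2::nat"] by simp
  have "srun prime_com m ((e * 400 + 400) + 600 * (p + 1) ^ 2) Q"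
    unfolding prime_com_def
  proof (rule srun_seq, rule srun_pow2[where e = e])
    show "m rE = e" by (rule m(1))
    show "2 ^ e \<le> \<Omega>" using p m unfolding p_def by linarith
    fix m1 assume 1: "frame {rN, rC} m m1" "m1 rN = 2 ^ e"
    show "srun next_prime_com m1 (600 * (p + 1) ^ 2) Q"
      unfolding p_def
    proof (rule srun_next_prime[where a = "2 ^ e"])
      show "m1 rN = 2 ^ e" by (rule 1(2))
      show "(2::nat) \<le> 2 ^ e" by (rule e2)
      show "next_prime (2 ^ e) \<le> \<Omega>" using m by linarith
      fix m2 assume 2: "frame {rN, rQ} m1 m2" "m2 rN = next_prime (2 ^ e)"
      show "Q m2" by (rule Q[OF frame_trans[OF 1(1) 2(1)] 2(2)]) auto
    qed
  qed
  moreover have "(e * 400 + 400) + 600 * (p + 1) ^ 2 \<le> 1400 * (U + 1) ^ 2"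
  proof -
    define z where "z = (U + 1) ^ 2"
    have "e < 2 ^ e" by (rule less_exp)
    then have "e \<le> U" using p m(3) unfolding p_def by linarith
    moreover have "U + 1 \<le> z" unfolding z_def power2_eq_square by simp
    moreover have "(p + 1) ^ 2 \<le> z" unfolding z_def using m(3) unfolding p_def by (intro power_mono) auto
    ultimately show ?thesis unfolding z_def[symmetric] by simp
  qed
  ultimately show ?thesis by (rule srun_time)
qed

lemma srun_step:
  assumes m: "params k y m" "m vb = b" "m vv = v" "m rS = s" "m rR = r"
    and b: "1 < b" and N: "p = next_prime (2 ^ b)" "d = chain_deg k y b" "r * p ^ d \<le> U" "1 \<le> r" "U \<le> \<Omega>"
    and Q: "\<And>m'. frame work_regs m m' \<Longrightarrow> m' vb = halve b \<Longrightarrow> m' vv = poly_hash p d s v mod 2 ^ halve b \<Longrightarrow>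
      m' rS = s div p ^ d \<Longrightarrow> m' rR = r * p ^ d \<Longrightarrow> Q m'"
  shows "srun step_com m (6000 * (U + 1) ^ 2) Q"
proof (rule srun_bounded)
  assume bd: "bounded_mem m"
  have hb: "1 \<le> halve b" "halve b \<le> b" using b unfolding halve_def by auto
  have p2: "2 \<le> p" unfolding N using next_prime(1) prime_ge_2_nat by blast
  have d1: "1 \<le> d" unfolding N chain_deg_def by simp
  have pd: "p ^ d \<le> U" using N(3,4) by (metis le_trans mult_le_mono1 nat_mult_1)
  have "p ^ 1 \<le> p ^ d" using p2 d1 by (intro power_increasing) auto
  then have pU: "p \<le> U" using pd by simp
  have "d < 2 ^ d" by (rule less_exp)
  also have "\<dots> \<le> p ^ d" using p2 by (intro power_mono) auto
  finally have dU: "d \<le> U" using pd by linarith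
  have bp: "2 ^ b \<le> p" unfolding N by (rule next_prime)
  have bU: "b \<le> U" using less_exp[of b] bp pU by linarith
  have "(2::nat) ^ halve b \<le> 2 ^ b" using hb by (intro power_increasing) auto
  then have h2: "2 ^ halve b \<le> \<Omega>" using bp pU N(5) by linarith
  have O: "b \<le> \<Omega>" "p \<le> \<Omega>" "d \<le> \<Omega>" "halve b \<le> \<Omega>" "v \<le> \<Omega>" "s \<le> \<Omega>" "r * p ^ d \<le> \<Omega>"
    using bU pU dU hb N(3,5) bounded_memD[OF bd, of vv] bounded_memD[OF bd, of rS] m by auto
  have par: "m gH = prec k y" using m(1) unfolding params_def by auto
  have dd: "2 * (4 * (prec k y + 2) div halve b + 1) = d" unfolding N chain_deg_def ..
  have hh: "(b + 1) div 2 = halve b" unfolding halve_def ..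
  have ddn: "Suc (Suc (2 * ((8 + 4 * prec k y) div (Suc b div 2)))) = d" using dd unfolding hh[symmetric] by simp
  have modO: "a mod 2 ^ halve b \<le> \<Omega>" for a :: nat
  proof -
    have "a mod 2 ^ halve b < 2 ^ halve b" by simp
    then show ?thesis using h2 by linarith
  qed
  \<comment> \<open>The nested sum mirrors the sequence of commands, one summand for each, so that
    the rule for sequences applies without arithmetic.\<close>
  have "srun step_com m (128 + (1400 * (U + 1) ^ 2 + (128 + (128 + (128 + (128 + ((d * 600 + 500) + ((d * 400 + 400) +
      (128 + ((halve b * 400 + 400) + 128)))))))))) Q"
    unfolding step_com_def
    apply (rule srun_seq, rule srun_asg)
    subgoal using O m by simp
    apply (rule srun_seq, rule srun_prime[where e = b and U = U])
    subgoal using m by simp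
    subgoal using b by simp
    subgoal using pU N by simp
    subgoal by (rule N(5))
    subgoal premises P1 for m1
    proof -
      have f1: "m1 a = m a" if "a \<notin> {rN, rQ, rC, rE}" for a using frameD[OF P1(1), of a] that by simp
      note m1 = f1[of vb] f1[of vv] f1[of rS] f1[of rR] f1[of gH] P1(2)
      show ?thesis
        apply (rule srun_seq, rule srun_asg)
        subgoal using m1 O N by simp
        apply (rule srun_seq, rule srun_asg)
        subgoal using m1 O m hh by simp
        apply (rule srun_seq, rule srun_asg)
        subgoal using m1 O m par by (simp add: ddn)
        apply (rule srun_seq, rule srun_asg)
        subgoal using m1 O m by simp
        apply (rule srun_seq, rule srun_poly[where p = p and d = d and s = s and x = v])
        subgoal using m1 N by simp
        subgoal by (rule p2)
        subgoal using m1 m par by (simp add: ddn)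
        subgoal using m1 m by simp
        subgoal using m1 m by simp
        subgoal premises P2 for m2
        proof -
          have f2: "m2 a = (m1(rP := p, vb := halve b, rD := d)) a" if "a \<notin> {rS, rA, rW, rC, rX}" for a
            using frameD[OF P2(1), of a] that m1 m par N hh by (simp add: ddn)
          show ?thesis
            apply (rule srun_seq, rule srun_mul_pow[where p = p and d = d and r = r])
            subgoal using f2[of rP] by simp
            subgoal using p2 by simp
            subgoal using f2[of rD] by simp
            subgoal using f2[of rR] m1 m by simp
            subgoal by (rule O)
            subgoal premises P3 for m3
            proof -
              have f3: "m3 a = (m1(rP := p, vb := halve b, rD := d, rR := r * p ^ d, rS := s div p ^ d, rA := poly_hash p d s v)) a"
                if "a \<notin> {rW, rC, rX}" for a
                using frameD[OF P3(1), of a] P3(2) f2[of a] P2(2,3) that by auto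
              show ?thesis
                apply (rule srun_seq, rule srun_asg)
                subgoal using f3[of vb] O by simp
                apply (rule srun_seq, rule srun_pow2[where e = "halve b"])
                subgoal using f3[of vb] by simp
                subgoal by (rule h2)
                subgoal premises P4 for m4
                proof -
                  have f4: "m4 a = (m1(rP := p, vb := halve b, rD := d, rR := r * p ^ d, rS := s div p ^ d, rA := poly_hash p d s v, rN := 2 ^ halve b)) a"
                    if "a \<notin> {rW, rC, rX, rE}" for a
                    using frameD[OF P4(1), of a] P4(2) f3[of a] that by auto
                  have ra: "m4 rA = poly_hash p d s v" "m4 rN = 2 ^ halve b" using f4[of rA] f4[of rN] by auto
                  show ?thesis
                  proof (rule srun_asg)
                    show "eval \<delta> m4 (V rA [mod] V rN) \<le> \<Omega>" using ra modO by simp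
                    have "frame work_regs m (m4(vv := eval \<delta> m4 (V rA [mod] V rN)))"
                      unfolding frame_def
                    proof (intro allI impI)
                      fix a assume a: "a \<notin> work_regs"
                      then have "m4 a = m1 a" using f4[of a] unfolding work_regs_def by simp
                      also have "\<dots> = m a" using f1[of a] a unfolding work_regs_def by simp
                      finally show "(m4(vv := eval \<delta> m4 (V rA [mod] V rN))) a = m a" using a unfolding work_regs_def by simp
                    qed
                    then show "Q (m4(vv := eval \<delta> m4 (V rA [mod] V rN)))"
                      by (rule Q) (use f4[of vb] f4[of rS] f4[of rR] ra in simp_all)
                  qed
                qed
                done
            qed
            done
        qed
        done
    qed
    done
  moreover have "128 + (1400 * (U + 1) ^ 2 + (128 + (128 + (128 + (128 + ((d * 600 + 500) + ((d * 400 + 400) +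
      (128 + ((halve b * 400 + 400) + 128))))))))) \<le> 6000 * (U + 1) ^ 2"
  proof -
    define z where "z = (U + 1) ^ 2"
    have "U + 1 \<le> z" unfolding z_def power2_eq_square by simp
    then show ?thesis unfolding z_def[symmetric] using dU bU hb by simp
  qed
  ultimately show ?thesis by (rule srun_time)
qed

lemma srun_split:
  assumes m: "params k y m" "m vb = b" "m vv = v" "m rS = s" "m rR = r"
    and N: "P = next_prime (2 ^ split_bits k y b)" "\<beta> = split_depth k y b" "r * P ^ (2 * \<beta> + 1) \<le> U" "1 \<le> r" "U \<le> \<Omega>"
    and Q: "\<And>m'. frame split_regs m m' \<Longrightarrow> m' vphi = nisan P \<beta> s v mod 2 ^ lam k y \<Longrightarrow>
      m' rS = s div P ^ (2 * \<beta> + 1) \<Longrightarrow> m' rR = r * P ^ (2 * \<beta> + 1) \<Longrightarrow> Q m'"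
  shows "srun split_com m (6000 * (U + 1) ^ 2) Q"
proof (rule srun_bounded)
  assume bd: "bounded_mem m"
  define e where "e = split_bits k y b"
  define d where "d = 2 * \<beta> + 1"
  have p2: "2 \<le> P" unfolding N using next_prime(1) prime_ge_2_nat by blast
  have pd: "P ^ d \<le> U" using N(3,4) unfolding d_def by (metis le_trans mult_le_mono1 nat_mult_1)
  have "P ^ 1 \<le> P ^ d" using p2 unfolding d_def by (intro power_increasing) auto
  then have pU: "P \<le> U" using pd by simp
  have "d < 2 ^ d" by (rule less_exp)
  also have "\<dots> \<le> P ^ d" using p2 by (intro power_mono) auto
  finally have dU: "d \<le> U" using pd by linarith
  have e1: "1 \<le> e" unfolding e_def split_bits_def by simp
  have ep: "2 ^ e \<le> P" unfolding N e_def by (rule next_prime)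
  have eU: "e \<le> U" using less_exp[of e] ep pU by linarith
  have lamP: "2 ^ lam k y \<le> \<Omega>" using bounded_memD[OF bd, of gPow] m(1) unfolding params_def by simp
  have O: "e \<le> \<Omega>" "P \<le> \<Omega>" "d \<le> \<Omega>" "\<beta> \<le> \<Omega>" "v \<le> \<Omega>" "s \<le> \<Omega>" "r * P ^ d \<le> \<Omega>"
    using eU pU dU N(3,5) bounded_memD[OF bd, of vv] bounded_memD[OF bd, of rS] m unfolding d_def by auto
  have par: "m gH = prec k y" "m gK = kap k" "m gPow = 2 ^ lam k y" "m gLam = lam k y" using m(1) unfolding params_def by auto
  have modO: "a mod 2 ^ lam k y \<le> \<Omega>" for a :: nat
  proof -
    have "a mod 2 ^ lam k y < 2 ^ lam k y" by simp
    then show ?thesis using lamP by linarith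
  qed
  have "srun split_com m (128 + (1400 * (U + 1) ^ 2 + (128 + (128 + (128 + ((\<beta> * 700 + 500) + (128 + ((d * 400 + 400) + 128)))))))) Q"
    unfolding split_com_def
    apply (rule srun_seq, rule srun_asg)
    subgoal using O(1) m par by (simp add: e_def split_bits_def)
    apply (rule srun_seq, rule srun_prime[where e = e and U = U])
    subgoal using m par by (simp add: e_def split_bits_def)
    subgoal by (rule e1)
    subgoal using pU N unfolding e_def by simp
    subgoal by (rule N(5))
    subgoal premises P1 for m1
    proof -
      have f1: "m1 a = m a" if "a \<notin> {rN, rQ, rC, rE}" for a using frameD[OF P1(1), of a] that by simp
      note m1 = f1[of vb] f1[of vv] f1[of rS] f1[of rR] f1[of gLam] f1[of gPow] P1(2)
      show ?thesis
        apply (rule srun_seq, rule srun_asg)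
        subgoal using m1 O N unfolding e_def by simp
        apply (rule srun_seq, rule srun_asg)
        subgoal using m1 O(4) m par N unfolding split_depth_def by (auto simp: of_bool_def)
        apply (rule srun_seq, rule srun_asg)
        subgoal using m1 O m par by simp
        apply (rule srun_seq, rule srun_nisan[where p = P and b = \<beta> and s = s and ?j0.0 = v])
        subgoal using m1 N unfolding e_def by simp
        subgoal by (rule p2)
        subgoal using m1 m par N unfolding split_depth_def by (auto simp: of_bool_def)
        subgoal using m1 m by simp
        subgoal using m1 m by simp
        subgoal premises P2 for m2
        proof -
          have f2: "m2 a = (m1(rP := P, rB := \<beta>)) a" if "a \<notin> {rS, rA, rJ, rC}" for a
            using frameD[OF P2(1), of a] that m1 m par N unfolding split_depth_def e_def by (auto simp: of_bool_def)
          show ?thesis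
            apply (rule srun_seq, rule srun_asg)
            subgoal using f2[of rB] O(3) unfolding d_def by simp
            apply (rule srun_seq, rule srun_mul_pow[where p = P and d = d and r = r])
            subgoal using f2[of rP] by simp
            subgoal using p2 by simp
            subgoal using f2[of rB] by (simp add: d_def)
            subgoal using f2[of rR] m1 m by simp
            subgoal by (rule O)
            subgoal premises P3 for m3
            proof -
              have f3: "m3 a = (m1(rP := P, rB := \<beta>, rR := r * P ^ d, rS := s div P ^ d, rA := nisan P \<beta> s v)) a"
                if "a \<notin> {rJ, rC, rD}" for a
                using frameD[OF P3(1), of a] P3(2) f2[of a] P2(2,3) that unfolding d_def by auto
              have r3: "m3 rA = nisan P \<beta> s v" "m3 gPow = 2 ^ lam k y" "m3 rS = s div P ^ d" "m3 rR = r * P ^ d"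
                using f3[of rA] f3[of gPow] m1 par f3[of rS] f3[of rR] by auto
              show ?thesis
              proof (rule srun_asg)
                show "eval \<delta> m3 (V rA [mod] V gPow) \<le> \<Omega>" using r3 modO by simp
                have "frame split_regs m (m3(vphi := eval \<delta> m3 (V rA [mod] V gPow)))"
                  unfolding frame_def
                proof (intro allI impI)
                  fix a assume a: "a \<notin> split_regs"
                  then have "m3 a = m1 a" using f3[of a] by simp
                  also have "\<dots> = m a" using f1[of a] a by simp
                  finally show "(m3(vphi := eval \<delta> m3 (V rA [mod] V gPow))) a = m a" using a by simp
                qed
                then show "Q (m3(vphi := eval \<delta> m3 (V rA [mod] V gPow)))"
                  by (rule Q) (use r3 in \<open>simp_all add: d_def\<close>)
              qed
            qed
            done
        qed
        done
    qed
    done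
  moreover have "128 + (1400 * (U + 1) ^ 2 + (128 + (128 + (128 + ((\<beta> * 700 + 500) + (128 + ((d * 400 + 400) + 128))))))) \<le> 6000 * (U + 1) ^ 2"
  proof -
    define z where "z = (U + 1) ^ 2"
    have "U + 1 \<le> z" unfolding z_def power2_eq_square by simp
    then show ?thesis unfolding z_def[symmetric] using dU unfolding d_def by simp
  qed
  ultimately show ?thesis by (rule srun_time)
qed

lemma srun_group:
  assumes m: "params k y m" "m vb = b" "m vv = v" "m rS = s" "m rR = r" "m vphi = \<phi>"
    and b: "1 \<le> b" and k: "1 \<le> k"
    and N: "p = next_prime (2 ^ b)" "P = next_prime (2 ^ group_bits k y b)" "r * P ^ (2 * lam k y + 1) \<le> U" "1 \<le> r" "U \<le> \<Omega>"
    and cO: "\<phi> + 2 ^ lam k y * (poly_hash p (group_deg k y) (nisan P (lam k y) s \<phi>) v mod class_size k (2 ^ lam k y) \<phi>) \<le> \<Omega>"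
    and Q: "\<And>m'. frame group_regs m m' \<Longrightarrow>
      m' vout = \<phi> + 2 ^ lam k y * (poly_hash p (group_deg k y) (nisan P (lam k y) s \<phi>) v mod class_size k (2 ^ lam k y) \<phi>) \<Longrightarrow>
      m' rR = r * P ^ (2 * lam k y + 1) \<Longrightarrow> Q m'"
  shows "srun group_com m (9000 * (U + 1) ^ 2) Q"
proof (rule srun_bounded)
  assume bd: "bounded_mem m"
  define e where "e = group_bits k y b"
  define lm where "lm = lam k y"
  define d where "d = 2 * lm + 1"
  define D where "D = group_deg k y"
  have p2: "2 \<le> P" unfolding N using next_prime(1) prime_ge_2_nat by blast
  have q2: "2 \<le> p" unfolding N using next_prime(1) prime_ge_2_nat by blast
  have pd: "P ^ d \<le> U" using N(3,4) unfolding d_def lm_def by (metis le_trans mult_le_mono1 nat_mult_1)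
  have "P ^ 1 \<le> P ^ d" using p2 unfolding d_def by (intro power_increasing) auto
  then have pU: "P \<le> U" using pd by simp
  have "d < 2 ^ d" by (rule less_exp)
  also have "\<dots> \<le> P ^ d" using p2 by (intro power_mono) auto
  finally have dU: "d \<le> U" using pd by linarith
  have ep: "2 ^ e \<le> P" unfolding N e_def by (rule next_prime)
  have eU: "e \<le> U" using less_exp[of e] ep pU by linarith
  have D1: "1 \<le> D" unfolding D_def group_deg_def by simp
  have "(2 * b + 8) * 1 \<le> (2 * b + 8) * D" by (rule mult_le_mono2[OF D1])
  then have "2 * b + 8 \<le> (2 * b + 8) * D" by (simp only: mult_1_right)
  also have "\<dots> \<le> e" unfolding e_def group_bits_def D_def by (rule le_add2)
  finally have e2b: "2 * b + 8 \<le> e" .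
  then have e1: "1 \<le> e" by linarith
  have "1 * D \<le> (2 * b + 8) * D" by (intro mult_le_mono1) simp
  also have "\<dots> \<le> e" unfolding e_def group_bits_def D_def by (rule le_add2)
  finally have De: "D \<le> e" by (simp only: mult_1)
  have ke: "k \<le> e" unfolding e_def group_bits_def by simp
  have "p < 2 ^ (2 * b + 8)" unfolding N(1) by (rule next_prime_power2_less)
  also have "\<dots> \<le> (2::nat) ^ e" using e2b by (intro power_increasing) auto
  finally have qU: "p \<le> U" using ep pU by linarith
  have bU: "b \<le> U" using e2b eU by linarith
  have lamP: "2 ^ lm \<le> \<Omega>" using bounded_memD[OF bd, of gPow] m(1) unfolding params_def lm_def by simp
  have O: "e \<le> \<Omega>" "P \<le> \<Omega>" "d \<le> \<Omega>" "lm \<le> \<Omega>" "p \<le> \<Omega>" "b \<le> \<Omega>" "D \<le> \<Omega>" "k \<le> \<Omega>" "v \<le> \<Omega>" "s \<le> \<Omega>" "\<phi> \<le> \<Omega>" "r * P ^ d \<le> \<Omega>"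
    using eU pU qU bU dU De ke N(3,5) bounded_memD[OF bd, of vv] bounded_memD[OF bd, of rS] bounded_memD[OF bd, of vphi] m
    unfolding d_def lm_def by auto
  have par: "m gH = prec k y" "m (Suc 0) = k" "m gPow = 2 ^ lm" "m gLam = lm" using m(1) unfolding params_def lm_def by auto
  have DD: "Suc (k div 2 ^ lm) = D" unfolding D_def group_deg_def lm_def by simp
  have ee: "2 * (prec k y + 4 + 3 * k + lm) + (2 * b + 8) * D = e" unfolding e_def group_bits_def D_def lm_def ..
  have "srun group_com m (128 + (1400 * (U + 1) ^ 2 + (128 + (128 + (1400 * (U + 1) ^ 2 + (128 + (128 + (128 + ((lm * 700 + 500) +
    (128 + ((d * 400 + 400) + (128 + (128 + (128 + (128 + ((D * 600 + 500) + 128)))))))))))))))) Q"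
    unfolding group_com_def
    apply (rule srun_seq, rule srun_asg)
    subgoal using O m par by simp
    apply (rule srun_seq, rule srun_prime[where e = b and U = U])
    subgoal using m by simp
    subgoal by (rule b)
    subgoal using qU N by simp
    subgoal by (rule N(5))
    subgoal premises P1 for m1
    proof -
      have f1: "m1 a = m a" if "a \<notin> {rN, rQ, rC, rE}" for a using frameD[OF P1(1), of a] that by simp
      note m1 = f1[of vb] f1[of vv] f1[of rS] f1[of rR] f1[of gLam] f1[of gPow] f1[of gH] f1[of "Suc 0"] f1[of vphi] P1(2)
      show ?thesis
        apply (rule srun_seq, rule srun_asg)
        subgoal using m1 O N by simp
        apply (rule srun_seq, rule srun_asg)
        subgoal using m1 O(1) m par ee by (simp add: DD)
        apply (rule srun_seq, rule srun_prime[where e = e and U = U])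
        subgoal using m1 m par ee by (simp add: DD)
        subgoal by (rule e1)
        subgoal using pU N unfolding e_def by simp
        subgoal by (rule N(5))
        subgoal premises P2 for m2
        proof -
          have f2: "m2 a = (m1(vp := p)) a" if "a \<notin> {rN, rQ, rC, rE}" for a using frameD[OF P2(1), of a] that m1 N by simp
          note m2 = f2[of vp] f2[of vv] f2[of rS] f2[of rR] f2[of gLam] f2[of gPow] f2[of "Suc 0"] f2[of vphi] P2(2)
          show ?thesis
            apply (rule srun_seq, rule srun_asg)
            subgoal using m2 O N unfolding e_def by simp
            apply (rule srun_seq, rule srun_asg)
            subgoal using m2 m1 par O by simp
            apply (rule srun_seq, rule srun_asg)
            subgoal using m2 m1 m O by simp
            apply (rule srun_seq, rule srun_nisan[where p = P and b = lm and s = s and ?j0.0 = \<phi>])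
            subgoal using m2 N unfolding e_def by simp
            subgoal by (rule p2)
            subgoal using m2 m1 par by simp
            subgoal using m2 m1 m by simp
            subgoal using m2 m1 m by simp
            subgoal premises P3 for m3
            proof -
              have f3: "m3 a = (m2(rP := P, rB := lm)) a" if "a \<notin> {rS, rA, rJ, rC}" for a
                using frameD[OF P3(1), of a] that m2 m1 par N unfolding e_def by simp
              show ?thesis
                apply (rule srun_seq, rule srun_asg)
                subgoal using f3[of rB] O(3) unfolding d_def by simp
                apply (rule srun_seq, rule srun_mul_pow[where p = P and d = d and r = r])
                subgoal using f3[of rP] by simp
                subgoal using p2 by simp
                subgoal using f3[of rB] by (simp add: d_def)
                subgoal using f3[of rR] m2 m1 m by simp
                subgoal by (rule O)
                subgoal premises P4 for m4
                proof -
                  have f4: "m4 a = (m2(rP := P, rB := lm, rR := r * P ^ d, rA := nisan P lm s \<phi>)) a"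
                    if "a \<notin> {rS, rJ, rC, rD}" for a
                    using frameD[OF P4(1), of a] P4(2) f3[of a] P3(2) that unfolding d_def by auto
                  note m4 = f4[of vp] f4[of "Suc 0"] f4[of gPow] f4[of vv] f4[of vphi] f4[of rA]
                  show ?thesis
                  proof (rule srun_bounded)
                    assume bd4: "bounded_mem m4"
                    have nO: "nisan P lm s \<phi> \<le> \<Omega>" using bounded_memD[OF bd4, of rA] m4 by simp
                    show ?thesis
                    apply (rule srun_seq, rule srun_asg)
                    subgoal using m4 m2 O by simp
                    apply (rule srun_seq, rule srun_asg)
                    subgoal using m4 m2 m1 par O by (simp add: DD)
                    apply (rule srun_seq, rule srun_asg)
                    subgoal using m4 m2 m1 m O by simp
                    apply (rule srun_seq, rule srun_asg)
                    subgoal using m4 nO by simp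
                    apply (rule srun_seq, rule srun_poly[where p = p and d = D and s = "nisan P lm s \<phi>" and x = v])
                    subgoal using m4 m2 by simp
                    subgoal by (rule q2)
                    subgoal using m4 m2 m1 par by (simp add: DD)
                    subgoal using m4 m2 by simp
                    subgoal using m4 m2 m1 m by simp
                    subgoal premises P5 for m5
                    proof -
                      have f5: "m5 a = m4 a" if "a \<notin> {rP, rD, rX, rS, rA, rW, rC}" for a using frameD[OF P5(1), of a] that by simp
                      have r5: "m5 rA = poly_hash p D (nisan P lm s \<phi>) v" "m5 vphi = \<phi>" "m5 gPow = 2 ^ lm" "m5 (Suc 0) = k" "m5 rR = r * P ^ d"
                        using P5(2) f5[of vphi] f5[of gPow] f5[of "Suc 0"] f5[of rR] m4 m2 m1 m par f4[of rR] by auto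
                      define c where "c = \<phi> + 2 ^ lm * (poly_hash p D (nisan P lm s \<phi>) v mod class_size k (2 ^ lm) \<phi>)"
                      have ev: "eval \<delta> m5 (V vphi [+] V gPow [*] (V rA [mod] ((V 1 [-] Const 1 [-] V vphi) [div] V gPow [+] Const 1))) = c"
                        using r5 unfolding c_def class_size_def by simp
                      show ?thesis
                      proof (rule srun_asg, unfold ev)
                        show "c \<le> \<Omega>" using cO unfolding c_def lm_def D_def by simp
                        have "frame group_regs m (m5(vout := c))"
                          unfolding frame_def
                        proof (intro allI impI)
                          fix a assume a: "a \<notin> group_regs"
                          then have "m5 a = m4 a" using f5[of a] by simp
                          also have "\<dots> = m2 a" using f4[of a] a by simp
                          also have "\<dots> = m1 a" using f2[of a] a by simp
                          also have "\<dots> = m a" using f1[of a] a by simp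
                          finally show "(m5(vout := c)) a = m a" using a by simp
                        qed
                        then show "Q (m5(vout := c))"
                          by (rule Q) (use r5 in \<open>simp_all add: d_def c_def lm_def D_def\<close>)
                      qed
                    qed
                    done
                  qed
                qed
                done
            qed
            done
        qed
        done
    qed
    done
  moreover have "128 + (1400 * (U + 1) ^ 2 + (128 + (128 + (1400 * (U + 1) ^ 2 + (128 + (128 + (128 + ((lm * 700 + 500) +
    (128 + ((d * 400 + 400) + (128 + (128 + (128 + (128 + ((D * 600 + 500) + 128))))))))))))))) \<le> 9000 * (U + 1) ^ 2"
  proof -
    define z where "z = (U + 1) ^ 2"
    have "U + 1 \<le> z" unfolding z_def power2_eq_square by simp
    then show ?thesis unfolding z_def[symmetric] using dU De eU unfolding d_def by simp
  qed
  ultimately show ?thesis by (rule srun_time)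
qed

text \<open>While the chain of halvings runs, the number of seeds consumed so far times the number of seeds
  still needed stays constant.\<close>

lemma srun_colour:
  assumes m: "params k y m" "m vv = v" "m rS = s" and k: "1 \<le> k"
    and U: "seed_count k y (start_bits k y) \<le> U" "start_bits k y \<le> U" "k \<le> U" "U \<le> \<Omega>"
    and v: "v < 2 ^ start_bits k y"
    and Q: "\<And>m'. frame work_regs m m' \<Longrightarrow> m' vout = colour_hash k y (start_bits k y) s v \<Longrightarrow>
      m' rR = seed_count k y (start_bits k y) \<Longrightarrow> Q m'"
  shows "srun colour_com m (22000 * (U + 1) ^ 3) Q"
proof -
  define t where "t = start_bits k y"
  define K where "K = seed_count k y t"
  define I where "I b m' \<longleftrightarrow> frame work_regs m m' \<and> m' vb = b \<and> kap k \<le> b \<and> b \<le> t \<and> 1 \<le> m' rR \<and> m' rR * seed_count k y b = K \<and>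
    m' vv < 2 ^ b \<and> colour_hash k y b (m' rS) (m' vv) = colour_hash k y t s v" for b m'
  have kap1: "1 \<le> kap k" using kap(3)[OF k] by simp
  have par: "params k y m1" if "frame work_regs m m1" for m1 by (rule params_frame[OF m(1) that]) simp
  have KU: "K \<le> U" using U unfolding K_def t_def by simp
  have stop8: "8 * kap k \<le> stop_bits k y" unfolding stop_bits_def by simp
  have pd0: "1 \<le> next_prime a ^ d" for a d using next_prime_gt0[of a] by (simp add: Suc_le_eq)
  note sc1 = seed_count_ge1
  have "srun colour_com m (128 + (128 + ((t * (6000 * (U + 1) ^ 2 + 64) + 64) + (6000 * (U + 1) ^ 2 + 9000 * (U + 1) ^ 2)))) Q"
    unfolding colour_com_def
  proof (intro srun_seq srun_asg)
    show "eval \<delta> m (Const 1) \<le> \<Omega>" using \<Omega>_ge by simp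
    show "eval \<delta> (m(rR := eval \<delta> m (Const 1))) (V gT) \<le> \<Omega>" using m(1) U unfolding params_def by simp
    show "srun (While (V gStop [<] V vb) step_com) (m(rR := eval \<delta> m (Const 1), vb := eval \<delta> (m(rR := eval \<delta> m (Const 1))) (V gT)))
      (t * (6000 * (U + 1) ^ 2 + 64) + 64) (\<lambda>m1. srun (split_com ;; group_com) m1 (6000 * (U + 1) ^ 2 + 9000 * (U + 1) ^ 2) Q)"
    proof (rule srun_while[where I = I])
      have tk: "kap k \<le> t" unfolding t_def start_bits_def prec_def by simp
      show "I t (m(rR := eval \<delta> m (Const 1), vb := eval \<delta> (m(rR := eval \<delta> m (Const 1))) (V gT)))"
        using m v tk unfolding I_def K_def params_def t_def by (auto simp: frame_def work_regs_def)
      fix b m1 assume I: "I b m1"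
      have p1: "params k y m1" using I par unfolding I_def by blast
      {
        assume "eval \<delta> m1 (V gStop [<] V vb) \<noteq> 0"
        then have c: "stop_bits k y < b" using p1 I unfolding params_def I_def by (auto simp: of_bool_def split: if_splits)
        then have b1: "1 < b" using stop8 kap1 by linarith
        define p where "p = next_prime (2 ^ b)"
        define d where "d = chain_deg k y b"
        have scb: "seed_count k y b = p ^ d * seed_count k y (halve b)"
          using c b1 unfolding p_def d_def by (subst seed_count.simps) simp
        have ch: "colour_hash k y b s1 v1 = colour_hash k y (halve b) (s1 div p ^ d) (poly_hash p d s1 v1 mod 2 ^ halve b)" for s1 v1
          using c b1 unfolding p_def d_def by (subst colour_hash.simps) simp
        \<comment> \<open>The remaining seed count is at least 1, so the partial product in
          \<open>rR\<close> never exceeds the total number of seeds.\<close>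
        have "m1 rR * p ^ d * 1 \<le> m1 rR * p ^ d * seed_count k y (halve b)" by (rule mult_le_mono2[OF sc1])
        also have "\<dots> = K" using I scb unfolding I_def by (simp add: mult.assoc)
        finally have rU: "m1 rR * p ^ d \<le> U" using KU by simp
        show "srun step_com m1 (6000 * (U + 1) ^ 2) (\<lambda>m'. \<exists>v'<b. I v' m')"
        proof (rule srun_step[OF p1 _ refl refl refl b1 p_def d_def rU])
          show "m1 vb = b" "1 \<le> m1 rR" "U \<le> \<Omega>" using I U unfolding I_def by auto
          fix m2 assume 2: "frame work_regs m1 m2" "m2 vb = halve b" "m2 vv = poly_hash p d (m1 rS) (m1 vv) mod 2 ^ halve b"
            "m2 rS = m1 rS div p ^ d" "m2 rR = m1 rR * p ^ d"
          have fr: "frame work_regs m m2" using I 2(1) unfolding I_def frame_def by simp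
          have hb: "halve b < b" "kap k \<le> halve b" using b1 c stop8 kap1 unfolding halve_def by auto
          have "I (halve b) m2" unfolding I_def
          proof (intro conjI)
            show "1 \<le> m2 rR" using I pd0 unfolding 2 I_def p_def by (simp add: Suc_le_eq)
            show "m2 rR * seed_count k y (halve b) = K" using I unfolding 2 I_def scb by (simp add: mult.assoc)
            show "m2 vv < 2 ^ halve b" unfolding 2 by simp
            show "colour_hash k y (halve b) (m2 rS) (m2 vv) = colour_hash k y t s v" using I unfolding 2 I_def ch by simp
            show "halve b \<le> t" using I hb unfolding I_def by simp
          qed (use fr 2 hb in auto)
          then show "\<exists>v'<b. I v' m2" using hb by blast
        qed
      }
      assume "eval \<delta> m1 (V gStop [<] V vb) = 0"
      then have c: "\<not> (stop_bits k y < b \<and> 1 < b)" using p1 I unfolding params_def I_def by (auto simp: of_bool_def split: if_splits)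
      have b1: "1 \<le> b" using I kap1 unfolding I_def by linarith
      define P1 where "P1 = next_prime (2 ^ split_bits k y b)"
      define P2 where "P2 = next_prime (2 ^ group_bits k y b)"
      define p where "p = next_prime (2 ^ b)"
      define \<beta> where "\<beta> = split_depth k y b"
      have scb: "seed_count k y b = P1 ^ (2 * \<beta> + 1) * P2 ^ (2 * lam k y + 1)"
        using c unfolding P1_def P2_def \<beta>_def by (subst seed_count.simps) auto
      have ch: "colour_hash k y b s1 v1 = split_hash k (lam k y) P1 \<beta> P2 p (group_deg k y) s1 v1" for s1 v1
        using c unfolding P1_def P2_def \<beta>_def p_def by (subst colour_hash.simps) auto
      have rK: "m1 rR * P1 ^ (2 * \<beta> + 1) * P2 ^ (2 * lam k y + 1) = K" using I unfolding I_def scb by (simp add: mult.assoc)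
      have "m1 rR * P1 ^ (2 * \<beta> + 1) * 1 \<le> m1 rR * P1 ^ (2 * \<beta> + 1) * P2 ^ (2 * lam k y + 1)"
        unfolding P2_def by (rule mult_le_mono2[OF pd0])
      then have r1: "m1 rR * P1 ^ (2 * \<beta> + 1) \<le> U" unfolding rK mult_1_right using KU by (rule order.trans)
      have r2: "m1 rR * P1 ^ (2 * \<beta> + 1) * P2 ^ (2 * lam k y + 1) \<le> U" using rK KU by simp
      show "srun (split_com ;; group_com) m1 (6000 * (U + 1) ^ 2 + 9000 * (U + 1) ^ 2) Q"
      proof (rule srun_seq, rule srun_split[OF p1 _ refl refl refl P1_def \<beta>_def r1])
        show "m1 vb = b" "1 \<le> m1 rR" "U \<le> \<Omega>" using I U unfolding I_def by auto
        fix m2 assume 2: "frame split_regs m1 m2" "m2 vphi = nisan P1 \<beta> (m1 rS) (m1 vv) mod 2 ^ lam k y"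
          "m2 rS = m1 rS div P1 ^ (2 * \<beta> + 1)" "m2 rR = m1 rR * P1 ^ (2 * \<beta> + 1)"
        have p2: "params k y m2" by (rule params_frame[OF p1 2(1)]) (auto simp: work_regs_def)
        have f2: "m2 vb = b" "m2 vv = m1 vv" using frameD[OF 2(1), of vb] frameD[OF 2(1), of vv] I unfolding I_def by auto
        have col: "m2 vphi + 2 ^ lam k y * (poly_hash p (group_deg k y) (nisan P2 (lam k y) (m2 rS) (m2 vphi)) (m2 vv) mod class_size k (2 ^ lam k y) (m2 vphi))
            = colour_hash k y t s v"
          using I unfolding I_def ch split_hash_def Let_def 2 f2 by simp
        show "srun group_com m2 (9000 * (U + 1) ^ 2) Q"
        proof (rule srun_group[OF p2 f2(1) refl refl refl refl b1 k p_def P2_def, unfolded col])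
          show "m2 rR * P2 ^ (2 * lam k y + 1) \<le> U" unfolding 2 by (rule r2)
          show "1 \<le> m2 rR" using I next_prime_gt0[of "2 ^ split_bits k y b"] unfolding 2 I_def P1_def by (simp add: Suc_le_eq)
          show "U \<le> \<Omega>" by (rule U)
          have "colour_hash k y t s v < k" unfolding t_def by (rule colour_hash_less[OF k])
          then show "colour_hash k y t s v \<le> \<Omega>" using U by linarith
          fix m3 assume 3: "frame group_regs m2 m3" "m3 vout = colour_hash k y t s v"
            "m3 rR = m2 rR * P2 ^ (2 * lam k y + 1)"
          show "Q m3"
          proof (rule Q)
            show "frame work_regs m m3" unfolding frame_def
            proof (intro allI impI)
              fix a assume a: "a \<notin> work_regs"
              have "m3 a = m2 a" using frameD[OF 3(1), of a] a unfolding work_regs_def by simp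
              also have "\<dots> = m1 a" using frameD[OF 2(1), of a] a unfolding work_regs_def by simp
              also have "\<dots> = m a" using I a unfolding I_def frame_def by simp
              finally show "m3 a = m a" .
            qed
            show "m3 rR = seed_count k y (start_bits k y)" using rK unfolding 3 2 K_def t_def by simp
          qed (use 3 in \<open>simp add: t_def\<close>)
        qed
      qed
    qed
  qed
  moreover have "128 + (128 + ((t * (6000 * (U + 1) ^ 2 + 64) + 64) + (6000 * (U + 1) ^ 2 + 9000 * (U + 1) ^ 2))) \<le> 22000 * (U + 1) ^ 3"
  proof -
    define z where "z = (U + 1) ^ 2"
    have z1: "1 \<le> z" unfolding z_def by simp
    have "t * (6000 * z + 64) \<le> U * (6000 * z + 64 * z)" using U z1 unfolding t_def by (intro mult_le_mono) auto
    then have "128 + (128 + ((t * (6000 * z + 64) + 64) + (6000 * z + 9000 * z))) \<le> U * (6064 * z) + 15320 * z" using z1 by simp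
    also have "\<dots> \<le> 22000 * (U * z + z)" by simp
    also have "U * z + z = (U + 1) ^ 3" unfolding z_def by (simp add: power2_eq_square power3_eq_cube algebra_simps)
    finally show ?thesis unfolding z_def .
  qed
  ultimately show ?thesis by (rule srun_time)
qed

end

section \<open>The greedy search for the code\<close>

abbreviation "gY \<equiv> 31 :: nat"
abbreviation "gE \<equiv> 32 :: nat"
abbreviation "gQ \<equiv> 38 :: nat"
abbreviation "gNu \<equiv> 39 :: nat"
abbreviation "gG \<equiv> 40 :: nat"
abbreviation "gGG \<equiv> 41 :: nat"
abbreviation "gR \<equiv> 42 :: nat"
abbreviation "gL \<equiv> 43 :: nat"
abbreviation "gP \<equiv> 44 :: nat"
abbreviation "gM \<equiv> 45 :: nat"
abbreviation "cSig \<equiv> 56 :: nat"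
abbreviation "cX \<equiv> 57 :: nat"
abbreviation "cI \<equiv> 58 :: nat"
abbreviation "cC \<equiv> 59 :: nat"
abbreviation "cR \<equiv> 60 :: nat"
abbreviation "cOld \<equiv> 61 :: nat"
abbreviation "cNew \<equiv> 62 :: nat"
abbreviation "cV \<equiv> 63 :: nat"
abbreviation "cW \<equiv> 64 :: nat"
abbreviation "cT \<equiv> 65 :: nat"
abbreviation "cJ \<equiv> 66 :: nat"
abbreviation "cY \<equiv> 67 :: nat"
abbreviation "cZ \<equiv> 68 :: nat"
abbreviation "cK \<equiv> 69 :: nat"

definition set_bit_length :: "nat \<Rightarrow> expr \<Rightarrow> com" where
  "set_bit_length i e = rN ::= e ;; bit_length_com ;; i ::= V rE"

definition set_pow2 :: "nat \<Rightarrow> expr \<Rightarrow> com" where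
  "set_pow2 i e = rE ::= e ;; pow2_com ;; i ::= V rN"

definition set_prime :: "nat \<Rightarrow> expr \<Rightarrow> com" where
  "set_prime i e = rE ::= e ;; prime_com ;; i ::= V rN"

definition set_code :: "nat \<Rightarrow> expr \<Rightarrow> expr \<Rightarrow> com" where
  "set_code i ex es = rP ::= V gP ;; rD ::= Const 2 ;; rX ::= ex ;; rS ::= es ;; poly_com ;; i ::= V rA [mod] V gQ"

context ram
begin

lemma frame_work_trans: "frame work_regs f m \<Longrightarrow> frame X m m1 \<Longrightarrow> X \<subseteq> work_regs \<Longrightarrow> frame work_regs f m1"
  unfolding frame_def by auto

lemma frame_work_upd: "frame work_regs f m \<Longrightarrow> i \<in> work_regs \<Longrightarrow> frame work_regs f (m(i := v))"
  unfolding frame_def by auto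

text \<open>The memory is known only outside the scratch registers, where it agrees with
  \<open>f\<close>. A sequence of assignments to global registers then becomes a chain of updates of
  \<open>f\<close>.\<close>

lemma srun_set:
  assumes "frame work_regs f m" "eval \<delta> m e = v" "v \<le> \<Omega>" "\<And>m'. frame work_regs (f(i := v)) m' \<Longrightarrow> Q m'"
  shows "srun (i ::= e) m 128 Q"
  by (rule srun_asg) (use assms in \<open>auto simp: frame_def\<close>)

lemma srun_set_bit_length:
  assumes f: "frame work_regs f m" "eval \<delta> m e = a" "2 * a + 1 \<le> \<Omega>"
    and Q: "\<And>m'. frame work_regs (f(i := bit_length a)) m' \<Longrightarrow> Q m'"
  shows "srun (set_bit_length i e) m (bit_length a * 400 + 700) Q"
proof -
  have "srun (set_bit_length i e) m (128 + ((bit_length a * 400 + 400) + 128)) Q"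
    unfolding set_bit_length_def
  proof (rule srun_seq, rule srun_asg, rule_tac [2] srun_seq, rule_tac [2] srun_bit_length[where a = a])
    show "eval \<delta> m e \<le> \<Omega>" using f by linarith
    show "(m(rN := eval \<delta> m e)) rN = a" using f by simp
    show "2 * a + 1 \<le> \<Omega>" by (rule f)
    fix m1 assume 1: "frame {rQ, rE} (m(rN := eval \<delta> m e)) m1" "m1 rE = bit_length a"
    have "frame work_regs f m1"
      by (rule frame_work_trans[OF frame_work_upd[OF f(1)] 1(1)]) (auto simp: work_regs_def)
    then show "srun (i ::= V rE) m1 128 Q"
      by (rule srun_set[where v = "bit_length a"]) (use 1 f bit_length_le_self[of a] in \<open>auto intro: Q\<close>)
  qed
  then show ?thesis by (rule srun_time) simp
qed

lemma srun_set_pow2: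
  assumes f: "frame work_regs f m" "eval \<delta> m e = a" "2 ^ a \<le> \<Omega>"
    and Q: "\<And>m'. frame work_regs (f(i := 2 ^ a)) m' \<Longrightarrow> Q m'"
  shows "srun (set_pow2 i e) m (a * 400 + 700) Q"
proof -
  have a: "a \<le> \<Omega>" using f(3) less_exp[of a] by linarith
  have "srun (set_pow2 i e) m (128 + ((a * 400 + 400) + 128)) Q"
    unfolding set_pow2_def
  proof (rule srun_seq, rule srun_asg, rule_tac [2] srun_seq, rule_tac [2] srun_pow2[where e = a])
    show "eval \<delta> m e \<le> \<Omega>" using f a by simp
    show "(m(rE := eval \<delta> m e)) rE = a" using f by simp
    show "2 ^ a \<le> \<Omega>" by (rule f)
    fix m1 assume 1: "frame {rN, rC} (m(rE := eval \<delta> m e)) m1" "m1 rN = 2 ^ a"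
    have "frame work_regs f m1"
      by (rule frame_work_trans[OF frame_work_upd[OF f(1)] 1(1)]) (auto simp: work_regs_def)
    then show "srun (i ::= V rN) m1 128 Q"
      by (rule srun_set[where v = "2 ^ a"]) (use 1 f in \<open>auto intro: Q\<close>)
  qed
  then show ?thesis by (rule srun_time) simp
qed

lemma srun_set_prime:
  assumes f: "frame work_regs f m" "eval \<delta> m e = a" "1 \<le> a" "next_prime (2 ^ a) \<le> U" "U \<le> \<Omega>"
    and Q: "\<And>m'. frame work_regs (f(i := next_prime (2 ^ a))) m' \<Longrightarrow> Q m'"
  shows "srun (set_prime i e) m (1700 * (U + 1) ^ 2) Q"
proof -
  have "2 ^ a \<le> \<Omega>" using f(4,5) next_prime(2)[of "2 ^ a"] by linarith
  then have a: "a \<le> \<Omega>" using less_exp[of a] by linarith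
  have "srun (set_prime i e) m (128 + (1400 * (U + 1) ^ 2 + 128)) Q"
    unfolding set_prime_def
  proof (rule srun_seq, rule srun_asg, rule_tac [2] srun_seq, rule_tac [2] srun_prime[where e = a and U = U])
    show "eval \<delta> m e \<le> \<Omega>" using f a by simp
    show "(m(rE := eval \<delta> m e)) rE = a" using f by simp
    show "1 \<le> a" "next_prime (2 ^ a) \<le> U" "U \<le> \<Omega>" by (rule f)+
    fix m1 assume 1: "frame {rN, rQ, rC} (m(rE := eval \<delta> m e)) m1" "m1 rN = next_prime (2 ^ a)"
    have "frame work_regs f m1"
      by (rule frame_work_trans[OF frame_work_upd[OF f(1)] 1(1)]) (auto simp: work_regs_def)
    then show "srun (i ::= V rN) m1 128 Q"
      by (rule srun_set[where v = "next_prime (2 ^ a)"]) (use 1 f in \<open>auto intro: Q\<close>)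
  qed
  moreover have "128 + (1400 * z + 128) \<le> 1700 * z" if "1 \<le> z" for z :: nat using that by simp
  ultimately show ?thesis by (rule srun_time[OF _ ]) simp
qed

lemma srun_set_code:
  assumes f: "frame work_regs f m" and reg: "f gP = p" "2 \<le> p" "f gQ = q"
    and ex: "\<And>m1. frame work_regs f m1 \<Longrightarrow> eval \<delta> m1 ex = x" "x \<le> \<Omega>"
    and es: "\<And>m1. frame work_regs f m1 \<Longrightarrow> eval \<delta> m1 es = s" "s \<le> \<Omega>"
    and Q: "\<And>m'. frame work_regs (f(i := poly_hash p 2 s x mod q)) m' \<Longrightarrow> Q m'"
  shows "srun (set_code i ex es) m 2400 Q"
proof (rule srun_bounded)
  assume bd: "bounded_mem m"
  have gPm: "m1 gP = p" "m1 gQ = q" if "frame work_regs f m1" for m1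
    using frameD[OF that, of gP] frameD[OF that, of gQ] reg unfolding work_regs_def by auto
  have pO: "p \<le> \<Omega>" using bounded_memD[OF bd, of gP] gPm[OF f] by simp
  define m1 where "m1 = m(rP := p)"
  define m2 where "m2 = m1(rD := 2)"
  define m3 where "m3 = m2(rX := x)"
  define m4 where "m4 = m3(rS := s)"
  have f1: "frame work_regs f m1" unfolding m1_def by (rule frame_work_upd[OF f]) (simp add: work_regs_def)
  have f2: "frame work_regs f m2" unfolding m2_def by (rule frame_work_upd[OF f1]) (simp add: work_regs_def)
  have f3: "frame work_regs f m3" unfolding m3_def by (rule frame_work_upd[OF f2]) (simp add: work_regs_def)
  have f4: "frame work_regs f m4" unfolding m4_def by (rule frame_work_upd[OF f3]) (simp add: work_regs_def)
  have e1: "eval \<delta> m (V gP) = p" using gPm[OF f] by simp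
  have poly: "srun (poly_com ;; i ::= V rA [mod] V gQ) m4 ((2 * 600 + 500) + 128) Q"
  proof (rule srun_seq, rule srun_poly[where p = p and d = 2 and s = s and x = x])
    show "m4 rP = p" "m4 rD = 2" "m4 rX = x" "m4 rS = s" unfolding m4_def m3_def m2_def m1_def by simp_all
    show "2 \<le> p" by (rule reg)
    fix m5 assume 5: "frame {rS, rA, rW, rC} m4 m5" "m5 rA = poly_hash p 2 s x"
    have f5: "frame work_regs f m5" by (rule frame_work_trans[OF f4 5(1)]) (auto simp: work_regs_def)
    show "srun (i ::= V rA [mod] V gQ) m5 128 Q"
    proof (rule srun_bounded)
      assume bd5: "bounded_mem m5"
      have "poly_hash p 2 s x mod q \<le> \<Omega>"
        using bounded_memD[OF bd5, of rA] 5 mod_less_eq_dividend[of "poly_hash p 2 s x" q] by linarith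
      then show ?thesis
        by (intro srun_set[OF f5, where v = "poly_hash p 2 s x mod q"]) (use 5 gPm[OF f5] in \<open>auto intro: Q\<close>)
    qed
  qed
  have "srun (set_code i ex es) m (128 + (128 + (128 + (128 + ((2 * 600 + 500) + 128))))) Q"
    unfolding set_code_def
    apply (rule srun_seq, rule srun_asg)
    subgoal using e1 pO by simp
    unfolding e1 m1_def[symmetric]
    apply (rule srun_seq, rule srun_asg)
    subgoal using \<Omega>_ge by simp
    unfolding eval.simps m2_def[symmetric]
    apply (rule srun_seq, rule srun_asg)
    subgoal using ex f2 by simp
    unfolding ex(1)[OF f2] m3_def[symmetric]
    apply (rule srun_seq, rule srun_asg)
    subgoal using es f3 by simp
    unfolding es(1)[OF f3] m4_def[symmetric]
    by (rule poly)
  then show ?thesis by (rule srun_time) simp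
qed

end

text \<open>Entry i of the code lives at address 99 + i, above all registers. The counter
  \<open>cJ\<close> exceeds the offset by 1, which turns 99 into 98.\<close>

definition pair_body :: com where
  "pair_body = set_code cY (V cV [-] Const 1) (Load (Const 98 [+] V cI [+] V cJ)) ;;
      set_code cZ (V cW [-] Const 1) (Load (Const 98 [+] V cI [+] V cJ)) ;;
      Cond (V cY [=] V cZ) (cT ::= V cT [*] Const 2) Skip"

definition pair_com :: com where
  "pair_com = cT ::= Const 1 ;; for_loop cJ (V gL [+] Const 1 [-] V cI)
     pair_body"

definition row_com :: com where
  "row_com = for_loop cW (V cV [-] Const 1) (pair_com ;; cNew ::= V cNew [+] V cT)"

definition potential_com :: com where
  "potential_com = cNew ::= Const 0 ;; for_loop cV (V gM) row_com"

definition bump_com :: com where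
  "bump_com = Store (Const 99 [+] V cI) (Load (Const 99 [+] V cI) [+] Const 1) ;; potential_com"

text \<open>The loop ends when new \<le> (1 + 2/q) * old, tested after clearing the
  denominator.\<close>

definition adjust_com :: com where
  "adjust_com = While ((V gQ [+] Const 2) [*] V cOld [<] V gQ [*] V cNew) bump_com"

text \<open>The loop counts down, so the code is filled from its last entry and the entries already
  fixed are always those from i + 1 to L. Its start value M * M is an upper bound for the empty
  potential.\<close>

definition greedy_com :: com where
  "greedy_com = cOld ::= V gM [*] V gM ;; for_loop cI (V gL)
     (Store (Const 99 [+] V cI) (Const 0) ;; potential_com ;;
      adjust_com ;;
      cOld ::= V cNew)"

definition pair_regs :: "nat set" where "pair_regs = work_regs \<union> {cT, cJ, cY, cZ}"

definition potential_regs :: "nat set" where "potential_regs = work_regs \<union> {cT, cJ, cY, cZ, cV, cW, cNew}"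

text \<open>Holds for every candidate, so that the rejected ones do not overflow a word
  either.\<close>

lemma potential_insert_le:
  assumes "finite I" "i \<notin> I"
  shows "potential p q (a(i := s)) (insert i I) M \<le> 2 * potential p q a I M"
proof -
  have "potential p q (a(i := s)) (insert i I) M \<le> (\<Sum>v<M. \<Sum>v'<v. 2 ^ card (collisions p q a I v v') * 2)"
    unfolding potential_def collisions_insert[OF assms] by (intro sum_mono mult_le_mono2) auto
  then show ?thesis unfolding potential_def by (simp add: sum_distrib_left mult.commute)
qed

lemma potential_empty: "potential p q a {} M \<le> M * M"
proof -
  have "potential p q a {} M = (\<Sum>v<M. v)" unfolding potential_def collisions_def by simp
  also have "\<dots> \<le> (\<Sum>v<M. M)" by (rule sum_mono) simp
  finally show ?thesis by simp
qed

text \<open>Converts the integer invariant of the search into a bound on the word size: (1 + 2/q)^j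
  is at most exp (2G), hence at most 16^G, and M^2 contributes another 4^G.\<close>

lemma greedy_bound:
  assumes q: "0 < q" and j: "j \<le> q * G" and old: "q ^ j * old \<le> (q + 2) ^ j * (2 ^ G * 2 ^ G)"
  shows "old \<le> 2 ^ (6 * G)"
proof -
  have "real q ^ j * real old \<le> real (q + 2) ^ j * (2 ^ G * 2 ^ G)"
    using of_nat_mono[OF old, where 'a = real] by simp
  then have "real old \<le> (real (q + 2) ^ j * (2 ^ G * 2 ^ G)) / real q ^ j" using q by (simp add: field_simps)
  also have "\<dots> = (real (q + 2) / real q) ^ j * (2 ^ G * 2 ^ G)" unfolding power_divide by simp
  also have "\<dots> = (1 + 2 / real q) ^ j * (2 ^ G * 2 ^ G)"
  proof -
    have "real (q + 2) / real q = 1 + 2 / real q" using q by (simp add: field_simps)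
    then show ?thesis by (simp only:)
  qed
  also have "\<dots> \<le> exp (2 / real q) ^ j * (2 ^ G * 2 ^ G)"
    using exp_ge_add_one_self[of "2 / real q"] by (intro mult_right_mono power_mono) auto
  also have "exp (2 / real q) ^ j = exp (real j * (2 / real q))" by (rule exp_of_nat_mult[symmetric])
  also have "\<dots> \<le> exp (real G * 2)"
  proof -
    have "real j \<le> real q * real G" using j by (metis of_nat_le_iff of_nat_mult)
    then have "real j * (2 / real q) \<le> real G * 2" using q by (simp add: field_simps)
    then show ?thesis by simp
  qed
  also have "exp (real G * 2) = (exp 1 ^ 2) ^ G" by (simp only: exp_of_nat_mult exp_double power_mult[symmetric] flip: mult_2_right) (simp add: exp_of_nat_mult[symmetric])
  also have "(exp 1 ^ 2) ^ G \<le> ((3::real) ^ 2) ^ G" using exp_le by (intro power_mono) auto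
  also have "\<dots> \<le> (16::real) ^ G" by (intro power_mono) auto
  also have "(16::real) ^ G * (2 ^ G * 2 ^ G) = (16 * 2 * 2) ^ G" by (simp only: power_mult_distrib mult.assoc)
  also have "\<dots> = 2 ^ (6 * G)" by (simp add: power_mult)
  finally have "real old \<le> real (2 ^ (6 * G))" by simp
  then show ?thesis by (simp only: of_nat_le_iff)
qed

context ram
begin

lemma srun_pair:
  assumes m: "m gP = p" "2 \<le> p" "m gQ = q" "m gL = L" "m cI = i" "m cV = Suc v" "m cW = Suc v'" and i: "1 \<le> i" "i \<le> L"
    and a: "a = (\<lambda>i. m (99 + i))" and LU: "L \<le> U" "U + 1 \<le> \<Omega>"
    and c: "2 ^ card (collisions p q a {i..L} v v') \<le> \<Omega>"
    and Q: "\<And>m'. frame pair_regs m m' \<Longrightarrow> m' cT = 2 ^ card (collisions p q a {i..L} v v') \<Longrightarrow> Q m'"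
  shows "srun pair_com m (6000 * (U + 1)) Q"
proof (rule srun_bounded)
  assume bd: "bounded_mem m"
  have vO: "v \<le> \<Omega>" "v' \<le> \<Omega>" using bounded_memD[OF bd, of cV] bounded_memD[OF bd, of cW] m by auto
  define N where "N = L + 1 - i"
  have N: "N \<le> \<Omega>" using LU unfolding N_def by simp
  define I where "I j m' \<longleftrightarrow> frame pair_regs m m' \<and> m' cT = 2 ^ card (collisions p q a {i + j..L} v v')" for j m'
  have "srun pair_com m (128 + (N * ((2400 + (2400 + (128 + 64))) + 192) + 192)) Q"
    unfolding pair_com_def
  proof (rule srun_seq, rule srun_asg)
    show "eval \<delta> m (Const 1) \<le> \<Omega>" using \<Omega>_ge by simp
    define m0 where "m0 = m(cT := eval \<delta> m (Const 1))"
    show "srun (for_loop cJ (V gL [+] Const 1 [-] V cI)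
     pair_body) m0 (N * ((2400 + (2400 + (128 + 64))) + 192) + 192) Q"
    proof (rule srun_for[where I = I and N = N])
      show "eval \<delta> m0 (V gL [+] Const 1 [-] V cI) = N" unfolding m0_def N_def using m by simp
      have "{i + N..L} = {}" unfolding N_def using i by auto
      then show "I N (m0(cJ := N))" unfolding I_def m0_def by (auto simp: frame_def pair_regs_def collisions_def)
      fix j m1 assume I: "I (Suc j) m1" and cj: "m1 cJ = Suc j" and j: "j < N"
      have r1: "m1 gP = p" "m1 gQ = q" "m1 cI = i" "m1 cV = Suc v" "m1 cW = Suc v'" "m1 (99 + (i + j)) = a (i + j)"
        using I m unfolding I_def frame_def pair_regs_def work_regs_def a by auto
      define s where "s = a (i + j)"
      define x where "x = poly_hash p 2 s v mod q"
      define x' where "x' = poly_hash p 2 s v' mod q"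
      have sO: "s \<le> \<Omega>" unfolding s_def a by (rule bounded_memD[OF bd])
      have ins: "{i + j..L} = insert (i + j) {i + Suc j..L}" using j unfolding N_def by auto
      have "2 ^ card (collisions p q (a(i + j := s)) (insert (i + j) {i + Suc j..L}) v v') =
        2 ^ card (collisions p q a {i + Suc j..L} v v') * (1 + of_bool (poly_hash p 2 s v mod q = poly_hash p 2 s v' mod q) :: nat)"
        by (rule collisions_insert) auto
      then have cc: "2 ^ card (collisions p q a {i + j..L} v v') = 2 ^ card (collisions p q a {i + Suc j..L} v v') * (1 + of_bool (x = x') :: nat)"
        unfolding ins s_def x_def x'_def fun_upd_triv .
      have "card (collisions p q a {i + j..L} v v') \<le> card (collisions p q a {i..L} v v')"
        by (rule card_mono) (auto simp: collisions_def)
      then have "(2::nat) ^ card (collisions p q a {i + j..L} v v') \<le> 2 ^ card (collisions p q a {i..L} v v')" by (rule power_increasing) simp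
      then have cO: "2 ^ card (collisions p q a {i + j..L} v v') \<le> \<Omega>" using c by linarith
      show "srun pair_body m1 (2400 + (2400 + (128 + 64))) (\<lambda>m'. m' cJ = Suc j \<and> I j (m'(cJ := j)))"
      unfolding pair_body_def
      proof (rule srun_seq, rule srun_set_code[OF frame_refl, where p = p and q = q and x = v and s = s])
        show "m1 gP = p" "2 \<le> p" "m1 gQ = q" "v \<le> \<Omega>" "s \<le> \<Omega>" using r1 m vO sO by auto
        have adr: "Suc (98 + (i + j)) = 99 + (i + j)" by simp
        fix m2 assume 2: "frame work_regs m1 m2"
        show "eval \<delta> m2 (V cV [-] Const 1) = v" using 2 r1 unfolding frame_def work_regs_def by simp
        show "eval \<delta> m2 (Load (Const 98 [+] V cI [+] V cJ)) = s"
          using 2 r1 cj i unfolding frame_def work_regs_def s_def by (simp add: add.assoc)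
      next
        fix m2 assume 2: "frame work_regs (m1(cY := poly_hash p 2 s v mod q)) m2"
        show "srun (set_code cZ (V cW [-] Const 1) (Load (Const 98 [+] V cI [+] V cJ)) ;;
        Cond (V cY [=] V cZ) (cT ::= V cT [*] Const 2) Skip) m2 (2400 + (128 + 64)) (\<lambda>m'. m' cJ = Suc j \<and> I j (m'(cJ := j)))"
        proof (rule srun_seq, rule srun_set_code[OF 2, where p = p and q = q and x = v' and s = s])
          show "(m1(cY := poly_hash p 2 s v mod q)) gP = p" "2 \<le> p" "(m1(cY := poly_hash p 2 s v mod q)) gQ = q" "v' \<le> \<Omega>" "s \<le> \<Omega>" using r1 m vO sO by auto
          fix m3 assume 3: "frame work_regs (m1(cY := poly_hash p 2 s v mod q)) m3"
          show "eval \<delta> m3 (V cW [-] Const 1) = v'" using 3 r1 unfolding frame_def work_regs_def by simp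
          show "eval \<delta> m3 (Load (Const 98 [+] V cI [+] V cJ)) = s"
            using 3 r1 cj i unfolding frame_def work_regs_def s_def by (simp add: add.assoc)
        next
          fix m3 assume "frame work_regs (m1(cY := poly_hash p 2 s v mod q, cZ := poly_hash p 2 s v' mod q)) m3"
          then have 3: "frame work_regs (m1(cY := x, cZ := x')) m3" unfolding x_def x'_def .
          have r3: "m3 cY = x" "m3 cZ = x'" "m3 cT = m1 cT" "m3 cJ = Suc j" using 3 cj unfolding frame_def work_regs_def by auto
          have f3: "frame pair_regs m m3" unfolding frame_def
          proof (intro allI impI)
            fix b assume b: "b \<notin> pair_regs"
            then have "m3 b = m1 b" using 3 unfolding frame_def pair_regs_def by simp
            also have "\<dots> = m b" using I b unfolding I_def frame_def by simp
            finally show "m3 b = m b" .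
          qed
          have t1: "m1 cT = 2 ^ card (collisions p q a {i + Suc j..L} v v')" using I unfolding I_def by simp
          show "srun (Cond (V cY [=] V cZ) (cT ::= V cT [*] Const 2) Skip) m3 (128 + 64) (\<lambda>m'. m' cJ = Suc j \<and> I j (m'(cJ := j)))"
          proof (rule srun_cond)
            assume "eval \<delta> m3 (V cY [=] V cZ) \<noteq> 0"
            then have "x = x'" using r3 by (auto simp: of_bool_def split: if_splits)
            then have t2: "2 ^ card (collisions p q a {i + j..L} v v') = m1 cT * 2" using cc t1 by simp
            show "srun (cT ::= V cT [*] Const 2) m3 128 (\<lambda>m'. m' cJ = Suc j \<and> I j (m'(cJ := j)))"
              by (rule srun_asg) (use t2 cO r3 f3 in \<open>auto simp: I_def frame_def pair_regs_def\<close>)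
          next
            assume "eval \<delta> m3 (V cY [=] V cZ) = 0"
            then have "x \<noteq> x'" using r3 by (auto simp: of_bool_def split: if_splits)
            then have t2: "2 ^ card (collisions p q a {i + j..L} v v') = m1 cT" using cc t1 by simp
            show "srun Skip m3 128 (\<lambda>m'. m' cJ = Suc j \<and> I j (m'(cJ := j)))"
              by (rule srun_time[OF srun_skip]) (use t2 r3 f3 in \<open>auto simp: I_def frame_def pair_regs_def\<close>)
          qed
        qed
      qed
    qed (use N in \<open>auto simp: I_def intro: Q\<close>)
  qed
  moreover have "128 + (N * ((2400 + (2400 + (128 + 64))) + 192) + 192) \<le> 6000 * (U + 1)"
    using LU i unfolding N_def by simp
  ultimately show ?thesis by (rule srun_time)
qed

lemma srun_row:
  assumes m: "m gP = p" "2 \<le> p" "m gQ = q" "m gL = L" "m cI = i" "m cV = Suc v" "m cNew = x" and i: "1 \<le> i" "i \<le> L"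
    and a: "a = (\<lambda>i. m (99 + i))" and LU: "L \<le> U" "v \<le> U" "U + 1 \<le> \<Omega>"
    and c: "x + (\<Sum>v'<v. 2 ^ card (collisions p q a {i..L} v v')) \<le> \<Omega>"
    and Q: "\<And>m'. frame potential_regs m m' \<Longrightarrow> m' cV = Suc v \<Longrightarrow> m' cNew = x + (\<Sum>v'<v. 2 ^ card (collisions p q a {i..L} v v')) \<Longrightarrow> Q m'"
  shows "srun row_com m (6400 * (U + 1) ^ 2) Q"
proof -
  define I where "I j m' \<longleftrightarrow> frame potential_regs m m' \<and> m' cV = Suc v \<and> j \<le> v \<and>
    m' cNew = x + (\<Sum>v'\<in>{j..<v}. 2 ^ card (collisions p q a {i..L} v v'))" for j m'
  have "srun row_com m (v * ((6000 * (U + 1) + 128) + 192) + 192) Q"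
    unfolding row_com_def
  proof (rule srun_for[where I = I and N = v])
    fix j m1 assume I: "I (Suc j) m1" and cj: "m1 cW = Suc j" and j: "j < v"
    have r1: "m1 gP = p" "m1 gQ = q" "m1 gL = L" "m1 cI = i" "m1 cV = Suc v" "m1 cW = Suc j" "\<And>i. m1 (99 + i) = m (99 + i)"
      using I m cj unfolding I_def frame_def potential_regs_def work_regs_def by auto
    have aa: "(\<lambda>i. m1 (99 + i)) = a" unfolding a r1 ..
    define y where "y = (2::nat) ^ card (collisions p q a {i..L} v j)"
    have sp: "(\<Sum>v'\<in>{j..<v}. 2 ^ card (collisions p q a {i..L} v v')) = y + (\<Sum>v'\<in>{Suc j..<v}. 2 ^ card (collisions p q a {i..L} v v'))"
      unfolding y_def using j by (rule sum.atLeast_Suc_lessThan)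
    have "(\<Sum>v'\<in>{j..<v}. 2 ^ card (collisions p q a {i..L} v v')) \<le> (\<Sum>v'<v. 2 ^ card (collisions p q a {i..L} v v') :: nat)"
      by (rule sum_mono2) auto
    then have yO: "m1 cNew + y \<le> \<Omega>" using I c sp unfolding I_def by simp
    show "srun (pair_com ;; cNew ::= V cNew [+] V cT) m1 (6000 * (U + 1) + 128) (\<lambda>m'. m' cW = Suc j \<and> I j (m'(cW := j)))"
    proof (rule srun_seq, rule srun_pair[where p = p and q = q and L = L and i = i and v = v and v' = j and a = a])
      show "2 ^ card (collisions p q a {i..L} v j) \<le> \<Omega>" using yO unfolding y_def by simp
      fix m2 assume 2: "frame pair_regs m1 m2" "m2 cT = 2 ^ card (collisions p q a {i..L} v j)"
      have r2: "m2 cNew = m1 cNew" "m2 cW = Suc j" "m2 cV = Suc v" "m2 cT = y" "frame potential_regs m m2"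
        using 2 I r1 unfolding I_def frame_def potential_regs_def pair_regs_def work_regs_def y_def by auto
      show "srun (cNew ::= V cNew [+] V cT) m2 128 (\<lambda>m'. m' cW = Suc j \<and> I j (m'(cW := j)))"
        by (rule srun_asg) (use r2 yO I j sp in \<open>auto simp: I_def frame_def potential_regs_def\<close>)
    qed (use r1 m i LU aa in auto)
  next
    fix m1 assume "I 0 m1"
    then show "Q m1" unfolding I_def by (intro Q) (auto simp: lessThan_atLeast0)
  qed (use m LU in \<open>auto simp: I_def frame_def potential_regs_def\<close>)
  moreover have "v * ((6000 * (U + 1) + 128) + 192) + 192 \<le> 6400 * (U + 1) ^ 2"
  proof -
    define z where "z = U * (U + 1)"
    have "v * ((6000 * (U + 1) + 128) + 192) \<le> U * (6400 * (U + 1))" using LU by (intro mult_le_mono) auto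
    also have "\<dots> = 6400 * z" unfolding z_def by (rule mult.left_commute)
    finally have "v * ((6000 * (U + 1) + 128) + 192) + 192 \<le> 6400 * (z + U + 1)" by simp
    also have "z + U + 1 = (U + 1) ^ 2" unfolding z_def by (simp add: power2_eq_square)
    finally show ?thesis .
  qed
  ultimately show ?thesis by (rule srun_time)
qed

lemma srun_potential:
  assumes m: "m gP = p" "2 \<le> p" "m gQ = q" "m gL = L" "m cI = i" "m gM = M" and i: "1 \<le> i" "i \<le> L"
    and a: "a = (\<lambda>i. m (99 + i))" and LU: "L \<le> U" "M \<le> U" "U + 1 \<le> \<Omega>"
    and c: "potential p q a {i..L} M \<le> \<Omega>"
    and Q: "\<And>m'. frame potential_regs m m' \<Longrightarrow> m' cNew = potential p q a {i..L} M \<Longrightarrow> Q m'"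
  shows "srun potential_com m (7000 * (U + 1) ^ 3) Q"
proof -
  define s where "s v = (\<Sum>v'<v. 2 ^ card (collisions p q a {i..L} v v') :: nat)" for v
  have pot: "potential p q a {i..L} M = (\<Sum>v<M. s v)" unfolding potential_def s_def ..
  define I where "I j m' \<longleftrightarrow> frame potential_regs m m' \<and> j \<le> M \<and> m' cNew = (\<Sum>v\<in>{j..<M}. s v)" for j m'
  have "srun potential_com m (128 + (M * (6400 * (U + 1) ^ 2 + 192) + 192)) Q"
    unfolding potential_com_def
  proof (rule srun_seq, rule srun_asg)
    show "eval \<delta> m (Const 0) \<le> \<Omega>" by simp
    show "srun (for_loop cV (V gM) row_com) (m(cNew := eval \<delta> m (Const 0))) (M * (6400 * (U + 1) ^ 2 + 192) + 192) Q"
    proof (rule srun_for[where I = I and N = M])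
      fix j m1 assume I: "I (Suc j) m1" and cj: "m1 cV = Suc j" and j: "j < M"
      have r1: "m1 gP = p" "m1 gQ = q" "m1 gL = L" "m1 cI = i" "\<And>i. m1 (99 + i) = m (99 + i)"
        using I m cj unfolding I_def frame_def potential_regs_def work_regs_def by auto
      have aa: "(\<lambda>i. m1 (99 + i)) = a" unfolding a r1 ..
      have sp: "(\<Sum>v\<in>{j..<M}. s v) = s j + (\<Sum>v\<in>{Suc j..<M}. s v)" using j by (rule sum.atLeast_Suc_lessThan)
      have "(\<Sum>v\<in>{j..<M}. s v) \<le> (\<Sum>v<M. s v)" by (rule sum_mono2) auto
      then have yO: "m1 cNew + s j \<le> \<Omega>" using I c sp unfolding I_def pot by simp
      show "srun row_com m1 (6400 * (U + 1) ^ 2) (\<lambda>m'. m' cV = Suc j \<and> I j (m'(cV := j)))"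
      proof (rule srun_row[where p = p and q = q and L = L and i = i and v = j and x = "m1 cNew" and a = a])
        show "m1 cNew + (\<Sum>v'<j. 2 ^ card (collisions p q a {i..L} j v')) \<le> \<Omega>" using yO unfolding s_def .
        fix m2 assume 2: "frame potential_regs m1 m2" "m2 cV = Suc j" "m2 cNew = m1 cNew + (\<Sum>v'<j. 2 ^ card (collisions p q a {i..L} j v'))"
        have f2: "frame potential_regs m m2" using I 2 unfolding I_def frame_def by simp
        show "m2 cV = Suc j \<and> I j (m2(cV := j))"
          using 2 f2 I j sp unfolding I_def s_def[symmetric] by (auto simp: frame_def potential_regs_def)
      qed (use r1 m i LU aa cj j in auto)
    next
      fix m1 assume "I 0 m1"
      then show "Q m1" unfolding I_def by (intro Q) (auto simp: lessThan_atLeast0 pot)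
    qed (use m LU in \<open>auto simp: I_def frame_def potential_regs_def\<close>)
  qed
  moreover have "128 + (M * (6400 * (U + 1) ^ 2 + 192) + 192) \<le> 7000 * (U + 1) ^ 3"
  proof -
    define z where "z = (U + 1) ^ 2"
    have z1: "1 \<le> z" unfolding z_def by simp
    have "M * (6400 * z + 192) \<le> U * (7000 * z)" using LU z1 by (intro mult_le_mono) auto
    then have "128 + (M * (6400 * z + 192) + 192) \<le> 7000 * (U * z + z)" using z1 by simp
    also have "U * z + z = (U + 1) ^ 3" unfolding z_def by (simp add: power2_eq_square power3_eq_cube algebra_simps)
    finally show ?thesis unfolding z_def .
  qed
  ultimately show ?thesis by (rule srun_time)
qed

text \<open>There are L entries, at most p^2 candidates for each, and one potential costs O(U^3);
  with L and p bounded by \<open>U\<close> this gives the sixth power.\<close>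

lemma srun_greedy:
  fixes G :: nat
  assumes m: "m gP = p" "m gQ = q" "m gL = L" "m gM = M" and p: "prime p" "q \<le> p" "M \<le> p" "0 < q"
    and L: "L = q * G" "M = 2 ^ G"
    and LU: "L \<le> U" "p \<le> U" "U + 1 \<le> \<Omega>" "p ^ 2 \<le> \<Omega>" "2 ^ (6 * G + 1) \<le> \<Omega>" "L + 100 \<le> \<Omega>"
    and Q: "\<And>m'. (\<And>b. b < 56 \<Longrightarrow> b \<notin> work_regs \<Longrightarrow> m' b = m b) \<Longrightarrow>
      real (potential p q (\<lambda>i. m' (99 + i)) {1..L} M) \<le> real (M ^ 2) * (1 + 2 / real q) ^ L \<Longrightarrow> Q m'"
  shows "srun greedy_com m (20000 * (U + 1) ^ 6) Q"
proof -
  have p2: "2 \<le> p" using p(1) by (rule prime_ge_2_nat)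
  have MU: "M \<le> U" using p(3) LU(2) by simp
  have M1: "M * M * 2 \<le> \<Omega>"
  proof -
    have "M * M * 2 = 2 ^ (2 * G + 1)" unfolding L by (simp add: power_add mult_2)
    also have "\<dots> \<le> (2::nat) ^ (6 * G + 1)" by (intro power_increasing) auto
    finally show ?thesis using LU by linarith
  qed
  define arr :: "mem \<Rightarrow> nat \<Rightarrow> nat" where "arr m' = (\<lambda>i. m' (99 + i))" for m'
  define TP where "TP = 7000 * (U + 1) ^ 3"
  define TB where "TB = 128 + (TP + ((p ^ 2 * ((128 + TP) + 64) + 64) + 128))"
  \<comment> \<open>The last conjunct is old \<le> (1 + 2/q)^(L - j) * M^2 with denominators
    cleared. The stored value \<open>cOld\<close> only has to dominate the potential, as it does at
    the start.\<close>
  define I where "I j m' \<longleftrightarrow> (\<forall>b. b < 56 \<longrightarrow> b \<notin> work_regs \<longrightarrow> m' b = m b) \<and> j \<le> L \<and>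
    potential p q (arr m') {j + 1..L} M \<le> m' cOld \<and> q ^ (L - j) * m' cOld \<le> (q + 2) ^ (L - j) * (M * M)" for j m'
  have "srun greedy_com m (128 + (L * (TB + 192) + 192)) Q"
    unfolding greedy_com_def
  proof (rule srun_seq, rule srun_asg)
    show "eval \<delta> m (V gM [*] V gM) \<le> \<Omega>" using m M1 by simp
    define m0 where "m0 = m(cOld := eval \<delta> m (V gM [*] V gM))"
    show "srun (for_loop cI (V gL)
     (Store (Const 99 [+] V cI) (Const 0) ;; potential_com ;;
      adjust_com ;;
      cOld ::= V cNew)) m0 (L * (TB + 192) + 192) Q"
    proof (rule srun_for[where I = I and N = L])
      show "eval \<delta> m0 (V gL) = L" unfolding m0_def using m by simp
      show "L \<le> \<Omega>" using LU by simp
      show "I L (m0(cI := L))" using potential_empty[of p q _ M] m unfolding I_def m0_def by (auto simp: work_regs_def)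
    next
      fix m1 assume I: "I 0 m1"
      then have 1: "potential p q (arr m1) {1..L} M \<le> m1 cOld" "q ^ L * m1 cOld \<le> (q + 2) ^ L * (M * M)" unfolding I_def by auto
      have "q ^ L * potential p q (arr m1) {1..L} M \<le> (q + 2) ^ L * (M * M)" using 1 by (meson mult_le_mono2 order.trans)
      then have "real (q ^ L * potential p q (arr m1) {1..L} M) \<le> real ((q + 2) ^ L * (M * M))" by (rule of_nat_mono)
      then have "real (potential p q (arr m1) {1..L} M) \<le> (real (q + 2) ^ L * (M * M)) / real q ^ L" using p(4) by (simp add: field_simps)
      also have "\<dots> = (real (q + 2) / real q) ^ L * (M * M)" unfolding power_divide by simp
      also have "real (q + 2) / real q = 1 + 2 / real q" using p(4) by (simp add: field_simps)
      finally have "real (potential p q (arr m1) {1..L} M) \<le> real (M ^ 2) * (1 + 2 / real q) ^ L" by (simp add: power2_eq_square mult.commute)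
      then show "Q m1" unfolding arr_def by (intro Q) (use I in \<open>auto simp: I_def\<close>)
    next
      fix j m1 assume I: "I (Suc j) m1" and cj: "m1 cI = Suc j" and j: "j < L"
      define i where "i = Suc j"
      define a0 where "a0 = arr m1"
      define old where "old = m1 cOld"
      define W where "W = potential_regs \<union> {99 + i}"
      have i: "1 \<le> i" "i \<le> L" "i \<notin> {i + 1..L}" "finite {i + 1..L}" using j unfolding i_def by auto
      have ins: "{i..L} = insert i {i + 1..L}" using i by auto
      have Iold: "potential p q a0 {i + 1..L} M \<le> old" "q ^ (L - i) * old \<le> (q + 2) ^ (L - i) * (M * M)"
        using I unfolding I_def i_def a0_def old_def by auto
      have oldb: "old \<le> 2 ^ (6 * G)"
        by (rule greedy_bound[of q "L - i"]) (use p L Iold in auto)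
      have potO: "potential p q (a0(i := s)) {i..L} M \<le> \<Omega>" for s
      proof -
        have "potential p q (a0(i := s)) {i..L} M \<le> 2 * potential p q a0 {i + 1..L} M" unfolding ins by (rule potential_insert_le[OF i(4,3)])
        also have "\<dots> \<le> 2 * 2 ^ (6 * G)" using Iold(1) oldb by simp
        finally show ?thesis using LU(5) by simp
      qed
      obtain s0 where s0: "s0 < p ^ 2" "q * potential p q (a0(i := s0)) {i..L} M \<le> (q + 2) * potential p q a0 {i + 1..L} M"
        using greedy_step[OF p(1,4,2,3) i(4,3)] unfolding ins by blast
      have s0': "q * potential p q (a0(i := s0)) {i..L} M \<le> (q + 2) * old"
        using s0(2) Iold(1) by (meson mult_le_mono2 order.trans)
      define w where "w s m2 \<longleftrightarrow> frame W m1 m2 \<and> m2 (99 + i) = s \<and> s \<le> s0" for s m2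
      have regs: "m2 gP = p" "m2 gQ = q" "m2 gL = L" "m2 cI = i" "m2 gM = M" "m2 cOld = old" "arr m2 = a0(i := s)"
        if "w s m2" for s m2
      proof -
        show "m2 gP = p" "m2 gQ = q" "m2 gL = L" "m2 cI = i" "m2 gM = M" "m2 cOld = old"
          using that I m cj unfolding w_def frame_def W_def potential_regs_def work_regs_def I_def i_def old_def by auto
        have "arr m2 b = (a0(i := s)) b" for b
        proof (cases "b = i")
          case True
          then show ?thesis using that unfolding w_def arr_def by simp
        next
          case False
          then have "99 + b \<notin> W" unfolding W_def potential_regs_def work_regs_def by auto
          then show ?thesis using False that unfolding w_def frame_def arr_def a0_def by simp
        qed
        then show "arr m2 = a0(i := s)" by blast
      qed
      have pot: "srun potential_com m2 TP Q'" if w: "w s m2"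
        and Q': "\<And>m3. w s m3 \<Longrightarrow> m3 cNew = potential p q (a0(i := s)) {i..L} M \<Longrightarrow> Q' m3" for s m2 Q'
        unfolding TP_def
      proof (rule srun_potential[where p = p and q = q and L = L and i = i and M = M and a = "a0(i := s)"])
        show "a0(i := s) = (\<lambda>i. m2 (99 + i))" using regs(7)[OF w] unfolding arr_def by simp
        fix m3 assume 3: "frame potential_regs m2 m3" "m3 cNew = potential p q (a0(i := s)) {i..L} M"
        have "99 + i \<notin> potential_regs" using i unfolding potential_regs_def work_regs_def by auto
        then have "m3 (99 + i) = m2 (99 + i)" using 3(1) unfolding frame_def by blast
        moreover have "frame W m1 m3" using w 3(1) unfolding w_def frame_def W_def by simp
        ultimately have "w s m3" using w unfolding w_def by simp
        then show "Q' m3" using 3(2) by (rule Q')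
      qed (use regs[OF w] p2 i LU MU potO in auto)
      have upd: "w s (m2(99 + i := s))" if "frame W m1 m2" "s \<le> s0" for s m2
        using that unfolding w_def frame_def W_def by auto
      \<comment> \<open>The variant is the distance to a candidate \<open>s0\<close> that is known
        to pass the test, so the search stops there or earlier.\<close>
      define NP where "NP v m2 \<longleftrightarrow> (\<exists>s. w s m2 \<and> m2 cNew = potential p q (a0(i := s)) {i..L} M \<and> v = s0 - s)" for v m2
      have step: "srun bump_com m2 (128 + TP) (\<lambda>m'. \<exists>v'<v. NP v' m')"
        if NP: "NP v m2" and e: "eval \<delta> m2 ((V gQ [+] Const 2) [*] V cOld [<] V gQ [*] V cNew) \<noteq> 0" for v m2
      proof -
        obtain s where s: "w s m2" "m2 cNew = potential p q (a0(i := s)) {i..L} M" "v = s0 - s" using NP unfolding NP_def by blast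
        have "(q + 2) * old < q * potential p q (a0(i := s)) {i..L} M" using e regs[OF s(1)] s(2) by (auto simp: of_bool_def split: if_splits)
        then have "s \<noteq> s0" using s0' by auto
        then have ss: "s < s0" using s(1) unfolding w_def by simp
        have m2i: "m2 (99 + i) = s" "m2 cI = i" using s(1) regs[OF s(1)] unfolding w_def by auto
        show ?thesis
        unfolding bump_com_def
        proof (rule srun_seq, rule srun_store)
          show "eval \<delta> m2 (Load (Const 99 [+] V cI) [+] Const 1) \<le> \<Omega>" using m2i ss s0(1) LU by simp
          have "m2(eval \<delta> m2 (Const 99 [+] V cI) := eval \<delta> m2 (Load (Const 99 [+] V cI) [+] Const 1)) = m2(99 + i := Suc s)"
            using m2i by simp
          moreover have "w (Suc s) (m2(99 + i := Suc s))" by (rule upd) (use s ss in \<open>auto simp: w_def\<close>)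
          ultimately have w': "w (Suc s) (m2(eval \<delta> m2 (Const 99 [+] V cI) := eval \<delta> m2 (Load (Const 99 [+] V cI) [+] Const 1)))" by simp
          show "srun potential_com (m2(eval \<delta> m2 (Const 99 [+] V cI) := eval \<delta> m2 (Load (Const 99 [+] V cI) [+] Const 1))) TP (\<lambda>m'. \<exists>v'<v. NP v' m')"
          proof (rule pot[OF w'])
            fix m3 assume "w (Suc s) m3" "m3 cNew = potential p q (a0(i := Suc s)) {i..L} M"
            then have "NP (s0 - Suc s) m3" unfolding NP_def by blast
            moreover have "s0 - Suc s < v" using ss s(3) by simp
            ultimately show "\<exists>v'<v. NP v' m3" by blast
          qed
        qed
      qed
      have fin: "srun (cOld ::= V cNew) m2 128 (\<lambda>m'. m' cI = Suc j \<and> I j (m'(cI := j)))"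
        if NP: "NP v m2" and e: "eval \<delta> m2 ((V gQ [+] Const 2) [*] V cOld [<] V gQ [*] V cNew) = 0" for v m2
      proof -
        obtain s where s: "w s m2" "m2 cNew = potential p q (a0(i := s)) {i..L} M" "v = s0 - s" using NP unfolding NP_def by blast
        define new where "new = m2 cNew"
        have nx: "q * new \<le> (q + 2) * old" using e regs[OF s(1)] unfolding new_def by (auto simp: of_bool_def split: if_splits)
        have Lj: "L - j = Suc (L - i)" using j unfolding i_def by simp
        have "q ^ (L - j) * new = q ^ (L - i) * (q * new)" unfolding Lj by simp
        also have "\<dots> \<le> q ^ (L - i) * ((q + 2) * old)" using nx by (rule mult_le_mono2)
        also have "\<dots> = (q + 2) * (q ^ (L - i) * old)" by (simp only: mult_ac)
        also have "\<dots> \<le> (q + 2) * ((q + 2) ^ (L - i) * (M * M))" using Iold(2) by (rule mult_le_mono2)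
        also have "\<dots> = (q + 2) ^ (L - j) * (M * M)" unfolding Lj power_Suc by (simp only: mult.assoc)
        finally have new_le: "q ^ (L - j) * new \<le> (q + 2) ^ (L - j) * (M * M)" .
        define m3 where "m3 = m2(cOld := new, cI := j)"
        have "arr m3 = a0(i := s)" using regs(7)[OF s(1)] unfolding m3_def arr_def by (auto simp: fun_eq_iff)
        moreover have "{j + 1..L} = {i..L}" unfolding i_def by simp
        ultimately have "potential p q (arr m3) {j + 1..L} M = new" by (simp only: new_def s(2))
        moreover have "m3 b = m b" if "b < 56" "b \<notin> work_regs" for b
        proof -
          have "m3 b = m2 b" using that unfolding m3_def by simp
          also have "\<dots> = m1 b" using s(1) that unfolding w_def frame_def W_def potential_regs_def by simp
          also have "\<dots> = m b" using I that unfolding I_def by simp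
          finally show ?thesis .
        qed
        ultimately have "I j m3" using new_le j unfolding I_def m3_def by simp
        moreover have "new \<le> \<Omega>" unfolding new_def s(2) by (rule potO)
        ultimately show ?thesis
          by (intro srun_asg) (use regs(4)[OF s(1)] in \<open>auto simp: m3_def new_def i_def\<close>)
      qed
      have whl: "srun (adjust_com ;; cOld ::= V cNew) m2
          ((p ^ 2 * ((128 + TP) + 64) + 64) + 128) (\<lambda>m'. m' cI = Suc j \<and> I j (m'(cI := j)))"
        if NP: "NP s0 m2" for m2
      proof -
        have "srun (adjust_com ;; cOld ::= V cNew) m2
          ((s0 * ((128 + TP) + 64) + 64) + 128) (\<lambda>m'. m' cI = Suc j \<and> I j (m'(cI := j)))"
          unfolding adjust_com_def by (rule srun_seq, rule srun_while[where I = NP, OF step fin NP])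
        moreover have "s0 * ((128 + TP) + 64) \<le> p ^ 2 * ((128 + TP) + 64)" using s0(1) by (intro mult_le_mono1) simp
        ultimately show ?thesis by (rule srun_time[OF _ add_le_mono1[OF add_le_mono1]])
      qed
      show "srun (Store (Const 99 [+] V cI) (Const 0) ;; potential_com ;;
        adjust_com ;;
        cOld ::= V cNew) m1 TB (\<lambda>m'. m' cI = Suc j \<and> I j (m'(cI := j)))"
        unfolding TB_def
      proof (rule srun_seq, rule srun_store)
        show "eval \<delta> m1 (Const 0) \<le> \<Omega>" by simp
        have "w 0 (m1(99 + i := 0))" by (rule upd) (auto simp: frame_def)
        then have w0: "w 0 (m1(eval \<delta> m1 (Const 99 [+] V cI) := eval \<delta> m1 (Const 0)))" using cj unfolding i_def by simp
        show "srun (potential_com ;; adjust_com ;; cOld ::= V cNew)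
          (m1(eval \<delta> m1 (Const 99 [+] V cI) := eval \<delta> m1 (Const 0))) (TP + ((p ^ 2 * ((128 + TP) + 64) + 64) + 128)) (\<lambda>m'. m' cI = Suc j \<and> I j (m'(cI := j)))"
        proof (rule srun_seq, rule pot[OF w0])
          fix m2 assume "w 0 m2" "m2 cNew = potential p q (a0(i := 0)) {i..L} M"
          then have "NP s0 m2" unfolding NP_def by (intro exI[of _ 0]) simp
          then show "srun (adjust_com ;; cOld ::= V cNew) m2
            ((p ^ 2 * ((128 + TP) + 64) + 64) + 128) (\<lambda>m'. m' cI = Suc j \<and> I j (m'(cI := j)))" by (rule whl)
        qed
      qed
    qed
  qed
  moreover have "128 + (L * (TB + 192) + 192) \<le> 20000 * (U + 1) ^ 6"
  proof -
    define z where "z = (U + 1) ^ 3"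
    define u where "u = (U + 1) ^ 2"
    have z1: "1 \<le> z" "1 \<le> u" unfolding z_def u_def by auto
    have "p ^ 2 \<le> u" unfolding u_def using LU by (intro power_mono) auto
    define x where "x = u * z"
    define X where "X = p ^ 2 * ((128 + TP) + 64)"
    have "X \<le> u * (8000 * z)" unfolding X_def TP_def z_def[symmetric] using z1 \<open>p ^ 2 \<le> u\<close> by (intro mult_le_mono) auto
    then have X: "X \<le> 8000 * x" unfolding x_def by (simp only: mult.left_commute)
    have zx: "z \<le> x" unfolding x_def using z1 mult_le_mono1[of 1 u z] by simp
    have "TB = 128 + (7000 * z + ((X + 64) + 128))" unfolding TB_def X_def TP_def z_def ..
    then have "TB + 192 \<le> 16000 * x" using X zx z1 by simp
    then have "TB + 192 \<le> 16000 * (u * z)" unfolding x_def .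
    then have "L * (TB + 192) \<le> U * (16000 * (u * z))" using LU by (intro mult_le_mono) auto
    also have "\<dots> = 16000 * (U * (u * z))" by (rule mult.left_commute)
    finally have "128 + (L * (TB + 192) + 192) \<le> 320 * x + 16000 * (U * (u * z))" using zx z1 by simp
    also have "\<dots> \<le> 20000 * (U * (u * z) + u * z)" unfolding x_def by simp
    also have "U * (u * z) + u * z = (U + 1) ^ 6"
    proof -
      have "(U + 1) ^ 6 = (U + 1) * (u * z)" unfolding u_def z_def by (simp only: power_add[symmetric] power_Suc[symmetric]) simp
      then show ?thesis by simp
    qed
    finally show ?thesis .
  qed
  ultimately show ?thesis by (rule srun_time)
qed

end

section \<open>Sizes of the moduli and global parameters\<close>

text \<open>2^g is about 2^t log n and at least the number of moduli, so a window of primes starting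
  there contains enough of them.\<close>

definition gexp :: "nat \<Rightarrow> nat \<Rightarrow> nat \<Rightarrow> nat" where
  "gexp n k y = start_bits k y + bit_length (bit_length n)"
text \<open>The upper end of the window in \<open>card_primes_between\<close>. Residues lie below
  2^G, which is the number of points on which the code has to be good.\<close>

definition Gexp :: "nat \<Rightarrow> nat \<Rightarrow> nat \<Rightarrow> nat" where "Gexp n k y = 2 * gexp n k y + 8"
definition code_length :: "nat \<Rightarrow> nat \<Rightarrow> nat \<Rightarrow> nat" where
  "code_length n k y = 2 ^ start_bits k y * Gexp n k y"
text \<open>About 2^t \<nu> / g moduli against codes of length 2^t (2g + 8): in the product
  \<open>g\<close> cancels and only one factor \<nu> remains.\<close>

definition residue_count :: "nat \<Rightarrow> nat \<Rightarrow> nat \<Rightarrow> nat" where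
  "residue_count n k y = 2 ^ start_bits k y * (bit_length n div gexp n k y + 1)"

definition globals :: "nat \<Rightarrow> nat \<Rightarrow> nat \<Rightarrow> mem \<Rightarrow> bool" where
  "globals n k y m \<longleftrightarrow> m 0 = n \<and> params k y m \<and> m gQ = 2 ^ start_bits k y \<and> m gG = gexp n k y \<and>
     m gR = residue_count n k y \<and> m gL = code_length n k y \<and>
     m gP = next_prime (2 ^ Gexp n k y) \<and> m gM = 2 ^ Gexp n k y"

text \<open>\<delta> is accessible only by comparisons. The test of 2^y + 1 against \<delta> * 2^y
  decides whether 1/2^y \<le> \<delta> - 1.\<close>

definition scale_com :: com where
  "scale_com = gE ::= Const 1 ;;
     While (LeParam (V gE [+] Const 1) (V gE) [=] Const 0) (gY ::= V gY [+] Const 1 ;; gE ::= V gE [*] Const 2)"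

definition params_com :: com where
  "params_com = set_bit_length gK (V 1) ;; gH ::= V gY [+] V gK [+] Const 2 ;;
     gT ::= V gH [+] Const 2 [*] V gK [+] Const 4 ;; gStop ::= Const 8 [*] V gK [+] V gT [div] V 1 ;;
     set_bit_length gLam (V gK) ;; gLam ::= (V gY [<] V 1) [*] (V gLam [-] Const 1) ;; set_pow2 gPow (V gLam) ;;
     set_pow2 gQ (V gT) ;; set_bit_length gNu (V 0) ;; set_bit_length gG (V gNu) ;; gG ::= V gT [+] V gG ;;
     gGG ::= Const 2 [*] V gG [+] Const 8 ;; set_prime gP (V gGG) ;; set_pow2 gM (V gGG) ;;
     gR ::= V gQ [*] (V gNu [div] V gG [+] Const 1) ;; gL ::= V gQ [*] V gGG"

text \<open>Inputs and global parameters occupy registers below 56 outside the scratch set; the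
  counters of the search and of the listing, and the array, lie at 56 or above.\<close>

lemma globals_frame: "globals n k y m \<Longrightarrow> (\<And>b. b < 56 \<Longrightarrow> b \<notin> work_regs \<Longrightarrow> m' b = m b) \<Longrightarrow> globals n k y m'"
  unfolding globals_def params_def work_regs_def by simp

lemma code_sizes:
  fixes n k y :: nat
  defines "t \<equiv> start_bits k y" and "g \<equiv> gexp n k y" and "G \<equiv> Gexp n k y"
  shows "code_length n k y \<le> 2 ^ G" "residue_count n k y \<le> 2 ^ g" "t \<le> g" "g \<le> G" "bit_length n \<le> 2 ^ g" "2 ^ t \<le> (2::nat) ^ G"
proof -
  have "G \<le> 2 ^ (g + 4)"
  proof -
    have "2 * g + 8 \<le> 16 * Suc g" by simp
    also have "\<dots> \<le> 16 * 2 ^ g" by (intro mult_le_mono2 Suc_leI less_exp)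
    also have "\<dots> = 2 ^ (g + 4)" by (simp add: power_add)
    finally show ?thesis unfolding G_def Gexp_def g_def[symmetric] .
  qed
  then have "2 ^ t * G \<le> 2 ^ g * 2 ^ (g + 4)" unfolding t_def g_def gexp_def by (intro mult_le_mono power_increasing) auto
  also have "\<dots> \<le> 2 ^ G" unfolding power_add[symmetric] G_def Gexp_def g_def[symmetric] by (rule power_increasing) auto
  finally show "code_length n k y \<le> 2 ^ G" unfolding code_length_def t_def G_def .
  have nb: "bit_length n + 1 \<le> 2 ^ bit_length (bit_length n)" using bit_length[of "bit_length n"] by simp
  have "2 ^ t * (bit_length n div g + 1) \<le> 2 ^ t * (bit_length n + 1)" by (intro mult_le_mono2 add_le_mono) auto
  also have "\<dots> \<le> 2 ^ t * 2 ^ bit_length (bit_length n)" using nb by (rule mult_le_mono2)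
  also have "\<dots> = 2 ^ g" unfolding g_def gexp_def t_def power_add ..
  finally show "residue_count n k y \<le> 2 ^ g" unfolding residue_count_def t_def g_def .
  show tg: "t \<le> g" unfolding t_def g_def gexp_def by simp
  show gG: "g \<le> G" unfolding g_def G_def Gexp_def by simp
  show "bit_length n \<le> 2 ^ g"
  proof -
    have "(2::nat) ^ bit_length (bit_length n) \<le> 2 ^ g" unfolding g_def gexp_def by (rule power_increasing) auto
    then show ?thesis using nb by linarith
  qed
  show "2 ^ t \<le> (2::nat) ^ G" using tg gG by (intro power_increasing) auto
qed

context ram
begin

text \<open>Form for elimination: the frame fact is consumed and handed on, updated, to the next
  command, while it is still at hand for evaluating the expression.\<close>

lemma srun_set_E:
  "frame work_regs f m \<Longrightarrow> (frame work_regs f m \<Longrightarrow> eval \<delta> m e = v) \<Longrightarrow> v \<le> \<Omega> \<Longrightarrow> (\<And>m'. frame work_regs (f(i := v)) m' \<Longrightarrow> Q m') \<Longrightarrow>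
    srun (i ::= e) m 128 Q"
  by (rule srun_set) auto

lemma srun_set_bit_length_E:
  "frame work_regs f m \<Longrightarrow> (frame work_regs f m \<Longrightarrow> eval \<delta> m e = a) \<Longrightarrow> 2 * a + 1 \<le> \<Omega> \<Longrightarrow>
    (\<And>m'. frame work_regs (f(i := bit_length a)) m' \<Longrightarrow> Q m') \<Longrightarrow> srun (set_bit_length i e) m (bit_length a * 400 + 700) Q"
  by (rule srun_set_bit_length) auto

lemma srun_set_pow2_E:
  "frame work_regs f m \<Longrightarrow> (frame work_regs f m \<Longrightarrow> eval \<delta> m e = a) \<Longrightarrow> 2 ^ a \<le> \<Omega> \<Longrightarrow>
    (\<And>m'. frame work_regs (f(i := 2 ^ a)) m' \<Longrightarrow> Q m') \<Longrightarrow> srun (set_pow2 i e) m (a * 400 + 700) Q"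
  by (rule srun_set_pow2) auto

lemma srun_set_prime_E:
  "frame work_regs f m \<Longrightarrow> (frame work_regs f m \<Longrightarrow> eval \<delta> m e = a) \<Longrightarrow> 1 \<le> a \<Longrightarrow> next_prime (2 ^ a) \<le> U \<Longrightarrow> U \<le> \<Omega> \<Longrightarrow>
    (\<And>m'. frame work_regs (f(i := next_prime (2 ^ a))) m' \<Longrightarrow> Q m') \<Longrightarrow> srun (set_prime i e) m (1700 * (U + 1) ^ 2) Q"
  by (rule srun_set_prime) auto

lemma srun_scale:
  assumes y: "real (2 ^ y + 1) \<le> \<delta> * real (2 ^ y)" "\<And>z. z < y \<Longrightarrow> \<not> real (2 ^ z + 1) \<le> \<delta> * real (2 ^ z)" and O: "2 ^ y \<le> \<Omega>" "m gY = 0"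
    and Q: "\<And>m'. frame {gY, gE} m m' \<Longrightarrow> m' gY = y \<Longrightarrow> Q m'"
  shows "srun scale_com m (y * 400 + 400) Q"
proof -
  define I where "I v m' \<longleftrightarrow> frame {gY, gE} m m' \<and> m' gY + v = y \<and> m' gE = 2 ^ m' gY" for v m'
  have "srun scale_com m (128 + (y * ((128 + 128) + 64) + 64)) Q"
    unfolding scale_com_def
  proof (rule srun_seq, rule srun_asg, rule_tac [2] srun_while[where I = I])
    show "eval \<delta> m (Const 1) \<le> \<Omega>" using \<Omega>_ge by simp
    show "I y (m(gE := eval \<delta> m (Const 1)))" unfolding I_def using O by (auto simp: frame_def)
    fix v m1 assume I: "I v m1"
    have ev: "eval \<delta> m1 (LeParam (V gE [+] Const 1) (V gE) [=] Const 0) = of_bool (\<not> real (2 ^ m1 gY + 1) \<le> \<delta> * real (2 ^ m1 gY))"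
      using I unfolding I_def by (simp add: of_bool_def)
    {
      assume "eval \<delta> m1 (LeParam (V gE [+] Const 1) (V gE) [=] Const 0) \<noteq> 0"
      then have ne: "m1 gY \<noteq> y" using y(1) unfolding ev by auto
      then obtain v' where v': "v = Suc v'" using I unfolding I_def by (cases v) auto
      have le: "Suc (m1 gY) \<le> y" using I ne unfolding I_def by simp
      then have "(2::nat) ^ Suc (m1 gY) \<le> 2 ^ y" by (intro power_increasing) auto
      then have e: "2 * 2 ^ m1 gY \<le> \<Omega>" using O by simp
      have "Suc (m1 gY) \<le> \<Omega>" using le O less_exp[of y] by linarith
      then show "srun (gY ::= V gY [+] Const 1 ;; gE ::= V gE [*] Const 2) m1 (128 + 128) (\<lambda>m'. \<exists>v'<v. I v' m')"
        by (intro srun_seq srun_asg) (use I e v' in \<open>auto simp: I_def frame_def\<close>)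
    }
    assume "eval \<delta> m1 (LeParam (V gE [+] Const 1) (V gE) [=] Const 0) = 0"
    then have "real (2 ^ m1 gY + 1) \<le> \<delta> * real (2 ^ m1 gY)" unfolding ev by (simp split: if_splits)
    then have "\<not> m1 gY < y" using y(2) by blast
    then show "Q m1" using I unfolding I_def by (intro Q) auto
  qed
  then show ?thesis by (rule srun_time) simp
qed

lemma srun_params:
  assumes m: "m 0 = n" "m 1 = k" "m gY = y" and k: "1 \<le> k" "k \<le> n"
    and U: "next_prime (2 ^ Gexp n k y) \<le> U" "U \<le> \<Omega>" "2 * n + 1 \<le> \<Omega>" "code_length n k y \<le> U"
    and Q: "\<And>m'. globals n k y m' \<Longrightarrow> Q m'"
  shows "srun params_com m (20000 * (U + 1) ^ 2) Q"
proof -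
  define t g G where "t = start_bits k y" and "g = gexp n k y" and "G = Gexp n k y"
  note cs = code_sizes[where n = n and k = k and y = y, folded t_def g_def G_def]
  have GU: "2 ^ G \<le> U" using U(1) next_prime(2)[of "2 ^ G"] unfolding G_def by linarith
  have "(2::nat) ^ g \<le> 2 ^ G" using cs by (intro power_increasing) auto
  then have gU: "2 ^ g \<le> U" using GU by linarith
  have pt: "2 ^ t \<le> U" using cs GU by linarith
  have le: "G \<le> U" "g \<le> U" "t \<le> U" "bit_length n \<le> U" "residue_count n k y \<le> U"
    using less_exp[of G] GU less_exp[of g] gU less_exp[of t] pt cs by linarith+
  have tt: "y + kap k + 2 + 2 * kap k + 4 = t" "prec k y \<le> t" "kap k \<le> t" "8 * kap k \<le> 8 * t" "lam k y \<le> t" "bit_length (kap k) \<le> t"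
    using bit_length_le_self[of "kap k"] unfolding t_def start_bits_def prec_def lam_def by auto
  have "2 ^ lam k y \<le> (2::nat) ^ t" using tt by (intro power_increasing) auto
  then have lU: "2 ^ lam k y \<le> U" using pt by linarith
  have blg: "bit_length (bit_length n) \<le> g" unfolding g_def gexp_def by simp
  have bln: "bit_length n \<le> n" by (rule bit_length_le_self)
  have kn: "kap k \<le> n" using kap(4)[of k] k by simp
  have stopU: "stop_bits k y \<le> \<Omega>"
  proof -
    have "t div k \<le> t" by simp
    then have "stop_bits k y \<le> 9 * t" using tt unfolding stop_bits_def t_def[symmetric] by linarith
    also have "\<dots> \<le> 2 ^ 8 * 2 ^ t" by (intro mult_le_mono less_imp_le[OF less_exp]) simp
    also have "\<dots> \<le> 2 ^ (8 + t)" by (simp only: power_add)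
    also have "\<dots> \<le> 2 ^ G" using cs(3) unfolding G_def Gexp_def g_def[symmetric] by (intro power_increasing) auto
    finally show ?thesis using GU U by linarith
  qed
  show ?thesis
    apply (rule srun_time)
    unfolding params_com_def
     apply (insert frame_refl[of work_regs m])
     apply (rule srun_seq, erule srun_set_bit_length_E[where a = k])
       apply (use m in \<open>simp add: frame_def work_regs_def\<close>)
    subgoal using k U by linarith
     apply (fold kap_def)
     apply (rule srun_seq, erule srun_set_E[where v = "prec k y"])
       apply (use m in \<open>simp add: frame_def work_regs_def prec_def\<close>)
    subgoal using tt le U by linarith
     apply (rule srun_seq, erule srun_set_E[where v = t])
       apply (simp add: frame_def work_regs_def t_def start_bits_def)
    subgoal using le U by linarith
     apply (rule srun_seq, erule srun_set_E[where v = "stop_bits k y"])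
       apply (use m in \<open>simp add: frame_def work_regs_def t_def stop_bits_def\<close>)
    subgoal using stopU .
     apply (rule srun_seq, erule srun_set_bit_length_E[where a = "kap k"])
       apply (simp add: frame_def work_regs_def)
    subgoal using kn U by linarith
     apply (rule srun_seq, erule srun_set_E[where v = "lam k y"])
       apply (use m in \<open>simp add: frame_def work_regs_def lam_def\<close>)
    subgoal using tt le U by linarith
     apply (rule srun_seq, erule srun_set_pow2_E[where a = "lam k y"])
       apply (simp add: frame_def work_regs_def)
    subgoal using lU U by linarith
     apply (rule srun_seq, erule srun_set_pow2_E[where a = t])
       apply (simp add: frame_def work_regs_def)
    subgoal using pt U by linarith
     apply (rule srun_seq, erule srun_set_bit_length_E[where a = n])
       apply (use m in \<open>simp add: frame_def work_regs_def\<close>)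
    subgoal using U by linarith
     apply (rule srun_seq, erule srun_set_bit_length_E[where a = "bit_length n"])
       apply (simp add: frame_def work_regs_def)
    subgoal using bln U by linarith
     apply (rule srun_seq, erule srun_set_E[where v = g])
       apply (simp add: frame_def work_regs_def g_def gexp_def t_def)
    subgoal using le U by linarith
     apply (rule srun_seq, erule srun_set_E[where v = G])
       apply (simp add: frame_def work_regs_def G_def Gexp_def g_def)
    subgoal using le U by linarith
     apply (rule srun_seq, erule srun_set_prime_E[where a = G and U = U])
         apply (simp add: frame_def work_regs_def)
    subgoal unfolding G_def Gexp_def by simp
    subgoal using U unfolding G_def by simp
    subgoal by (rule U)
     apply (rule srun_seq, erule srun_set_pow2_E[where a = G])
       apply (simp add: frame_def work_regs_def)
    subgoal using GU U by linarith
     apply (rule srun_seq, erule srun_set_E[where v = "residue_count n k y"])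
       apply (simp add: frame_def work_regs_def residue_count_def t_def g_def)
    subgoal using le U by linarith
     apply (erule srun_set_E[where v = "code_length n k y"])
       apply (simp add: frame_def work_regs_def code_length_def t_def G_def)
    subgoal using U by linarith
    subgoal premises P for m'
      by (rule Q) (use P m in \<open>simp add: globals_def params_def frame_def work_regs_def t_def g_def G_def\<close>)
    subgoal
    proof -
      define z where "z = (U + 1) ^ 2"
      have "U + 1 \<le> z" unfolding z_def power2_eq_square by simp
      then show ?thesis unfolding z_def[symmetric] using le tt blg by (simp add: kap_def)
    qed
    done
qed

end

section \<open>Listing the family\<close>

text \<open>The shifts by 1 mediate between {1..n}, {1..k} and the initial segments {..<n}, {..<k}
  on which the hashes act.\<close>

definition family_fun :: "nat \<Rightarrow> nat \<Rightarrow> nat \<Rightarrow> (nat \<Rightarrow> nat) \<Rightarrow> nat \<Rightarrow> nat \<Rightarrow> nat \<Rightarrow> nat \<Rightarrow> nat" where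
  "family_fun n k y a c i \<sigma> = (\<lambda>x\<in>{1..n}. colour_hash k y (start_bits k y) \<sigma>
     (poly_hash (next_prime (2 ^ Gexp n k y)) 2 (a i) ((x - 1) mod c) mod 2 ^ start_bits k y) + 1)"

definition seed_list :: "nat \<Rightarrow> nat \<Rightarrow> nat \<Rightarrow> (nat \<Rightarrow> nat) \<Rightarrow> nat \<Rightarrow> nat \<Rightarrow> (nat \<Rightarrow> nat) list" where
  "seed_list n k y a c i = map (family_fun n k y a c i) [0..<seed_count k y (start_bits k y)]"

text \<open>The order is reversed because the loop over the code counts down.\<close>

definition code_list :: "nat \<Rightarrow> nat \<Rightarrow> nat \<Rightarrow> (nat \<Rightarrow> nat) \<Rightarrow> nat \<Rightarrow> (nat \<Rightarrow> nat) list" where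
  "code_list n k y a c = concat (map (seed_list n k y a c) (rev [1..<Suc (code_length n k y)]))"

text \<open>While the counter falls from n to 1, the difference n - \<open>cX\<close> runs from 0 to
  n - 1, so a table appears in increasing order of its arguments.\<close>

definition emit_com :: com where
  "emit_com = for_loop cX (V 0)
     (set_code cY ((V 0 [-] V cX) [mod] V cC) (Load (Const 99 [+] V cI)) ;;
      vv ::= V cY ;; rS ::= V cSig ;; colour_com ;; cK ::= V rR ;; Emit (V vout [+] Const 1))"

text \<open>The number of seeds becomes known only by an evaluation. The limit \<open>cK\<close>
  starts at 1 to admit seed 0, and the evaluations for that seed overwrite it with the true
  count.\<close>

definition seeds_com :: com where
  "seeds_com = cSig ::= Const 0 ;; cK ::= Const 1 ;;
     While (V cSig [<] V cK) (emit_com ;; cSig ::= V cSig [+] Const 1)"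

text \<open>Each search for a prime starts one above the previous modulus, so the moduli are
  distinct and consecutive primes.\<close>

definition residue_com :: com where
  "residue_com = rN ::= V cC ;; next_prime_com ;; cC ::= V rN ;; for_loop cI (V gL) seeds_com ;; cC ::= V cC [+] Const 1"

definition main_com :: com where
  "main_com = set_pow2 cC (V gG) ;; for_loop cR (V gR)
     residue_com"

definition emit_regs :: "nat set" where "emit_regs = work_regs \<union> {cX, cY, cK}"
definition seed_regs :: "nat set" where "seed_regs = work_regs \<union> {cX, cY, cK, cSig}"
definition code_regs :: "nat set" where "code_regs = work_regs \<union> {cX, cY, cK, cSig, cI}"
definition main_regs :: "nat set" where "main_regs = work_regs \<union> {cX, cY, cK, cSig, cI, cC, cR}"

lemma tables_append: "tables n (fs @ gs) = tables n fs @ tables n gs"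
  unfolding tables_def by simp

lemma tables_single: "tables n [f] = map f [1..<Suc n]"
  unfolding tables_def by simp

lemma tables_Nil: "tables n [] = []"
  unfolding tables_def by simp

context ram
begin

lemma run_emits:
  assumes g: "globals n k y m" and k: "1 \<le> k" "k \<le> n"
    and m: "m cC = c" "m cI = i" "m cSig = \<sigma>" "a = (\<lambda>i. m (99 + i))" and c: "1 \<le> c"
    and U: "seed_count k y (start_bits k y) \<le> U" "start_bits k y \<le> U" "k \<le> U" "U \<le> \<Omega>" "n \<le> \<Omega>"
    and Q: "\<And>m'. frame emit_regs m m' \<Longrightarrow> m' cK = seed_count k y (start_bits k y) \<Longrightarrow> Q m' (tables n [family_fun n k y a c i \<sigma>])"
  shows "run emit_com m (n * (26000 * (U + 1) ^ 3)) Q"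
proof (rule run_bounded)
  assume bd: "bounded_mem m"
  define t where "t = start_bits k y"
  define K where "K = seed_count k y t"
  define p where "p = next_prime (2 ^ Gexp n k y)"
  define f where "f = family_fun n k y a c i \<sigma>"
  \<comment> \<open>Before the first argument has been processed the count in \<open>cK\<close> may
    still be provisional, hence the guard \<open>j < n\<close>.\<close>
  define I where "I j m' os \<longleftrightarrow> frame emit_regs m m' \<and> j \<le> n \<and> (j < n \<longrightarrow> m' cK = K) \<and> os = map f [1..<Suc (n - j)]" for j m' os
  have p2: "2 \<le> p" unfolding p_def using next_prime(1) prime_ge_2_nat by blast
  have "run emit_com m (n * ((2400 + (128 + (128 + (22000 * (U + 1) ^ 3 + (128 + 64))))) + 192) + 192) Q"
    unfolding emit_com_def
  proof (rule run_for[where I = I])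
    show "eval \<delta> m (V 0) = n" using g unfolding globals_def by simp
    show "n \<le> \<Omega>" by (rule U)
    show "I n (m(cX := n)) []" unfolding I_def by (simp add: frame_def emit_regs_def)
    show "Q m' os" if "I 0 m' os" "m' cX = 0" for m' os
      using that Q[of m'] k unfolding I_def K_def t_def f_def by (simp only: tables_single) simp
    fix j m1 os assume I: "I (Suc j) m1 os" and cj: "m1 cX = Suc j" and j: "j < n"
    define x where "x = n - Suc j"
    have nj: "n - j = Suc x" using j unfolding x_def by simp
    have os: "os = map f [1..<Suc x]" using I unfolding I_def x_def by simp
    have g1: "globals n k y m1" by (rule globals_frame[OF g]) (use I in \<open>auto simp: I_def frame_def emit_regs_def\<close>)
    have r1: "m1 cC = c" "m1 cI = i" "m1 cSig = \<sigma>" "m1 (99 + i) = a i"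
      using I m unfolding I_def frame_def emit_regs_def work_regs_def by auto
    define v where "v = poly_hash p 2 (a i) (x mod c) mod 2 ^ t"
    have fx: "f (Suc x) = colour_hash k y t \<sigma> v + 1"
    proof -
      have "Suc x \<in> {1..n}" using j unfolding x_def by simp
      then show ?thesis unfolding f_def family_fun_def v_def p_def t_def by simp
    qed
    have aO: "a i \<le> \<Omega>" "\<sigma> \<le> \<Omega>" using bounded_memD[OF bd, of cSig] m by (auto intro: bounded_memD[OF bd])
    have xO: "x mod c \<le> \<Omega>" using mod_less_eq_dividend[of x c] U(5) unfolding x_def by linarith
    show "run (set_code cY ((V 0 [-] V cX) [mod] V cC) (Load (Const 99 [+] V cI)) ;;
      vv ::= V cY ;; rS ::= V cSig ;; colour_com ;; cK ::= V rR ;; Emit (V vout [+] Const 1)) m1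
      (2400 + (128 + (128 + (22000 * (U + 1) ^ 3 + (128 + 64))))) (\<lambda>m' o'. m' cX = Suc j \<and> I j (m'(cX := j)) (os @ o'))"
    proof (rule run_seq_silent, rule srun_set_code[OF frame_refl, where p = p and q = "2 ^ t" and x = "x mod c" and s = "a i"])
      show "m1 gP = p" "2 \<le> p" "m1 gQ = 2 ^ t" "x mod c \<le> \<Omega>" "a i \<le> \<Omega>"
        using g1 p2 xO aO unfolding globals_def p_def t_def by auto
      fix m2 assume 2: "frame work_regs m1 m2"
      have "m2 0 = n" "m2 cX = Suc j" "m2 cC = c" "m2 cI = i" "m2 (99 + i) = a i"
        using 2 g1 r1 cj unfolding frame_def work_regs_def globals_def by auto
      then show "eval \<delta> m2 ((V 0 [-] V cX) [mod] V cC) = x mod c" "eval \<delta> m2 (Load (Const 99 [+] V cI)) = a i"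
        unfolding x_def by auto
    next
      fix m2 assume "frame work_regs (m1(cY := poly_hash p 2 (a i) (x mod c) mod 2 ^ t)) m2"
      then have 2: "frame work_regs (m1(cY := v)) m2" unfolding v_def .
      have r2: "m2 cY = v" "m2 cSig = \<sigma>" "m2 cX = Suc j" using 2 r1 cj unfolding frame_def work_regs_def by auto
      have f2: "frame emit_regs m m2" unfolding frame_def
      proof (intro allI impI)
        fix b assume b: "b \<notin> emit_regs"
        then have "m2 b = m1 b" using 2 unfolding frame_def emit_regs_def by simp
        also have "\<dots> = m b" using I b unfolding I_def frame_def by simp
        finally show "m2 b = m b" .
      qed
      show "run (vv ::= V cY ;; rS ::= V cSig ;; colour_com ;; cK ::= V rR ;; Emit (V vout [+] Const 1)) m2
        (128 + (128 + (22000 * (U + 1) ^ 3 + (128 + 64)))) (\<lambda>m' o'. m' cX = Suc j \<and> I j (m'(cX := j)) (os @ o'))"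
      proof (rule run_bounded)
        assume bd2: "bounded_mem m2"
        have vO: "v \<le> \<Omega>" using bounded_memD[OF bd2, of cY] r2 by simp
        define m3 where "m3 = m2(vv := v, rS := \<sigma>)"
        have f3: "frame emit_regs m m3" using f2 unfolding m3_def by (simp add: frame_def emit_regs_def work_regs_def)
        have g3: "globals n k y m3" by (rule globals_frame[OF g]) (use f3 in \<open>auto simp: frame_def emit_regs_def\<close>)
        have col: "run (colour_com ;; cK ::= V rR ;; Emit (V vout [+] Const 1)) m3
          (22000 * (U + 1) ^ 3 + (128 + 64)) (\<lambda>m' o'. m' cX = Suc j \<and> I j (m'(cX := j)) (os @ o'))"
        proof (rule run_seq_silent, rule srun_colour[where k = k and y = y and v = v and s = \<sigma> and U = U])
          show "params k y m3" using g3 unfolding globals_def by simp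
          show "m3 vv = v" "m3 rS = \<sigma>" unfolding m3_def by auto
          show "v < 2 ^ start_bits k y" unfolding v_def t_def by simp
          show "1 \<le> k" "seed_count k y (start_bits k y) \<le> U" "start_bits k y \<le> U" "k \<le> U" "U \<le> \<Omega>" by (rule k U)+
          fix m4 assume 4: "frame work_regs m3 m4" "m4 vout = colour_hash k y (start_bits k y) \<sigma> v" "m4 rR = seed_count k y (start_bits k y)"
          have f4: "frame emit_regs m (m4(cK := K))" using f3 4(1) unfolding emit_regs_def frame_def by simp
          have x4: "m4 cX = Suc j" using 4(1) r2 unfolding frame_def work_regs_def m3_def by simp
          show "run (cK ::= V rR ;; Emit (V vout [+] Const 1)) m4 (128 + 64) (\<lambda>m' o'. m' cX = Suc j \<and> I j (m'(cX := j)) (os @ o'))"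
          proof (rule run_seq_silent, rule srun_asg, rule_tac [2] run_emit)
            show "eval \<delta> m4 (V rR) \<le> \<Omega>" using 4 U by simp
            have e: "m4(cK := eval \<delta> m4 (V rR)) = m4(cK := K)" using 4 unfolding K_def t_def by simp
            have o: "os @ [eval \<delta> (m4(cK := K)) (V vout [+] Const 1)] = map f [1..<Suc (n - j)]"
              unfolding os nj using 4 fx unfolding t_def by simp
            show "(m4(cK := eval \<delta> m4 (V rR))) cX = Suc j \<and>
              I j ((m4(cK := eval \<delta> m4 (V rR)))(cX := j)) (os @ [eval \<delta> (m4(cK := eval \<delta> m4 (V rR))) (V vout [+] Const 1)])"
              unfolding e o I_def using x4 f4 j by (auto simp: frame_def emit_regs_def)
          qed
        qed
        show ?thesis
          apply (rule run_seq_silent, rule srun_asg)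
          subgoal using r2 vO by simp
          apply (rule run_seq_silent, rule srun_asg)
          subgoal using r2 aO by simp
          using col r2 unfolding m3_def by simp
      qed
    qed
  qed
  moreover have "n * ((2400 + (128 + (128 + (22000 * (U + 1) ^ 3 + (128 + 64))))) + 192) + 192 \<le> n * (26000 * (U + 1) ^ 3)"
  proof -
    define z where "z = (U + 1) ^ 3"
    have z1: "1 \<le> z" unfolding z_def by simp
    have n1: "1 \<le> n" using k by simp
    have "n * ((2400 + (128 + (128 + (22000 * z + (128 + 64))))) + 192) + 192 \<le> n * (22000 * z + 3040) + n * 192"
      by (rule add_mono[OF mult_le_mono2]) (use n1 in simp_all)
    also have "\<dots> = n * (22000 * z + 3232)" by (simp add: distrib_left)
    also have "\<dots> \<le> n * (26000 * z)" using z1 by (intro mult_le_mono2) simp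
    finally show ?thesis unfolding z_def .
  qed
  ultimately show ?thesis by (rule run_mono)
qed

lemma run_seeds:
  assumes g: "globals n k y m" and k: "1 \<le> k" "k \<le> n"
    and m: "m cC = c" "m cI = i" "a = (\<lambda>i. m (99 + i))" and c: "1 \<le> c"
    and U: "seed_count k y (start_bits k y) \<le> U" "start_bits k y \<le> U" "k \<le> U" "U + 1 \<le> \<Omega>" "n \<le> \<Omega>"
    and Q: "\<And>m'. frame seed_regs m m' \<Longrightarrow> Q m' (tables n (seed_list n k y a c i))"
  shows "run seeds_com m (U * (n * (27000 * (U + 1) ^ 3))) Q"
proof -
  define K where "K = seed_count k y (start_bits k y)"
  define z where "z = n * (26000 * (U + 1) ^ 3)"
  define I where "I w m' os \<longleftrightarrow> frame seed_regs m m' \<and> m' cSig \<le> K \<and> w = K - m' cSig \<and> m' cK = (if m' cSig = 0 then 1 else K) \<and>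
    os = tables n (map (family_fun n k y a c i) [0..<m' cSig])" for w m' os
  have K1: "1 \<le> K" unfolding K_def by (rule seed_count_ge1)
  have "run seeds_com m (128 + (128 + (K * ((z + 128) + 64) + 64))) Q"
    unfolding seeds_com_def
  proof (rule run_seq_silent, rule srun_asg, rule_tac [2] run_seq_silent, rule_tac [2] srun_asg, rule_tac [3] run_while[where I = I])
    show "eval \<delta> m (Const 0) \<le> \<Omega>" "eval \<delta> (m(cSig := eval \<delta> m (Const 0))) (Const 1) \<le> \<Omega>" using \<Omega>_ge by auto
    show "I K (m(cSig := eval \<delta> m (Const 0), cK := eval \<delta> (m(cSig := eval \<delta> m (Const 0))) (Const 1))) []"
      unfolding I_def by (auto simp: frame_def seed_regs_def tables_Nil)
    fix w m1 os assume I: "I w m1 os"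
    {
      assume "eval \<delta> m1 (V cSig [<] V cK) = 0"
      then have "m1 cSig = K" using I K1 unfolding I_def by (auto simp: of_bool_def split: if_splits)
      then show "Q m1 os" using I Q[of m1] unfolding I_def seed_list_def K_def by simp
    }
    assume "eval \<delta> m1 (V cSig [<] V cK) \<noteq> 0"
    then have lt: "m1 cSig < K" using I K1 unfolding I_def by (auto simp: of_bool_def split: if_splits)
    have g1: "globals n k y m1" by (rule globals_frame[OF g]) (use I in \<open>auto simp: I_def frame_def seed_regs_def\<close>)
    have r1: "m1 cC = c" "m1 cI = i" "\<And>i. m1 (99 + i) = m (99 + i)"
      using I m unfolding I_def frame_def seed_regs_def work_regs_def by auto
    have a1: "a = (\<lambda>i. m1 (99 + i))" unfolding r1 m(3) ..
    show "run (emit_com ;; cSig ::= V cSig [+] Const 1) m1 (z + 128) (\<lambda>m' o'. \<exists>w'<w. I w' m' (os @ o'))"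
      unfolding z_def
    proof (rule run_seq, rule run_emits[OF g1 k r1(1,2) refl a1 c U(1-3)])
      show "U \<le> \<Omega>" "n \<le> \<Omega>" using U by auto
      fix m2 assume 2: "frame emit_regs m1 m2" "m2 cK = seed_count k y (start_bits k y)"
      have s2: "m2 cSig = m1 cSig" using 2(1) unfolding frame_def emit_regs_def work_regs_def by simp
      have fr: "frame seed_regs m (m2(cSig := Suc (m1 cSig)))" using 2(1) I unfolding I_def frame_def seed_regs_def emit_regs_def by simp
      have "I (K - Suc (m1 cSig)) (m2(cSig := Suc (m1 cSig))) (os @ tables n [family_fun n k y a c i (m1 cSig)])"
        using I fr lt 2(2) unfolding I_def K_def by (simp add: tables_append)
      then show "run (cSig ::= V cSig [+] Const 1) m2 128 (\<lambda>m3 o3. \<exists>w'<w. I w' m3 (os @ (tables n [family_fun n k y a c i (m1 cSig)] @ o3)))"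
        by (intro run_asg) (use s2 lt U I in \<open>auto simp: K_def I_def intro!: exI[of _ "K - Suc (m1 cSig)"]\<close>)
    qed
  qed
  moreover have "128 + (128 + (K * ((z + 128) + 64) + 64)) \<le> U * (n * (27000 * (U + 1) ^ 3))"
  proof -
    define u where "u = n * (U + 1) ^ 3"
    have "1 * 1 \<le> n * (U + 1) ^ 3" using k by (intro mult_le_mono) auto
    then have u1: "1 \<le> u" unfolding u_def by simp
    have z: "z = 26000 * u" unfolding z_def u_def by (rule mult.left_commute)
    have U1: "1 \<le> U" using K1 U(1) unfolding K_def by simp
    have "128 + (128 + (K * ((z + 128) + 64) + 64)) \<le> 320 * U + U * (26000 * u + 192)"
    proof -
      have "K * ((z + 128) + 64) \<le> U * (26000 * u + 192)" unfolding z K_def using U(1) by (intro mult_le_mono) auto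
      then show ?thesis using U1 by simp
    qed
    also have "\<dots> = U * (26000 * u + 512)" by (simp add: distrib_left)
    also have "\<dots> \<le> U * (27000 * u)" using u1 by (intro mult_le_mono2) simp
    finally show ?thesis unfolding u_def by (simp only: mult.left_commute)
  qed
  ultimately show ?thesis by (rule run_mono)
qed

lemma run_code:
  assumes g: "globals n k y m" and k: "1 \<le> k" "k \<le> n"
    and m: "m cC = c" "a = (\<lambda>i. m (99 + i))" and c: "1 \<le> c"
    and U: "seed_count k y (start_bits k y) \<le> U" "start_bits k y \<le> U" "k \<le> U" "U + 1 \<le> \<Omega>" "n \<le> \<Omega>" "code_length n k y \<le> \<Omega>"
    and Q: "\<And>m'. frame code_regs m m' \<Longrightarrow> Q m' (tables n (code_list n k y a c))"
  shows "run (for_loop cI (V gL) seeds_com) m (code_length n k y * (U * (n * (27000 * (U + 1) ^ 3)) + 192) + 192) Q"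
proof -
  define L where "L = code_length n k y"
  define I where "I j m' os \<longleftrightarrow> frame code_regs m m' \<and> j \<le> L \<and>
    os = tables n (concat (map (seed_list n k y a c) (rev [Suc j..<Suc L])))" for j m' os
  show ?thesis
    unfolding L_def[symmetric]
  proof (rule run_for[where I = I])
    show "eval \<delta> m (V gL) = L" using g unfolding globals_def L_def by simp
    show "L \<le> \<Omega>" unfolding L_def by (rule U)
    show "I L (m(cI := L)) []" unfolding I_def by (simp add: frame_def code_regs_def tables_Nil)
    show "Q m' os" if "I 0 m' os" for m' os using that Q[of m'] unfolding I_def code_list_def L_def by simp
    fix j m1 os assume I: "I (Suc j) m1 os" and cj: "m1 cI = Suc j" and j: "j < L"
    have g1: "globals n k y m1" by (rule globals_frame[OF g]) (use I in \<open>auto simp: I_def frame_def code_regs_def\<close>)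
    have r1: "m1 cC = c" "\<And>i. m1 (99 + i) = m (99 + i)"
      using I m unfolding I_def frame_def code_regs_def work_regs_def by auto
    have a1: "a = (\<lambda>i. m1 (99 + i))" unfolding r1 m(2) ..
    show "run seeds_com m1 (U * (n * (27000 * (U + 1) ^ 3))) (\<lambda>m' o'. m' cI = Suc j \<and> I j (m'(cI := j)) (os @ o'))"
    proof (rule run_seeds[OF g1 k r1(1) cj a1 c U(1-5)])
      fix m2 assume 2: "frame seed_regs m1 m2"
      have "m2 cI = Suc j" using 2 cj unfolding frame_def seed_regs_def work_regs_def by simp
      moreover have "frame code_regs m (m2(cI := j))" using I 2 unfolding I_def frame_def code_regs_def seed_regs_def by simp
      moreover have "rev [Suc j..<Suc L] = rev [Suc (Suc j)..<Suc L] @ [Suc j]" using j by (simp add: upt_conv_Cons del: upt_Suc)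
      ultimately show "m2 cI = Suc j \<and> I j (m2(cI := j)) (os @ tables n (seed_list n k y a c (Suc j)))"
        using I j unfolding I_def by (simp add: tables_append del: upt_Suc)
    qed
  qed
qed

lemma run_main:
  assumes g: "globals n k y m" and k: "1 \<le> k" "k \<le> n" and a: "a = (\<lambda>i. m (99 + i))"
    and U: "seed_count k y (start_bits k y) \<le> U" "start_bits k y \<le> U" "k \<le> U" "U + 1 \<le> \<Omega>" "n \<le> \<Omega>" "2 ^ Gexp n k y + 1 \<le> \<Omega>"
    and Q: "\<And>m' cs. distinct cs \<Longrightarrow> length cs = residue_count n k y \<Longrightarrow>
      (\<And>c. c \<in> set cs \<Longrightarrow> prime c \<and> 2 ^ gexp n k y \<le> c \<and> c \<le> 2 ^ Gexp n k y) \<Longrightarrow>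
      Q m' (tables n (concat (map (code_list n k y a) cs)))"
  shows "run main_com m (residue_count n k y * (600 * (2 ^ Gexp n k y + 1) ^ 2 +
      code_length n k y * (U * (n * (27000 * (U + 1) ^ 3)) + 192) + 1000) + gexp n k y * 400 + 1000) Q"
proof -
  define gg G where "gg = gexp n k y" and "G = Gexp n k y"
  define R where "R = residue_count n k y"
  define L where "L = code_length n k y"
  define T where "T = L * (U * (n * (27000 * (U + 1) ^ 3)) + 192) + 192"
  note cs = code_sizes[where n = n and k = k and y = y, folded gg_def G_def R_def L_def]
  have gg1: "1 \<le> gg" unfolding gg_def gexp_def start_bits_def by simp
  have G8: "G = 2 * gg + 8" unfolding G_def Gexp_def gg_def ..
  have gG: "(2::nat) ^ gg \<le> 2 ^ G" using cs by (intro power_increasing) auto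
  have GO: "2 ^ G \<le> \<Omega>" using U(6) unfolding G_def by simp
  have ggO: "2 ^ gg \<le> \<Omega>" using gG GO by linarith
  have RO: "R \<le> \<Omega>" using cs(2) ggO by linarith
  define m0 where "m0 = m(cC := 2 ^ gg)"
  define I where "I j m' os \<longleftrightarrow> frame main_regs m m' \<and> j \<le> R \<and> 2 ^ gg \<le> m' cC \<and> m' cC \<le> 2 ^ G \<and>
    (\<exists>cs. distinct cs \<and> length cs = R - j \<and> set cs = {c. prime c \<and> 2 ^ gg \<le> c \<and> c < m' cC} \<and>
      os = tables n (concat (map (code_list n k y a) cs)))" for j m' os
  have loop: "run (for_loop cR (V gR)
     residue_com) m1
     (R * ((128 + (600 * (2 ^ G + 1) ^ 2 + (128 + (T + 128)))) + 192) + 192) Q"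
    if m1: "frame work_regs m0 m1" for m1
  proof (rule run_for[where I = I and N = R])
    have m1': "m1 b = m0 b" if "b \<notin> work_regs" for b using m1 that unfolding frame_def by simp
    show "eval \<delta> m1 (V gR) = R" using g m1'[of gR] unfolding R_def globals_def m0_def by (simp add: work_regs_def)
    show "R \<le> \<Omega>" by (rule RO)
    have "frame main_regs m (m1(cR := R))" using m1' unfolding m0_def by (simp add: frame_def main_regs_def)
    then show "I R (m1(cR := R)) []" using gG m1'[of cC]
      unfolding I_def m0_def by (auto simp: work_regs_def tables_Nil)
    show "Q m' os" if I0: "I 0 m' os" for m' os
    proof -
      obtain cs where cs: "frame main_regs m m'" "m' cC \<le> 2 ^ G" "distinct cs" "length cs = R" "set cs = {c. prime c \<and> 2 ^ gg \<le> c \<and> c < m' cC}"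
        "os = tables n (concat (map (code_list n k y a) cs))"
        using I0 unfolding I_def diff_zero by blast
      then show ?thesis by (auto intro!: Q simp: R_def gg_def G_def)
    qed
    fix j m1 os assume I: "I (Suc j) m1 os" and cj: "m1 cR = Suc j" and j: "j < R"
    obtain cs where c1: "frame main_regs m m1" "2 ^ gg \<le> m1 cC" "m1 cC \<le> 2 ^ G" "distinct cs" "length cs = R - Suc j"
      "set cs = {c. prime c \<and> 2 ^ gg \<le> c \<and> c < m1 cC}" "os = tables n (concat (map (code_list n k y a) cs))"
      using I unfolding I_def by blast
    define c0 where "c0 = m1 cC"
    define c where "c = next_prime c0"
    \<comment> \<open>The list \<open>cs\<close> contains all primes from 2^gg up to, but not
      including, \<open>c0\<close>, yet it is shorter than R. As the window holds at least 2^(gg +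
      1) primes, which is no less than R, one of them is left.\<close>
    have "\<exists>p. prime p \<and> c0 \<le> p \<and> p < 2 ^ G"
    proof (rule ccontr)
      assume no: "\<not> ?thesis"
      have "{p::nat. prime p \<and> 2 ^ gg \<le> p \<and> p < 2 ^ (2 * gg + 8)} \<subseteq> set cs"
        using no unfolding c1(6) c0_def G8 by (auto simp: not_le)
      then have "card {p::nat. prime p \<and> 2 ^ gg \<le> p \<and> p < 2 ^ (2 * gg + 8)} \<le> card (set cs)" by (intro card_mono) auto
      also have "\<dots> < R" using c1(4,5) j by (simp add: distinct_card)
      also have "R \<le> 2 ^ (gg + 1)" using code_sizes(2)[of n k y] unfolding R_def gg_def by simp
      finally show False using card_primes_between[of gg] by linarith
    qed
    then obtain p where p: "prime p" "c0 \<le> p" "p < 2 ^ G" by blast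
    have c: "prime c" "c0 \<le> c" "c < 2 ^ G"
      using next_prime[of c0] next_prime_le[OF p(1,2)] p(3) unfolding c_def by auto
    have newset: "insert c (set cs) = {p. prime p \<and> 2 ^ gg \<le> p \<and> p < c + 1}"
    proof -
      have "p \<in> insert c (set cs)" if "prime p" "2 ^ gg \<le> p" "p < c + 1" for p
      proof (cases "p < c0")
        case True
        then show ?thesis using that c1(6) unfolding c0_def by simp
      next
        case False
        then have "c \<le> p" unfolding c_def using that by (intro next_prime_le) auto
        then show ?thesis using that by simp
      qed
      moreover have "2 ^ gg \<le> c" using c(2) c1(2) unfolding c0_def by simp
      ultimately show ?thesis using c c1(6) unfolding c0_def by auto
    qed
    have cn: "c \<notin> set cs" using c(2) unfolding c1(6) c0_def by simp
    have two: "2 \<le> c0"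
    proof -
      have "2 ^ 1 \<le> (2::nat) ^ gg" using gg1 by (intro power_increasing) auto
      then show ?thesis using c1(2) unfolding c0_def by simp
    qed
    have cO: "c0 \<le> \<Omega>" "c \<le> \<Omega>" "Suc c \<le> \<Omega>" using c GO by auto
    have npT: "600 * (next_prime c0 + 1) ^ 2 \<le> 600 * (2 ^ G + 1) ^ 2"
      using c(3) unfolding c_def[symmetric] by (intro mult_le_mono2 power_mono) auto
    show "run residue_com m1
      (128 + (600 * (2 ^ G + 1) ^ 2 + (128 + (T + 128)))) (\<lambda>m' o'. m' cR = Suc j \<and> I j (m'(cR := j)) (os @ o'))"
    unfolding residue_com_def
    proof (rule run_seq_silent, rule srun_asg)
      show "eval \<delta> m1 (V cC) \<le> \<Omega>" using cO unfolding c0_def by simp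
      define m2 where "m2 = m1(rN := eval \<delta> m1 (V cC))"
      show "run (next_prime_com ;; cC ::= V rN ;; for_loop cI (V gL) seeds_com ;; cC ::= V cC [+] Const 1) m2
        (600 * (2 ^ G + 1) ^ 2 + (128 + (T + 128))) (\<lambda>m' o'. m' cR = Suc j \<and> I j (m'(cR := j)) (os @ o'))"
      proof (rule run_seq_silent, rule srun_time[OF srun_next_prime npT])
        show "m2 rN = c0" unfolding m2_def c0_def by simp
        show "2 \<le> c0" by (rule two)
        show "next_prime c0 \<le> \<Omega>" by (rule cO(2)[unfolded c_def])
        fix m3 assume 3: "frame {rN, rQ} m2 m3" "m3 rN = next_prime c0"
        have m3: "m3 b = m1 b" if "b \<notin> work_regs" for b using 3(1) that unfolding m2_def frame_def work_regs_def by simp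
        show "run (cC ::= V rN ;; for_loop cI (V gL) seeds_com ;; cC ::= V cC [+] Const 1) m3
          (128 + (T + 128)) (\<lambda>m' o'. m' cR = Suc j \<and> I j (m'(cR := j)) (os @ o'))"
        proof (rule run_seq_silent, rule srun_asg)
          show "eval \<delta> m3 (V rN) \<le> \<Omega>" using 3 cO unfolding c_def by simp
          define m4 where "m4 = m3(cC := eval \<delta> m3 (V rN))"
          have c4: "m4 cC = c" unfolding m4_def c_def using 3 by simp
          have f4: "frame main_regs m m4" using c1(1) m3 unfolding m4_def by (simp add: frame_def main_regs_def)
          have g4: "globals n k y m4" by (rule globals_frame[OF g]) (use f4 in \<open>auto simp: frame_def main_regs_def\<close>)
          have "m4 (99 + i) = m (99 + i)" for i using f4 unfolding frame_def main_regs_def work_regs_def by simp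
          then have a4: "a = (\<lambda>i. m4 (99 + i))" unfolding a by simp
          have r4: "m4 cR = Suc j" using m3[of cR] cj unfolding m4_def by (simp add: work_regs_def)
          show "run (for_loop cI (V gL) seeds_com ;; cC ::= V cC [+] Const 1) m4
            (T + 128) (\<lambda>m' o'. m' cR = Suc j \<and> I j (m'(cR := j)) (os @ o'))"
            unfolding T_def L_def
          proof (rule run_seq, rule run_code[OF g4 k c4 a4 _ U(1-5)])
            show "1 \<le> c" using two c(2) by simp
            show "code_length n k y \<le> \<Omega>" using cs(1) GO unfolding L_def by linarith
            fix m5 assume 5: "frame code_regs m4 m5"
            have r5: "m5 cC = c" "m5 cR = Suc j" using 5 c4 r4 unfolding frame_def code_regs_def work_regs_def by auto
            have f5: "frame main_regs m (m5(cC := Suc c, cR := j))" using f4 5 unfolding frame_def main_regs_def code_regs_def by simp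
            have "I j (m5(cC := Suc c, cR := j)) (os @ tables n (code_list n k y a c))"
              unfolding I_def
            proof (intro conjI exI[of _ "cs @ [c]"])
              show "distinct (cs @ [c])" using c1(4) cn by simp
              show "length (cs @ [c]) = R - j" using c1(5) j by simp
              show "set (cs @ [c]) = {p. prime p \<and> 2 ^ gg \<le> p \<and> p < (m5(cC := Suc c, cR := j)) cC}" using newset by simp
              show "os @ tables n (code_list n k y a c) = tables n (concat (map (code_list n k y a) (cs @ [c])))"
                unfolding c1(7) by (simp add: tables_append)
              show "2 ^ gg \<le> (m5(cC := Suc c, cR := j)) cC" using c(2) c1(2) unfolding c0_def by simp
            qed (use f5 j c(3) in auto)
            then show "run (cC ::= V cC [+] Const 1) m5 128
              (\<lambda>m6 o6. m6 cR = Suc j \<and> I j (m6(cR := j)) (os @ (tables n (code_list n k y a c) @ o6)))"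
              by (intro run_asg) (use r5 cO in auto)
          qed
        qed
      qed
    qed
  qed
  have "run main_com m ((gg * 400 + 700) + (R * ((128 + (600 * (2 ^ G + 1) ^ 2 + (128 + (T + 128)))) + 192) + 192)) Q"
    unfolding main_com_def
  proof (rule run_seq_silent, rule srun_set_pow2[OF frame_refl, where a = gg])
    show "eval \<delta> m (V gG) = gg" using g unfolding globals_def gg_def by simp
    show "2 ^ gg \<le> \<Omega>" by (rule ggO)
  qed (rule loop, simp add: m0_def)
  moreover have "(gg * 400 + 700) + (R * ((128 + (600 * (2 ^ G + 1) ^ 2 + (128 + (T + 128)))) + 192) + 192)
    \<le> R * (600 * (2 ^ G + 1) ^ 2 + L * (U * (n * (27000 * (U + 1) ^ 3)) + 192) + 1000) + gg * 400 + 1000"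
  proof -
    have "R * ((128 + (600 * (2 ^ G + 1) ^ 2 + (128 + (T + 128)))) + 192)
      \<le> R * (600 * (2 ^ G + 1) ^ 2 + L * (U * (n * (27000 * (U + 1) ^ 3)) + 192) + 1000)"
      unfolding T_def by (rule mult_le_mono2) simp
    then show ?thesis by linarith
  qed
  ultimately show ?thesis unfolding R_def gg_def G_def L_def by (rule run_mono)
qed

end

section \<open>The family\<close>

definition phf_com :: com where
  "phf_com = scale_com ;; params_com ;; greedy_com ;; main_com"

lemma small_phf_com: "small_com phf_com"
  unfolding phf_com_def residue_com_def adjust_com_def bump_com_def pair_body_def scale_com_def params_com_def greedy_com_def main_com_def seeds_com_def emit_com_def
    potential_com_def row_com_def pair_com_def colour_com_def group_com_def split_com_def step_com_def prime_com_def
    set_bit_length_def set_pow2_def set_prime_def set_code_def poly_com_def nisan_com_def pow2_com_def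
    next_prime_com_def mul_pow_com_def bit_length_com_def for_loop_def
  by (simp add: small_expr_def)

text \<open>The three stages lose \<open>1 / 2 ^ prec k y\<close> each time they are used, and \<open>prec k y\<close> is
  chosen such that the sum of these losses is at most \<open>ln \<delta>\<close>.\<close>

lemma total_loss_le:
  assumes k: "1 \<le> k" and \<delta>: "1 < \<delta>" "\<delta> \<le> 2" and y: "real (2 ^ y + 1) \<le> \<delta> * real (2 ^ y)"
  shows "exp (1 / 2 ^ prec k y + real (chain_length k y (start_bits k y) + 1) / 2 ^ prec k y) \<le> \<delta>"
proof -
  define h where "h = prec k y"
  define \<epsilon> where "\<epsilon> = \<delta> - 1"
  have \<epsilon>: "0 < \<epsilon>" "\<epsilon> \<le> 1" using \<delta> unfolding \<epsilon>_def by auto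
  have "1 \<le> \<epsilon> * 2 ^ y" using y unfolding \<epsilon>_def by (simp add: algebra_simps)
  then have e: "1 / 2 ^ y \<le> \<epsilon>" by (simp add: field_simps)
  have "chain_length k y (start_bits k y) + 2 \<le> kap k + 2" using chain_length_start[OF k] by simp
  also have "\<dots> \<le> 2 * 2 ^ kap k"
  proof -
    have "kap k + 1 \<le> 2 ^ kap k" using less_exp[of "kap k"] by linarith
    moreover have "1 \<le> (2::nat) ^ kap k" by simp
    ultimately show ?thesis by linarith
  qed
  finally have "real (chain_length k y (start_bits k y) + 2) \<le> 2 * 2 ^ kap k"
    by (metis of_nat_le_iff of_nat_mult of_nat_numeral of_nat_power)
  then have "real (chain_length k y (start_bits k y) + 2) / 2 ^ h \<le> (2 * 2 ^ kap k) / 2 ^ h" by (intro divide_right_mono) auto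
  also have "\<dots> = 1 / 2 ^ y / 2" unfolding h_def prec_def by (simp add: power_add)
  also have "\<dots> \<le> \<epsilon> / 2" using e by simp
  \<comment> \<open>From ln u \<le> u - 1 at u = 1/(1 + \<epsilon>); the factor 1/2 is due to
    \<epsilon> \<le> 1.\<close>
  also have "\<dots> \<le> ln (1 + \<epsilon>)"
  proof -
    have "1 - 1 / (1 + \<epsilon>) \<le> ln (1 + \<epsilon>)"
      using ln_le_minus_one[of "1 / (1 + \<epsilon>)"] \<epsilon> by (simp add: ln_div)
    moreover have "\<epsilon> / 2 \<le> 1 - 1 / (1 + \<epsilon>)"
    proof -
      have "1 - 1 / (1 + \<epsilon>) = \<epsilon> / (1 + \<epsilon>)" using \<epsilon> by (simp add: field_simps)
      moreover have "\<epsilon> / 2 \<le> \<epsilon> / (1 + \<epsilon>)" using \<epsilon> by (intro divide_left_mono) auto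
      ultimately show ?thesis by simp
    qed
    ultimately show ?thesis by linarith
  qed
  also have "1 + \<epsilon> = \<delta>" unfolding \<epsilon>_def by simp
  finally have "real (chain_length k y (start_bits k y) + 2) / 2 ^ h \<le> ln \<delta>" .
  moreover have "1 / 2 ^ h + real (chain_length k y (start_bits k y) + 1) / 2 ^ h = real (chain_length k y (start_bits k y) + 2) / 2 ^ h"
    by (simp add: add_divide_distrib)
  ultimately show ?thesis unfolding h_def[symmetric] using \<delta> by (metis exp_le_cancel_iff exp_ln less_trans zero_less_one)
qed

lemma code_list_size:
  "length (concat (map (code_list n k y a) cs)) = length cs * (code_length n k y * seed_count k y (start_bits k y))"
proof -
  have 1: "length (code_list n k y a c) = code_length n k y * seed_count k y (start_bits k y)" for c
    unfolding code_list_def by (simp add: length_concat comp_def seed_list_def sum_list_triv)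
  show ?thesis by (simp add: length_concat comp_def 1 sum_list_triv)
qed

text \<open>Different indices may give equal functions, so the multiset is counted through the list
  of indices. That this list is distinct follows by comparing its length with the cardinality of its
  set.\<close>

lemma size_filter_code_list:
  assumes "distinct cs"
  shows "size {#f \<in># mset (concat (map (code_list n k y a) cs)). P f#} =
    card {u \<in> (set cs \<times> {1..code_length n k y}) \<times> {..<seed_count k y (start_bits k y)}.
      P ((\<lambda>((c, i), \<sigma>). family_fun n k y a c i \<sigma>) u)}"
proof -
  define K L where "K = seed_count k y (start_bits k y)" and "L = code_length n k y"
  define xs where "xs = concat (map (\<lambda>c. concat (map (\<lambda>i. map (\<lambda>\<sigma>. ((c, i), \<sigma>)) [0..<K]) (rev [1..<Suc L]))) cs)"
  define F where "F = (\<lambda>((c, i), \<sigma>). family_fun n k y a c i \<sigma>)"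
  have eq: "concat (map (code_list n k y a) cs) = map F xs"
    unfolding xs_def code_list_def seed_list_def F_def K_def[symmetric] L_def[symmetric] by (simp add: map_concat comp_def del: upt_Suc)
  have set: "set xs = (set cs \<times> {1..L}) \<times> {..<K}"
    unfolding xs_def by (auto simp: image_iff less_Suc_eq_le simp del: upt_Suc)
  have "length xs = length cs * (L * K)"
    using arg_cong[OF eq, of length] unfolding code_list_size K_def L_def by simp
  also have "\<dots> = card (set xs)" unfolding set using assms by (simp add: card_cartesian_product distinct_card)
  finally have "distinct xs" by (metis card_distinct)
  then have dist: "distinct (filter (\<lambda>u. P (F u)) xs)" by simp
  have "size {#f \<in># mset (concat (map (code_list n k y a) cs)). P f#} = length (filter P (map F xs))"
    unfolding eq by (simp only: mset_filter[symmetric] size_mset)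
  also have "\<dots> = length (filter (\<lambda>u. P (F u)) xs)" by (simp add: filter_map comp_def)
  also have "\<dots> = card (set (filter (\<lambda>u. P (F u)) xs))" using dist by (rule distinct_card[symmetric])
  also have "set (filter (\<lambda>u. P (F u)) xs) = {u \<in> set xs. P (F u)}" by simp
  also have "\<dots> = {u \<in> (set cs \<times> {1..L}) \<times> {..<K}. P (F u)}" unfolding set ..
  finally show ?thesis unfolding K_def L_def F_def .
qed

text \<open>The bound on the potential makes the code good and costs 1/2^h; the colouring costs
  another \<open>chain_length + 1\<close> times 1/2^h. The sum \<eta> satisfies exp \<eta> \<le>
  \<delta> by \<open>total_loss_le\<close>.\<close>

lemma balanced_code_list:
  assumes k: "1 \<le> k" "k \<le> n" and \<delta>: "1 < \<delta>" "\<delta> \<le> 2" and y: "real (2 ^ y + 1) \<le> \<delta> * real (2 ^ y)"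
    and cs: "distinct cs" "length cs = residue_count n k y"
      "\<And>c. c \<in> set cs \<Longrightarrow> prime c \<and> 2 ^ gexp n k y \<le> c \<and> c \<le> 2 ^ Gexp n k y"
    and pot: "real (potential (next_prime (2 ^ Gexp n k y)) (2 ^ start_bits k y) a {1..code_length n k y} (2 ^ Gexp n k y))
      \<le> real ((2 ^ Gexp n k y) ^ 2) * (1 + 2 / real (2 ^ start_bits k y)) ^ code_length n k y"
  shows "balanced_phf_family \<delta> n k (mset (concat (map (code_list n k y a) cs)))"
proof -
  define t g G where "t = start_bits k y" and "g = gexp n k y" and "G = Gexp n k y"
  define K L where "K = seed_count k y t" and "L = code_length n k y"
  define p where "p = next_prime (2 ^ G)"
  define h where "h = prec k y"
  define \<eta> where "\<eta> = 1 / 2 ^ h + real (chain_length k y t + 1) / 2 ^ h"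
  have L: "L = 2 ^ t * G" unfolding L_def code_length_def t_def G_def ..
  have g0: "0 < g" "0 < G" unfolding g_def G_def Gexp_def gexp_def start_bits_def by auto
  have coll: "card (collisions p (2 ^ t) a {1..2 ^ t * G} v v') \<le> 6 * G" if "v' < v" "v < 2 ^ G" for v v'
    by (rule collisions_le_of_potential[OF _ refl refl _ that])
       (use pot in \<open>simp_all add: p_def t_def G_def L_def[symmetric] L[unfolded t_def G_def] code_length_def\<close>)
  define f1 where "f1 = (\<lambda>(c, i) x. poly_hash p 2 (a i) (x mod c) mod 2 ^ t)"
  have b1: "inj_balanced (1 / 2 ^ h) k n (set cs \<times> {1..2 ^ t * G}) f1"
    unfolding f1_def
  proof (rule inj_balanced_residue_code[where \<nu> = "bit_length n" and g = g and \<kappa> = "kap k"])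
    show "card (set cs) = 2 ^ t * (bit_length n div g + 1)" using cs(1,2) unfolding residue_count_def t_def g_def by (simp add: distinct_card)
    show "n \<le> 2 ^ bit_length n" using bit_length[of n] by simp
    show "k < 2 ^ kap k" by (rule kap)
    show "2 * kap k + h + 4 \<le> t" unfolding t_def h_def start_bits_def by simp
  qed (use cs g0 coll in \<open>auto simp: g_def G_def\<close>)
  have kt: "kap k \<le> t" unfolding t_def start_bits_def by simp
  have b2: "inj_balanced (real (chain_length k y t + 1) / 2 ^ h) k (2 ^ t) {..<K} (colour_hash k y t)"
    unfolding h_def K_def by (rule colour_hash_balanced[OF k(1) kt])
  have b: "inj_balanced \<eta> k n ((set cs \<times> {1..L}) \<times> {..<K}) (\<lambda>(ci, \<sigma>) x. colour_hash k y t \<sigma> (f1 ci x))"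
    unfolding \<eta>_def L by (rule inj_balanced_compose[OF b1 b2]) (auto simp: f1_def)
  obtain T :: real where T: "T > 0" "\<And>S. S \<subseteq> {..<n} \<and> card S = k \<Longrightarrow>
     T * exp (- \<eta>) \<le> real (card {u \<in> (set cs \<times> {1..L}) \<times> {..<K}. inj_on ((\<lambda>(ci, \<sigma>) x. colour_hash k y t \<sigma> (f1 ci x)) u) S}) \<and>
     real (card {u \<in> (set cs \<times> {1..L}) \<times> {..<K}. inj_on ((\<lambda>(ci, \<sigma>) x. colour_hash k y t \<sigma> (f1 ci x)) u) S}) \<le> T * exp \<eta>"
    using b unfolding inj_balanced_def by blast
  have e\<eta>: "exp \<eta> \<le> \<delta>" unfolding \<eta>_def h_def t_def by (rule total_loss_le[OF k(1) \<delta> y])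
  have fam: "family_fun n k y a c i \<sigma> x = colour_hash k y t \<sigma> (f1 (c, i) (x - 1)) + 1" if "x \<in> {1..n}" for c i \<sigma> x
    using that unfolding family_fun_def f1_def p_def t_def G_def by simp
  show ?thesis unfolding balanced_phf_family_def
  proof (intro conjI exI[of _ T] allI impI)
    show "set_mset (mset (concat (map (code_list n k y a) cs))) \<subseteq> {1..n} \<rightarrow>\<^sub>E {1..k}"
    proof
      fix f assume "f \<in># mset (concat (map (code_list n k y a) cs))"
      then obtain c i \<sigma> where f: "f = family_fun n k y a c i \<sigma>"
        unfolding code_list_def seed_list_def by auto
      have "f x \<in> {1..k}" if "x \<in> {1..n}" for x
        using colour_hash_less[OF k(1), of y t \<sigma> "f1 (c, i) (x - 1)"] unfolding f fam[OF that] by simp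
      moreover have "f x = undefined" if "x \<notin> {1..n}" for x using that unfolding f family_fun_def restrict_def by (simp only: if_False)
      ultimately show "f \<in> {1..n} \<rightarrow>\<^sub>E {1..k}" by (intro PiE_I) auto
    qed
    show "T > 0" by (rule T)
    fix S assume S: "S \<subseteq> {1..n} \<and> card S = k"
    define S' where "S' = (\<lambda>x. x - 1) ` S"
    have inj1: "inj_on (\<lambda>x. x - 1 :: nat) S" by (rule inj_on_diff_nat) (use S in auto)
    have "x - 1 < n" if "x \<in> S" for x using subsetD[of S "{1..n}" x] S that by auto
    then have S': "S' \<subseteq> {..<n}" "card S' = k" using S card_image[OF inj1] unfolding S'_def by auto
    have io: "inj_on (family_fun n k y a c i \<sigma>) S \<longleftrightarrow> inj_on (\<lambda>x. colour_hash k y t \<sigma> (f1 (c, i) x)) S'" for c i \<sigma>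
    proof -
      have "inj_on (family_fun n k y a c i \<sigma>) S \<longleftrightarrow> inj_on (\<lambda>x. colour_hash k y t \<sigma> (f1 (c, i) (x - 1)) + 1) S"
        by (rule inj_on_cong, rule fam) (use S in auto)
      also have "\<dots> \<longleftrightarrow> inj_on ((\<lambda>x. colour_hash k y t \<sigma> (f1 (c, i) x)) \<circ> (\<lambda>x. x - 1)) S"
        unfolding inj_on_def by simp
      also have "\<dots> \<longleftrightarrow> inj_on (\<lambda>x. colour_hash k y t \<sigma> (f1 (c, i) x)) S'"
        unfolding S'_def using comp_inj_on_iff[OF inj1] by blast
      finally show ?thesis .
    qed
    define N where "N = size {#f \<in># mset (concat (map (code_list n k y a) cs)). inj_on f S#}"
    have "N = card {u \<in> (set cs \<times> {1..L}) \<times> {..<K}. inj_on ((\<lambda>(ci, \<sigma>) x. colour_hash k y t \<sigma> (f1 ci x)) u) S'}"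
      unfolding N_def size_filter_code_list[OF cs(1)] K_def L_def t_def[symmetric]
    proof (rule arg_cong[where f = card], rule Collect_cong, rule conj_cong)
      fix u :: "(nat \<times> nat) \<times> nat"
      show "inj_on ((\<lambda>((c, i), \<sigma>). family_fun n k y a c i \<sigma>) u) S = inj_on ((\<lambda>(ci, \<sigma>) x. colour_hash k y t \<sigma> (f1 ci x)) u) S'"
        by (cases u, cases "fst u") (simp add: io)
    qed (rule refl)
    then have N: "T * exp (- \<eta>) \<le> real N" "real N \<le> T * exp \<eta>" using T(2)[of S'] S' by auto
    have "T / \<delta> \<le> T / exp \<eta>" using T(1) e\<eta> \<delta> by (intro divide_left_mono mult_pos_pos) auto
    also have "\<dots> = T * exp (- \<eta>)" by (simp add: exp_minus divide_inverse)
    finally show "T / \<delta> \<le> real (size {#f \<in># mset (concat (map (code_list n k y a) cs)). inj_on f S#})"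
      using N unfolding N_def by linarith
    have "T * exp \<eta> \<le> \<delta> * T" using T e\<eta> by (simp add: mult.commute)
    then show "real (size {#f \<in># mset (concat (map (code_list n k y a) cs)). inj_on f S#}) \<le> \<delta> * T"
      using N unfolding N_def by linarith
  qed
qed

definition phf_time :: "nat \<Rightarrow> nat \<Rightarrow> nat \<Rightarrow> nat \<Rightarrow> nat" where
  "phf_time n k y U = (y * 400 + 400) + (20000 * (2 ^ (2 * Gexp n k y + 8) + 1) ^ 2 +
     (20000 * (2 ^ (2 * Gexp n k y + 8) + 1) ^ 6 +
      (residue_count n k y * (600 * (2 ^ Gexp n k y + 1) ^ 2 +
         code_length n k y * (U * (n * (27000 * (U + 1) ^ 3)) + 192) + 1000) + gexp n k y * 400 + 1000)))"

text \<open>Here semantics and combinatorics meet: the bound on the potential that the greedy search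
  guarantees for the array in memory is the hypothesis under which the listed family is
  balanced.\<close>

lemma (in ram) exec_phf_com:
  assumes k: "1 \<le> k" "k \<le> n" and \<delta>: "1 < \<delta>" "\<delta> \<le> 2"
    and y: "real (2 ^ y + 1) \<le> \<delta> * real (2 ^ y)" "\<And>z. z < y \<Longrightarrow> \<not> real (2 ^ z + 1) \<le> \<delta> * real (2 ^ z)"
    and U: "seed_count k y (start_bits k y) \<le> U" "start_bits k y \<le> U" "k \<le> U" "U + 1 \<le> \<Omega>"
    and O: "2 * n + 1 \<le> \<Omega>" "2 ^ (6 * Gexp n k y + 16) \<le> \<Omega>"
  shows "\<exists>fs T m. exec w \<delta> phf_com (input n k, []) T (m, tables n fs) \<and> balanced_phf_family \<delta> n k (mset fs) \<and>
    length fs = residue_count n k y * (code_length n k y * seed_count k y (start_bits k y)) \<and> T \<le> phf_time n k y U"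
proof -
  define G where "G = Gexp n k y"
  define W where "W = (2::nat) ^ (2 * G + 8)"
  define p where "p = next_prime (2 ^ G)"
  define q where "q = (2::nat) ^ start_bits k y"
  define L where "L = code_length n k y"
  note cs = code_sizes[where n = n and k = k and y = y, folded G_def q_def]
  have pW: "p < W" unfolding p_def W_def by (rule next_prime_power2_less)
  have pp: "prime p" "2 ^ G \<le> p" unfolding p_def by (rule next_prime)+
  have G8: "8 \<le> G" unfolding G_def Gexp_def by simp
  have powO: "2 ^ i \<le> \<Omega>" if "i \<le> 6 * G + 16" for i
    using power_increasing[OF that, of "2::nat"] O(2) unfolding G_def by linarith
  have "W + 1 \<le> 2 ^ (2 * G + 9)" unfolding W_def by (simp add: power_add)
  then have WO: "W + 1 \<le> \<Omega>" using powO[of "2 * G + 9"] by linarith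
  have "p ^ 2 \<le> W ^ 2" using pW by (intro power_mono) auto
  also have "W ^ 2 = 2 ^ (4 * G + 16)" unfolding W_def power_mult[symmetric] by (simp add: algebra_simps)
  finally have p2O: "p ^ 2 \<le> \<Omega>" using powO[of "4 * G + 16"] by linarith
  have LG: "L \<le> 2 ^ G" unfolding L_def by (rule cs)
  have LW: "L \<le> W" using LG pp pW by linarith
  have "L + 100 \<le> 2 ^ (G + 7)"
  proof -
    have "(128::nat) * 1 \<le> 128 * 2 ^ G" by (intro mult_le_mono2) simp
    moreover have "(2::nat) ^ (G + 7) = 128 * 2 ^ G" by (simp add: power_add)
    moreover have "L + 100 \<le> 2 ^ G + 100 * 2 ^ G" using LG by (intro add_mono) auto
    ultimately show ?thesis by linarith
  qed
  then have LO: "L + 100 \<le> \<Omega>" using powO[of "G + 7"] by linarith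
  have qp: "q \<le> p" using cs(6) pp by linarith
  have yt: "y \<le> G" using cs(3,4) unfolding start_bits_def prec_def by simp
  have bd: "bounded_mem (input n k)" unfolding bounded_mem_def input_def using O k by auto
  define Good where "Good os \<longleftrightarrow> (\<exists>fs. os = tables n fs \<and> balanced_phf_family \<delta> n k (mset fs) \<and>
    length fs = residue_count n k y * (L * seed_count k y (start_bits k y)))" for os
  have "run phf_com (input n k) (phf_time n k y U) (\<lambda>m os. Good os)"
    unfolding phf_com_def residue_com_def adjust_com_def bump_com_def pair_body_def phf_time_def G_def[symmetric] W_def[symmetric]
  proof (rule run_seq_silent, rule srun_scale[OF y])
    show "2 ^ y \<le> \<Omega>" using powO[of y] yt by simp
    show "input n k gY = 0" unfolding input_def by simp
    fix m1 assume 1: "frame {gY, gE} (input n k) m1" "m1 gY = y"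
    have m1: "m1 0 = n" "m1 1 = k" using frameD[OF 1(1), of 0] frameD[OF 1(1), of 1] unfolding input_def by auto
    show "run (params_com ;; greedy_com ;; main_com) m1 (20000 * (W + 1) ^ 2 + (20000 * (W + 1) ^ 6 +
      (residue_count n k y * (600 * (2 ^ G + 1) ^ 2 +
         code_length n k y * (U * (n * (27000 * (U + 1) ^ 3)) + 192) + 1000) + gexp n k y * 400 + 1000))) (\<lambda>m os. Good os)"
    proof (rule run_seq_silent, rule srun_params[OF m1 1(2) k])
      show "next_prime (2 ^ Gexp n k y) \<le> W" using pW unfolding p_def G_def by simp
      show "W \<le> \<Omega>" using WO by simp
      show "2 * n + 1 \<le> \<Omega>" by (rule O)
      show "code_length n k y \<le> W" using LW unfolding L_def .
      fix m2 assume g2: "globals n k y m2"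
      show "run (greedy_com ;; main_com) m2 (20000 * (W + 1) ^ 6 +
        (residue_count n k y * (600 * (2 ^ G + 1) ^ 2 +
         code_length n k y * (U * (n * (27000 * (U + 1) ^ 3)) + 192) + 1000) + gexp n k y * 400 + 1000)) (\<lambda>m os. Good os)"
      proof (rule run_seq_silent, rule srun_greedy[where p = p and q = q and L = L and M = "2 ^ G" and G = G])
        show "m2 gP = p" "m2 gQ = q" "m2 gL = L" "m2 gM = 2 ^ G" using g2 unfolding globals_def p_def q_def L_def G_def by auto
        show "prime p" "q \<le> p" "2 ^ G \<le> p" by (rule pp qp)+
        show "0 < q" unfolding q_def by simp
        show "L = q * G" unfolding L_def code_length_def q_def G_def ..
        show "2 ^ (6 * G + 1) \<le> \<Omega>" by (rule powO) simp
        fix m3 assume 3: "\<And>b. b < 56 \<Longrightarrow> b \<notin> work_regs \<Longrightarrow> m3 b = m2 b"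
          "real (potential p q (\<lambda>i. m3 (99 + i)) {1..L} (2 ^ G)) \<le> real ((2 ^ G) ^ 2) * (1 + 2 / real q) ^ L"
        have g3: "globals n k y m3" by (rule globals_frame[OF g2 3(1)])
        show "run main_com m3 (residue_count n k y * (600 * (2 ^ G + 1) ^ 2 +
          code_length n k y * (U * (n * (27000 * (U + 1) ^ 3)) + 192) + 1000) + gexp n k y * 400 + 1000) (\<lambda>m os. Good os)"
          unfolding G_def
        proof (rule run_main[OF g3 k refl U])
          show "n \<le> \<Omega>" using O by simp
          have "2 ^ G + 1 \<le> (2::nat) ^ (G + 1)" by simp
          then show "2 ^ Gexp n k y + 1 \<le> \<Omega>" using powO[of "G + 1"] unfolding G_def by linarith
          fix cs :: "nat list" assume cs: "distinct cs" "length cs = residue_count n k y"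
            "\<And>c. c \<in> set cs \<Longrightarrow> prime c \<and> 2 ^ gexp n k y \<le> c \<and> c \<le> 2 ^ Gexp n k y"
          have "balanced_phf_family \<delta> n k (mset (concat (map (code_list n k y (\<lambda>i. m3 (99 + i))) cs)))"
            by (rule balanced_code_list[OF k \<delta> y(1) cs(1,2) _ 3(2)[unfolded p_def q_def L_def G_def]]) (rule cs(3))
          moreover have "length (concat (map (code_list n k y (\<lambda>i. m3 (99 + i))) cs)) = residue_count n k y * (L * seed_count k y (start_bits k y))"
            unfolding code_list_size cs(2) L_def ..
          ultimately show "Good (tables n (concat (map (code_list n k y (\<lambda>i. m3 (99 + i))) cs)))" unfolding Good_def by blast
        qed
      qed (use LW pW WO p2O LO in auto)
    qed
  qed
  then obtain T m os where r: "exec w \<delta> phf_com (input n k, []) T (m, [] @ os)" "T \<le> phf_time n k y U" "Good os"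
    by (rule runE[where out = "[]"]) (use small_phf_com bd in auto)
  then show ?thesis unfolding Good_def L_def by auto
qed

section \<open>Size and time bounds\<close>

text \<open>Absorbs the preprocessing into the factor \<open>n\<close>. Up to factors depending on
  \<open>k\<close> and \<open>y\<close>, the search takes W^6 steps with W of order \<nu>^4, whence
  the exponent 24, and 2^\<nu> is at most 2n for the bit length \<nu> of \<open>n\<close>.\<close>

lemma power24_le: "(x::nat) ^ 24 \<le> 2 ^ 120 * 2 ^ x"
proof -
  have "x \<le> 24 * Suc (x div 24)" using dividend_less_times_div[of 24 x] by simp
  also have "\<dots> \<le> 2 ^ 5 * 2 ^ (x div 24)" by (intro mult_le_mono Suc_leI less_exp) simp
  finally have "x ^ 24 \<le> (2 ^ 5 * 2 ^ (x div 24)) ^ 24" by (rule power_mono) simp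
  also have "\<dots> = 2 ^ 120 * 2 ^ (x div 24 * 24)" by (simp only: power_mult_distrib power_mult[symmetric]) simp
  also have "\<dots> \<le> 2 ^ 120 * 2 ^ x" by (intro mult_le_mono2 power_increasing) simp_all
  finally show ?thesis .
qed

text \<open>Estimates are made with E i = 2^(i * Z): products add the indices, and a constant up to
  2^i is at most E i because Z \<ge> 1. The listing dominates: \<open>U\<close> seeds with
  \<open>n\<close> evaluations of cost O(U^3) each, which gives about U^4, i.e. 4 * 26000 in the
  exponent; 105000 is this with slack.\<close>

lemma phf_bounds:
  fixes n k y :: nat
  assumes k: "1 \<le> k" "k \<le> n"
  defines "Z \<equiv> expo k y" and "\<nu> \<equiv> bit_length n" and "U \<equiv> 2 ^ (26000 * expo k y)"
  shows "residue_count n k y * (code_length n k y * seed_count k y (start_bits k y)) \<le> 2 ^ (105000 * Z) * \<nu>"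
    and "phf_time n k y U \<le> 2 ^ (105000 * Z) * (n * \<nu>)"
    and "2 ^ (6 * Gexp n k y + 16) \<le> 2 ^ (105000 * Z) * (n * \<nu>)" "2 * n + 1 \<le> 2 ^ (105000 * Z) * (n * \<nu>)"
      "200 \<le> 2 ^ (105000 * Z) * (n * \<nu>)" "U + 1 \<le> 2 ^ (105000 * Z) * (n * \<nu>)"
      "seed_count k y (start_bits k y) \<le> U" "start_bits k y \<le> U" "k \<le> U"
proof -
  note eb = expo_bounds[OF k(1), of y, folded Z_def]
  define E where "E i = (2::nat) ^ (i * Z)" for i
  have EE: "E i * E j = E (i + j)" for i j unfolding E_def by (simp add: power_add add_mult_distrib)
  have Epow: "E i ^ j = E (i * j)" for i j unfolding E_def power_mult[symmetric] by (simp add: mult_ac)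
  have Emono: "i \<le> j \<Longrightarrow> E i \<le> E j" for i j unfolding E_def by (intro power_increasing mult_le_mono1) auto
  have Ege: "2 ^ i \<le> E i" for i unfolding E_def using mult_le_mono2[OF eb(13), of i] by (intro power_increasing) auto
  have E1: "1 \<le> E i" for i unfolding E_def by simp
  have ZE: "Z \<le> E 1" unfolding E_def using less_exp[of Z] by simp
  define t g G where "t = start_bits k y" and "g = gexp n k y" and "G = Gexp n k y"
  define R L where "R = residue_count n k y" and "L = code_length n k y"
  define W where "W = (2::nat) ^ (2 * G + 8)"
  define N where "N = n * \<nu>"
  note cs = code_sizes[where n = n and k = k and y = y, folded t_def g_def G_def R_def L_def \<nu>_def]
  have n1: "1 \<le> n" using k by simp
  have nu1: "1 \<le> \<nu>" unfolding \<nu>_def by (rule bit_length_ge1[OF n1])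
  have "1 * 1 \<le> n * \<nu>" by (rule mult_le_mono[OF n1 nu1])
  then have N1: "1 \<le> N" unfolding N_def by simp
  have nN: "n \<le> N" unfolding N_def using mult_le_mono2[OF nu1, of n] by simp
  have t10: "t \<le> 10 * Z" unfolding t_def by (rule eb)
  have tE: "2 ^ t \<le> E 10" unfolding E_def using t10 by (intro power_increasing) auto
  have half: "2 ^ bit_length m \<le> 2 * m" if "1 \<le> m" for m
  proof -
    have "bit_length m = Suc (bit_length m - 1)" using bit_length_ge1[OF that] by simp
    then have "2 ^ bit_length m = 2 * (2::nat) ^ (bit_length m - 1)" by (metis power_Suc)
    then show ?thesis using power_bit_length_le[OF that] by simp
  qed
  have nu24: "\<nu> ^ 24 \<le> E 121 * n"
  proof -
    have "\<nu> ^ 24 \<le> 2 ^ 120 * 2 ^ \<nu>" by (rule power24_le)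
    also have "\<dots> \<le> 2 ^ 120 * (2 * n)" unfolding \<nu>_def using half[OF n1] by (rule mult_le_mono2)
    also have "\<dots> = 2 ^ 121 * n" by simp
    also have "\<dots> \<le> E 121 * n" by (rule mult_le_mono1[OF Ege])
    finally show ?thesis .
  qed
  have nuN: "\<nu> ^ j \<le> E 121 * N" if "j \<le> 24" for j
  proof -
    have "\<nu> ^ j \<le> \<nu> ^ 24" using that nu1 by (intro power_increasing) auto
    also have "\<dots> \<le> E 121 * N" using nu24 mult_le_mono2[OF nN] by (rule order.trans)
    finally show ?thesis .
  qed
  have g: "2 ^ g \<le> E 11 * \<nu>"
  proof -
    have "2 ^ g = 2 ^ t * (2::nat) ^ bit_length \<nu>" unfolding g_def gexp_def t_def \<nu>_def by (rule power_add)
    also have "\<dots> \<le> E 10 * (E 1 * \<nu>)"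
      using half[OF nu1] mult_le_mono1[OF Ege[of 1], of \<nu>] by (intro mult_le_mono[OF tE]) (simp add: order.trans)
    also have "\<dots> = E 11 * \<nu>" unfolding mult.assoc[symmetric] EE by simp
    finally show ?thesis .
  qed
  have G: "2 ^ G \<le> E 30 * \<nu> ^ 2"
  proof -
    have "2 ^ G = 2 ^ 8 * ((2::nat) ^ g) ^ 2" unfolding G_def Gexp_def g_def[symmetric] by (simp only: power_add power_mult[symmetric] mult.commute)
    also have "\<dots> \<le> E 8 * (E 11 * \<nu>) ^ 2" by (intro mult_le_mono Ege power_mono[OF g]) simp
    also have "\<dots> = E 30 * \<nu> ^ 2" unfolding power_mult_distrib Epow mult.assoc[symmetric] EE by simp
    finally show ?thesis .
  qed
  have Wle: "W + 1 \<le> E 69 * \<nu> ^ 4"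
  proof -
    have "W + 1 \<le> 2 ^ 1 * W" unfolding W_def by simp
    also have "\<dots> = 2 ^ 1 * (2 ^ 8 * ((2::nat) ^ G) ^ 2)" unfolding W_def by (simp only: power_add power_mult[symmetric] mult.commute)
    also have "2 ^ 1 * (2 ^ 8 * ((2::nat) ^ G) ^ 2) \<le> E 1 * (E 8 * (E 30 * \<nu> ^ 2) ^ 2)"
      by (intro mult_le_mono Ege power_mono[OF G]) simp
    also have "\<dots> = E 69 * \<nu> ^ 4" unfolding power_mult_distrib Epow mult.assoc[symmetric] EE power_mult[symmetric] by simp
    finally show ?thesis .
  qed
  \<comment> \<open>535 = 6 * 69 + 121: the sixth power of the bound for W + 1, and the price of
    replacing \<nu>^24 by N.\<close>
  define Y where "Y = E 535 * N"
  have W6: "(W + 1) ^ 6 \<le> Y"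
  proof -
    have "(W + 1) ^ 6 \<le> (E 69 * \<nu> ^ 4) ^ 6" by (rule power_mono[OF Wle]) simp
    also have "\<dots> = E 414 * \<nu> ^ 24" unfolding power_mult_distrib Epow power_mult[symmetric] by simp
    also have "\<dots> \<le> E 414 * (E 121 * N)" by (rule mult_le_mono2[OF nuN]) simp
    also have "\<dots> = Y" unfolding Y_def mult.assoc[symmetric] EE by simp
    finally show ?thesis .
  qed
  have Wj: "(W + 1) ^ j \<le> Y" if "j \<le> 6" for j
    using power_increasing[OF that, of "W + 1"] W6 by simp
  have GW: "2 ^ G \<le> W" unfolding W_def by (rule power_increasing) auto
  have gG: "(2::nat) ^ g \<le> 2 ^ G" using cs(4) by (intro power_increasing) auto
  have RW: "R \<le> W" using cs(2) gG GW by linarith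
  have W1: "W + 1 \<le> Y" using Wj[of 1] by simp
  have gW: "g \<le> Y" using less_exp[of g] gG GW W1 by linarith
  \<comment> \<open>The cancellation of \<open>g\<close>: the product of
    \<open>\<nu> div g + 1\<close> and \<open>2 * g + 8\<close> is O(\<nu> + g), and g is at most t
    + \<nu> with t = O(Z). Hence a single factor \<nu> suffices.\<close>
  have RL: "R * L \<le> E 140 * \<nu>"
  proof -
    have g1: "1 \<le> g" unfolding g_def gexp_def start_bits_def by simp
    have "(\<nu> div g + 1) * (2 * g + 8) \<le> (\<nu> div g + 1) * (10 * g)" using g1 by (intro mult_le_mono2) simp
    also have "\<dots> = 10 * (\<nu> div g * g) + 10 * g" by (simp add: algebra_simps)
    also have "\<dots> \<le> 10 * \<nu> + 10 * (t + \<nu>)"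
      using div_times_less_eq_dividend[of \<nu> g] bit_length_le_self[of \<nu>] unfolding g_def gexp_def t_def \<nu>_def[symmetric]
      by (intro add_mono mult_le_mono2) auto
    also have "\<dots> \<le> (120 * Z) * \<nu>"
    proof -
      define x where "x = Z * \<nu>"
      have "t * 1 \<le> (10 * Z) * \<nu>" by (rule mult_le_mono[OF t10 nu1])
      then have "t \<le> 10 * x" unfolding x_def by simp
      moreover have "1 * \<nu> \<le> x" unfolding x_def by (rule mult_le_mono1[OF eb(13)])
      ultimately have "10 * \<nu> + 10 * (t + \<nu>) \<le> 120 * x" by simp
      then show ?thesis unfolding x_def by (simp only: mult.assoc)
    qed
    also have "\<dots> \<le> E 120 * \<nu>"
    proof -
      have "120 * Z < 2 ^ (120 * Z)" by (rule less_exp)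
      then show ?thesis unfolding E_def by (intro mult_le_mono1) (rule less_imp_le)
    qed
    finally have 1: "(\<nu> div g + 1) * (2 * g + 8) \<le> E 120 * \<nu>" .
    have "R * L = (2 ^ t * 2 ^ t) * ((\<nu> div g + 1) * (2 * g + 8))"
      unfolding R_def L_def residue_count_def code_length_def Gexp_def t_def g_def \<nu>_def by (simp only: mult_ac)
    also have "\<dots> \<le> (E 10 * E 10) * (E 120 * \<nu>)" by (intro mult_le_mono tE 1)
    also have "\<dots> = E 140 * \<nu>" unfolding mult.assoc[symmetric] EE by simp
    finally show ?thesis .
  qed
  have UE: "U = E 26000" unfolding U_def E_def Z_def ..
  show sc: "seed_count k y (start_bits k y) \<le> U" unfolding U_def by (rule seed_count_le[OF k(1)])
  have big: "2 ^ (105000 * Z) = E 105000" unfolding E_def ..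
  have E_le: "E i \<le> U" if "i \<le> 26000" for i unfolding UE by (rule Emono[OF that])
  show "start_bits k y \<le> U"
    using less_exp[of t] tE E_le[of 10] unfolding t_def by linarith
  show "k \<le> U" using eb(1) ZE E_le[of 1] by linarith
  have U1: "U + 1 \<le> E 26001"
  proof -
    have "U + 1 \<le> 2 ^ 1 * U" unfolding U_def by simp
    also have "\<dots> \<le> E 1 * E 26000" unfolding UE by (rule mult_le_mono1[OF Ege])
    finally show ?thesis unfolding EE by simp
  qed
  have toN: "a \<le> 2 ^ (105000 * Z) * (n * \<nu>)" if "a \<le> E i * N" "i \<le> 105000" for a i
    unfolding big N_def[symmetric] using that(1) mult_le_mono1[OF Emono[OF that(2)], of N] by (rule order.trans)
  have EN: "E i \<le> E i * N" for i using mult_le_mono2[OF N1, of "E i"] by simp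
  show "U + 1 \<le> 2 ^ (105000 * Z) * (n * \<nu>)" by (rule toN[OF order.trans[OF U1 EN]]) simp
  have "200 \<le> E 8" using Ege[of 8] by simp
  then show "200 \<le> 2 ^ (105000 * Z) * (n * \<nu>)" by (intro toN[OF order.trans[OF _ EN]]) auto
  have "2 * n + 1 \<le> 2 ^ 2 * N" using nN n1 by simp
  then show "2 * n + 1 \<le> 2 ^ (105000 * Z) * (n * \<nu>)" by (intro toN[OF order.trans[OF _ mult_le_mono1[OF Ege[of 2]]]]) auto
  have "2 ^ (6 * G + 16) = 2 ^ 16 * ((2::nat) ^ G) ^ 6" by (simp only: power_add power_mult[symmetric] mult.commute)
  also have "\<dots> \<le> E 16 * Y"
  proof (intro mult_le_mono Ege)
    have "((2::nat) ^ G) ^ 6 \<le> (W + 1) ^ 6" using GW by (intro power_mono) auto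
    then show "((2::nat) ^ G) ^ 6 \<le> Y" using W6 by (rule order.trans)
  qed
  also have "\<dots> = E 551 * N" unfolding Y_def mult.assoc[symmetric] EE by simp
  finally show "2 ^ (6 * Gexp n k y + 16) \<le> 2 ^ (105000 * Z) * (n * \<nu>)" unfolding G_def by (rule toN) simp
  have "R * (L * seed_count k y (start_bits k y)) = (R * L) * seed_count k y (start_bits k y)" by simp
  also have "\<dots> \<le> (E 140 * \<nu>) * E 26000" using sc unfolding UE by (intro mult_le_mono RL)
  also have "\<dots> = (E 140 * E 26000) * \<nu>" by (simp only: mult_ac)
  also have "\<dots> \<le> E 105000 * \<nu>" unfolding EE by (intro mult_le_mono1 Emono) simp
  finally show "residue_count n k y * (code_length n k y * seed_count k y (start_bits k y)) \<le> 2 ^ (105000 * Z) * \<nu>"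
    unfolding R_def L_def big .
  \<comment> \<open>A common bound for all summands of the running time; the largest of them needs
    140 + 104020 = 104160.\<close>
  define H where "H = E 104200 * N"
  have YH: "E 15 * Y \<le> H"
  proof -
    have "E 15 * Y = E 550 * N" unfolding Y_def mult.assoc[symmetric] EE by simp
    also have "\<dots> \<le> H" unfolding H_def by (intro mult_le_mono1 Emono) simp
    finally show ?thesis .
  qed
  have cY: "c * x \<le> H" if "c \<le> 2 ^ 15" "x \<le> Y" for c x
  proof -
    have "c * x \<le> E 15 * Y" using that Ege[of 15] by (intro mult_le_mono) auto
    then show ?thesis using YH by linarith
  qed
  have T1: "y * 400 + 400 \<le> H"
  proof -
    have "y * 400 + 400 \<le> 2 ^ 10 * Z" using eb(2,13) by simp
    also have "\<dots> \<le> E 10 * E 1" by (intro mult_le_mono Ege ZE)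
    also have "\<dots> \<le> E 104200" unfolding EE by (rule Emono) simp
    also have "\<dots> \<le> H" unfolding H_def by (rule EN)
    finally show ?thesis .
  qed
  have T2: "20000 * (W + 1) ^ 2 \<le> H" "20000 * (W + 1) ^ 6 \<le> H" by (intro cY Wj; simp)+
  have T3: "R * (600 * (2 ^ G + 1) ^ 2) \<le> H"
  proof -
    have "R * (2 ^ G + 1) ^ 2 \<le> (W + 1) * (W + 1) ^ 2" using RW GW by (intro mult_le_mono power_mono) auto
    also have "\<dots> = (W + 1) ^ 3" by (simp only: power2_eq_square power3_eq_cube mult.assoc)
    also have "\<dots> \<le> Y" by (rule Wj) simp
    finally have "600 * (R * (2 ^ G + 1) ^ 2) \<le> H" by (intro cY) simp_all
    then show ?thesis by (simp only: mult.left_commute)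
  qed
  have T4: "R * (L * (U * (n * (27000 * (U + 1) ^ 3)) + 192)) \<le> H"
  proof -
    have "U * (n * (27000 * (U + 1) ^ 3)) \<le> E 26001 * (n * (E 15 * E 26001 ^ 3))"
    proof (intro mult_le_mono power_mono)
      show "U \<le> E 26001" using U1 by simp
      show "27000 \<le> E 15" using Ege[of 15] by simp
    qed (use U1 in auto)
    also have "\<dots> = (E 26001 * (E 15 * E 26001 ^ 3)) * n" by (simp only: mult_ac)
    also have "\<dots> = E 104019 * n" unfolding Epow EE by simp
    finally have 1: "U * (n * (27000 * (U + 1) ^ 3)) \<le> E 104019 * n" .
    have "192 \<le> E 8" using Ege[of 8] by simp
    also have "\<dots> \<le> E 104019" by (rule Emono) simp
    also have "\<dots> \<le> E 104019 * n" using mult_le_mono2[OF n1, of "E 104019"] by simp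
    finally have c192: "192 \<le> E 104019 * n" .
    have "U * (n * (27000 * (U + 1) ^ 3)) + 192 \<le> 2 ^ 1 * (E 104019 * n)"
      unfolding power_one_right mult_2 by (rule add_mono[OF 1 c192])
    also have "\<dots> \<le> E 1 * (E 104019 * n)" by (rule mult_le_mono1[OF Ege])
    also have "\<dots> = E 104020 * n" unfolding mult.assoc[symmetric] EE by simp
    finally have 2: "U * (n * (27000 * (U + 1) ^ 3)) + 192 \<le> E 104020 * n" .
    have "R * (L * (U * (n * (27000 * (U + 1) ^ 3)) + 192)) = (R * L) * (U * (n * (27000 * (U + 1) ^ 3)) + 192)" by (rule mult.assoc[symmetric])
    also have "\<dots> \<le> (E 140 * \<nu>) * (E 104020 * n)" by (rule mult_le_mono[OF RL 2])
    also have "\<dots> = (E 140 * E 104020) * N" unfolding N_def by (simp only: mult_ac)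
    also have "\<dots> \<le> H" unfolding EE H_def by (intro mult_le_mono1 Emono) simp
    finally show ?thesis .
  qed
  have T5: "R * 1000 \<le> H"
  proof -
    have "1000 * R \<le> H" using RW Wj[of 1] by (intro cY) auto
    then show ?thesis by (simp only: mult.commute)
  qed
  have T6: "g * 400 + 1000 \<le> H"
  proof -
    have "1 \<le> Y" using Wj[of 0] by simp
    then have "g * 400 + 1000 \<le> 1400 * Y" using gW by simp
    also have "\<dots> \<le> H" by (rule cY) simp_all
    finally show ?thesis .
  qed
  have "phf_time n k y U = (y * 400 + 400) + (20000 * (W + 1) ^ 2 + (20000 * (W + 1) ^ 6 +
      (R * (600 * (2 ^ G + 1) ^ 2) + R * (L * (U * (n * (27000 * (U + 1) ^ 3)) + 192)) + R * 1000 + (g * 400 + 1000))))"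
    unfolding phf_time_def W_def G_def R_def L_def g_def by (simp only: distrib_left add.assoc)
  also have "\<dots> \<le> H + (H + (H + (H + H + H + H)))" by (intro add_mono T1 T2 T3 T4 T5 T6)
  also have "\<dots> \<le> 2 ^ 3 * H" by simp
  also have "\<dots> \<le> E 3 * H" by (rule mult_le_mono1[OF Ege])
  also have "\<dots> = E 104203 * N" unfolding H_def mult.assoc[symmetric] EE by simp
  finally show "phf_time n k y U \<le> 2 ^ (105000 * Z) * (n * \<nu>)" by (rule toN) simp
qed

lemma lg_ge: "1 \<le> lg x" "log 2 x \<le> lg x"
  unfolding lg_def by auto

lemma bit_length_le_lg: "1 \<le> m \<Longrightarrow> real (bit_length m) \<le> log 2 (real m) + 1"
proof -
  assume m: "1 \<le> m"
  have "real (bit_length m - 1) \<le> log 2 (real m)" by (rule le_log2_of_power) (rule power_bit_length_le[OF m])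
  then show ?thesis by linarith
qed

text \<open>The inequality amounts to 1/(\<delta> - 1) \<le> 2^y. By minimality it fails for y - 1,
  which bounds y in terms of \<delta>.\<close>

lemma scale_exists:
  assumes \<delta>: "1 < \<delta>" "\<delta> \<le> (2::real)"
  obtains y :: nat where "real (2 ^ y + 1) \<le> \<delta> * real (2 ^ y)" "\<And>z. z < y \<Longrightarrow> \<not> real (2 ^ z + 1) \<le> \<delta> * real (2 ^ z)"
    "real y \<le> 1 + log 2 (1 / (\<delta> - 1))"
proof -
  define P where "P z \<longleftrightarrow> real (2 ^ z + 1) \<le> \<delta> * real (2 ^ z)" for z :: nat
  have P: "P z \<longleftrightarrow> 1 / (\<delta> - 1) \<le> 2 ^ z" for z unfolding P_def using \<delta> by (simp add: field_simps)
  obtain z0 where "1 / (\<delta> - 1) < 2 ^ z0" using real_arch_pow[of 2 "1 / (\<delta> - 1)"] by auto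
  then have "P z0" unfolding P by simp
  then have y: "P (LEAST z. P z)" by (rule LeastI)
  have min: "\<not> P z" if "z < (LEAST z. P z)" for z using not_less_Least[OF that] .
  have "real (LEAST z. P z) \<le> 1 + log 2 (1 / (\<delta> - 1))"
  proof (cases "LEAST z. P z")
    case 0
    have "0 \<le> log 2 (1 / (\<delta> - 1))" using \<delta> by simp
    then show ?thesis using 0 by simp
  next
    case (Suc x)
    then have "\<not> P x" using min[of x] by simp
    then have "2 ^ x \<le> 1 / (\<delta> - 1)" unfolding P by simp
    then have "real x \<le> log 2 (1 / (\<delta> - 1))" using \<delta> by (simp add: le_log_iff powr_realpow)
    then show ?thesis using Suc by simp
  qed
  with y min show ?thesis unfolding P_def by (rule that)
qed

text \<open>The bit length of \<open>k\<close> is at most 2 lg k, and its own bit length at most 3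
  lg (lg k). The rounding of \<open>y\<close> contributes a multiple of lg k, which is dominated by
  k lg (lg k).\<close>

lemma expo_le:
  assumes k: "1 \<le> k" and y: "real y \<le> 1 + l" "0 \<le> l"
  shows "real (expo k y) \<le> 5 * (real k * lg (lg (real k)) + lg (real k) * l)"
proof -
  define X where "X = real k * lg (lg (real k))"
  have kap2: "real (kap k) \<le> 2 * lg (real k)" using bit_length_le_lg[OF k] lg_ge[of "real k"] unfolding kap_def by linarith
  have kap1: "1 \<le> kap k" by (rule kap(3)[OF k])
  have "log 2 (real (kap k)) \<le> log 2 (2 * lg (real k))" using kap2 kap1 lg_ge(1)[of "real k"] by (intro log_mono) auto
  also have "\<dots> = 1 + log 2 (lg (real k))" using lg_ge(1)[of "real k"] by (simp add: log_mult)
  finally have bl: "real (bit_length (kap k)) \<le> 3 * lg (lg (real k))"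
    using bit_length_le_lg[OF kap1] lg_ge[of "lg (real k)"] by linarith
  have kX: "real k \<le> X" unfolding X_def using lg_ge(1)[of "lg (real k)"] k by simp
  have "real k < 2 ^ k" by (rule of_nat_less_two_power)
  then have "log 2 (real k) < real k" using k by (simp add: log_less_iff powr_realpow)
  then have lX: "lg (real k) \<le> X" using kX k unfolding lg_def by auto
  have "real (expo k y) = real k * real (bit_length (kap k)) + real (kap k) * real y" unfolding expo_def by simp
  also have "\<dots> \<le> real k * (3 * lg (lg (real k))) + (2 * lg (real k)) * (1 + l)"
    using bl kap2 y by (intro add_mono mult_left_mono mult_mono) auto
  also have "\<dots> = 3 * X + 2 * lg (real k) + 2 * (lg (real k) * l)" unfolding X_def by (simp add: algebra_simps)
  also have "\<dots> \<le> 5 * (X + lg (real k) * l)"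
  proof -
    have "0 \<le> lg (real k) * l" using lg_ge(1)[of "real k"] y by (intro mult_nonneg_nonneg) auto
    then show ?thesis using lX by (simp only: distrib_left)
  qed
  finally show ?thesis unfolding X_def .
qed

text \<open>The exponent \<open>e\<close> is any number above the one achieved, so that both parts
  of the theorem are instances. The constant is 5 * 105000, from \<open>expo_le\<close> and
  \<open>phf_bounds\<close>, plus some slack; the slack covers the factor 2 between the bit length
  of \<open>n\<close> and lg n, as Y \<ge> 1.\<close>

lemma constructs_family_phf_com:
  fixes n k :: nat and \<delta> :: real
  assumes k: "1 \<le> k" "k \<le> n" and \<delta>: "1 < \<delta>" "\<delta> \<le> 2"
  defines "Y \<equiv> real k * lg (lg (real k)) + lg (real k) * log 2 (1 / (\<delta> - 1))"
  assumes e: "525200 * Y \<le> e" and C: "525200 \<le> C"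
    and B: "2 powr e * lg (real n) \<le> B" and \<tau>: "2 powr e * (real n * lg (real n)) \<le> \<tau>"
  shows "constructs_family phf_com C n k \<delta> B \<tau>"
proof -
  define l where "l = log 2 (1 / (\<delta> - 1))"
  have l0: "0 \<le> l" using \<delta> unfolding l_def by simp
  obtain y where y: "real (2 ^ y + 1) \<le> \<delta> * real (2 ^ y)" "\<And>z. z < y \<Longrightarrow> \<not> real (2 ^ z + 1) \<le> \<delta> * real (2 ^ z)"
    "real y \<le> 1 + l"
    using scale_exists[OF \<delta>] unfolding l_def by blast
  define Z where "Z = expo k y"
  define \<nu> where "\<nu> = bit_length n"
  define U where "U = (2::nat) ^ (26000 * Z)"
  define \<Omega> where "\<Omega> = 2 ^ (105000 * Z) * (n * \<nu>)"
  note pb = phf_bounds[OF k, of y, folded Z_def, folded \<nu>_def U_def, folded \<Omega>_def]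
  have n1: "1 \<le> n" using k by simp
  have Z: "real Z \<le> 5 * Y" unfolding Z_def Y_def l_def[symmetric] by (rule expo_le[OF k(1) y(3) l0])
  have Y1: "1 \<le> Y"
  proof -
    have "1 * 1 \<le> real k * lg (lg (real k))" using k lg_ge by (intro mult_mono) auto
    moreover have "0 \<le> lg (real k) * l" using lg_ge(1)[of "real k"] l0 by (intro mult_nonneg_nonneg) auto
    ultimately show ?thesis unfolding Y_def l_def by linarith
  qed
  have \<nu>: "real \<nu> \<le> 2 * lg (real n)" using bit_length_le_lg[OF n1] lg_ge[of "real n"] unfolding \<nu>_def by linarith
  have pow: "2 ^ (105000 * Z) * 2 \<le> 2 powr (525001 * Y)"
  proof -
    have "2 ^ (105000 * Z) * 2 = 2 powr (real (105000 * Z) + 1)" by (simp add: powr_add powr_realpow del: of_nat_mult)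
    also have "\<dots> \<le> 2 powr (525001 * Y)" using Z Y1 by (intro powr_mono) auto
    finally show ?thesis .
  qed
  have n_lg: "1 \<le> real n * lg (real n)" using mult_mono[of 1 "real n" 1 "lg (real n)"] n1 lg_ge(1)[of "real n"] by simp
  have size: "real (2 ^ (105000 * Z) * \<nu>) \<le> 2 powr (525001 * Y) * lg (real n)"
  proof -
    have "real (2 ^ (105000 * Z) * \<nu>) \<le> 2 ^ (105000 * Z) * (2 * lg (real n))" using \<nu> by simp
    also have "\<dots> = (2 ^ (105000 * Z) * 2) * lg (real n)" by (rule mult.assoc[symmetric])
    also have "\<dots> \<le> 2 powr (525001 * Y) * lg (real n)" using pow lg_ge(1)[of "real n"] by (intro mult_right_mono) auto
    finally show ?thesis .
  qed
  have \<Omega>_le: "real \<Omega> \<le> 2 powr (525001 * Y) * (real n * lg (real n))"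
  proof -
    have "real \<Omega> = real n * real (2 ^ (105000 * Z) * \<nu>)" unfolding \<Omega>_def by simp
    also have "\<dots> \<le> real n * (2 powr (525001 * Y) * lg (real n))" using size by (intro mult_left_mono) auto
    finally show ?thesis by (simp only: mult.left_commute)
  qed
  have mono_e: "2 powr (525001 * Y) \<le> 2 powr e" using e Y1 by (intro powr_mono) auto
  have \<Omega>\<tau>: "2 powr (525001 * Y) * (real n * lg (real n)) \<le> \<tau>"
    using mult_right_mono[OF mono_e, of "real n * lg (real n)"] n_lg \<tau> by linarith
  define D where "D = log 2 \<tau>"
  have \<Omega>0: "200 \<le> \<Omega>" by (rule pb(5))
  have \<tau>0: "real \<Omega> \<le> \<tau>" using \<Omega>_le \<Omega>\<tau> by linarith
  then have \<tau>2: "2 \<le> \<tau>" using \<Omega>0 by linarith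
  have log\<Omega>: "log 2 (real \<Omega>) \<le> D" unfolding D_def using \<tau>0 \<Omega>0 by (intro log_mono) auto
  have D1: "1 \<le> D" unfolding D_def using \<tau>2 by (simp add: le_log_iff)
  define w where "w = nat \<lfloor>C * log 2 \<tau>\<rfloor>"
  have "525200 * D \<le> C * D" using C D1 by (intro mult_right_mono) auto
  moreover have "C * D - 1 < real w" unfolding w_def D_def[symmetric] by linarith
  ultimately have w: "60 * D < real w" using D1 by linarith
  \<comment> \<open>The memory bound is at most \<tau> and a word has more than 60 log \<tau> bits:
    the hypothesis of the locale.\<close>
  have "\<Omega> ^ 60 < 2 ^ w"
  proof -
    have "real \<Omega> = 2 powr log 2 (real \<Omega>)" using \<Omega>0 by simp
    also have "\<dots> \<le> 2 powr D" using log\<Omega> by (intro powr_mono) auto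
    finally have "real \<Omega> ^ 60 \<le> (2 powr D) ^ 60" by (rule power_mono) simp
    also have "\<dots> = 2 powr (60 * D)" using powr_realpow[of "2 powr D" 60] by (simp add: powr_powr mult.commute)
    also have "\<dots> < 2 powr real w" using w by simp
    finally have "real (\<Omega> ^ 60) < real (2 ^ w)" by (simp add: powr_realpow)
    then show ?thesis by (simp only: of_nat_less_iff)
  qed
  with \<Omega>0 interpret ram w \<delta> \<Omega> by unfold_locales
  obtain fs T m where ex: "exec w \<delta> phf_com (input n k, []) T (m, tables n fs)" "balanced_phf_family \<delta> n k (mset fs)"
    "length fs = residue_count n k y * (code_length n k y * seed_count k y (start_bits k y))" "T \<le> phf_time n k y U"
    using exec_phf_com[OF k \<delta> y(1) _ pb(7,8,9,6,4,3)] y(2) by blast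
  have "real (length fs) \<le> real (2 ^ (105000 * Z) * \<nu>)" unfolding ex(3) using pb(1) by (simp only: of_nat_le_iff)
  also have "\<dots> \<le> 2 powr e * lg (real n)"
    using size mult_right_mono[OF mono_e, of "lg (real n)"] lg_ge(1)[of "real n"] by linarith
  finally have "real (length fs) \<le> B" using B by linarith
  moreover have "real T \<le> \<tau>" using ex(4) pb(2) \<tau>0 by linarith
  ultimately show ?thesis unfolding constructs_family_def w_def[symmetric] using ex(1,2) by blast
qed

theorem theorem7:
  "\<exists>P :: com.
     (\<exists>C :: real. \<forall>(n :: nat) (k :: nat) (\<delta> :: real). 1 \<le> k \<and> k \<le> n \<and> 1 < \<delta> \<and> \<delta> \<le> 2 \<longrightarrow>
        constructs_family P C n k \<delta>
          (2 powr (C * (real k * lg (lg (real k)))) / (\<delta> - 1) powr (C * lg (real k))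
             * lg (real n))
          (2 powr (C * (real k * lg (lg (real k)))) / (\<delta> - 1) powr (C * lg (real k))
             * (real n * lg (real n))
           + (\<delta> - 1) powr (- (C * (real k / lg (real k)))))) \<and>
     (\<forall>\<delta> :: real. 1 < \<delta> \<and> \<delta> \<le> 2 \<longrightarrow>
        (\<exists>C :: real. \<forall>(n :: nat) (k :: nat). 1 \<le> k \<and> k \<le> n \<longrightarrow>
           constructs_family P C n k \<delta>
             (2 powr (C * (real k * lg (lg (real k)))) * lg (real n))
             (2 powr (C * (real k * lg (lg (real k)))) * (real n * lg (real n)))))"
proof (intro exI[of _ phf_com] conjI allI impI)
  show "\<exists>C :: real. \<forall>(n :: nat) (k :: nat) (\<delta> :: real). 1 \<le> k \<and> k \<le> n \<and> 1 < \<delta> \<and> \<delta> \<le> 2 \<longrightarrow>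
        constructs_family phf_com C n k \<delta>
          (2 powr (C * (real k * lg (lg (real k)))) / (\<delta> - 1) powr (C * lg (real k))
             * lg (real n))
          (2 powr (C * (real k * lg (lg (real k)))) / (\<delta> - 1) powr (C * lg (real k))
             * (real n * lg (real n))
           + (\<delta> - 1) powr (- (C * (real k / lg (real k)))))"
  proof (intro exI[of _ 525200] allI impI)
    fix n k :: nat and \<delta> :: real
    assume a: "1 \<le> k \<and> k \<le> n \<and> 1 < \<delta> \<and> \<delta> \<le> 2"
    define Y where "Y = real k * lg (lg (real k)) + lg (real k) * log 2 (1 / (\<delta> - 1))"
    \<comment> \<open>Since \<delta> - 1 is 2 to the power - log (1/(\<delta> - 1)), the quotient in
      the statement is a single power of 2 with exponent 525200 * Y.\<close>
    have "(\<delta> - 1) powr (525200 * lg (real k)) = (2 powr log 2 (\<delta> - 1)) powr (525200 * lg (real k))" using a by simp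
    also have "\<dots> = 2 powr (- (525200 * (lg (real k) * log 2 (1 / (\<delta> - 1)))))"
      using a unfolding powr_powr by (simp add: log_divide mult_ac)
    finally have eq: "2 powr (525200 * (real k * lg (lg (real k)))) / (\<delta> - 1) powr (525200 * lg (real k)) = 2 powr (525200 * Y)"
      unfolding Y_def by (simp add: powr_minus powr_add distrib_left divide_inverse)
    show "constructs_family phf_com 525200 n k \<delta>
          (2 powr (525200 * (real k * lg (lg (real k)))) / (\<delta> - 1) powr (525200 * lg (real k)) * lg (real n))
          (2 powr (525200 * (real k * lg (lg (real k)))) / (\<delta> - 1) powr (525200 * lg (real k)) * (real n * lg (real n))
           + (\<delta> - 1) powr (- (525200 * (real k / lg (real k)))))"
      unfolding eq by (rule constructs_family_phf_com[where e = "525200 * Y"]) (use a in \<open>auto simp: Y_def\<close>)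
  qed
  fix \<delta> :: real assume \<delta>: "1 < \<delta> \<and> \<delta> \<le> 2"
  define l where "l = log 2 (1 / (\<delta> - 1))"
  have l0: "0 \<le> l" using \<delta> unfolding l_def by simp
  show "\<exists>C :: real. \<forall>(n :: nat) (k :: nat). 1 \<le> k \<and> k \<le> n \<longrightarrow>
           constructs_family phf_com C n k \<delta>
             (2 powr (C * (real k * lg (lg (real k)))) * lg (real n))
             (2 powr (C * (real k * lg (lg (real k)))) * (real n * lg (real n)))"
  proof (intro exI[of _ "525200 * (1 + l)"] allI impI)
    fix n k :: nat assume k: "1 \<le> k \<and> k \<le> n"
    define X where "X = real k * lg (lg (real k))"
    have "real k < 2 ^ k" by (rule of_nat_less_two_power)
    then have "log 2 (real k) < real k" using k by (simp add: log_less_iff powr_realpow)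
    then have "lg (real k) \<le> real k" using k unfolding lg_def by auto
    also have "\<dots> \<le> X" unfolding X_def using lg_ge(1)[of "lg (real k)"] k by simp
    \<comment> \<open>For fixed \<delta> the second term of the exponent is at most \<open>l\<close>
      times the first, so it merely enlarges the constant by the factor 1 + l.\<close>
    finally have "lg (real k) * l \<le> X * l" using l0 by (rule mult_right_mono)
    then have "525200 * (X + lg (real k) * l) \<le> 525200 * (1 + l) * X" by (simp add: algebra_simps)
    then show "constructs_family phf_com (525200 * (1 + l)) n k \<delta>
             (2 powr (525200 * (1 + l) * (real k * lg (lg (real k)))) * lg (real n))
             (2 powr (525200 * (1 + l) * (real k * lg (lg (real k)))) * (real n * lg (real n)))"
      using k \<delta> l0 unfolding X_def l_def by (intro constructs_family_phf_com[OF _ _ _ _ _ _ order.refl order.refl]) auto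
  qed
qed

end
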